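(* (i) Let $d\ge3$. For each finite (real, not necessarily positive) Borel measure $\mu$ in $\mathbb{R}^d$ the Riesz potential $u(x)=\int_{\mathbb{R}^d}\frac{1}{|x-y|^{d-2}}\,d\mu(y)$, $x\in\mathbb{R}^d$, is differentiable of the second order in the capacity sense at almost all points with respect to Lebesgue measure in $\mathbb{R}^d$. (ii) There exists a finite (real, not necessarily positive) Borel measure $\mu$ in $\mathbb{C}$, with $\int_{\mathbb{C}}\log(1+|w|)\,d|\mu|(w)<\infty$, such that for Lebesgue almost every point $a\in\mathbb{C}$ the logarithmic potential $u(z)=\int_{\mathbb{C}}\log\frac{1}{|z-w|}\,d\mu(w)$ of $\mu$ is not differentiable of the second order in the weak capacity sense at $a$.
   Context: $B(a,r)$ is the ball of center $a$ and radius $r$; $\mathbb{C}$ is identified with $\mathbb{R}^2$. Capacity: if $d\ge3$ and $E\subset\mathbb{R}^d$ is compact, the Newtonian capacity is $\operatorname{Cap}(E)=\sup\nu(E)$, the supremum being over all positive finite Borel measures $\nu$ supported on $E$ with $\int\frac{d\nu(y)}{|x-y|^{d-2}}\le1$ for all $x\in\mathbb{R}^d$. In the plane, the Wiener capacity of a compact set $E$ contained in a disc of radius $1/2$ is defined in the same way with the kernel $\frac{1}{|x-y|^{d-2}}$ replaced by $\log\frac{1}{|z-w|}$. For a non-compact Borel set (contained in a disc of radius $1/2$ in the plane case), $\operatorname{Cap}$ is the supremum of the capacities of its compact subsets. Second order differentiability: given real numbers $A_i$, $1\le i\le d$, and $B_{jk}$, $1\le j,k\le d$, put $$\tilde D(x)=\left|u(x)-u(a)-\sum_{i=1}^dA_i(x_i-a_i)-\sum_{j,k=1}^dB_{jk}(x_j-a_j)(x_k-a_k)\right|,\qquad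 D(x)=\frac{\tilde D(x)}{|x-a|^2}.$$ The function $u$ is differentiable of the second order in the capacity sense at $a$ if there exist such $A_i,B_{jk}$ with $$\lim_{r\to0}\frac{\sup_{t>0}t\,\operatorname{Cap}(\{x\in B(a,r):D(x)>t\})}{\operatorname{Cap}(B(a,r))}=0,$$ and differentiable of the second order in the weak capacity sense at $a$ if there exist such $A_i,B_{jk}$ with $$\lim_{r\to0}\frac{\sup_{t>0}t\,\operatorname{Cap}(\{x\in B(a,r):\tilde D(x)>t\})}{r^2\operatorname{Cap}(B(a,r))}=0.$$ In both cases the integral defining $u(a)$ is required to converge absolutely. Potentials are defined outside a set of capacity zero; points $x$ where $u$ is not defined play no role in these definitions. *)

theory Defs
  imports "HOL-Analysis.Analysis"
begin

section \<open>Finite real Borel measures\<close>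

text \<open>
  The library has no signed measures. A finite real Borel measure is a real-valued countably
  additive function on the Borel sets; its values on other sets are irrelevant.
\<close>

definition signed_borel_measure :: "('a::topological_space set \<Rightarrow> real) \<Rightarrow> bool" where
  "signed_borel_measure \<mu> \<longleftrightarrow> \<mu> {} = 0 \<and>
     (\<forall>A::nat \<Rightarrow> 'a set. range A \<subseteq> sets borel \<longrightarrow> disjoint_family A \<longrightarrow>
        (\<lambda>n. \<mu> (A n)) sums \<mu> (\<Union>n. A n))"

text \<open>
  The positive variation \<open>\<mu>\<^sup>+(A) = sup {\<mu>(B). B \<subseteq> A}\<close>. The function
  \<^const>\<open>ennreal\<close> sends negative numbers to 0, which does not change the supremum because
  \<open>B = {}\<close> is allowed. That \<^const>\<open>measure_of\<close> does not degenerate to the zero measure is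
  the lemma \<open>emeasure_jordan_pos\<close> below.
\<close>

definition jordan_pos_fun :: "('a::topological_space set \<Rightarrow> real) \<Rightarrow> 'a set \<Rightarrow> ennreal" where
  "jordan_pos_fun \<mu> A = (SUP B\<in>{B \<in> sets borel. B \<subseteq> A}. ennreal (\<mu> B))"

definition jordan_pos :: "('a::topological_space set \<Rightarrow> real) \<Rightarrow> 'a measure" where
  "jordan_pos \<mu> = measure_of UNIV (sets borel) (jordan_pos_fun \<mu>)"

definition jordan_neg :: "('a::topological_space set \<Rightarrow> real) \<Rightarrow> 'a measure" where
  "jordan_neg \<mu> = jordan_pos (\<lambda>A. - \<mu> A)"

definition total_variation :: "('a::topological_space set \<Rightarrow> real) \<Rightarrow> 'a measure" where
  "total_variation \<mu> = measure_of UNIV (sets borel)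
     (\<lambda>A. emeasure (jordan_pos \<mu>) A + emeasure (jordan_neg \<mu>) A)"

definition signed_integral :: "('a::topological_space set \<Rightarrow> real) \<Rightarrow> ('a \<Rightarrow> real) \<Rightarrow> real" where
  "signed_integral \<mu> f = (\<integral>x. f x \<partial>jordan_pos \<mu>) - (\<integral>x. f x \<partial>jordan_neg \<mu>)"

lemma signed_borel_measure_Un:
  assumes "signed_borel_measure \<mu>" "A \<in> sets borel" "B \<in> sets borel" "A \<inter> B = {}"
  shows "\<mu> (A \<union> B) = \<mu> A + \<mu> B"
proof -
  have 0: "\<mu> {} = 0" using assms(1) by (simp add: signed_borel_measure_def)
  have "range (binaryset A B) \<subseteq> sets borel" "disjoint_family (binaryset A B)"
    using assms(2-4) by (auto simp: range_binaryset_eq disjoint_family_on_def binaryset_def)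
  hence "(\<lambda>n. \<mu> (binaryset A B n)) sums \<mu> (\<Union>n. binaryset A B n)"
    using assms(1) unfolding signed_borel_measure_def by blast
  moreover have "(\<lambda>n. \<mu> (binaryset A B n)) sums (\<mu> A + \<mu> B)"
    using binaryset_sums[of \<mu> A B] 0 by simp
  ultimately show ?thesis by (simp add: UN_binaryset_eq sums_unique2)
qed

lemma jordan_pos_fun_superadd:
  assumes "signed_borel_measure \<mu>" "A \<inter> B = {}"
  shows "jordan_pos_fun \<mu> A + jordan_pos_fun \<mu> B \<le> jordan_pos_fun \<mu> (A \<union> B)"
proof -
  have *: "ennreal (\<mu> C) + ennreal (\<mu> D) \<le> jordan_pos_fun \<mu> (A \<union> B)"
    if C: "C \<in> sets borel" "C \<subseteq> A" and D: "D \<in> sets borel" "D \<subseteq> B" for C D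
  proof -
    have le: "ennreal (\<mu> E) \<le> jordan_pos_fun \<mu> (A \<union> B)"
      if "E \<in> sets borel" "E \<subseteq> A \<union> B" for E
      unfolding jordan_pos_fun_def using that by (intro SUP_upper) auto
    have "\<mu> (C \<union> D) = \<mu> C + \<mu> D"
      using signed_borel_measure_Un[OF assms(1) C(1) D(1)] C D assms(2) by blast
    moreover have "ennreal (\<mu> (C \<union> D)) \<le> jordan_pos_fun \<mu> (A \<union> B)"
      using C D by (intro le) auto
    moreover have "ennreal (\<mu> C) \<le> jordan_pos_fun \<mu> (A \<union> B)" "ennreal (\<mu> D) \<le> jordan_pos_fun \<mu> (A \<union> B)"
      using C D by (auto intro!: le)
    ultimately show ?thesis
      by (cases "0 \<le> \<mu> C"; cases "0 \<le> \<mu> D") (auto simp: ennreal_neg)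
  qed
  have ne: "{C \<in> sets borel. C \<subseteq> E} \<noteq> {}" for E :: "'a set" by auto
  have "jordan_pos_fun \<mu> A + jordan_pos_fun \<mu> B =
      (SUP D\<in>{D \<in> sets borel. D \<subseteq> B}. jordan_pos_fun \<mu> A + ennreal (\<mu> D))"
    unfolding jordan_pos_fun_def[of \<mu> B] by (rule ennreal_SUP_add_right[OF ne])
  also have "\<dots> \<le> jordan_pos_fun \<mu> (A \<union> B)"
  proof (rule SUP_least)
    fix D assume D: "D \<in> {D \<in> sets borel. D \<subseteq> B}"
    have "jordan_pos_fun \<mu> A + ennreal (\<mu> D) =
        (SUP C\<in>{C \<in> sets borel. C \<subseteq> A}. ennreal (\<mu> C) + ennreal (\<mu> D))"
      unfolding jordan_pos_fun_def[of \<mu> A] by (rule ennreal_SUP_add_left[symmetric, OF ne])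
    also have "\<dots> \<le> jordan_pos_fun \<mu> (A \<union> B)"
      using D by (intro SUP_least *) auto
    finally show "jordan_pos_fun \<mu> A + ennreal (\<mu> D) \<le> jordan_pos_fun \<mu> (A \<union> B)" .
  qed
  finally show ?thesis .
qed

lemma ennreal_sum_le: "ennreal (sum f {..<n::nat}) \<le> (\<Sum>i<n. ennreal (f i))"
proof (induction n)
  case (Suc n)
  have "ennreal (sum f {..<n} + f n) \<le> ennreal (sum f {..<n}) + ennreal (f n)"
    by (cases "0 \<le> sum f {..<n}"; cases "0 \<le> f n")
       (auto simp: ennreal_neg intro!: ennreal_leI)
  also have "\<dots> \<le> (\<Sum>i<n. ennreal (f i)) + ennreal (f n)"
    using Suc.IH by (rule add_right_mono)
  finally show ?case by simp
qed simp

lemma countably_additive_jordan_pos_fun: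
  assumes "signed_borel_measure (\<mu> :: 'a::topological_space set \<Rightarrow> real)"
  shows "countably_additive (sets borel) (jordan_pos_fun \<mu>)"
proof (rule countably_additiveI)
  fix A :: "nat \<Rightarrow> 'a set"
  assume A: "range A \<subseteq> sets borel" "disjoint_family A"
  show "(\<Sum>i. jordan_pos_fun \<mu> (A i)) = jordan_pos_fun \<mu> (\<Union> (range A))"
  proof (rule antisym)
    have *: "(\<Sum>i<n. jordan_pos_fun \<mu> (A i)) \<le> jordan_pos_fun \<mu> (\<Union>i<n. A i)" for n
    proof (induction n)
      case (Suc n)
      have "A i \<inter> A n = {}" if "i < n" for i
        using A(2) that by (simp add: disjoint_family_on_def)
      hence disj: "(\<Union>i<n. A i) \<inter> A n = {}" by blast
      have "(\<Sum>i<Suc n. jordan_pos_fun \<mu> (A i)) \<le>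
          jordan_pos_fun \<mu> (\<Union>i<n. A i) + jordan_pos_fun \<mu> (A n)"
        using add_right_mono[OF Suc.IH] by simp
      also have "\<dots> \<le> jordan_pos_fun \<mu> ((\<Union>i<n. A i) \<union> A n)"
        using jordan_pos_fun_superadd[OF assms disj] .
      also have "(\<Union>i<n. A i) \<union> A n = (\<Union>i<Suc n. A i)"
        by (simp add: lessThan_Suc Un_commute)
      finally show ?case .
    qed simp
    have "jordan_pos_fun \<mu> (\<Union>i<n. A i) \<le> jordan_pos_fun \<mu> (\<Union> (range A))" for n
      unfolding jordan_pos_fun_def by (intro SUP_subset_mono) auto
    with * show "(\<Sum>i. jordan_pos_fun \<mu> (A i)) \<le> jordan_pos_fun \<mu> (\<Union> (range A))"
      by (intro suminf_le_const) (auto intro: order_trans)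
  next
    show "jordan_pos_fun \<mu> (\<Union> (range A)) \<le> (\<Sum>i. jordan_pos_fun \<mu> (A i))"
      unfolding jordan_pos_fun_def[of \<mu> "\<Union> (range A)"]
    proof (rule SUP_least)
      fix B assume B: "B \<in> {B \<in> sets borel. B \<subseteq> \<Union> (range A)}"
      have "range (\<lambda>n. B \<inter> A n) \<subseteq> sets borel" "disjoint_family (\<lambda>n. B \<inter> A n)"
        using A B by (auto simp: disjoint_family_on_def)
      hence "(\<lambda>n. \<mu> (B \<inter> A n)) sums \<mu> (\<Union>n. B \<inter> A n)"
        using assms unfolding signed_borel_measure_def by blast
      also have "(\<Union>n. B \<inter> A n) = B" using B by auto
      finally have "(\<lambda>n. ennreal (\<Sum>i<n. \<mu> (B \<inter> A i))) \<longlonglongrightarrow> ennreal (\<mu> B)"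
        unfolding sums_def by (rule tendsto_ennrealI)
      moreover have "ennreal (\<Sum>i<n. \<mu> (B \<inter> A i)) \<le> (\<Sum>i. jordan_pos_fun \<mu> (A i))" for n
      proof -
        have "ennreal (\<Sum>i<n. \<mu> (B \<inter> A i)) \<le> (\<Sum>i<n. ennreal (\<mu> (B \<inter> A i)))"
          by (rule ennreal_sum_le)
        also have "\<dots> \<le> (\<Sum>i<n. jordan_pos_fun \<mu> (A i))"
          unfolding jordan_pos_fun_def using A B by (intro sum_mono SUP_upper) auto
        also have "\<dots> \<le> (\<Sum>i. jordan_pos_fun \<mu> (A i))"
          by (rule sum_le_suminf) auto
        finally show ?thesis .
      qed
      ultimately show "ennreal (\<mu> B) \<le> (\<Sum>i. jordan_pos_fun \<mu> (A i))"
        by (intro LIMSEQ_le_const2) auto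
    qed
  qed
qed

lemma emeasure_jordan_pos:
  assumes "signed_borel_measure \<mu>" "A \<in> sets borel"
  shows "emeasure (jordan_pos \<mu>) A = jordan_pos_fun \<mu> A"
proof (rule emeasure_measure_of[OF jordan_pos_def])
  have "\<mu> {} = 0" using assms(1) by (simp add: signed_borel_measure_def)
  hence "jordan_pos_fun \<mu> {} = 0"
    unfolding jordan_pos_fun_def by (intro antisym SUP_least) auto
  thus "positive (sets (jordan_pos \<mu>)) (jordan_pos_fun \<mu>)" by (simp add: positive_def)
  have "sets (jordan_pos \<mu>) = sets borel"
    using sets.sigma_sets_eq[of borel] by (simp add: jordan_pos_def)
  thus "countably_additive (sets (jordan_pos \<mu>)) (jordan_pos_fun \<mu>)" "A \<in> sets (jordan_pos \<mu>)"
    using countably_additive_jordan_pos_fun[OF assms(1)] assms(2) by simp_all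
qed auto


section \<open>Kernels and capacity\<close>

text \<open>
  Both kernels take the value \<open>\<infinity>\<close> on the diagonal; the case distinction is needed because
  \<open>1 / 0 = 0\<close> and \<open>ln 0 = 0\<close> in the library.
\<close>

definition newton_kernel :: "'a::euclidean_space \<Rightarrow> 'a \<Rightarrow> ereal" where
  "newton_kernel x y = (if x = y then \<infinity> else ereal (1 / dist x y ^ (DIM('a) - 2)))"

definition log_kernel :: "complex \<Rightarrow> complex \<Rightarrow> ereal" where
  "log_kernel z w = (if z = w then \<infinity> else ereal (ln (1 / dist z w)))"

text \<open>
  The integral of an extended real function against a positive measure. Wherever it is used below
  the negative part has a finite integral, so \<open>\<infinity> - \<infinity>\<close> does not occur.
\<close>

definition ereal_integral :: "'a measure \<Rightarrow> ('a \<Rightarrow> ereal) \<Rightarrow> ereal" where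
  "ereal_integral \<nu> f =
     enn2ereal (\<integral>\<^sup>+y. e2ennreal (f y) \<partial>\<nu>) - enn2ereal (\<integral>\<^sup>+y. e2ennreal (- f y) \<partial>\<nu>)"

definition compact_capacity :: "('a::euclidean_space \<Rightarrow> 'a \<Rightarrow> ereal) \<Rightarrow> 'a set \<Rightarrow> ennreal" where
  "compact_capacity K E =
     (SUP \<nu>\<in>{\<nu>. finite_measure \<nu> \<and> sets \<nu> = sets borel \<and> emeasure \<nu> (- E) = 0 \<and>
               (\<forall>x. ereal_integral \<nu> (K x) \<le> 1)}. emeasure \<nu> E)"

definition capacity :: "('a::euclidean_space \<Rightarrow> 'a \<Rightarrow> ereal) \<Rightarrow> 'a set \<Rightarrow> ennreal" where
  "capacity K E =
     (if compact E then compact_capacity K E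
      else (SUP C\<in>{C. compact C \<and> C \<subseteq> E}. compact_capacity K C))"


section \<open>Potentials\<close>

text \<open>The set of points at which the integral defining the potential converges absolutely.\<close>

definition potential_dom ::
    "('a::euclidean_space \<Rightarrow> 'a \<Rightarrow> ereal) \<Rightarrow> ('a set \<Rightarrow> real) \<Rightarrow> 'a set" where
  "potential_dom K \<mu> = {x. (\<integral>\<^sup>+y. e2ennreal \<bar>K x y\<bar> \<partial>total_variation \<mu>) < \<infinity>}"

text \<open>
  For \<open>x\<close> in \<open>potential_dom K \<mu>\<close> the set where \<open>K x\<close> is infinite is null for the total variation
  of \<open>\<mu>\<close>, so the value that \<^const>\<open>real_of_ereal\<close> assigns to \<open>\<infinity>\<close> is immaterial.
\<close>

definition potential ::
    "('a::euclidean_space \<Rightarrow> 'a \<Rightarrow> ereal) \<Rightarrow> ('a set \<Rightarrow> real) \<Rightarrow> 'a \<Rightarrow> real" where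
  "potential K \<mu> x = signed_integral \<mu> (\<lambda>y. real_of_ereal (K x y))"


section \<open>Second order differentiability\<close>

definition taylor2_error ::
    "('a::euclidean_space \<Rightarrow> real) \<Rightarrow> 'a \<Rightarrow> ('a \<Rightarrow> real) \<Rightarrow> ('a \<Rightarrow> 'a \<Rightarrow> real) \<Rightarrow> 'a \<Rightarrow> real" where
  "taylor2_error u a A B x =
     \<bar>u x - u a - (\<Sum>i\<in>Basis. A i * ((x - a) \<bullet> i))
        - (\<Sum>j\<in>Basis. \<Sum>k\<in>Basis. B j k * ((x - a) \<bullet> j) * ((x - a) \<bullet> k))\<bar>"

text \<open>
  In the next two definitions \<open>S\<close> is the set on which the function \<open>u\<close> is defined. For the
  logarithmic kernel the ball lies in a disc of radius \<open>1/2\<close> as soon as \<open>r\<close> is small, which is all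
  that matters for the limit.
\<close>

definition capacity_differentiable2 ::
    "('a::euclidean_space \<Rightarrow> 'a \<Rightarrow> ereal) \<Rightarrow> 'a set \<Rightarrow> ('a \<Rightarrow> real) \<Rightarrow> 'a \<Rightarrow> bool" where
  "capacity_differentiable2 K S u a \<longleftrightarrow> a \<in> S \<and>
     (\<exists>A B. ((\<lambda>r. (SUP t\<in>{0<..}. ennreal t *
                    capacity K {x \<in> ball a r \<inter> S. taylor2_error u a A B x / (norm (x - a))\<^sup>2 > t})
                  / capacity K (ball a r)) \<longlongrightarrow> 0) (at_right (0::real)))"

definition weak_capacity_differentiable2 ::
    "('a::euclidean_space \<Rightarrow> 'a \<Rightarrow> ereal) \<Rightarrow> 'a set \<Rightarrow> ('a \<Rightarrow> real) \<Rightarrow> 'a \<Rightarrow> bool" where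
  "weak_capacity_differentiable2 K S u a \<longleftrightarrow> a \<in> S \<and>
     (\<exists>A B. ((\<lambda>r. (SUP t\<in>{0<..}. ennreal t *
                    capacity K {x \<in> ball a r \<inter> S. taylor2_error u a A B x > t})
                  / (ennreal (r\<^sup>2) * capacity K (ball a r))) \<longlongrightarrow> 0) (at_right (0::real)))"

end

theory Submission
  imports Defs
begin

text \<open>
Part (i). It suffices to treat a finite positive measure \<open>M\<close>. Let \<open>F\<close> be the closed set of points
where \<open>M (ball a r) \<le> l * r ^ d\<close> for all \<open>r\<close>; by Vitali's covering lemma its complement has volume
\<open>O(1 / l)\<close>, so almost every point lies in such a set. Smear out each mass at \<open>y \<notin> F\<close> with a radial
bump of radius \<open>dist y F / 2\<close>. Together with the part of \<open>M\<close> on \<open>F\<close> this gives a bounded density \<open>g\<close>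
(\<open>potential_decomposition\<close>), and by Newton's theorem (\<open>newton_mean_value\<close>) the potential at \<open>x\<close> only
changes through the masses with \<open>dist x y \<le> dist y F / 2\<close>. If \<open>a \<in> F\<close>, such \<open>y\<close> satisfy
\<open>norm (y - a) \<le> 2 * norm (x - a)\<close>; so near \<open>a\<close> the change is at most \<open>(norm (x - a))^2\<close> times the
potential of the measure \<open>\<tau>\<close> that has density \<open>C / (norm (y - a))^2\<close> with respect to \<open>M\<close> on
\<open>ball a (2 * r) - F\<close>. For almost every \<open>a \<in> F\<close> the set \<open>- F\<close> has \<open>M\<close>-density zero at \<open>a\<close>, hence
\<open>\<tau>\<close> has mass \<open>o(r ^ (d - 2))\<close> (\<open>inverse_square_mass\<close>). Symmetry of the kernel gives the weak type
bound \<open>t * Cap {potential of \<tau> \<ge> t} \<le> mass of \<tau>\<close> (\<open>newton_weak_type\<close>), and \<open>Cap (ball a r)\<close> is of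
order \<open>r ^ (d - 2)\<close>.

It remains to expand \<open>pot g\<close> pointwise to second order (\<open>pot_second_order\<close>). Newton's theorem makes
\<open>newton - newton_reg s\<close> a kernel supported in a ball of radius \<open>s\<close>, with integral \<open>O(s^2)\<close>; so \<open>w\<close>
minus its mean at scale \<open>s\<close> is \<open>O(s^2)\<close> in mean square whenever \<open>w\<close> is the potential of a square
integrable density. The identity \<open>second_difference_identity\<close> turns this into a bound for second
differences, and in the limit \<open>s \<rightarrow> 0\<close> for the Hessian: a substitute for the \<open>L2\<close> theory of singular
integrals. Apply it to the difference of two consecutive mollifications of \<open>pot g\<close>, taken at scales
along which the mollifications of \<open>g\<close> converge geometrically. The maximal set estimate and
Borel-Cantelli yield, at almost every \<open>a\<close>, a convergent series of Taylor polynomials, and an expansion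
of \<open>pot g\<close> in the mean over balls (\<open>taylor_telescope\<close>). It holds pointwise because \<open>pot g\<close> differs
from its means at scale \<open>s\<close> by \<open>O(s^2)\<close> (\<open>average_to_pointwise\<close>).

Part (ii). In the plane a disc of radius \<open>\<rho>\<close> has capacity of order \<open>1 / ln (1 / \<rho>)\<close>, so even
exponentially small discs count. The potential exceeds \<open>t\<close> on a disc of radius about \<open>exp (- t / c)\<close>
around an atom of mass \<open>c\<close>; hence \<open>t\<close> times the capacity of that disc stays above a multiple of \<open>c\<close>
for all large \<open>t\<close> (\<open>SUP_capacity_lower\<close>). Put atoms of mass \<open>h^2 / 16 ^ n\<close> on a grid of mesh
\<open>h = 1 / 2 ^ 16 ^ n\<close>, for each \<open>n\<close>. At \<open>r = 3 * h\<close> the normalising factor \<open>r^2 * Cap (ball a r)\<close> is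
also of order \<open>h^2 / 16 ^ n\<close>, so the quotient stays away from \<open>0\<close> at every point \<open>a\<close>.
\<close>

text \<open>
Integrals without an explicit measure are taken with respect to Lebesgue measure.
\<close>

abbreviation nn_integral_lborel :: "('a::euclidean_space => ennreal) => ennreal" (binder "\<integral>+" 10)
  where "nn_integral_lborel f \<equiv> nn_integral lborel f"

abbreviation integral_lborel :: "('a::euclidean_space => real) => real" (binder "\<integral>\<^sub>L" 10)
  where "integral_lborel f \<equiv> lebesgue_integral lborel f"

section \<open>Coverings and maximal sets\<close>

lemma emeasure_countable_subadd:
  assumes "sets \<alpha> = sets borel" "countable C" "\<And>j. j \<in> C ==> A j \<in> sets borel"
  shows "emeasure \<alpha> (\<Union>j\<in>C. A j) \<le> (\<integral>\<^sup>+j. emeasure \<alpha> (A j) \<partial>count_space C)"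
proof -
  have [measurable]: "A j \<in> sets \<alpha>" if "j \<in> C" for j using assms that by simp
  have U: "(\<Union>j\<in>C. A j) \<in> sets \<alpha>" using assms by (intro sets.countable_UN'') auto
  have "emeasure \<alpha> (\<Union>j\<in>C. A j) = (\<integral>\<^sup>+x. indicator (\<Union>j\<in>C. A j) x \<partial>\<alpha>)"
    using U by simp
  also have "... \<le> (\<integral>\<^sup>+x. (\<integral>\<^sup>+j. indicator (A j) x \<partial>count_space C) \<partial>\<alpha>)"
  proof (intro nn_integral_mono)
    fix x
    show "indicator (\<Union>j\<in>C. A j) x \<le> (\<integral>\<^sup>+j. indicator (A j) x \<partial>count_space C)"
    proof (cases "x \<in> (\<Union>j\<in>C. A j)")
      case True
      then obtain j where j: "j \<in> C" "x \<in> A j" by blast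
      hence "(1::ennreal) = (\<integral>\<^sup>+i. indicator {j} i \<partial>count_space C)" by (subst nn_integral_indicator) auto
      also have "... \<le> (\<integral>\<^sup>+j. indicator (A j) x \<partial>count_space C)"
        using j by (intro nn_integral_mono) (auto split: split_indicator)
      finally show ?thesis using True by simp
    qed simp
  qed
  also have "... = (\<integral>\<^sup>+j. emeasure \<alpha> (A j) \<partial>count_space C)"
    using assms by (subst nn_integral_count_space_nn_integral) (auto intro!: nn_integral_cong)
  finally show ?thesis .
qed

text \<open>
If every point of \<open>E\<close> is the centre of a ball on which \<open>\<beta>\<close> controls the \<open>\<alpha>\<close>-mass of the five times
larger ball, then \<open>\<beta>\<close> controls the \<open>\<alpha>\<close>-mass of \<open>E\<close>: a disjoint subfamily of the balls still covers
\<open>E\<close> after enlargement. All density and maximal estimates below are instances of this.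
\<close>

lemma vitali_compare:
  fixes \<alpha> \<beta> :: "'a::euclidean_space measure"
  assumes [simp]: "sets \<alpha> = sets borel" "sets \<beta> = sets borel" and V: "V \<in> sets borel"
  assumes r: "\<And>x. x \<in> E ==> \<exists>r>0. r \<le> R \<and> ball x r \<subseteq> V \<and>
      emeasure \<alpha> (cball x (5 * r)) \<le> K * emeasure \<beta> (ball x r)"
  obtains E' where "E' \<in> sets borel" "E \<subseteq> E'" "emeasure \<alpha> E' \<le> K * emeasure \<beta> V"
proof -
  from r obtain \<rho> where \<rho>: "\<And>x. x \<in> E ==> 0 < \<rho> x \<and> \<rho> x \<le> R" "\<And>x. x \<in> E ==> ball x (\<rho> x) \<subseteq> V"
     "\<And>x. x \<in> E ==> emeasure \<alpha> (cball x (5 * \<rho> x)) \<le> K * emeasure \<beta> (ball x (\<rho> x))"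
    by metis
  have "E \<subseteq> (\<Union>i\<in>E. cball i (\<rho> i))" using \<rho>(1) by fastforce
  then obtain C where C: "countable C" "C \<subseteq> E"
     "pairwise (\<lambda>i j. disjnt (cball i (\<rho> i)) (cball j (\<rho> j))) C"
     "E \<subseteq> (\<Union>i\<in>C. cball i (5 * \<rho> i))"
    by (rule Vitali_covering_lemma_cballs[of E "\<lambda>x. x" \<rho> E R]) (use \<rho>(1) in blast)+
  show ?thesis
  proof
    show "(\<Union>j\<in>C. cball j (5 * \<rho> j)) \<in> sets borel"
      using C(1) by (intro sets.countable_UN'') auto
    show "E \<subseteq> (\<Union>j\<in>C. cball j (5 * \<rho> j))" by (rule C(4))
    have "emeasure \<alpha> (\<Union>j\<in>C. cball j (5 * \<rho> j)) \<le> (\<integral>\<^sup>+j. emeasure \<alpha> (cball j (5 * \<rho> j)) \<partial>count_space C)"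
      using C(1) by (intro emeasure_countable_subadd) auto
    also have "... \<le> (\<integral>\<^sup>+j. K * emeasure \<beta> (ball j (\<rho> j)) \<partial>count_space C)"
      using \<rho>(3) C(2) by (intro nn_integral_mono) auto
    also have "... = K * (\<integral>\<^sup>+j. emeasure \<beta> (ball j (\<rho> j)) \<partial>count_space C)"
      by (rule nn_integral_cmult) auto
    also have "(\<integral>\<^sup>+j. emeasure \<beta> (ball j (\<rho> j)) \<partial>count_space C) = emeasure \<beta> (\<Union>j\<in>C. ball j (\<rho> j))"
    proof (intro emeasure_UN_countable[symmetric] C(1))
      show "disjoint_family_on (\<lambda>j. ball j (\<rho> j)) C"
        unfolding disjoint_family_on_def
      proof (intro ballI impI)
        fix i j assume "i \<in> C" "j \<in> C" "i \<noteq> j"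
        hence "disjnt (cball i (\<rho> i)) (cball j (\<rho> j))" using C(3) by (auto simp: pairwise_def)
        thus "ball i (\<rho> i) \<inter> ball j (\<rho> j) = {}"
          using ball_subset_cball[of i "\<rho> i"] ball_subset_cball[of j "\<rho> j"] unfolding disjnt_def by blast
      qed
    qed auto
    also have "... \<le> emeasure \<beta> V"
      using \<rho>(2) C(2) V by (intro emeasure_mono) auto
    finally show "emeasure \<alpha> (\<Union>j\<in>C. cball j (5 * \<rho> j)) \<le> K * emeasure \<beta> V"
      by (meson mult_left_mono order_trans zero_le)
  qed
qed

definition maximal_set :: "'a::euclidean_space measure => real => 'a set" where
  "maximal_set \<beta> l = {a. \<forall>r>0. emeasure \<beta> (ball a r) \<le> ennreal (l * r ^ DIM('a))}"

lemma maximal_setD: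
  fixes \<beta> :: "'a::euclidean_space measure"
  shows "a \<in> maximal_set \<beta> l ==> r > 0 ==> emeasure \<beta> (ball a r) \<le> ennreal (l * r ^ DIM('a))"
  unfolding maximal_set_def by auto

text \<open>
The balls are open, so each condition \<open>M (ball a r) \<le> c\<close> passes to limits of \<open>a\<close>.
\<close>

lemma closed_maximal_set:
  fixes \<beta> :: "'a::euclidean_space measure"
  assumes [simp]: "sets \<beta> = sets borel"
  shows "closed (maximal_set \<beta> l)"
  unfolding closed_sequential_limits
proof safe
  fix x a assume x: "\<forall>n. x n \<in> maximal_set \<beta> l" "x \<longlonglongrightarrow> a"
  show "a \<in> maximal_set \<beta> l" unfolding maximal_set_def
  proof safe
    fix r :: real assume r: "r > 0"
    have *: "emeasure \<beta> (ball a s) \<le> ennreal (l * r ^ DIM('a))" if "s < r" for s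
    proof -
      have "r - s > 0" using that by simp
      then obtain n where "dist (x n) a < r - s"
        using x(2) unfolding lim_sequentially by (meson order_refl)
      hence "ball a s \<subseteq> ball (x n) r"
      proof (intro subsetI)
        fix y assume d: "dist (x n) a < r - s" and "y \<in> ball a s"
        thus "y \<in> ball (x n) r" using dist_triangle[of "x n" y a] by auto
      qed
      hence "emeasure \<beta> (ball a s) \<le> emeasure \<beta> (ball (x n) r)" by (intro emeasure_mono) auto
      also have "... \<le> ennreal (l * r ^ DIM('a))" using x(1) r by (auto simp: maximal_set_def)
      finally show ?thesis .
    qed
    define s where "s n = r - r / (real n + 1)" for n
    have inc: "incseq (\<lambda>n. ball a (s n))"
      unfolding s_def using r by (intro monoI subset_ball) (auto intro!: divide_left_mono)
    have sr: "s n < r" for n using r by (simp add: s_def)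
    have U: "(\<Union>n. ball a (s n)) = ball a r"
    proof
      show "(\<Union>n. ball a (s n)) \<subseteq> ball a r" by (intro UN_least subset_ball less_imp_le sr)
      show "ball a r \<subseteq> (\<Union>n. ball a (s n))"
      proof
        fix y assume y: "y \<in> ball a r"
        have "s \<longlonglongrightarrow> r - 0"
          unfolding s_def using LIMSEQ_Suc[OF lim_const_over_n[of r]] by (intro tendsto_intros) (simp add: add.commute)
        hence "eventually (\<lambda>n. dist a y < s n) sequentially" using y by (intro order_tendstoD) auto
        then obtain n where "dist a y < s n" by (auto simp: eventually_sequentially)
        thus "y \<in> (\<Union>n. ball a (s n))" by auto
      qed
    qed
    have "(\<lambda>n. emeasure \<beta> (ball a (s n))) \<longlonglongrightarrow> emeasure \<beta> (\<Union>n. ball a (s n))"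
      using inc by (intro Lim_emeasure_incseq) auto
    thus "emeasure \<beta> (ball a r) \<le> ennreal (l * r ^ DIM('a))"
      unfolding U by (rule LIMSEQ_le_const2) (use * sr in auto)
  qed
qed

definition vitali_const :: "'a::euclidean_space itself => real" where
  "vitali_const _ = 5 ^ DIM('a) * unit_ball_vol (DIM('a))"

lemma vitali_const_pos: "vitali_const TYPE('a::euclidean_space) > 0"
  by (simp add: vitali_const_def)

lemma emeasure_cball5:
  fixes x :: "'a::euclidean_space"
  assumes "r \<ge> 0" shows "emeasure lborel (cball x (5 * r)) = ennreal (vitali_const TYPE('a) * r ^ DIM('a))"
  using assms by (simp add: emeasure_cball vitali_const_def power_mult_distrib mult_ac)

text \<open>
The weak type bound for the maximal function: off the maximal set, small volume is outweighed by mass.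
\<close>

lemma emeasure_compl_maximal_set:
  fixes \<beta> :: "'a::euclidean_space measure"
  assumes [simp]: "sets \<beta> = sets borel" and fin: "emeasure \<beta> UNIV < \<infinity>" and l: "l > 0"
  shows "emeasure lborel (- maximal_set \<beta> l) \<le> ennreal (vitali_const TYPE('a) / l) * emeasure \<beta> UNIV"
proof -
  define T where "T = enn2real (emeasure \<beta> UNIV)"
  have T: "emeasure \<beta> UNIV = ennreal T" "T \<ge> 0" using fin by (auto simp: T_def less_top)
  define R where "R = max 1 (T / l)"
  obtain E' where E': "E' \<in> sets borel" "- maximal_set \<beta> l \<subseteq> E'"
     "emeasure lborel E' \<le> ennreal (vitali_const TYPE('a) / l) * emeasure \<beta> UNIV"
  proof (rule vitali_compare[where \<alpha> = lborel and \<beta> = \<beta> and V = UNIV and E = "- maximal_set \<beta> l" and R = R and K = "ennreal (vitali_const TYPE('a) / l)"])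
    fix x assume "x \<in> - maximal_set \<beta> l"
    then obtain r where r: "r > 0" "emeasure \<beta> (ball x r) > ennreal (l * r ^ DIM('a))"
      by (auto simp: maximal_set_def not_le)
    have "ennreal (l * r ^ DIM('a)) < ennreal T"
      using r(2) unfolding T(1)[symmetric] by (rule less_le_trans) (auto intro!: emeasure_mono)
    hence *: "r ^ DIM('a) < T / l" using l r T(2)
      by (subst (asm) ennreal_less_iff) (auto simp: field_simps)
    have "r \<le> R"
    proof (cases "r \<le> 1")
      case False
      hence "r ^ 1 \<le> r ^ DIM('a)" by (intro power_increasing) auto
      with * show ?thesis by (simp add: R_def)
    qed (simp add: R_def)
    moreover have "emeasure lborel (cball x (5 * r)) \<le> ennreal (vitali_const TYPE('a) / l) * emeasure \<beta> (ball x r)"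
    proof -
      have "emeasure lborel (cball x (5 * r)) = ennreal (vitali_const TYPE('a) / l) * ennreal (l * r ^ DIM('a))"
        using r l vitali_const_pos[where 'a='a] by (subst emeasure_cball5) (auto simp: ennreal_mult[symmetric])
      also have "... \<le> ennreal (vitali_const TYPE('a) / l) * emeasure \<beta> (ball x r)"
        using r by (intro mult_left_mono) auto
      finally show ?thesis .
    qed
    ultimately show "\<exists>r>0. r \<le> R \<and> ball x r \<subseteq> UNIV \<and>
      emeasure lborel (cball x (5 * r)) \<le> ennreal (vitali_const TYPE('a) / l) * emeasure \<beta> (ball x r)" using r by auto
  qed auto
  have "emeasure lborel (- maximal_set \<beta> l) \<le> emeasure lborel E'"
    using E' by (intro emeasure_mono) auto
  with E'(3) show ?thesis by simp
qed

text \<open>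
On the maximal set \<open>\<beta>\<close> is bounded by a multiple of Lebesgue measure. The roles of the two measures
in the covering argument are exchanged, with \<open>V\<close> an open set slightly larger than \<open>E\<close>.
\<close>

lemma emeasure_subset_maximal_set:
  fixes \<beta> :: "'a::euclidean_space measure"
  assumes [simp]: "sets \<beta> = sets borel" and l: "l \<ge> 0" and E: "E \<in> sets borel" "E \<subseteq> maximal_set \<beta> l"
    and finE: "emeasure lborel E < \<infinity>"
  shows "emeasure \<beta> E \<le> ennreal (10 ^ DIM('a) * l / unit_ball_vol DIM('a)) * emeasure lborel E"
proof -
  define K where "K = 10 ^ DIM('a) * l / unit_ball_vol DIM('a)"
  have K0: "K \<ge> 0" using l by (simp add: K_def)
  have "emeasure \<beta> E \<le> ennreal K * (emeasure lborel E + ennreal e)" if e: "e > 0" for e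
  proof -
    obtain V where V: "open V" "E \<subseteq> V" "emeasure lborel (V - E) < ennreal e"
    proof -
      have "E \<in> sets lebesgue" using E(1) by (simp add: sets_completionI_sets)
      then obtain V where V: "open V" "E \<subseteq> V" "emeasure lebesgue (V - E) < ennreal e"
        using sets_lebesgue_outer_open[OF _ e] by blast
      moreover have "V - E \<in> sets borel" using V E by auto
      ultimately show ?thesis using that by (simp add: main_part_sets)
    qed
    have VE: "emeasure lborel V \<le> emeasure lborel E + ennreal e"
    proof -
      have "emeasure lborel V \<le> emeasure lborel (E \<union> (V - E))" using V E by (intro emeasure_mono) auto
      also have "... \<le> emeasure lborel E + emeasure lborel (V - E)" using V E by (intro emeasure_subadditive) auto
      also have "... \<le> emeasure lborel E + ennreal e" using V(3) by (intro add_left_mono) auto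
      finally show ?thesis .
    qed
    obtain E' where E': "E' \<in> sets borel" "E \<subseteq> E'" "emeasure \<beta> E' \<le> ennreal K * emeasure lborel V"
    proof (rule vitali_compare[where \<alpha> = \<beta> and \<beta> = lborel and V = V and E = E and R = 1 and K = "ennreal K"])
      fix x assume x: "x \<in> E"
      obtain r where r: "r > 0" "ball x r \<subseteq> V" using V x by (meson open_contains_ball subsetD)
      define s where "s = min r 1"
      have s: "s > 0" "s \<le> 1" "ball x s \<subseteq> V" using r by (auto simp: s_def)
      have "emeasure \<beta> (cball x (5 * s)) \<le> emeasure \<beta> (ball x (10 * s))"
        using s by (intro emeasure_mono) auto
      also have "... \<le> ennreal (l * (10 * s) ^ DIM('a))" using E(2) x s by (intro maximal_setD) auto
      also have "... = ennreal K * emeasure lborel (ball x s)"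
      proof -
        have "unit_ball_vol (real DIM('a)) \<noteq> 0" using unit_ball_vol_pos[of "real DIM('a)"] by linarith
        hence "l * (10 * s) ^ DIM('a) = K * (unit_ball_vol (real DIM('a)) * s ^ DIM('a))"
          by (simp add: K_def power_mult_distrib)
        hence "ennreal (l * (10 * s) ^ DIM('a)) = ennreal (K * (unit_ball_vol (real DIM('a)) * s ^ DIM('a)))" by (rule arg_cong)
        thus ?thesis using s K0 by (subst emeasure_ball) (simp_all only: ennreal_mult[symmetric] less_imp_le zero_le_mult_iff unit_ball_vol_nonneg zero_le_power simp_thms)
      qed
      finally show "\<exists>r>0. r \<le> 1 \<and> ball x r \<subseteq> V \<and> emeasure \<beta> (cball x (5 * r)) \<le> ennreal K * emeasure lborel (ball x r)"
        using s by auto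
    qed (use V in auto)
    have "emeasure \<beta> E \<le> emeasure \<beta> E'" using E' by (intro emeasure_mono) auto
    also have "... \<le> ennreal K * (emeasure lborel E + ennreal e)"
      using E'(3) VE by (meson mult_left_mono order_trans zero_le)
    finally show ?thesis .
  qed
  note * = this
  have "(\<lambda>n. ennreal K * (emeasure lborel E + ennreal (1 / (real (Suc n))))) \<longlonglongrightarrow> ennreal K * (emeasure lborel E + ennreal 0)"
    by (intro ennreal_tendsto_cmult tendsto_add tendsto_const tendsto_ennrealI LIMSEQ_Suc lim_1_over_n) auto
  hence "emeasure \<beta> E \<le> ennreal K * (emeasure lborel E + ennreal 0)"
    by (rule LIMSEQ_le_const) (use * in auto)
  thus ?thesis by (simp add: K_def)
qed

text \<open>
Where the density fails to be zero at scale \<open>q\<close>, the covering argument inside an open set \<open>V \<supseteq> E\<close> of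
small \<open>\<sigma>\<close>-mass shows that the volume is at most \<open>\<sigma> V / q\<close>.
\<close>

lemma AE_zero_density:
  fixes \<sigma> :: "'a::euclidean_space measure"
  assumes [simp]: "sets \<sigma> = sets borel" and fin: "emeasure \<sigma> UNIV < \<infinity>"
    and E: "E \<in> sets borel" "emeasure \<sigma> E = 0"
  shows "AE a in lborel. a \<in> E --> (\<forall>\<epsilon>>0. \<exists>r0>0. \<forall>r. 0 < r \<and> r < r0 -->
           emeasure \<sigma> (ball a r) \<le> ennreal (\<epsilon> * r ^ DIM('a)))"
proof -
  define B where "B q = {a\<in>E. \<forall>r0>0. \<exists>r. 0 < r \<and> r < r0 \<and> emeasure \<sigma> (ball a r) > ennreal (q * r ^ DIM('a))}" for q :: real
  have null: "\<exists>Z\<in>null_sets lborel. B q \<subseteq> Z" if q: "q > 0" for q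
  proof -
    have ex: "\<exists>E'. E' \<in> sets borel \<and> B q \<subseteq> E' \<and> emeasure lborel E' \<le> ennreal (vitali_const TYPE('a) / q) * ennreal (1 / Suc n)" for n
    proof -
      have "finite_measure \<sigma>" using fin by (intro finite_measureI) (auto simp: space_borel sets_eq_imp_space_eq[OF assms(1)])
      then have "emeasure \<sigma> E = (INF U\<in>{U. E \<subseteq> U \<and> open U}. emeasure \<sigma> U)"
        using E by (intro outer_regular) (auto simp: less_top[symmetric] finite_measure.emeasure_finite)
      hence "(INF U\<in>{U. E \<subseteq> U \<and> open U}. emeasure \<sigma> U) < ennreal (1 / Suc n)" using E(2) by simp
      then obtain V where V: "open V" "E \<subseteq> V" "emeasure \<sigma> V < ennreal (1 / Suc n)"
        by (auto simp: INF_less_iff)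
      obtain E' where E': "E' \<in> sets borel" "B q \<subseteq> E'" "emeasure lborel E' \<le> ennreal (vitali_const TYPE('a) / q) * emeasure \<sigma> V"
      proof (rule vitali_compare[where \<alpha> = lborel and \<beta> = \<sigma> and V = V and E = "B q" and R = 1 and K = "ennreal (vitali_const TYPE('a) / q)"])
        fix x assume x: "x \<in> B q"
        hence "x \<in> V" using V by (auto simp: B_def)
        then obtain s where s: "s > 0" "ball x s \<subseteq> V" using V by (meson open_contains_ball)
        have "min s 1 > 0" using s by simp
        then obtain r where r: "0 < r" "r < min s 1" "emeasure \<sigma> (ball x r) > ennreal (q * r ^ DIM('a))"
          using x unfolding B_def by blast
        have "emeasure lborel (cball x (5 * r)) = ennreal (vitali_const TYPE('a) / q) * ennreal (q * r ^ DIM('a))"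
          using r q vitali_const_pos[where 'a='a] by (subst emeasure_cball5) (auto simp: ennreal_mult[symmetric])
        also have "... \<le> ennreal (vitali_const TYPE('a) / q) * emeasure \<sigma> (ball x r)"
          using r by (intro mult_left_mono) auto
        finally show "\<exists>r>0. r \<le> 1 \<and> ball x r \<subseteq> V \<and>
           emeasure lborel (cball x (5 * r)) \<le> ennreal (vitali_const TYPE('a) / q) * emeasure \<sigma> (ball x r)"
          using r s by (intro exI[of _ r]) auto
      qed (use V in auto)
      have "emeasure lborel E' \<le> ennreal (vitali_const TYPE('a) / q) * ennreal (1 / Suc n)"
        using E'(3) V(3) by (meson mult_left_mono order_trans zero_le less_imp_le)
      with E' show ?thesis by blast
    qed
    then obtain E' where E': "\<And>n. E' n \<in> sets borel" "\<And>n. B q \<subseteq> E' n"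
       "\<And>n. emeasure lborel (E' n) \<le> ennreal (vitali_const TYPE('a) / q) * ennreal (1 / Suc n)" by metis
    have "emeasure lborel (\<Inter>n. E' n) \<le> ennreal (vitali_const TYPE('a) / q) * ennreal 0"
    proof (rule LIMSEQ_le_const)
      show "(\<lambda>n. ennreal (vitali_const TYPE('a) / q) * ennreal (1 / Suc n)) \<longlonglongrightarrow> ennreal (vitali_const TYPE('a) / q) * ennreal 0"
        by (intro ennreal_tendsto_cmult tendsto_ennrealI LIMSEQ_Suc lim_1_over_n) auto
      show "\<exists>N. \<forall>n\<ge>N. emeasure lborel (\<Inter>n. E' n) \<le> ennreal (vitali_const TYPE('a) / q) * ennreal (1 / Suc n)"
      proof (intro exI allI impI)
        fix n
        have "emeasure lborel (\<Inter>n. E' n) \<le> emeasure lborel (E' n)" using E'(1) by (intro emeasure_mono) auto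
        with E'(3)[of n] show "emeasure lborel (\<Inter>n. E' n) \<le> ennreal (vitali_const TYPE('a) / q) * ennreal (1 / Suc n)" by simp
      qed
    qed
    hence "(\<Inter>n. E' n) \<in> null_sets lborel" using E'(1) by (intro null_setsI) auto
    moreover have "B q \<subseteq> (\<Inter>n. E' n)" using E'(2) by blast
    ultimately show ?thesis by blast
  qed
  have "AE a in lborel. \<forall>n::nat. a \<notin> B (1 / Suc n)"
  proof (subst AE_all_countable, intro allI)
    fix n
    obtain Z where "Z \<in> null_sets lborel" "B (1 / Suc n) \<subseteq> Z" using null[of "1 / Suc n"] by auto
    thus "AE a in lborel. a \<notin> B (1 / Suc n)" by (intro AE_I'[of Z]) auto
  qed
  thus ?thesis
  proof eventually_elim
    case (elim a)
    show ?case
    proof (intro impI allI)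
      fix \<epsilon> :: real assume a: "a \<in> E" and \<epsilon>: "\<epsilon> > 0"
      obtain n where n: "1 / Suc n < \<epsilon>" using \<epsilon> by (meson nat_approx_posE)
      from elim a obtain r0 where r0: "r0 > 0" "\<And>r. 0 < r ==> r < r0 ==> emeasure \<sigma> (ball a r) \<le> ennreal (1 / Suc n * r ^ DIM('a))"
        by (force simp: B_def not_less)
      show "\<exists>r0>0. \<forall>r. 0 < r \<and> r < r0 --> emeasure \<sigma> (ball a r) \<le> ennreal (\<epsilon> * r ^ DIM('a))"
      proof (intro exI[of _ r0] conjI allI impI, rule r0)
        fix r assume r: "0 < r \<and> r < r0"
        have "ennreal (1 / Suc n * r ^ DIM('a)) \<le> ennreal (\<epsilon> * r ^ DIM('a))"
          using n r by (intro ennreal_leI mult_right_mono) auto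
        with r0(2) r show "emeasure \<sigma> (ball a r) \<le> ennreal (\<epsilon> * r ^ DIM('a))" by (meson order_trans)
      qed
    qed
  qed
qed

section \<open>Convolution\<close>

lemma ball_cball_borel [measurable]:
  "ball z r \<in> sets borel" "cball z r \<in> sets borel" for z :: "'a::metric_space"
  by auto

lemma nn_integral_translate:
  fixes f :: "'a::euclidean_space => ennreal"
  assumes [measurable]: "f \<in> borel_measurable borel"
  shows "(\<integral>+y. f (x + y)) = (\<integral>+y. f y)"
  by (subst (2) lborel_distr_plus[of x, symmetric]) (simp add: nn_integral_distr)

lemma nn_integral_scale:
  fixes f :: "'a::euclidean_space => ennreal"
  assumes [measurable]: "f \<in> borel_measurable borel" and c: "c \<noteq> 0"
  shows "(\<integral>+y. f y) = ennreal (\<bar>c\<bar> ^ DIM('a)) * (\<integral>+y. f (x + c *\<^sub>R y))"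
  by (subst lborel_affine[OF c, of x])
     (simp add: nn_integral_density nn_integral_distr nn_integral_cmult)

lemma nn_integral_reflect:
  fixes f :: "'a::euclidean_space => ennreal"
  assumes [measurable]: "f \<in> borel_measurable borel"
  shows "(\<integral>+y. f (x - y)) = (\<integral>+y. f y)"
  using nn_integral_scale[of f "-1" x] by simp

definition conv :: "('a::euclidean_space => ennreal) => ('a => ennreal) => 'a => ennreal" where
  "conv f g x = (\<integral>+y. f (x - y) * g y)"

lemma measurable_conv [measurable]:
  assumes [measurable]: "f \<in> borel_measurable borel" "g \<in> borel_measurable borel"
  shows "conv f g \<in> borel_measurable borel"
  unfolding conv_def by measurable

lemma conv_commute:
  assumes [measurable]: "f \<in> borel_measurable borel" "g \<in> borel_measurable borel"
  shows "conv f g = conv g f"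
proof
  fix x
  show "conv f g x = conv g f x"
    unfolding conv_def by (subst nn_integral_reflect[of _ x, symmetric]) (auto simp: mult.commute)
qed

lemma conv_assoc:
  assumes [measurable]: "f \<in> borel_measurable borel" "g \<in> borel_measurable borel" "h \<in> borel_measurable borel"
  shows "conv f (conv g h) = conv (conv f g) h"
proof
  fix x
  have "conv f (conv g h) x = (\<integral>+y. (\<integral>+z. f (x - y) * (g (y - z) * h z)))"
    unfolding conv_def by (simp add: nn_integral_cmult)
  also have "... = (\<integral>+z. (\<integral>+y. f (x - y) * (g (y - z) * h z)))"
    by (rule lborel_pair.Fubini') measurable
  also have "... = (\<integral>+z. (\<integral>+y. f (x - y) * g (y - z)) * h z)"
    by (simp add: nn_integral_multc mult.assoc[symmetric])
  also have "(\<integral>+y. f (x - y) * g (y - z)) = conv f g (x - z)" for z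
    unfolding conv_def
    by (subst nn_integral_translate[of _ z, symmetric]) (auto simp: algebra_simps)
  hence "(\<integral>+z. (\<integral>+y. f (x - y) * g (y - z)) * h z) = conv (conv f g) h x"
    by (simp add: conv_def[of "conv f g"])
  finally show "conv f (conv g h) x = conv (conv f g) h x" .
qed

lemma conv_left_commute:
  assumes [measurable]: "f \<in> borel_measurable borel" "g \<in> borel_measurable borel" "h \<in> borel_measurable borel"
  shows "conv f (conv g h) = conv g (conv f h)"
  by (simp add: conv_assoc conv_commute[of f g])

lemma nn_integral_conv:
  assumes [measurable]: "f \<in> borel_measurable borel" "g \<in> borel_measurable borel"
  shows "(\<integral>+x. conv f g x) = (\<integral>+x. f x) * (\<integral>+x. g x)"
proof -
  have "(\<integral>+x. conv f g x) = (\<integral>+y. (\<integral>+x. f (x - y) * g y))"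
    unfolding conv_def by (rule lborel_pair.Fubini') measurable
  also have "... = (\<integral>+y. (\<integral>+x. f x) * g y)"
  proof (intro nn_integral_cong)
    fix y
    have "(\<integral>+x. f (x - y)) = (\<integral>+x. f x)"
      using nn_integral_translate[of f "-y"] by simp
    thus "(\<integral>+x. f (x - y) * g y) = (\<integral>+x. f x) * g y" by (simp add: nn_integral_multc)
  qed
  finally show ?thesis by (simp add: nn_integral_cmult)
qed

section \<open>A twice differentiable radial bump\<close>

lemma pospow_deriv:
  assumes "k \<ge> 2"
  shows "((\<lambda>t::real. max 0 t ^ k) has_real_derivative real k * max 0 t ^ (k - 1)) (at t)"
proof -
  consider "t > 0" | "t < 0" | "t = 0" by linarith
  thus ?thesis
  proof cases
    case 1
    have "((\<lambda>t::real. t ^ k) has_real_derivative real k * t ^ (k - 1)) (at t)"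
      by (auto intro!: derivative_eq_intros)
    hence "((\<lambda>t::real. t ^ k) has_real_derivative real k * max 0 t ^ (k - 1)) (at t)"
      using 1 by simp
    thus ?thesis
      by (rule has_field_derivative_transform_within_open[of _ _ t "{0<..}"]) (use 1 in auto)
  next
    case 2
    have "((\<lambda>t::real. 0) has_real_derivative real k * max 0 t ^ (k - 1)) (at t)"
      using 2 assms by (auto intro!: derivative_eq_intros)
    thus ?thesis
      by (rule has_field_derivative_transform_within_open[of _ _ t "{..<0}"]) (use 2 assms in auto)
  next
    case 3
    have "((\<lambda>h. max 0 h ^ k / h) \<longlongrightarrow> 0) (at (0::real))"
    proof (rule Lim_null_comparison)
      show "eventually (\<lambda>h::real. norm (max 0 h ^ k / h) \<le> \<bar>h\<bar> ^ (k - 1)) (at 0)"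
      proof (intro always_eventually allI)
        fix h :: real
        have "k = Suc (k - 1)" using assms by simp
        hence "max 0 h ^ k = max 0 h * max 0 h ^ (k - 1)" by (metis power_Suc)
        also have "... \<le> \<bar>h\<bar> * \<bar>h\<bar> ^ (k - 1)" by (intro mult_mono power_mono) auto
        finally show "norm (max 0 h ^ k / h) \<le> \<bar>h\<bar> ^ (k - 1)"
          by (auto simp: divide_simps abs_mult power_abs mult.commute)
      qed
      have "((\<lambda>h::real. \<bar>h\<bar> ^ (k - 1)) \<longlongrightarrow> \<bar>0\<bar> ^ (k - 1)) (at 0)" by (intro tendsto_intros)
      thus "((\<lambda>h::real. \<bar>h\<bar> ^ (k - 1)) \<longlongrightarrow> 0) (at 0)" using assms by (simp add: power_0_left)
    qed
    thus ?thesis using 3 assms unfolding DERIV_def by (simp add: power_0_left)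
  qed
qed

definition bump_pow :: "nat => real => 'a::euclidean_space => real" where
  "bump_pow k \<rho> z = max 0 (1 - (z \<bullet> z) / \<rho>^2) ^ k"

lemma bump_pow_nonneg [simp]: "bump_pow k \<rho> z \<ge> 0" by (simp add: bump_pow_def)

lemma continuous_on_bump_pow [continuous_intros]:
  "continuous_on A f ==> continuous_on A (\<lambda>x. bump_pow k \<rho> (f x))"
  unfolding bump_pow_def divide_inverse by (intro continuous_intros)

lemma measurable_bump_pow [measurable]: "bump_pow k \<rho> \<in> borel_measurable borel"
  by (intro borel_measurable_continuous_onI continuous_intros)

lemma bump_pow_le_1 [simp]: "bump_pow k \<rho> z \<le> 1"
  unfolding bump_pow_def by (intro power_le_one) auto

lemma bump_pow_eq_0: "\<rho> > 0 ==> norm z \<ge> \<rho> ==> k > 0 ==> bump_pow k \<rho> z = 0"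
  by (simp add: bump_pow_def dot_square_norm power_mono field_simps max_def)

text \<open>
The powers of \<open>max 0 (1 - (norm z / \<rho>)^2)\<close> are closed under differentiation up to polynomial factors;
this makes an explicit bump more convenient than an abstract smooth one. The fourth power has two
continuous derivatives.
\<close>

lemma bump_pow_deriv:
  assumes "k \<ge> 2"
  shows "((\<lambda>t. bump_pow k \<rho> (z + t *\<^sub>R v)) has_real_derivative
           - (2 * real k / \<rho>^2) * ((z + t *\<^sub>R v) \<bullet> v) * bump_pow (k - 1) \<rho> (z + t *\<^sub>R v)) (at t)"
proof -
  have "((\<lambda>t. 1 - ((z + t *\<^sub>R v) \<bullet> (z + t *\<^sub>R v)) / \<rho>^2) has_real_derivative - (2 * ((z + t *\<^sub>R v) \<bullet> v)) / \<rho>^2) (at t)"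
    unfolding inner_add_left inner_add_right inner_scaleR_left inner_scaleR_right
    by (auto intro!: derivative_eq_intros simp: algebra_simps inner_commute divide_inverse)
  from DERIV_chain2[OF pospow_deriv[OF assms] this]
  show ?thesis by (simp add: bump_pow_def field_simps)
qed

definition bump_mass :: "'a::euclidean_space itself => real" where
  "bump_mass _ = enn2real (\<integral>+(z::'a). ennreal (bump_pow 4 1 z))"

lemma bump_mass:
  shows nn_integral_bump_pow: "(\<integral>+(z::'a::euclidean_space). ennreal (bump_pow 4 1 z)) = ennreal (bump_mass TYPE('a))"
    and bump_mass_pos: "bump_mass TYPE('a) > 0"
proof -
  let ?I = "\<integral>+(z::'a). ennreal (bump_pow 4 1 z)"
  have "?I \<le> (\<integral>+(z::'a). indicator (ball 0 1) z)"
  proof (intro nn_integral_mono)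
    fix z :: 'a
    show "ennreal (bump_pow 4 1 z) \<le> indicator (ball 0 1) z"
      using bump_pow_eq_0[of 1 z 4] by (cases "norm z < 1") (auto simp: ennreal_le_1)
  qed
  also have "... = emeasure lborel (ball (0::'a) 1)" by simp
  also have "... < \<infinity>" by (simp add: emeasure_ball)
  finally have fin: "?I < \<infinity>" .
  thus "?I = ennreal (bump_mass TYPE('a))" by (simp add: bump_mass_def less_top)
  have "0 < ennreal ((3/4) ^ 4) * emeasure lborel (ball (0::'a) (1/2))"
    by (simp add: emeasure_ball ennreal_zero_less_mult_iff)
  also have "... = (\<integral>+(z::'a). ennreal ((3/4) ^ 4) * indicator (ball 0 (1/2)) z)"
    by (simp add: nn_integral_cmult_indicator)
  also have "... \<le> ?I"
  proof (intro nn_integral_mono)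
    fix z :: 'a
    have "(3/4) ^ 4 \<le> bump_pow 4 1 z" if "norm z < 1/2"
    proof -
      have "norm z ^ 2 \<le> (1/2) ^ 2" using that by (intro power_mono) auto
      hence "3/4 \<le> 1 - z \<bullet> z" by (simp add: power2_norm_eq_inner power_divide)
      thus ?thesis unfolding bump_pow_def by (intro power_mono) auto
    qed
    thus "ennreal ((3/4) ^ 4) * indicator (ball 0 (1/2)) z \<le> ennreal (bump_pow 4 1 z)"
      by (auto split: split_indicator intro!: ennreal_leI)
  qed
  finally have "?I > 0" .
  with fin show "bump_mass TYPE('a) > 0" by (simp add: bump_mass_def enn2real_positive_iff)
qed

definition bump :: "real => 'a::euclidean_space => real" where
  "bump \<rho> z = bump_pow 4 \<rho> z / (bump_mass TYPE('a) * \<rho> ^ DIM('a))"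

lemma bump_nonneg [simp]: "\<rho> > 0 ==> bump \<rho> z \<ge> 0"
  by (simp add: bump_def bump_mass_pos less_imp_le)

lemma continuous_on_bump [continuous_intros]:
  "continuous_on A f ==> continuous_on A (\<lambda>x. bump \<rho> (f x))"
  unfolding bump_def divide_inverse by (intro continuous_intros)

lemma measurable_bump [measurable]: "bump \<rho> \<in> borel_measurable borel"
  by (intro borel_measurable_continuous_onI continuous_intros)

lemma bump_minus [simp]: "bump \<rho> (- z) = bump \<rho> z"
  by (simp add: bump_def bump_pow_def)

lemma bump_eq_0: "\<rho> > 0 ==> norm z \<ge> \<rho> ==> bump \<rho> z = 0"
  by (simp add: bump_def bump_pow_eq_0)

lemma bump_le: "\<rho> > 0 ==> bump \<rho> (z::'a::euclidean_space) \<le> 1 / (bump_mass TYPE('a) * \<rho> ^ DIM('a))"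
  unfolding bump_def using bump_mass_pos[where 'a='a] by (intro divide_right_mono) (auto intro!: mult_nonneg_nonneg less_imp_le)

lemma bump_scale: "\<rho> > 0 ==> bump \<rho> (\<rho> *\<^sub>R z) = bump 1 z / \<rho> ^ DIM('a)" for z :: "'a::euclidean_space"
  by (simp add: bump_def bump_pow_def power2_eq_square)

lemma nn_integral_bump:
  assumes \<rho>: "\<rho> > 0"
  shows "(\<integral>+(z::'a::euclidean_space). ennreal (bump \<rho> z)) = 1"
proof -
  have b: "bump 1 z = (1 / bump_mass TYPE('a)) * bump_pow 4 1 z" for z :: 'a by (simp add: bump_def)
  have 1: "(\<integral>+(z::'a). ennreal (bump 1 z)) = 1"
  proof -
    have "(\<integral>+(z::'a). ennreal (bump 1 z)) =
        (\<integral>+(z::'a). ennreal (1 / bump_mass TYPE('a)) * ennreal (bump_pow 4 1 z))"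
      using bump_mass_pos[where 'a='a] by (intro nn_integral_cong) (simp add: ennreal_mult[symmetric] b)
    also have "... = ennreal (1 / bump_mass TYPE('a)) * ennreal (bump_mass TYPE('a))"
      by (subst nn_integral_cmult) (auto simp: nn_integral_bump_pow)
    finally show ?thesis using bump_mass_pos[where 'a='a] by (simp add: ennreal_mult[symmetric])
  qed
  have "(\<integral>+(z::'a). ennreal (bump \<rho> z)) = ennreal (\<rho> ^ DIM('a)) * (\<integral>+(z::'a). ennreal (bump \<rho> (\<rho> *\<^sub>R z)))"
    using \<rho> by (subst nn_integral_scale[of _ \<rho> 0]) auto
  also have "... = (\<integral>+(z::'a). ennreal (\<rho> ^ DIM('a)) * ennreal (bump 1 z / \<rho> ^ DIM('a)))"
    using \<rho> by (simp add: bump_scale nn_integral_cmult)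
  also have "... = (\<integral>+(z::'a). ennreal (bump 1 z))"
    using \<rho> by (intro nn_integral_cong) (simp add: ennreal_mult[symmetric])
  finally show ?thesis using 1 by simp
qed

lemma integrable_bump: "\<rho> > 0 ==> integrable lborel (bump \<rho> :: 'a::euclidean_space => real)"
  by (rule integrableI_nonneg) (auto simp: nn_integral_bump)

lemma integral_bump: "\<rho> > 0 ==> (\<integral>\<^sub>L (z::'a::euclidean_space). bump \<rho> z) = 1"
  by (subst integral_eq_nn_integral) (auto simp: nn_integral_bump)

section \<open>The Newton kernel\<close>

definition newton :: "'a::euclidean_space => real" where
  "newton z = 1 / norm z ^ (DIM('a) - 2)"

lemma newton_nonneg [simp]: "newton z \<ge> 0" by (simp add: newton_def)

lemma measurable_newton [measurable]: "newton \<in> borel_measurable borel"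
  unfolding newton_def by measurable

lemma newton_minus [simp]: "newton (- z) = newton z" by (simp add: newton_def)

lemma newton_antimono: "0 < r ==> r \<le> norm z ==> newton z \<le> 1 / r ^ (DIM('a) - 2)" for z :: "'a::euclidean_space"
  unfolding newton_def by (intro divide_left_mono power_mono mult_pos_pos zero_less_power) auto

lemma ennreal_le_suminf: "f k \<le> (\<Sum>k. f k)" for f :: "nat => ennreal"
  using sum_le_suminf[of f "{k}"] by simp

lemma dyadic_exists:
  fixes t :: real
  assumes "0 < t" "t \<le> 1"
  shows "\<exists>k. (1/2) ^ Suc k < t \<and> t \<le> (1/2) ^ k"
proof -
  obtain n where n: "(1/2) ^ n < t" using real_arch_pow_inv[of t "1/2"] assms by auto
  define m where "m = (LEAST n. (1/2) ^ n < t)"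
  have m: "(1/2) ^ m < t" unfolding m_def by (rule LeastI[of "\<lambda>n. (1/2) ^ n < t", OF n])
  hence "m \<noteq> 0" using assms by (cases m) auto
  then obtain k where k: "m = Suc k" by (cases m) auto
  have "\<not> (1/2) ^ k < t" using not_less_Least[of k "\<lambda>n. (1/2) ^ n < t"] k unfolding m_def by simp
  with m k show ?thesis by (auto simp: not_less)
qed

definition newton_const :: "'a::euclidean_space itself => real" where
  "newton_const _ = 2 ^ DIM('a) * unit_ball_vol DIM('a)"

lemma newton_const_pos: "newton_const TYPE('a::euclidean_space) > 0"
  by (simp add: newton_const_def)

text \<open>
Summation over dyadic shells: on the shell of radius \<open>2 ^ (- k)\<close> the kernel is of order
\<open>2 ^ (k * (d - 2))\<close> and the volume of order \<open>2 ^ (- k * d)\<close>.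
\<close>

lemma nn_integral_newton_cball:
  assumes d: "DIM('a::euclidean_space) \<ge> 3" and \<rho>: "\<rho> > 0"
  shows "(\<integral>+(z::'a). ennreal (newton z) * indicator (cball 0 \<rho>) z) \<le> ennreal (newton_const TYPE('a) * \<rho>^2)"
proof -
  let ?d = "DIM('a)" let ?\<omega> = "unit_ball_vol (real DIM('a))"
  define c where "c k = (2 ^ Suc k / \<rho>) ^ (?d - 2)" for k
  have c0: "c k \<ge> 0" for k using \<rho> by (simp add: c_def)
  have le: "ennreal (newton z) * indicator (cball 0 \<rho>) z \<le> (\<Sum>k. ennreal (c k) * indicator (cball 0 (\<rho> * (1/2) ^ k)) z)" for z :: 'a
  proof (cases "z \<noteq> 0 \<and> norm z \<le> \<rho>")
    case True
    then obtain k where k: "(1/2) ^ Suc k < norm z / \<rho>" "norm z / \<rho> \<le> (1/2) ^ k"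
      using dyadic_exists[of "norm z / \<rho>"] \<rho> by auto
    have "newton z \<le> 1 / (\<rho> * (1/2) ^ Suc k) ^ (?d - 2)"
      using k \<rho> by (intro newton_antimono) (auto simp: field_simps)
    also have "... = c k" by (simp add: c_def power_divide power_mult_distrib field_simps)
    finally have "ennreal (newton z) * indicator (cball 0 \<rho>) z \<le> ennreal (c k) * indicator (cball 0 (\<rho> * (1/2) ^ k)) z"
      using k \<rho> True by (auto simp: field_simps intro!: ennreal_leI)
    also have "... \<le> (\<Sum>k. ennreal (c k) * indicator (cball 0 (\<rho> * (1/2) ^ k)) z)"
      by (rule ennreal_le_suminf)
    finally show ?thesis .
  qed (use d in \<open>auto simp: newton_def power_0_left\<close>)
  have "(\<integral>+(z::'a). ennreal (newton z) * indicator (cball 0 \<rho>) z) \<le>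
     (\<integral>+(z::'a). (\<Sum>k. ennreal (c k) * indicator (cball 0 (\<rho> * (1/2) ^ k)) z))"
    by (intro nn_integral_mono le)
  also have "... = (\<Sum>k. ennreal (c k) * emeasure lborel (cball (0::'a) (\<rho> * (1/2) ^ k)))"
    by (subst nn_integral_suminf) (auto simp: nn_integral_cmult_indicator)
  also have "... = (\<Sum>k. ennreal (?\<omega> * 2 ^ (?d - 2) * \<rho>^2 * (1/4) ^ k))"
  proof (intro suminf_cong)
    fix k
    obtain n where n: "?d = n + 2" "?d - 2 = n" using d by (intro that[of "?d - 2"]) auto
    have half: "2 * 2 ^ k / \<rho> * (\<rho> * (1/2) ^ k) = 2" using \<rho> by (simp add: power_divide)
    have "c k * (?\<omega> * (\<rho> * (1/2) ^ k) ^ ?d) = ?\<omega> * ((2 * 2 ^ k / \<rho> * (\<rho> * (1/2) ^ k)) ^ n * (\<rho> * (1/2) ^ k)^2)"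
      unfolding c_def n(2) unfolding n(1) power_add power_mult_distrib power_Suc by (simp only: mult_ac)
    also have "... = ?\<omega> * 2 ^ (?d - 2) * \<rho>^2 * ((1/2) ^ k)^2"
      unfolding half n(2) by (simp only: power_mult_distrib mult_ac)
    also have "((1/2::real) ^ k)^2 = (1/4) ^ k" by (simp add: power2_eq_square power_mult_distrib[symmetric])
    finally show "ennreal (c k) * emeasure lborel (cball (0::'a) (\<rho> * (1/2) ^ k)) = ennreal (?\<omega> * 2 ^ (?d - 2) * \<rho>^2 * (1/4) ^ k)"
      using c0[of k] \<rho> by (simp add: emeasure_cball ennreal_mult[symmetric])
  qed
  also have "... = ennreal (\<Sum>k. ?\<omega> * 2 ^ (?d - 2) * \<rho>^2 * (1/4) ^ k)"
    by (intro suminf_ennreal2) (auto intro!: summable_mult summable_geometric)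
  also have "(\<Sum>k. ?\<omega> * 2 ^ (?d - 2) * \<rho>^2 * (1/4) ^ k) = ?\<omega> * 2 ^ (?d - 2) * \<rho>^2 * (4/3)"
    by (subst suminf_mult) (auto simp: summable_geometric suminf_geometric)
  also have "ennreal ... \<le> ennreal (newton_const TYPE('a) * \<rho>^2)"
  proof (intro ennreal_leI)
    have "?d = (?d - 2) + 2" using d by simp
    hence "(2::real) ^ ?d = 2 ^ (?d - 2) * 2 ^ 2" by (metis power_add)
    hence "(2::real) ^ ?d = 2 ^ (?d - 2) * 4" by simp
    moreover have "0 \<le> ?\<omega> * 2 ^ (?d - 2) * \<rho>^2" by (intro mult_nonneg_nonneg) auto
    ultimately show "?\<omega> * 2 ^ (?d - 2) * \<rho>^2 * (4/3) \<le> newton_const TYPE('a) * \<rho>^2"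
      unfolding newton_const_def by (simp add: mult_ac)
  qed
  finally show ?thesis .
qed

text \<open>
Away from its pole the kernel is at most \<open>1 / \<rho> ^ (d - 2)\<close>, so the position of the ball costs only a
factor.
\<close>

lemma nn_integral_newton_shift:
  fixes x :: "'a::euclidean_space"
  assumes d: "DIM('a) \<ge> 3" and \<rho>: "\<rho> > 0"
  shows "(\<integral>+y. ennreal (newton (x - y)) * indicator (cball z \<rho>) y) \<le> ennreal (2 * newton_const TYPE('a) * \<rho>^2)"
proof -
  let ?d = "DIM('a)" let ?\<omega> = "unit_ball_vol (real DIM('a))"
  have "(\<integral>+y. ennreal (newton (x - y)) * indicator (cball z \<rho>) y) \<le>
    (\<integral>+y. ennreal (newton (x - y)) * indicator (cball 0 \<rho>) (x - y) + ennreal (1 / \<rho> ^ (?d - 2)) * indicator (cball z \<rho>) y)"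
  proof (intro nn_integral_mono)
    fix y
    show "ennreal (newton (x - y)) * indicator (cball z \<rho>) y \<le>
       ennreal (newton (x - y)) * indicator (cball 0 \<rho>) (x - y) + ennreal (1 / \<rho> ^ (?d - 2)) * indicator (cball z \<rho>) y"
    proof (cases "norm (x - y) \<le> \<rho>")
      case False
      hence "newton (x - y) \<le> 1 / \<rho> ^ (?d - 2)" using \<rho> by (intro newton_antimono) auto
      thus ?thesis by (auto split: split_indicator intro!: ennreal_leI add_increasing)
    qed (auto split: split_indicator)
  qed
  also have "... = (\<integral>+y. ennreal (newton (x - y)) * indicator (cball 0 \<rho>) (x - y)) + ennreal (1 / \<rho> ^ (?d - 2)) * emeasure lborel (cball z \<rho>)"
    by (subst nn_integral_add) (measurable, auto simp: nn_integral_cmult_indicator)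
  also have "(\<integral>+y. ennreal (newton (x - y)) * indicator (cball 0 \<rho>) (x - y)) = (\<integral>+(z::'a). ennreal (newton z) * indicator (cball 0 \<rho>) z)"
    by (rule nn_integral_reflect) measurable
  also have "ennreal (1 / \<rho> ^ (?d - 2)) * emeasure lborel (cball z \<rho>) = ennreal (?\<omega> * \<rho>^2)"
  proof -
    obtain n where n: "?d = n + 2" "?d - 2 = n" using d by (intro that[of "?d - 2"]) auto
    have "1 / \<rho> ^ (?d - 2) * (?\<omega> * \<rho> ^ ?d) = ?\<omega> * \<rho>^2"
      unfolding n(2) unfolding n(1) using \<rho> by (simp add: power_add power2_eq_square)
    thus ?thesis using \<rho> by (simp add: emeasure_cball ennreal_mult[symmetric])
  qed
  also have "(\<integral>+(z::'a). ennreal (newton z) * indicator (cball 0 \<rho>) z) + ennreal (?\<omega> * \<rho>^2) \<le>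
     ennreal (newton_const TYPE('a) * \<rho>^2) + ennreal (newton_const TYPE('a) * \<rho>^2)"
    by (intro add_mono nn_integral_newton_cball d \<rho> ennreal_leI mult_right_mono)
       (auto simp: newton_const_def)
  also have "... = ennreal (2 * newton_const TYPE('a) * \<rho>^2)"
    using newton_const_pos[where 'a='a] by (subst ennreal_plus[symmetric]) auto
  finally show ?thesis .
qed

section \<open>Means of the Newton kernel over balls\<close>

lemma norm_line_deriv:
  fixes p v :: "'a::euclidean_space"
  assumes "p + t *\<^sub>R v \<noteq> 0"
  shows "((\<lambda>t. norm (p + t *\<^sub>R v)) has_real_derivative ((p + t *\<^sub>R v) \<bullet> v) / norm (p + t *\<^sub>R v)) (at t)"
proof -
  have 1: "((\<lambda>t. (p + t *\<^sub>R v) \<bullet> (p + t *\<^sub>R v)) has_real_derivative 2 * ((p + t *\<^sub>R v) \<bullet> v)) (at t)"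
  proof -
    have e: "(p + t *\<^sub>R v) \<bullet> (p + t *\<^sub>R v) = p \<bullet> p + 2 * t * (p \<bullet> v) + t^2 * (v \<bullet> v)" for t
      by (simp add: inner_add_left inner_add_right inner_commute power2_eq_square algebra_simps)
    show ?thesis unfolding e by (auto intro!: derivative_eq_intros simp: inner_add_left)
  qed
  have "(p + t *\<^sub>R v) \<bullet> (p + t *\<^sub>R v) > 0" using assms by (simp only: inner_gt_zero_iff not_False_eq_True)
  note pos = this
  have eq: "inverse (sqrt a) / 2 * (2 * b) = b / sqrt a" for a b :: real by (simp add: inverse_eq_divide)
  show ?thesis unfolding norm_eq_sqrt_inner
    by (rule DERIV_cong[OF DERIV_chain2[OF DERIV_real_sqrt[OF pos] 1] eq])
qed

lemma inverse_norm_power_line_deriv: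
  fixes p v :: "'a::euclidean_space"
  assumes "p + t *\<^sub>R v \<noteq> 0" "n > 0"
  shows "((\<lambda>t. 1 / norm (p + t *\<^sub>R v) ^ n) has_real_derivative
           - real n * ((p + t *\<^sub>R v) \<bullet> v) / norm (p + t *\<^sub>R v) ^ (n + 2)) (at t)"
proof -
  let ?r = "norm (p + t *\<^sub>R v)"
  have r: "?r \<noteq> 0" using assms by simp
  obtain m where m: "n = Suc m" using assms(2) by (cases n) auto
  have "((\<lambda>r. inverse (r ^ Suc m)) has_real_derivative - (real (Suc m) * ?r ^ (Suc m - Suc 0) * inverse ((?r ^ Suc m) ^ Suc (Suc 0)))) (at ?r)"
    using r by (intro DERIV_inverse_fun DERIV_pow) simp
  moreover have "- (real (Suc m) * ?r ^ (Suc m - Suc 0) * inverse ((?r ^ Suc m) ^ Suc (Suc 0))) = - real n / ?r ^ (n + 1)"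
    using r unfolding m by (simp add: field_simps power2_eq_square)
  ultimately have "((\<lambda>r. 1 / r ^ n) has_real_derivative - real n / ?r ^ (n + 1)) (at ?r)"
    by (simp only: m inverse_eq_divide)
  from DERIV_chain2[OF this norm_line_deriv[OF assms(1)]] show ?thesis
    using r by (simp add: mult_ac)
qed

definition newton_grad :: "'a::euclidean_space => 'a => real" where
  "newton_grad z v = - real (DIM('a) - 2) * (z \<bullet> v) / norm z ^ DIM('a)"

lemma newton_line_deriv:
  fixes p v :: "'a::euclidean_space"
  assumes d: "DIM('a) \<ge> 3" and "p + t *\<^sub>R v \<noteq> 0"
  shows "((\<lambda>t. newton (p + t *\<^sub>R v)) has_real_derivative newton_grad (p + t *\<^sub>R v) v) (at t)"
proof -
  have "DIM('a) - 2 + 2 = DIM('a)" "DIM('a) - 2 > 0" using d by auto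
  thus ?thesis
    using inverse_norm_power_line_deriv[OF assms(2), of "DIM('a) - 2"] by (simp add: newton_def newton_grad_def)
qed

definition newton_hess :: "'a::euclidean_space => 'a => real" where
  "newton_hess z v = - real (DIM('a) - 2) * ((v \<bullet> v) / norm z ^ DIM('a) - real DIM('a) * (z \<bullet> v)^2 / norm z ^ (DIM('a) + 2))"

lemma newton_grad_line_deriv:
  fixes p v :: "'a::euclidean_space"
  assumes "p + t *\<^sub>R v \<noteq> 0"
  shows "((\<lambda>t. newton_grad (p + t *\<^sub>R v) v) has_real_derivative newton_hess (p + t *\<^sub>R v) v) (at t)"
proof -
  let ?c = "- real (DIM('a) - 2)"
  have 1: "((\<lambda>t. ((p + t *\<^sub>R v) \<bullet> v)) has_real_derivative v \<bullet> v) (at t)"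
    unfolding inner_add_left inner_scaleR_left by (auto intro!: derivative_eq_intros)
  have "((\<lambda>t. ?c * (((p + t *\<^sub>R v) \<bullet> v) * (1 / norm (p + t *\<^sub>R v) ^ DIM('a)))) has_real_derivative
     ?c * ((v \<bullet> v) * (1 / norm (p + t *\<^sub>R v) ^ DIM('a)) +
       (- real DIM('a) * ((p + t *\<^sub>R v) \<bullet> v) / norm (p + t *\<^sub>R v) ^ (DIM('a) + 2)) * ((p + t *\<^sub>R v) \<bullet> v))) (at t)"
    by (rule DERIV_cmult[OF DERIV_mult[OF 1 inverse_norm_power_line_deriv[OF assms]]]) simp
  moreover have "?c * (((p + t *\<^sub>R v) \<bullet> v) * (1 / norm (p + t *\<^sub>R v) ^ DIM('a))) = newton_grad (p + t *\<^sub>R v) v" for t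
    by (simp add: newton_grad_def)
  moreover have "?c * ((v \<bullet> v) * (1 / norm (p + t *\<^sub>R v) ^ DIM('a)) +
       (- real DIM('a) * ((p + t *\<^sub>R v) \<bullet> v) / norm (p + t *\<^sub>R v) ^ (DIM('a) + 2)) * ((p + t *\<^sub>R v) \<bullet> v)) = newton_hess (p + t *\<^sub>R v) v"
    unfolding newton_hess_def power2_eq_square by (simp only: mult_minus_left divide_minus_left mult_1_right times_divide_eq_right times_divide_eq_left mult.assoc diff_conv_add_uminus)
  ultimately show ?thesis by (simp only:)
qed

text \<open>
Harmonicity of the Newton kernel, for its explicit second derivatives. The identity also holds at the
pole since division by \<open>0\<close> gives \<open>0\<close>.
\<close>

lemma newton_harmonic: "(\<Sum>e\<in>Basis. newton_hess z e) = 0" for z :: "'a::euclidean_space"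
proof (cases "z = 0")
  case False
  have "(\<Sum>e\<in>Basis. newton_hess z e) = - real (DIM('a) - 2) * (real DIM('a) / norm z ^ DIM('a) -
      real DIM('a) * (\<Sum>e\<in>Basis. (z \<bullet> e)^2) / norm z ^ (DIM('a) + 2))"
  proof -
    have "(\<Sum>e\<in>(Basis::'a set). e \<bullet> e) = real DIM('a)" by simp
    thus ?thesis unfolding newton_hess_def sum_distrib_left[symmetric] sum_subtractf sum_divide_distrib[symmetric]
      by (simp only:)
  qed
  also have "(\<Sum>e\<in>Basis. (z \<bullet> e)^2) = norm z ^ 2"
    unfolding power2_norm_eq_inner euclidean_inner[of z z] by (simp only: power2_eq_square)
  finally show ?thesis using False by (simp add: power_add power2_eq_square)
qed (simp add: newton_hess_def)

lemma newton_grad_Basis: "newton_grad z v = (\<Sum>e\<in>Basis. (v \<bullet> e) * newton_grad z e)" for z :: "'a::euclidean_space"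
proof -
  have "z \<bullet> v = (\<Sum>e\<in>Basis. (v \<bullet> e) * (z \<bullet> e))" by (subst euclidean_inner) (simp add: mult.commute)
  thus ?thesis by (simp add: newton_grad_def sum_distrib_left sum_divide_distrib mult_ac)
qed

lemma integrable_continuous_compact_support:
  fixes f :: "'a::euclidean_space => real"
  assumes "continuous_on UNIV f" "\<And>y. norm y > R ==> f y = 0"
  shows "integrable lborel f"
proof -
  have "integrable lborel (\<lambda>x. indicator (cball 0 R) x *\<^sub>R f x)"
    by (rule borel_integrable_compact) (use assms in \<open>auto intro: continuous_on_subset\<close>)
  also have "(\<lambda>x. indicator (cball 0 R) x *\<^sub>R f x) = f"
    using assms(2) by (auto simp: fun_eq_iff indicator_def not_le)
  finally show ?thesis .
qed

lemma integral_lborel_translate: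
  fixes f :: "'a::euclidean_space => real"
  assumes [measurable]: "f \<in> borel_measurable borel"
  shows "(\<integral>\<^sub>L y. f (x + y)) = (\<integral>\<^sub>L y. f y)"
  by (subst (2) lborel_distr_plus[of x, symmetric]) (simp add: integral_distr)

lemma integral_cbox_eq_lborel:
  fixes f :: "'a::euclidean_space => real"
  assumes "continuous_on UNIV f" "\<And>y. y \<notin> cbox a b ==> f y = 0"
  shows "integral (cbox a b) f = (\<integral>\<^sub>L y. f y)"
proof -
  obtain R where R: "cbox a b \<subseteq> cball 0 R" by (meson bounded_cbox bounded_subset_ballD ball_subset_cball order_trans)
  have "integrable lborel f"
    by (rule integrable_continuous_compact_support[OF assms(1), of R]) (use R assms(2) in force)
  hence "(\<integral>\<^sub>L y. f y) = integral UNIV f" by (simp add: integral_lborel)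
  also have "... = integral UNIV (\<lambda>x. if x \<in> cbox a b then f x else 0)"
    by (rule arg_cong[of _ _ "integral UNIV"]) (use assms(2) in auto)
  also have "... = integral (cbox a b) f" by (rule integral_restrict_UNIV)
  finally show ?thesis ..
qed

text \<open>
The integral of \<open>F\<close> over a translate is constant; differentiate it under the integral sign.
\<close>

lemma integral_partial_derivative_eq_0:
  fixes F F' :: "'a::euclidean_space => real"
  assumes F: "continuous_on UNIV F" and F': "continuous_on UNIV F'"
    and der: "\<And>y. ((\<lambda>t. F (y + t *\<^sub>R e)) has_real_derivative F' y) (at 0)"
    and supp: "\<And>y. norm y > R ==> F y = 0"
  shows "(\<integral>\<^sub>L y. F' y) = 0"
proof -
  have supp': "F' y = 0" if y: "norm y > R" for y
  proof -
    have "((\<lambda>t. F (y + t *\<^sub>R e)) has_real_derivative 0) (at 0)"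
    proof (rule has_field_derivative_transform_within_open[of "\<lambda>_. 0" _ _ "{t. R < norm (y + t *\<^sub>R e)}"])
      show "open {t. R < norm (y + t *\<^sub>R e)}" by (intro open_Collect_less continuous_intros)
    qed (use y supp in auto)
    with der[of y] show ?thesis by (rule DERIV_unique)
  qed
  obtain a b :: 'a where ab: "cball 0 (R + norm e) \<subseteq> cbox a b"
    by (metis bounded_cball bounded_subset_cbox_symmetric)
  have out: "F (y + t *\<^sub>R e) = 0" "F' (y + t *\<^sub>R e) = 0" if "y \<notin> cbox a b" "\<bar>t\<bar> < 1" for y t
  proof -
    have "norm y > R + norm e" using that ab by force
    moreover have "norm (t *\<^sub>R e) \<le> norm e" using that by (simp add: mult_left_le_one_le)
    ultimately have "norm (y + t *\<^sub>R e) > R" using norm_diff_ineq[of y "t *\<^sub>R e"] by linarith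
    thus "F (y + t *\<^sub>R e) = 0" "F' (y + t *\<^sub>R e) = 0" using supp supp' by auto
  qed
  have meas: "F \<in> borel_measurable borel" using F by (rule borel_measurable_continuous_onI)
  have T: "integral (cbox a b) (\<lambda>y. F (y + t *\<^sub>R e)) = (\<integral>\<^sub>L y. F y)" if t: "\<bar>t\<bar> < 1" for t
  proof -
    have "integral (cbox a b) (\<lambda>y. F (y + t *\<^sub>R e)) = (\<integral>\<^sub>L y. F (y + t *\<^sub>R e))"
      by (rule integral_cbox_eq_lborel) (use t out in \<open>auto intro!: continuous_on_compose2[OF F] continuous_intros\<close>)
    thus ?thesis using integral_lborel_translate[OF meas, of "t *\<^sub>R e"] by (simp add: add.commute)
  qed
  have "((\<lambda>t. integral (cbox a b) (\<lambda>y. F (y + t *\<^sub>R e))) has_real_derivative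
           integral (cbox a b) (\<lambda>y. F' (y + 0 *\<^sub>R e))) (at 0 within {-1<..<1})"
  proof (rule leibniz_rule_field_derivative)
    fix t :: real and y :: 'a
    have "((\<lambda>s. F ((y + t *\<^sub>R e) + s *\<^sub>R e)) has_real_derivative F' (y + t *\<^sub>R e)) (at 0)" by (rule der)
    hence "((\<lambda>s. F (y + s *\<^sub>R e)) has_real_derivative F' (y + t *\<^sub>R e)) (at (0 + t))"
      by (subst DERIV_shift) (simp add: algebra_simps)
    thus "((\<lambda>s. F (y + s *\<^sub>R e)) has_real_derivative F' (y + t *\<^sub>R e)) (at t within {- 1<..<1})"
      by (simp add: has_field_derivative_at_within)
  next
    fix t :: real
    show "(\<lambda>y. F (y + t *\<^sub>R e)) integrable_on cbox a b"
      by (intro integrable_continuous continuous_on_compose2[OF F] continuous_intros) auto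
  next
    show "continuous_on ({- 1<..<1} \<times> cbox a b) (\<lambda>(t, y). F' (y + t *\<^sub>R e))"
      unfolding split_beta by (intro continuous_on_compose2[OF F'] continuous_intros) auto
  qed auto
  hence 1: "((\<lambda>t. integral (cbox a b) (\<lambda>y. F (y + t *\<^sub>R e))) has_real_derivative
           integral (cbox a b) F') (at 0)"
    by (simp add: at_within_open[of _ "{-1<..<1::real}"])
  have "((\<lambda>t. integral (cbox a b) (\<lambda>y. F (y + t *\<^sub>R e))) has_real_derivative 0) (at 0)"
    by (rule has_field_derivative_transform_within_open[of "\<lambda>_. \<integral>\<^sub>L y. F y" _ _ "{-1<..<1}"]) (use T in auto)
  with 1 have "integral (cbox a b) F' = 0" by (rule DERIV_unique)
  moreover have "integral (cbox a b) F' = (\<integral>\<^sub>L y. F' y)"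
    using out(2)[of _ 0] by (intro integral_cbox_eq_lborel F') auto
  ultimately show ?thesis by simp
qed

lemma continuous_on_newton: "DIM('a) \<ge> 3 ==> continuous_on (- {0}) (newton :: 'a::euclidean_space => real)"
  unfolding newton_def by (intro continuous_intros) auto

text \<open>
Newton's theorem: outside its support a radial mass distribution acts like a point mass at its centre.
Without polar coordinates: \<open>\<psi> s = \<integral> \<phi> y * newton (x - s y)\<close> is constant in \<open>s\<close>, so \<open>\<psi> 1 = \<psi> 0\<close>. Its
derivative is \<open>- \<integral> \<phi> y * newton_grad (x - s y) y\<close>, and \<open>\<phi> y * y\<close> is proportional to the gradient of
the next power \<open>\<chi>\<close> of the bump; integration by parts moves this gradient onto \<open>newton_grad\<close>, whose
divergence vanishes.
\<close>

lemma newton_mean_value: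
  fixes x :: "'a::euclidean_space"
  assumes d: "DIM('a) \<ge> 3" and \<rho>: "\<rho> > 0" and x: "norm x > \<rho>"
  shows "(\<integral>\<^sub>L y. bump \<rho> y * newton (x - y)) = newton x"
proof -
  define U where "U = {- (norm x / \<rho>)<..<norm x / \<rho>}"
  have "norm x / \<rho> > 1" using \<rho> x by (simp add: field_simps)
  hence U01: "0 \<in> U" "1 \<in> U" by (auto simp: U_def)
  have big: "norm y > \<rho>" if "s \<in> U" "s *\<^sub>R y = x" for s y
  proof (rule ccontr)
    assume "\<not> norm y > \<rho>"
    hence "norm x \<le> \<bar>s\<bar> * \<rho>" unfolding that(2)[symmetric] by (simp add: mult_left_mono)
    moreover have "\<bar>s\<bar> * \<rho> < norm x / \<rho> * \<rho>" using that(1) \<rho> by (intro mult_strict_right_mono) (auto simp: U_def)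
    ultimately show False using \<rho> by simp
  qed
  let ?\<phi> = "bump_pow 4 \<rho> :: 'a => real" and ?\<chi> = "bump_pow 5 \<rho> :: 'a => real"
  have \<phi>0: "?\<phi> y = 0" "?\<chi> y = 0" if "norm y > \<rho>" for y using that \<rho> by (auto intro!: bump_pow_eq_0)
  define B where "B = {y::'a. norm y > \<rho>}"
  have oB: "open B" unfolding B_def by (intro open_Collect_less continuous_intros)
  \<comment> \<open>The divergence theorem for \<open>\<chi> y * newton_grad (x - s y)\<close>, one coordinate at a time.\<close>
  have zero: "(\<integral>\<^sub>L y. - (10 / \<rho>^2) * ((y \<bullet> e) * ?\<phi> y * newton_grad (x - s *\<^sub>R y) e) + ?\<chi> y * (- s * newton_hess (x - s *\<^sub>R y) e)) = 0"
    and int: "integrable lborel (\<lambda>y. - (10 / \<rho>^2) * ((y \<bullet> e) * ?\<phi> y * newton_grad (x - s *\<^sub>R y) e) + ?\<chi> y * (- s * newton_hess (x - s *\<^sub>R y) e))"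
    if s: "s \<in> U" for s e
  proof -
    define A where "A = {y. x - s *\<^sub>R y \<noteq> 0}"
    have oA: "open A" unfolding A_def by (intro open_Collect_neq continuous_intros)
    have AB: "A \<union> B = UNIV" using big[OF s] by (auto simp: A_def B_def)
    let ?F = "\<lambda>y. ?\<chi> y * newton_grad (x - s *\<^sub>R y) e"
    let ?F' = "\<lambda>y. - (10 / \<rho>^2) * ((y \<bullet> e) * ?\<phi> y * newton_grad (x - s *\<^sub>R y) e) + ?\<chi> y * (- s * newton_hess (x - s *\<^sub>R y) e)"
    have cF: "continuous_on UNIV ?F"
      unfolding AB[symmetric]
    proof (rule continuous_on_open_Un[OF oA oB])
      show "continuous_on A ?F" unfolding newton_grad_def by (intro continuous_intros) (auto simp: A_def)
      show "continuous_on B ?F" by (rule continuous_on_cong[THEN iffD1, OF refl _ continuous_on_const[of _ 0]]) (auto simp: B_def \<phi>0)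
    qed
    have cF': "continuous_on UNIV ?F'"
      unfolding AB[symmetric]
    proof (rule continuous_on_open_Un[OF oA oB])
      show "continuous_on A ?F'" unfolding newton_grad_def newton_hess_def by (intro continuous_intros) (auto simp: A_def)
      show "continuous_on B ?F'" by (rule continuous_on_cong[THEN iffD1, OF refl _ continuous_on_const[of _ 0]]) (auto simp: B_def \<phi>0)
    qed
    have supp: "?F y = 0" if "norm y > \<rho>" for y using \<phi>0[OF that] by simp
    have der: "((\<lambda>t. ?F (y + t *\<^sub>R e)) has_real_derivative ?F' y) (at 0)" for y
    proof (cases "y \<in> B")
      case True
      have "((\<lambda>t. ?F (y + t *\<^sub>R e)) has_real_derivative 0) (at 0)"
      proof (rule has_field_derivative_transform_within_open[of "\<lambda>_. 0" _ _ "{t. \<rho> < norm (y + t *\<^sub>R e)}"])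
        show "open {t. \<rho> < norm (y + t *\<^sub>R e)}" by (intro open_Collect_less continuous_intros)
      qed (use True supp in \<open>auto simp: B_def\<close>)
      moreover have "?F' y = 0" using True \<phi>0 by (simp add: B_def)
      ultimately show ?thesis by (simp only:)
    next
      case False
      hence yA: "x - s *\<^sub>R y \<noteq> 0" using AB by (auto simp: A_def)
      have 1: "((\<lambda>t. ?\<chi> (y + t *\<^sub>R e)) has_real_derivative - (10 / \<rho>^2) * (y \<bullet> e) * ?\<phi> y) (at 0)"
        using bump_pow_deriv[of 5 \<rho> y e 0] by simp
      have 2: "((\<lambda>t. newton_grad (x - s *\<^sub>R (y + t *\<^sub>R e)) e) has_real_derivative - s * newton_hess (x - s *\<^sub>R y) e) (at 0)"
      proof -
        have "((\<lambda>t. newton_grad ((x - s *\<^sub>R y) + t *\<^sub>R e) e) has_real_derivative newton_hess (x - s *\<^sub>R y) e) (at (- s * 0))"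
          using newton_grad_line_deriv[of "x - s *\<^sub>R y" 0 e] yA by simp
        moreover have "((\<lambda>t. - s * t) has_real_derivative - s) (at 0)" by (auto intro!: derivative_eq_intros)
        ultimately have "((\<lambda>t. newton_grad ((x - s *\<^sub>R y) + (- s * t) *\<^sub>R e) e) has_real_derivative newton_hess (x - s *\<^sub>R y) e * - s) (at 0)"
          by (rule DERIV_chain2[where g = "\<lambda>t. - s * t"])
        thus ?thesis by (simp add: algebra_simps)
      qed
      have "((\<lambda>t. ?F (y + t *\<^sub>R e)) has_real_derivative (- (10 / \<rho>^2) * (y \<bullet> e) * ?\<phi> y) * newton_grad (x - s *\<^sub>R (y + 0 *\<^sub>R e)) e +
           (- s * newton_hess (x - s *\<^sub>R y) e) * ?\<chi> (y + 0 *\<^sub>R e)) (at 0)"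
        by (rule DERIV_mult[OF 1 2])
      thus ?thesis by (simp add: mult_ac)
    qed
    show "(\<integral>\<^sub>L y. ?F' y) = 0"
      by (rule integral_partial_derivative_eq_0[OF cF cF' der supp])
    show "integrable lborel ?F'"
      by (rule integrable_continuous_compact_support[OF cF', of \<rho>]) (simp add: \<phi>0)
  qed
  have sum: "(\<Sum>e\<in>Basis. - (10 / \<rho>^2) * ((y \<bullet> e) * ?\<phi> y * newton_grad (x - s *\<^sub>R y) e) + ?\<chi> y * (- s * newton_hess (x - s *\<^sub>R y) e))
     = - (10 / \<rho>^2) * (?\<phi> y * newton_grad (x - s *\<^sub>R y) y)" for s y
  proof -
    have *: "(\<Sum>e\<in>Basis. ?\<chi> y * (- s * newton_hess (x - s *\<^sub>R y) e)) = ?\<chi> y * (- s) * (\<Sum>e\<in>Basis. newton_hess (x - s *\<^sub>R y) e)"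
      unfolding sum_distrib_left by (simp only: mult_ac)
    also have "... = 0" by (simp add: newton_harmonic)
    finally have 0: "(\<Sum>e\<in>Basis. ?\<chi> y * (- s * newton_hess (x - s *\<^sub>R y) e)) = 0" .
    show ?thesis
      unfolding sum.distrib 0 newton_grad_Basis[of _ y] sum_distrib_left by (simp only: mult_ac add_0_right)
  qed
  have der0: "(\<integral>\<^sub>L y. ?\<phi> y * newton_grad (x - s *\<^sub>R y) y) = 0" if s: "s \<in> U" for s
  proof -
    have "(\<integral>\<^sub>L y. - (10 / \<rho>^2) * (?\<phi> y * newton_grad (x - s *\<^sub>R y) y)) = 0"
      unfolding sum[symmetric] by (subst Bochner_Integration.integral_sum) (use int[OF s] zero[OF s] in auto)
    thus ?thesis using \<rho> by simp
  qed
  obtain a b :: 'a where ab: "cball 0 \<rho> \<subseteq> cbox a b"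
    by (metis bounded_cball bounded_subset_cbox_symmetric)
  \<comment> \<open>On \<open>P\<close> the kernel is regular, on \<open>Q\<close> the bump vanishes; both are open and cover \<open>U \<times> UNIV\<close>.\<close>
  define P where "P = {(s, y). s \<in> U \<and> x - s *\<^sub>R y \<noteq> 0}"
  define Q where "Q = U \<times> B"
  have oU: "open U" by (simp add: U_def)
  have "P = (U \<times> UNIV) \<inter> {p. x - fst p *\<^sub>R snd p \<noteq> 0}" by (auto simp: P_def)
  hence oP: "open P" using oU by (auto intro!: open_Int open_Times open_Collect_neq continuous_intros)
  have oQ: "open Q" unfolding Q_def by (intro open_Times oU oB)
  have PQ: "U \<times> UNIV = P \<union> Q" using big by (auto simp: P_def Q_def B_def)
  have c0: "continuous_on (P \<union> Q) (\<lambda>(s, y). ?\<phi> y * newton (x - s *\<^sub>R y))"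
    unfolding split_beta
  proof (rule continuous_on_open_Un[OF oP oQ])
    show "continuous_on P (\<lambda>p. ?\<phi> (snd p) * newton (x - fst p *\<^sub>R snd p))"
      unfolding newton_def by (intro continuous_intros) (auto simp: P_def)
    show "continuous_on Q (\<lambda>p. ?\<phi> (snd p) * newton (x - fst p *\<^sub>R snd p))"
      by (rule continuous_on_cong[THEN iffD1, OF refl _ continuous_on_const[of _ 0]]) (auto simp: Q_def B_def \<phi>0)
  qed
  have c1: "continuous_on (P \<union> Q) (\<lambda>(s, y). ?\<phi> y * (- newton_grad (x - s *\<^sub>R y) y))"
    unfolding split_beta
  proof (rule continuous_on_open_Un[OF oP oQ])
    show "continuous_on P (\<lambda>p. ?\<phi> (snd p) * (- newton_grad (x - fst p *\<^sub>R snd p) (snd p)))"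
      unfolding newton_grad_def by (intro continuous_intros) (auto simp: P_def)
    show "continuous_on Q (\<lambda>p. ?\<phi> (snd p) * (- newton_grad (x - fst p *\<^sub>R snd p) (snd p)))"
      by (rule continuous_on_cong[THEN iffD1, OF refl _ continuous_on_const[of _ 0]]) (auto simp: Q_def B_def \<phi>0)
  qed
  have c0s: "continuous_on UNIV (\<lambda>y. ?\<phi> y * newton (x - s *\<^sub>R y))" if "s \<in> U" for s
    using that by (intro continuous_on_compose2[OF c0, of UNIV "\<lambda>y. (s, y)", simplified]) (auto simp: PQ[symmetric] intro!: continuous_intros)
  have c1s: "continuous_on UNIV (\<lambda>y. ?\<phi> y * (- newton_grad (x - s *\<^sub>R y) y))" if "s \<in> U" for s
    using that by (intro continuous_on_compose2[OF c1, of UNIV "\<lambda>y. (s, y)", unfolded prod.case]) (auto simp: PQ[symmetric] intro!: continuous_intros)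
  have out: "norm y > \<rho>" if "y \<notin> cbox a b" for y using that ab by force
  have D: "((\<lambda>s. integral (cbox a b) (\<lambda>y. ?\<phi> y * newton (x - s *\<^sub>R y))) has_real_derivative 0) (at s within U)"
    if s: "s \<in> U" for s
  proof -
    have "((\<lambda>s. integral (cbox a b) (\<lambda>y. ?\<phi> y * newton (x - s *\<^sub>R y))) has_real_derivative
       integral (cbox a b) (\<lambda>y. ?\<phi> y * (- newton_grad (x - s *\<^sub>R y) y))) (at s within U)"
    proof (rule leibniz_rule_field_derivative)
      fix s y assume s: "s \<in> U"
      show "((\<lambda>s. ?\<phi> y * newton (x - s *\<^sub>R y)) has_real_derivative ?\<phi> y * (- newton_grad (x - s *\<^sub>R y) y)) (at s within U)"
      proof (cases "norm y > \<rho>")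
        case False
        with big[OF s, of y] have ne: "x + (- s) *\<^sub>R y \<noteq> 0" by auto
        have "((\<lambda>t. newton (x + t *\<^sub>R y)) has_real_derivative newton_grad (x + (- s) *\<^sub>R y) y) (at (- s))"
          by (rule newton_line_deriv[OF d ne])
        moreover have "((\<lambda>t. - t) has_real_derivative - 1) (at s within U)" by (auto intro!: derivative_eq_intros)
        ultimately have "((\<lambda>s. newton (x + (- s) *\<^sub>R y)) has_real_derivative newton_grad (x + (- s) *\<^sub>R y) y * - 1) (at s within U)"
          by (rule DERIV_chain2[where g = "\<lambda>t. - t"])
        hence "((\<lambda>s. newton (x - s *\<^sub>R y)) has_real_derivative - newton_grad (x - s *\<^sub>R y) y) (at s within U)"
          by simp
        thus ?thesis by (rule DERIV_cmult)
      qed (simp add: \<phi>0)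
    next
      fix s assume "s \<in> U"
      show "(\<lambda>y. ?\<phi> y * newton (x - s *\<^sub>R y)) integrable_on cbox a b"
        by (intro integrable_continuous continuous_on_subset[OF c0s[OF \<open>s \<in> U\<close>]]) auto
    next
      show "continuous_on (U \<times> cbox a b) (\<lambda>(s, y). ?\<phi> y * - newton_grad (x - s *\<^sub>R y) y)"
        by (rule continuous_on_subset[OF c1]) (auto simp: PQ[symmetric])
    qed (use s in \<open>auto simp: U_def\<close>)
    also have "integral (cbox a b) (\<lambda>y. ?\<phi> y * (- newton_grad (x - s *\<^sub>R y) y)) = (\<integral>\<^sub>L y. ?\<phi> y * (- newton_grad (x - s *\<^sub>R y) y))"
      by (rule integral_cbox_eq_lborel[OF c1s[OF s]]) (simp add: \<phi>0 out)
    also have "... = 0" using der0[OF s] by simp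
    finally show ?thesis .
  qed
  \<comment> \<open>\<open>U\<close> contains both \<open>0\<close> and \<open>1\<close> because \<open>norm x > \<rho>\<close>.\<close>
  have "\<exists>c. \<forall>s\<in>U. integral (cbox a b) (\<lambda>y. ?\<phi> y * newton (x - s *\<^sub>R y)) = c"
    by (rule has_field_derivative_zero_constant) (use D in \<open>auto simp: U_def\<close>)
  then obtain c where c: "\<And>s. s \<in> U ==> integral (cbox a b) (\<lambda>y. ?\<phi> y * newton (x - s *\<^sub>R y)) = c" by blast
  have I: "integral (cbox a b) (\<lambda>y. ?\<phi> y * newton (x - s *\<^sub>R y)) = (\<integral>\<^sub>L y. ?\<phi> y * newton (x - s *\<^sub>R y))" if "s \<in> U" for s
    by (rule integral_cbox_eq_lborel[OF c0s[OF that]]) (simp add: \<phi>0 out)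
  have "(\<integral>\<^sub>L y. ?\<phi> y * newton (x - 1 *\<^sub>R y)) = (\<integral>\<^sub>L y. ?\<phi> y * newton (x - 0 *\<^sub>R y))"
    using c[OF U01(1)] c[OF U01(2)] I[OF U01(1)] I[OF U01(2)] by argo
  hence eq: "(\<integral>\<^sub>L y. ?\<phi> y * newton (x - y)) = (\<integral>\<^sub>L y. ?\<phi> y * newton x)"
    by (simp only: scaleR_one scaleR_zero_left diff_zero)
  have "(\<integral>\<^sub>L y. bump \<rho> y * newton (x - y)) = (\<integral>\<^sub>L (y::'a). bump \<rho> y * newton x)"
    unfolding bump_def using eq by simp
  thus ?thesis using integral_bump[OF \<rho>, where 'a='a] by simp
qed

section \<open>The regularised Newton kernel\<close>

lemma integral_of_finite_nn_integral:
  fixes f :: "'a => real"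
  assumes "f \<in> borel_measurable M" "\<And>x. f x \<ge> 0" "(\<integral>\<^sup>+x. ennreal (f x) \<partial>M) < \<infinity>"
  shows "integrable M f" "ennreal (\<integral>x. f x \<partial>M) = (\<integral>\<^sup>+x. ennreal (f x) \<partial>M)"
proof -
  show i: "integrable M f" using assms by (intro integrableI_nonneg) auto
  show "ennreal (\<integral>x. f x \<partial>M) = (\<integral>\<^sup>+x. ennreal (f x) \<partial>M)"
    using nn_integral_eq_integral[OF i] assms(2) by simp
qed

definition reg_const :: "'a::euclidean_space itself => real" where
  "reg_const _ = 2 * newton_const TYPE('a) / bump_mass TYPE('a)"

lemma reg_const_pos: "reg_const TYPE('a::euclidean_space) > 0"
  using newton_const_pos[where 'a='a] bump_mass_pos[where 'a='a] by (simp add: reg_const_def)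

definition newton_reg :: "real => 'a::euclidean_space => real" where
  "newton_reg \<rho> x = (\<integral>\<^sub>L y. bump \<rho> y * newton (x - y))"

lemma nn_integral_newton_reg:
  fixes x :: "'a::euclidean_space"
  assumes d: "DIM('a) \<ge> 3" and \<rho>: "\<rho> > 0"
  shows "(\<integral>+y. ennreal (bump \<rho> y * newton (x - y))) \<le> ennreal (reg_const TYPE('a) / \<rho> ^ (DIM('a) - 2))"
proof -
  let ?b = "1 / (bump_mass TYPE('a) * \<rho> ^ DIM('a))"
  have b: "?b \<ge> 0" using \<rho> bump_mass_pos[where 'a='a] by simp
  have "(\<integral>+y. ennreal (bump \<rho> y * newton (x - y))) \<le>
     (\<integral>+y. ennreal ?b * (ennreal (newton (x - y)) * indicator (cball 0 \<rho>) y))"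
  proof (intro nn_integral_mono)
    fix y :: 'a
    show "ennreal (bump \<rho> y * newton (x - y)) \<le> ennreal ?b * (ennreal (newton (x - y)) * indicator (cball 0 \<rho>) y)"
    proof (cases "norm y \<le> \<rho>")
      case True
      have "bump \<rho> y * newton (x - y) \<le> ?b * newton (x - y)" by (intro mult_right_mono bump_le \<rho>) simp
      thus ?thesis using True b by (simp add: ennreal_mult[symmetric] ennreal_leI)
    qed (simp add: bump_eq_0[OF \<rho>])
  qed
  also have "... = ennreal ?b * (\<integral>+y. ennreal (newton (x - y)) * indicator (cball 0 \<rho>) y)"
    by (rule nn_integral_cmult) measurable
  also have "... \<le> ennreal ?b * ennreal (2 * newton_const TYPE('a) * \<rho>^2)"
    by (intro mult_left_mono nn_integral_newton_shift d \<rho>) simp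
  also have "... = ennreal (?b * (2 * newton_const TYPE('a) * \<rho>^2))"
    using b newton_const_pos[where 'a='a] by (subst ennreal_mult) auto
  also have "?b * (2 * newton_const TYPE('a) * \<rho>^2) = reg_const TYPE('a) / \<rho> ^ (DIM('a) - 2)"
  proof -
    have "DIM('a) = (DIM('a) - 2) + 2" using d by simp
    hence "\<rho> ^ DIM('a) = \<rho> ^ (DIM('a) - 2) * \<rho>^2" by (metis power_add)
    thus ?thesis using \<rho> by (simp add: reg_const_def)
  qed
  finally show ?thesis .
qed

text \<open>
The Newton kernel smeared out at scale \<open>\<rho>\<close> loses its pole.
\<close>

lemma newton_reg:
  fixes x :: "'a::euclidean_space"
  assumes d: "DIM('a) \<ge> 3" and \<rho>: "\<rho> > 0"
  shows integrable_newton_reg: "integrable lborel (\<lambda>y. bump \<rho> y * newton (x - y))"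
    and ennreal_newton_reg: "ennreal (newton_reg \<rho> x) = conv (\<lambda>z. ennreal (newton z)) (\<lambda>z. ennreal (bump \<rho> z)) x"
    and newton_reg_nonneg: "newton_reg \<rho> x \<ge> 0"
    and newton_reg_le: "newton_reg \<rho> x \<le> reg_const TYPE('a) / \<rho> ^ (DIM('a) - 2)"
proof -
  have nn: "bump \<rho> y * newton (x - y) \<ge> 0" for y using \<rho> by simp
  have fin: "(\<integral>+y. ennreal (bump \<rho> y * newton (x - y))) < \<infinity>"
    using nn_integral_newton_reg[OF d \<rho>] by (rule order.strict_trans1) simp
  note * = integral_of_finite_nn_integral[OF _ nn fin]
  show "integrable lborel (\<lambda>y. bump \<rho> y * newton (x - y))" by (rule *) measurable
  have e: "ennreal (newton_reg \<rho> x) = (\<integral>+y. ennreal (bump \<rho> y * newton (x - y)))"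
    unfolding newton_reg_def by (rule *) measurable
  show "ennreal (newton_reg \<rho> x) = conv (\<lambda>z. ennreal (newton z)) (\<lambda>z. ennreal (bump \<rho> z)) x"
    unfolding e conv_def using \<rho> by (simp add: ennreal_mult mult.commute)
  show "newton_reg \<rho> x \<ge> 0" unfolding newton_reg_def by (intro Bochner_Integration.integral_nonneg nn)
  have "ennreal (newton_reg \<rho> x) \<le> ennreal (reg_const TYPE('a) / \<rho> ^ (DIM('a) - 2))"
    unfolding e by (rule nn_integral_newton_reg[OF d \<rho>])
  thus "newton_reg \<rho> x \<le> reg_const TYPE('a) / \<rho> ^ (DIM('a) - 2)"
    using reg_const_pos[where 'a='a] \<rho> by (subst (asm) ennreal_le_iff) auto
qed

lemma newton_reg_eq_newton:
  fixes x :: "'a::euclidean_space"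
  assumes "DIM('a) \<ge> 3" "\<rho> > 0" "norm x > \<rho>"
  shows "newton_reg \<rho> x = newton x"
  unfolding newton_reg_def by (rule newton_mean_value[OF assms])

lemma measurable_newton_reg [measurable]: "newton_reg \<rho> \<in> borel_measurable borel"
  unfolding newton_reg_def by measurable

lemma measurable_newton_reg2:
  "(\<lambda>p. newton_reg (fst p) (snd p :: 'a::euclidean_space)) \<in> borel_measurable (borel \<Otimes>\<^sub>M borel)"
  unfolding newton_reg_def bump_def bump_pow_def newton_def by measurable

text \<open>
By Newton's theorem the difference is supported in the ball of radius \<open>\<rho>\<close>, where both terms are
dominated by the Newton kernel.
\<close>

lemma newton_diff_le:
  fixes x :: "'a::euclidean_space"
  assumes d: "DIM('a) \<ge> 3" and \<rho>: "\<rho> > 0" and x: "x \<noteq> 0"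
  shows "\<bar>newton x - newton_reg \<rho> x\<bar> \<le> (1 + reg_const TYPE('a)) * newton x * indicator (cball 0 \<rho>) x"
proof (cases "norm x \<le> \<rho>")
  case True
  have "newton_reg \<rho> x \<le> reg_const TYPE('a) * (1 / \<rho> ^ (DIM('a) - 2))"
    using newton_reg_le[OF d \<rho>, of x] by simp
  also have "1 / \<rho> ^ (DIM('a) - 2) \<le> newton x"
    unfolding newton_def using True x \<rho> by (intro divide_left_mono power_mono mult_pos_pos zero_less_power) auto
  finally have "newton_reg \<rho> x \<le> reg_const TYPE('a) * newton x"
    using reg_const_pos[where 'a='a] by (simp add: mult_left_mono)
  moreover have "0 \<le> reg_const TYPE('a) * newton x" using reg_const_pos[where 'a='a] by simp
  ultimately have "\<bar>newton x - newton_reg \<rho> x\<bar> \<le> newton x + reg_const TYPE('a) * newton x"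
    using newton_nonneg[of x] newton_reg_nonneg[OF d \<rho>, of x] unfolding abs_le_iff by linarith
  thus ?thesis using True by (simp add: algebra_simps)
qed (simp add: newton_reg_eq_newton d \<rho>)

definition diff_const :: "'a::euclidean_space itself => real" where
  "diff_const _ = (1 + reg_const TYPE('a)) * newton_const TYPE('a)"

lemma diff_const_pos: "diff_const TYPE('a::euclidean_space) > 0"
  using newton_const_pos[where 'a='a] reg_const_pos[where 'a='a] by (simp add: diff_const_def)

lemma nn_integral_newton_diff:
  assumes d: "DIM('a::euclidean_space) \<ge> 3" and \<rho>: "\<rho> > 0"
  shows "(\<integral>+(x::'a). ennreal \<bar>newton x - newton_reg \<rho> x\<bar>) \<le> ennreal (diff_const TYPE('a) * \<rho>^2)"
proof -
  let ?c = "1 + reg_const TYPE('a)"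
  have c: "?c > 0" using reg_const_pos[where 'a='a] by simp
  have "(\<integral>+(x::'a). ennreal \<bar>newton x - newton_reg \<rho> x\<bar>) \<le>
     (\<integral>+(x::'a). ennreal ?c * (ennreal (newton x) * indicator (cball 0 \<rho>) x))"
  proof (rule nn_integral_mono_AE)
    have "AE x::'a in lborel. x \<noteq> 0" by (rule AE_lborel_singleton)
    thus "AE x::'a in lborel. ennreal \<bar>newton x - newton_reg \<rho> x\<bar> \<le> ennreal ?c * (ennreal (newton x) * indicator (cball 0 \<rho>) x)"
    proof eventually_elim
      case (elim x)
      have "ennreal \<bar>newton x - newton_reg \<rho> x\<bar> \<le> ennreal (?c * newton x * indicator (cball 0 \<rho>) x)"
        by (intro ennreal_leI newton_diff_le d \<rho> elim)
      also have "... = ennreal ?c * (ennreal (newton x) * indicator (cball 0 \<rho>) x)"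
        using c by (auto simp: ennreal_mult split: split_indicator)
      finally show ?case .
    qed
  qed
  also have "... = ennreal ?c * (\<integral>+(x::'a). ennreal (newton x) * indicator (cball 0 \<rho>) x)"
    by (rule nn_integral_cmult) measurable
  also have "... \<le> ennreal ?c * ennreal (newton_const TYPE('a) * \<rho>^2)"
    by (intro mult_left_mono nn_integral_newton_cball d \<rho>) simp
  also have "... = ennreal (diff_const TYPE('a) * \<rho>^2)"
    using c newton_const_pos[where 'a='a] by (simp add: ennreal_mult[symmetric] diff_const_def mult.assoc)
  finally show ?thesis .
qed

section \<open>Potentials of bounded densities\<close>

definition bdd_density :: "real => ('a::euclidean_space => real) => bool" where
  "bdd_density L g \<longleftrightarrow> g \<in> borel_measurable borel \<and> (\<forall>x. 0 \<le> g x \<and> g x \<le> L) \<and> integrable lborel g"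

lemma bdd_densityD:
  assumes "bdd_density L g"
  shows "g \<in> borel_measurable borel" "0 \<le> g x" "g x \<le> L" "integrable lborel g" "L \<ge> 0"
  using assms order_trans[of 0 "g x" L] by (auto simp: bdd_density_def)

definition pot :: "('a::euclidean_space => real) => 'a => real" where
  "pot g x = (\<integral>\<^sub>L y. newton (x - y) * g y)"

definition smooth :: "real => ('a::euclidean_space => real) => 'a => real" where
  "smooth \<rho> v x = (\<integral>\<^sub>L y. bump \<rho> (x - y) * v y)"

lemma measurable_pot [measurable]:
  assumes [measurable]: "g \<in> borel_measurable borel"
  shows "pot g \<in> borel_measurable borel"
  unfolding pot_def by measurable

lemma measurable_smooth [measurable]:
  assumes [measurable]: "g \<in> borel_measurable borel"
  shows "smooth \<rho> g \<in> borel_measurable borel"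
  unfolding smooth_def by measurable

lemma pot_facts:
  fixes g :: "'a::euclidean_space => real"
  assumes d: "DIM('a) \<ge> 3" and g: "bdd_density L g"
  shows integrable_pot: "integrable lborel (\<lambda>y. newton (x - y) * g y)"
    and ennreal_pot: "ennreal (pot g x) = conv (\<lambda>z. ennreal (newton z)) (\<lambda>z. ennreal (g z)) x"
    and pot_nonneg: "pot g x \<ge> 0"
    and pot_bound: "pot g x \<le> 2 * newton_const TYPE('a) * L + (\<integral>\<^sub>L y. g y)"
proof -
  note [measurable] = bdd_densityD(1)[OF g]
  have g0: "0 \<le> g y" "g y \<le> L" for y using bdd_densityD[OF g] by auto
  have L: "L \<ge> 0" using bdd_densityD(5)[OF g] .
  have I0: "(\<integral>\<^sub>L y. g y) \<ge> 0" using g0 by simp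
  have nn: "newton (x - y) * g y \<ge> 0" for y using g0 by simp
  have "(\<integral>+y. ennreal (newton (x - y) * g y)) \<le>
     (\<integral>+y. ennreal L * (ennreal (newton (x - y)) * indicator (cball x 1) y) + ennreal (g y))"
  proof (intro nn_integral_mono)
    fix y
    show "ennreal (newton (x - y) * g y) \<le> ennreal L * (ennreal (newton (x - y)) * indicator (cball x 1) y) + ennreal (g y)"
    proof (cases "norm (x - y) \<le> 1")
      case True
      have "ennreal (newton (x - y) * g y) \<le> ennreal (L * newton (x - y))"
        using g0[of y] by (intro ennreal_leI) (simp add: mult.commute mult_right_mono)
      thus ?thesis using True L by (auto simp: ennreal_mult dist_norm intro!: add_increasing2)
    next
      case False
      hence "newton (x - y) \<le> 1" using newton_antimono[of 1 "x - y"] by simp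
      hence "newton (x - y) * g y \<le> 1 * g y" using g0 by (intro mult_right_mono) auto
      hence "ennreal (newton (x - y) * g y) \<le> ennreal (g y)" by (intro ennreal_leI) simp
      thus ?thesis by (intro add_increasing) auto
    qed
  qed
  also have "... = ennreal L * (\<integral>+y. ennreal (newton (x - y)) * indicator (cball x 1) y) + (\<integral>+y. ennreal (g y))"
  proof -
    have m: "(\<lambda>y. ennreal (newton (x - y)) * indicator (cball x 1) y) \<in> borel_measurable lborel" by measurable
    have m1: "(\<lambda>y. ennreal (g y)) \<in> borel_measurable lborel" by measurable
    have m2: "(\<lambda>y. ennreal L * (ennreal (newton (x - y)) * indicator (cball x 1) y)) \<in> borel_measurable lborel" by measurable
    show ?thesis unfolding nn_integral_add[OF m2 m1] nn_integral_cmult[OF m] ..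
  qed
  also have "(\<integral>+y. ennreal (g y)) = ennreal (\<integral>\<^sub>L y. g y)"
    using nn_integral_eq_integral[OF bdd_densityD(4)[OF g]] g0 by simp
  also have "ennreal L * (\<integral>+y. ennreal (newton (x - y)) * indicator (cball x 1) y) + ennreal (\<integral>\<^sub>L y. g y) \<le>
     ennreal L * ennreal (2 * newton_const TYPE('a) * 1^2) + ennreal (\<integral>\<^sub>L y. g y)"
    by (intro add_right_mono mult_left_mono nn_integral_newton_shift d) auto
  also have "... = ennreal (2 * newton_const TYPE('a) * L + (\<integral>\<^sub>L y. g y))"
    using L I0 newton_const_pos[where 'a='a] by (simp add: ennreal_mult[symmetric] mult_ac)
  finally have le: "(\<integral>+y. ennreal (newton (x - y) * g y)) \<le> ennreal (2 * newton_const TYPE('a) * L + (\<integral>\<^sub>L y. g y))" .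
  hence fin: "(\<integral>+y. ennreal (newton (x - y) * g y)) < \<infinity>" by (rule order.strict_trans1) simp
  note * = integral_of_finite_nn_integral[OF _ nn fin]
  show "integrable lborel (\<lambda>y. newton (x - y) * g y)" by (rule *) measurable
  have e: "ennreal (pot g x) = (\<integral>+y. ennreal (newton (x - y) * g y))"
    unfolding pot_def by (rule *) measurable
  show "ennreal (pot g x) = conv (\<lambda>z. ennreal (newton z)) (\<lambda>z. ennreal (g z)) x"
    unfolding e conv_def using g0 by (simp add: ennreal_mult)
  show "pot g x \<ge> 0" unfolding pot_def by (intro Bochner_Integration.integral_nonneg nn)
  show "pot g x \<le> 2 * newton_const TYPE('a) * L + (\<integral>\<^sub>L y. g y)"
    using le unfolding e[symmetric] using L I0 newton_const_pos[where 'a='a] by (subst (asm) ennreal_le_iff) auto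
qed

lemma smooth_facts:
  fixes v :: "'a::euclidean_space => real"
  assumes \<rho>: "\<rho> > 0" and [measurable]: "v \<in> borel_measurable borel" and v: "\<And>x. 0 \<le> v x" "\<And>x. v x \<le> L"
  shows integrable_smooth: "integrable lborel (\<lambda>y. bump \<rho> (x - y) * v y)"
    and ennreal_smooth: "ennreal (smooth \<rho> v x) = conv (\<lambda>z. ennreal (bump \<rho> z)) (\<lambda>z. ennreal (v z)) x"
    and smooth_nonneg: "smooth \<rho> v x \<ge> 0"
    and smooth_le: "smooth \<rho> v x \<le> L"
proof -
  have L: "L \<ge> 0" using v order_trans by blast
  have nn: "bump \<rho> (x - y) * v y \<ge> 0" for y using \<rho> v by simp
  have "(\<integral>+y. ennreal (bump \<rho> (x - y) * v y)) \<le> (\<integral>+y. ennreal (bump \<rho> (x - y)) * ennreal L)"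
    using \<rho> v by (intro nn_integral_mono) (auto simp: ennreal_mult[symmetric] L intro!: ennreal_leI mult_left_mono)
  also have "... = (\<integral>+(y::'a). ennreal (bump \<rho> y)) * ennreal L"
    by (subst nn_integral_multc, measurable, subst nn_integral_reflect[of "\<lambda>z. ennreal (bump \<rho> z)"]) auto
  finally have le: "(\<integral>+y. ennreal (bump \<rho> (x - y) * v y)) \<le> ennreal L" by (simp add: nn_integral_bump[OF \<rho>])
  hence fin: "(\<integral>+y. ennreal (bump \<rho> (x - y) * v y)) < \<infinity>" by (rule order.strict_trans1) simp
  note * = integral_of_finite_nn_integral[OF _ nn fin]
  show "integrable lborel (\<lambda>y. bump \<rho> (x - y) * v y)" by (rule *) measurable
  have e: "ennreal (smooth \<rho> v x) = (\<integral>+y. ennreal (bump \<rho> (x - y) * v y))"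
    unfolding smooth_def by (rule *) measurable
  show "ennreal (smooth \<rho> v x) = conv (\<lambda>z. ennreal (bump \<rho> z)) (\<lambda>z. ennreal (v z)) x"
    unfolding e conv_def using v \<rho> by (simp add: ennreal_mult)
  show "smooth \<rho> v x \<ge> 0" unfolding smooth_def by (intro Bochner_Integration.integral_nonneg nn)
  show "smooth \<rho> v x \<le> L"
    using le unfolding e[symmetric] using L by (subst (asm) ennreal_le_iff) auto
qed

lemma bdd_density_smooth:
  fixes g :: "'a::euclidean_space => real"
  assumes \<rho>: "\<rho> > 0" and g: "bdd_density L g"
  shows "bdd_density L (smooth \<rho> g)" "(\<integral>\<^sub>L x. smooth \<rho> g x) = (\<integral>\<^sub>L x. g x)"
proof -
  note [measurable] = bdd_densityD(1)[OF g]
  have g0: "0 \<le> g y" "g y \<le> L" for y using bdd_densityD[OF g] by auto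
  note s = smooth_facts[OF \<rho> bdd_densityD(1)[OF g] g0]
  have "(\<integral>+x. ennreal (smooth \<rho> g x)) = (\<integral>+x. ennreal (g x))"
    unfolding s(2) by (subst nn_integral_conv) (auto simp: nn_integral_bump[OF \<rho>])
  moreover have "(\<integral>+x. ennreal (g x)) = ennreal (\<integral>\<^sub>L x. g x)"
    using nn_integral_eq_integral[OF bdd_densityD(4)[OF g]] g0 by simp
  ultimately have e: "(\<integral>+x. ennreal (smooth \<rho> g x)) = ennreal (\<integral>\<^sub>L x. g x)" by simp
  have i: "integrable lborel (smooth \<rho> g)"
    by (rule integrableI_nonneg) (use s(3) e in auto)
  show "bdd_density L (smooth \<rho> g)"
    unfolding bdd_density_def using i s(3,4) by auto
  have "ennreal (\<integral>\<^sub>L x. smooth \<rho> g x) = ennreal (\<integral>\<^sub>L x. g x)"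
    using nn_integral_eq_integral[OF i] s(3) e by simp
  thus "(\<integral>\<^sub>L x. smooth \<rho> g x) = (\<integral>\<^sub>L x. g x)"
    by (subst (asm) ennreal_inj) (auto intro!: Bochner_Integration.integral_nonneg s(3) g0)
qed

lemma smooth_pot:
  fixes g :: "'a::euclidean_space => real"
  assumes d: "DIM('a) \<ge> 3" and \<rho>: "\<rho> > 0" and g: "bdd_density L g"
  shows smooth_pot_eq_pot_smooth: "smooth \<rho> (pot g) x = pot (smooth \<rho> g) x"
    and smooth_pot_eq_reg: "smooth \<rho> (pot g) x = (\<integral>\<^sub>L y. newton_reg \<rho> (x - y) * g y)"
    and integrable_reg: "integrable lborel (\<lambda>y. newton_reg \<rho> (x - y) * g y)"
proof -
  note [measurable] = bdd_densityD(1)[OF g]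
  have g0: "0 \<le> g y" "g y \<le> L" for y using bdd_densityD[OF g] by auto
  let ?N = "\<lambda>z::'a. ennreal (newton z)" and ?B = "\<lambda>z::'a. ennreal (bump \<rho> z)" and ?g = "\<lambda>z. ennreal (g z)"
  have 1: "ennreal (smooth \<rho> (pot g) x) = conv ?B (conv ?N ?g) x"
    by (subst ennreal_smooth[OF \<rho>, of _ "2 * newton_const TYPE('a) * L + (\<integral>\<^sub>L y. g y)"])
       (auto simp: pot_facts[OF d g])
  have 2: "ennreal (pot (smooth \<rho> g) x) = conv ?N (conv ?B ?g) x"
    by (subst ennreal_pot[OF d bdd_density_smooth(1)[OF \<rho> g]])
       (simp add: smooth_facts(2)[OF \<rho> bdd_densityD(1)[OF g] g0])
  have nn: "smooth \<rho> (pot g) x \<ge> 0"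
    by (rule smooth_nonneg[OF \<rho>, of _ "2 * newton_const TYPE('a) * L + (\<integral>\<^sub>L y. g y)"]) (auto simp: pot_facts[OF d g])
  have nn2: "pot (smooth \<rho> g) x \<ge> 0" by (rule pot_nonneg[OF d bdd_density_smooth(1)[OF \<rho> g]])
  have "ennreal (smooth \<rho> (pot g) x) = ennreal (pot (smooth \<rho> g) x)"
    unfolding 1 2 by (subst conv_left_commute) auto
  thus "smooth \<rho> (pot g) x = pot (smooth \<rho> g) x" using nn nn2 by simp
  have 3: "ennreal (smooth \<rho> (pot g) x) = conv (conv ?N ?B) ?g x"
    unfolding 1 by (subst conv_assoc) (auto simp: conv_commute[of ?B ?N])
  also have "... = (\<integral>+y. ennreal (newton_reg \<rho> (x - y) * g y))"
    unfolding conv_def[of "conv ?N ?B"] ennreal_newton_reg[OF d \<rho>, symmetric]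
    using g0 newton_reg_nonneg[OF d \<rho>] by (intro nn_integral_cong) (simp add: ennreal_mult)
  finally have 4: "(\<integral>+y. ennreal (newton_reg \<rho> (x - y) * g y)) = ennreal (smooth \<rho> (pot g) x)" ..
  have nn3: "newton_reg \<rho> (x - y) * g y \<ge> 0" for y using g0 newton_reg_nonneg[OF d \<rho>] by simp
  have fin: "(\<integral>+y. ennreal (newton_reg \<rho> (x - y) * g y)) < \<infinity>" unfolding 4 by simp
  note * = integral_of_finite_nn_integral[OF _ nn3 fin]
  show "integrable lborel (\<lambda>y. newton_reg \<rho> (x - y) * g y)" by (rule *) measurable
  have "ennreal (\<integral>\<^sub>L y. newton_reg \<rho> (x - y) * g y) = ennreal (smooth \<rho> (pot g) x)"
    unfolding 4[symmetric] by (rule *) measurable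
  thus "smooth \<rho> (pot g) x = (\<integral>\<^sub>L y. newton_reg \<rho> (x - y) * g y)"
    using nn by (subst (asm) ennreal_inj) (auto intro!: Bochner_Integration.integral_nonneg nn3)
qed

text \<open>
Mollification changes a potential only through the local kernel \<open>newton - newton_reg \<rho>\<close>, whose
integral is of order \<open>\<rho>^2\<close>; so a potential of a bounded density is within \<open>O(\<rho>^2)\<close> of its means.
\<close>

lemma pot_minus_smooth:
  fixes g :: "'a::euclidean_space => real"
  assumes d: "DIM('a) \<ge> 3" and \<rho>: "\<rho> > 0" and g: "bdd_density L g"
  shows pot_minus_smooth_eq: "pot g x - smooth \<rho> (pot g) x = (\<integral>\<^sub>L y. (newton (x - y) - newton_reg \<rho> (x - y)) * g y)"
    and integrable_pot_minus_smooth: "integrable lborel (\<lambda>y. (newton (x - y) - newton_reg \<rho> (x - y)) * g y)"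
    and pot_minus_smooth_le: "\<bar>pot g x - smooth \<rho> (pot g) x\<bar> \<le> L * diff_const TYPE('a) * \<rho>^2"
proof -
  note [measurable] = bdd_densityD(1)[OF g]
  have g0: "0 \<le> g y" "g y \<le> L" for y using bdd_densityD[OF g] by auto
  have L: "L \<ge> 0" using bdd_densityD(5)[OF g] .
  note i = Bochner_Integration.integrable_diff[OF integrable_pot[OF d g, of x] integrable_reg[OF d \<rho> g, of x]]
  show i': "integrable lborel (\<lambda>y. (newton (x - y) - newton_reg \<rho> (x - y)) * g y)"
    using i by (simp add: left_diff_distrib)
  show e: "pot g x - smooth \<rho> (pot g) x = (\<integral>\<^sub>L y. (newton (x - y) - newton_reg \<rho> (x - y)) * g y)"
    unfolding smooth_pot_eq_reg[OF d \<rho> g] unfolding pot_def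
    using integrable_pot[OF d g, of x] integrable_reg[OF d \<rho> g, of x] by (simp add: left_diff_distrib)
  have "ennreal \<bar>pot g x - smooth \<rho> (pot g) x\<bar> \<le> (\<integral>+y. ennreal (norm ((newton (x - y) - newton_reg \<rho> (x - y)) * g y)))"
    unfolding e using integral_norm_bound_ennreal[OF i'] by simp
  also have "... \<le> (\<integral>+y. ennreal \<bar>newton (x - y) - newton_reg \<rho> (x - y)\<bar> * ennreal L)"
    using g0 by (intro nn_integral_mono) (auto simp: abs_mult ennreal_mult[symmetric] L intro!: ennreal_leI mult_left_mono)
  also have "... = (\<integral>+(y::'a). ennreal \<bar>newton y - newton_reg \<rho> y\<bar>) * ennreal L"
    by (subst nn_integral_multc, measurable, subst nn_integral_reflect[of "\<lambda>y. ennreal \<bar>newton y - newton_reg \<rho> y\<bar>"]) auto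
  also have "... \<le> ennreal (diff_const TYPE('a) * \<rho>^2) * ennreal L"
    by (intro mult_right_mono nn_integral_newton_diff d \<rho>) simp
  also have "... = ennreal (L * diff_const TYPE('a) * \<rho>^2)"
    using L diff_const_pos[where 'a='a] by (simp add: ennreal_mult[symmetric] mult_ac)
  finally show "\<bar>pot g x - smooth \<rho> (pot g) x\<bar> \<le> L * diff_const TYPE('a) * \<rho>^2"
    using L diff_const_pos[where 'a='a] by (subst (asm) ennreal_le_iff) auto
qed

section \<open>Mean square approximation by mollifiers\<close>

lemma integral_reflect:
  fixes f :: "'a::euclidean_space => real"
  assumes [measurable]: "f \<in> borel_measurable borel"
  shows "(\<integral>\<^sub>L y. f (x - y)) = (\<integral>\<^sub>L y. f y)"
  by (subst (2) lborel_affine[of "-1" x]) (simp_all add: density_1 integral_distr)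

lemma integrable_lborel_translate:
  fixes f :: "'a::euclidean_space => real"
  assumes "integrable lborel f"
  shows "integrable lborel (\<lambda>y. f (x + y))"
proof -
  have [measurable]: "f \<in> borel_measurable borel" using borel_measurable_integrable[OF assms] by simp
  have "integrable (distr lborel borel ((+) x)) f" unfolding lborel_distr_plus by (rule assms)
  thus ?thesis by (subst (asm) integrable_distr_eq) auto
qed

lemma integral_bump_shift: "\<rho> > 0 ==> (\<integral>\<^sub>L y. bump \<rho> (x - y)) = 1" for x :: "'a::euclidean_space"
  by (subst integral_reflect) (auto simp: integral_bump)

lemma integrable_bump_shift: "\<rho> > 0 ==> integrable lborel (\<lambda>y. bump \<rho> (x - y))" for x :: "'a::euclidean_space"
  using integrable_smooth[of \<rho> "\<lambda>_. 1" 1 x] by simp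

text \<open>
Lower half of Lebesgue's differentiation theorem. For rational \<open>q\<close> the measure with density
\<open>max 0 (q - g)\<close> gives no mass to \<open>{g \<ge> q}\<close>, hence has zero density at almost all of its points;
there the means of \<open>g\<close> are eventually at least \<open>q - \<epsilon>\<close>.
\<close>

lemma AE_smooth_lower:
  fixes g :: "'a::euclidean_space => real"
  assumes g: "bdd_density L g"
  shows "AE x in lborel. \<forall>\<epsilon>>0. \<exists>\<rho>0>0. \<forall>\<rho>. 0 < \<rho> \<and> \<rho> < \<rho>0 --> smooth \<rho> g x \<ge> g x - \<epsilon>"
proof -
  note [measurable] = bdd_densityD(1)[OF g]
  have g0: "0 \<le> g y" "g y \<le> L" for y using bdd_densityD[OF g] by auto
  define h where "h q y = max 0 (real_of_rat q - g y)" for q y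
  have h[measurable]: "h q \<in> borel_measurable borel" for q unfolding h_def by measurable
  define Q where "Q q = \<bar>real_of_rat q\<bar>" for q
  have h0: "h q y \<ge> 0" "h q y \<le> Q q" for q y
    using g0(1)[of y] abs_ge_self[of "real_of_rat q"] unfolding h_def Q_def by linarith+
  \<comment> \<open>The restriction to a ball makes the measure finite.\<close>
  define \<sigma> where "\<sigma> q n = density lborel (\<lambda>y. ennreal (h q y) * indicator (ball 0 (real n)) y)" for q and n :: nat
  have s\<sigma>: "sets (\<sigma> q n) = sets borel" for q n by (simp add: \<sigma>_def)
  have em: "emeasure (\<sigma> q n) A = (\<integral>+y. ennreal (h q y) * indicator (ball 0 (real n)) y * indicator A y)" if "A \<in> sets borel" for q n A
    unfolding \<sigma>_def using that by (subst emeasure_density) auto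
  have fin: "emeasure (\<sigma> q n) UNIV < \<infinity>" for q n
  proof -
    have "emeasure (\<sigma> q n) UNIV \<le> (\<integral>+y. ennreal (Q q) * indicator (ball (0::'a) (real n)) y)"
      by (subst em) (auto intro!: nn_integral_mono ennreal_leI h0 split: split_indicator)
    also have "... < \<infinity>" by (simp add: nn_integral_cmult_indicator emeasure_ball ennreal_mult_less_top)
    finally show ?thesis .
  qed
  have zero: "emeasure (\<sigma> q n) {x. g x \<ge> real_of_rat q} = 0" for q n
    by (subst em) (auto simp: h_def nn_integral_0_iff_AE split: split_indicator intro!: AE_I2)
  have Em: "{x. g x \<ge> real_of_rat q} \<in> sets borel" for q by measurable
  have "AE x in lborel. \<forall>q n. g x \<ge> real_of_rat q --> (\<forall>\<epsilon>>0. \<exists>r0>0. \<forall>r. 0 < r \<and> r < r0 -->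
           emeasure (\<sigma> q n) (ball x r) \<le> ennreal (\<epsilon> * r ^ DIM('a)))"
  proof (subst AE_all_countable, intro allI, subst AE_all_countable, intro allI)
    fix q n
    show "AE x in lborel. g x \<ge> real_of_rat q --> (\<forall>\<epsilon>>0. \<exists>r0>0. \<forall>r. 0 < r \<and> r < r0 -->
           emeasure (\<sigma> q n) (ball x r) \<le> ennreal (\<epsilon> * r ^ DIM('a)))"
      using AE_zero_density[OF s\<sigma> fin Em zero, of q n] by simp
  qed
  thus ?thesis
  proof eventually_elim
    case (elim x)
    show ?case
    proof (intro allI impI)
      fix \<epsilon> :: real assume \<epsilon>: "\<epsilon> > 0"
      let ?b = "bump_mass TYPE('a)"
      obtain q where q: "g x - \<epsilon> / 2 < real_of_rat q" "real_of_rat q < g x"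
        using of_rat_dense[of "g x - \<epsilon> / 2" "g x"] \<epsilon> by auto
      obtain n where n: "norm x < real n" using reals_Archimedean2 by blast
      have "\<epsilon> / 2 * ?b > 0" using \<epsilon> bump_mass_pos[where 'a='a] by simp
      then obtain r0 where r0: "r0 > 0" "\<And>r. 0 < r ==> r < r0 ==> emeasure (\<sigma> q n) (ball x r) \<le> ennreal (\<epsilon> / 2 * ?b * r ^ DIM('a))"
        using elim q(2) by (metis less_imp_le)
      show "\<exists>\<rho>0>0. \<forall>\<rho>. 0 < \<rho> \<and> \<rho> < \<rho>0 --> smooth \<rho> g x \<ge> g x - \<epsilon>"
      proof (intro exI[of _ "min r0 (real n - norm x)"] conjI allI impI)
        show "min r0 (real n - norm x) > 0" using r0 n by simp
        fix \<rho> assume "0 < \<rho> \<and> \<rho> < min r0 (real n - norm x)"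
        hence \<rho>: "\<rho> > 0" "\<rho> < r0" "\<rho> < real n - norm x" by auto
        have sub: "ball x \<rho> \<subseteq> ball 0 (real n)"
        proof
          fix y assume "y \<in> ball x \<rho>"
          thus "y \<in> ball 0 (real n)" using \<rho>(3) norm_triangle_sub[of y x] by (simp add: dist_norm norm_minus_commute)
        qed
        note sh = smooth_facts[OF \<rho>(1) h[of q] h0[of q]]
        note sg = smooth_facts[OF \<rho>(1) bdd_densityD(1)[OF g] g0]
        have "ennreal (smooth \<rho> (h q) x) \<le> (\<integral>+y. ennreal (1 / (?b * \<rho> ^ DIM('a))) * (ennreal (h q y) * indicator (ball 0 (real n)) y * indicator (ball x \<rho>) y))"
          unfolding sh(2) conv_def
        proof (intro nn_integral_mono)
          fix y
          show "ennreal (bump \<rho> (x - y)) * ennreal (h q y) \<le> ennreal (1 / (?b * \<rho> ^ DIM('a))) * (ennreal (h q y) * indicator (ball 0 (real n)) y * indicator (ball x \<rho>) y)"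
          proof (cases "y \<in> ball x \<rho>")
            case True
            hence "y \<in> ball 0 (real n)" using sub by blast
            thus ?thesis using True by (auto intro!: mult_right_mono ennreal_leI bump_le \<rho>)
          next
            case False
            thus ?thesis by (simp add: bump_eq_0 \<rho> dist_norm)
          qed
        qed
        also have "... = ennreal (1 / (?b * \<rho> ^ DIM('a))) * emeasure (\<sigma> q n) (ball x \<rho>)"
          by (subst nn_integral_cmult) (measurable, simp add: em)
        also have "... \<le> ennreal (1 / (?b * \<rho> ^ DIM('a))) * ennreal (\<epsilon> / 2 * ?b * \<rho> ^ DIM('a))"
          by (intro mult_left_mono r0 \<rho>) simp
        also have "... = ennreal (\<epsilon> / 2)"
          using \<rho> \<epsilon> bump_mass_pos[where 'a='a] by (simp add: ennreal_mult[symmetric])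
        finally have sle: "smooth \<rho> (h q) x \<le> \<epsilon> / 2" using \<epsilon> by simp
        have "real_of_rat q - smooth \<rho> (h q) x = (\<integral>\<^sub>L y. bump \<rho> (x - y) * real_of_rat q - bump \<rho> (x - y) * h q y)"
          unfolding smooth_def using integral_bump_shift[OF \<rho>(1), of x] integrable_bump_shift[OF \<rho>(1), of x] sh(1) by simp
        also have "... \<le> smooth \<rho> g x"
          unfolding smooth_def
        proof (intro integral_mono)
          fix y
          have "bump \<rho> (x - y) * (real_of_rat q - h q y) \<le> bump \<rho> (x - y) * g y"
            using \<rho> by (intro mult_left_mono) (auto simp: h_def)
          thus "bump \<rho> (x - y) * real_of_rat q - bump \<rho> (x - y) * h q y \<le> bump \<rho> (x - y) * g y"
            by (simp add: right_diff_distrib)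
        qed (use integrable_bump_shift[OF \<rho>(1), of x] sh(1) sg(1) in auto)
        finally show "smooth \<rho> g x \<ge> g x - \<epsilon>" using sle q by linarith
      qed
    qed
  qed
qed

text \<open>
The one-sided limit suffices (an argument of Scheffe): the negative part of \<open>smooth (\<rho> n) g - g\<close>
tends to \<open>0\<close> by dominated convergence, and the positive part has the same integral because
mollification preserves the integral.
\<close>

lemma smooth_L1:
  fixes g :: "'a::euclidean_space => real"
  assumes g: "bdd_density L g" and \<rho>: "\<And>n. \<rho> n > 0" "\<rho> \<longlonglongrightarrow> 0"
  shows "(\<lambda>n. \<integral>\<^sub>L x. \<bar>smooth (\<rho> n) g x - g x\<bar>) \<longlonglongrightarrow> 0"
proof -
  note [measurable] = bdd_densityD(1)[OF g]
  have g0: "0 \<le> g y" "g y \<le> L" for y using bdd_densityD[OF g] by auto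
  note s = bdd_density_smooth[OF \<rho>(1) g]
  have s0: "0 \<le> smooth (\<rho> n) g y" "smooth (\<rho> n) g y \<le> L" for y n using bdd_densityD[OF s(1)] by auto
  note i = bdd_densityD(4)[OF g] bdd_densityD(4)[OF s(1)]
  have ip: "integrable lborel (\<lambda>x. max 0 (g x - smooth (\<rho> n) g x))" for n
    using i by (intro integrable_max) auto
  have eq: "(\<integral>\<^sub>L x. \<bar>smooth (\<rho> n) g x - g x\<bar>) = 2 * (\<integral>\<^sub>L x. max 0 (g x - smooth (\<rho> n) g x))" for n
  proof -
    have "(\<integral>\<^sub>L x. \<bar>smooth (\<rho> n) g x - g x\<bar>) = (\<integral>\<^sub>L x. 2 * max 0 (g x - smooth (\<rho> n) g x) + (smooth (\<rho> n) g x - g x))"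
      by (intro Bochner_Integration.integral_cong) (auto simp: max_def abs_if)
    also have "... = 2 * (\<integral>\<^sub>L x. max 0 (g x - smooth (\<rho> n) g x)) + ((\<integral>\<^sub>L x. smooth (\<rho> n) g x) - (\<integral>\<^sub>L x. g x))"
      using ip i by simp
    finally show ?thesis using s(2) by simp
  qed
  have "(\<lambda>n. \<integral>\<^sub>L x. max 0 (g x - smooth (\<rho> n) g x)) \<longlonglongrightarrow> (\<integral>\<^sub>L (x::'a). 0)"
  proof (rule integral_dominated_convergence[where w = g])
    show "AE x in lborel. (\<lambda>n. max 0 (g x - smooth (\<rho> n) g x)) \<longlonglongrightarrow> 0"
      using AE_smooth_lower[OF g]
    proof eventually_elim
      case (elim x)
      show ?case
      proof (rule LIMSEQ_I)
        fix e :: real assume "e > 0"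
        hence "e / 2 > 0" by simp
        then obtain r where r: "r > 0" "\<And>\<rho>. 0 < \<rho> ==> \<rho> < r ==> smooth \<rho> g x \<ge> g x - e / 2"
          using elim[rule_format, of "e / 2"] by blast
        obtain N where N: "\<And>n. n \<ge> N ==> \<rho> n < r" using order_tendstoD(2)[OF \<rho>(2) r(1)] by (auto simp: eventually_sequentially)
        show "\<exists>no. \<forall>n\<ge>no. norm (max 0 (g x - smooth (\<rho> n) g x) - 0) < e"
        proof (intro exI allI impI)
          fix n assume "n \<ge> N"
          from r(2)[OF \<rho>(1) N[OF this]] \<open>e > 0\<close> show "norm (max 0 (g x - smooth (\<rho> n) g x) - 0) < e" by auto
        qed
      qed
    qed
    show "AE x in lborel. norm (max 0 (g x - smooth (\<rho> n) g x)) \<le> g x" for n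
      using g0 s0 by (intro AE_I2) (auto simp: max_def)
  qed (use i in auto)
  hence "(\<lambda>n. 2 * (\<integral>\<^sub>L x. max 0 (g x - smooth (\<rho> n) g x))) \<longlonglongrightarrow> 2 * 0" by (intro tendsto_mult tendsto_const) simp
  thus ?thesis unfolding eq by simp
qed

lemma smooth_L2_sequence:
  fixes g :: "'a::euclidean_space => real"
  assumes g: "bdd_density L g"
  obtains \<rho> where "\<And>k. \<rho> k > 0" "\<And>k. \<rho> k \<le> (1/2) ^ k"
     "\<And>k. (\<integral>+x. ennreal ((smooth (\<rho> k) g x - g x)^2)) \<le> ennreal ((1/16) ^ k)"
proof -
  note [measurable] = bdd_densityD(1)[OF g]
  have g0: "0 \<le> g y" "g y \<le> L" for y using bdd_densityD[OF g] by auto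
  have L: "L \<ge> 0" using bdd_densityD(5)[OF g] .
  have "\<exists>\<rho>>0. \<rho> \<le> (1/2) ^ k \<and> (\<integral>+x. ennreal ((smooth \<rho> g x - g x)^2)) \<le> ennreal ((1/16) ^ k)" for k
  proof -
    define r :: "nat => real" where "r n = 1 / (real n + 1)" for n
    have r: "r n > 0" for n by (simp add: r_def)
    have r0: "r \<longlonglongrightarrow> 0" unfolding r_def using LIMSEQ_inverse_real_of_nat by (simp add: inverse_eq_divide add.commute)
    have "eventually (\<lambda>n. r n < (1/2) ^ k) sequentially" by (rule order_tendstoD[OF r0]) simp
    moreover have "eventually (\<lambda>n. (\<integral>\<^sub>L x. \<bar>smooth (r n) g x - g x\<bar>) < (1/16) ^ k / (L + 1)) sequentially"
      by (rule order_tendstoD[OF smooth_L1[OF g r r0]]) (use L in auto)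
    ultimately have "eventually (\<lambda>n. r n < (1/2) ^ k \<and> (\<integral>\<^sub>L x. \<bar>smooth (r n) g x - g x\<bar>) < (1/16) ^ k / (L + 1)) sequentially"
      by (rule eventually_conj)
    then obtain n where n: "r n < (1/2) ^ k" "(\<integral>\<^sub>L x. \<bar>smooth (r n) g x - g x\<bar>) < (1/16) ^ k / (L + 1)"
      by (auto simp: eventually_sequentially)
    note s = bdd_density_smooth[OF r g]
    have s0: "0 \<le> smooth (r n) g y" "smooth (r n) g y \<le> L" for y using bdd_densityD[OF s(1)] by auto
    have i: "integrable lborel (\<lambda>x. \<bar>smooth (r n) g x - g x\<bar>)"
      using bdd_densityD(4)[OF g] bdd_densityD(4)[OF s(1)] by auto
    have "(\<integral>+x. ennreal ((smooth (r n) g x - g x)^2)) \<le> (\<integral>+x. ennreal L * ennreal \<bar>smooth (r n) g x - g x\<bar>)"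
    proof (intro nn_integral_mono)
      fix x
      have "\<bar>smooth (r n) g x - g x\<bar> \<le> L" using g0[of x] s0[of x] by auto
      hence "\<bar>smooth (r n) g x - g x\<bar> * \<bar>smooth (r n) g x - g x\<bar> \<le> L * \<bar>smooth (r n) g x - g x\<bar>"
        by (intro mult_right_mono) auto
      thus "ennreal ((smooth (r n) g x - g x)^2) \<le> ennreal L * ennreal \<bar>smooth (r n) g x - g x\<bar>"
        using L by (simp add: ennreal_mult[symmetric] power2_eq_square ennreal_leI)
    qed
    also have "... = ennreal L * ennreal (\<integral>\<^sub>L x. \<bar>smooth (r n) g x - g x\<bar>)"
      using nn_integral_eq_integral[OF i] by (simp add: nn_integral_cmult)
    also have "... = ennreal (L * (\<integral>\<^sub>L x. \<bar>smooth (r n) g x - g x\<bar>))"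
      using L by (simp add: ennreal_mult)
    also have "... \<le> ennreal ((1/16) ^ k)"
    proof (rule ennreal_leI)
      have "L * (\<integral>\<^sub>L x. \<bar>smooth (r n) g x - g x\<bar>) \<le> (L + 1) * (\<integral>\<^sub>L x. \<bar>smooth (r n) g x - g x\<bar>)"
        by (intro mult_right_mono) auto
      also have "... \<le> (L + 1) * ((1/16) ^ k / (L + 1))" using n(2) L by (intro mult_left_mono) auto
      finally show "L * (\<integral>\<^sub>L x. \<bar>smooth (r n) g x - g x\<bar>) \<le> (1/16) ^ k" using L by simp
    qed
    finally show ?thesis using r[of n] n(1) by (intro exI[of _ "r n"]) auto
  qed
  hence "\<exists>\<rho>. \<forall>k. \<rho> k > 0 \<and> \<rho> k \<le> (1/2) ^ k \<and> (\<integral>+x. ennreal ((smooth (\<rho> k) g x - g x)^2)) \<le> ennreal ((1/16) ^ k)"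
    by (intro choice allI)
  thus ?thesis using that by blast
qed

section \<open>Second differences in mean square\<close>

lemma integrable_lborel_pairI:
  fixes f :: "'a::euclidean_space => 'b::euclidean_space => real"
  assumes [measurable]: "case_prod f \<in> borel_measurable (borel \<Otimes>\<^sub>M borel)"
    and "(\<integral>+x. \<integral>+y. ennreal \<bar>f x y\<bar>) < \<infinity>"
  shows "integrable (lborel \<Otimes>\<^sub>M lborel) (case_prod f)"
proof (rule integrableI_bounded)
  show "case_prod f \<in> borel_measurable (lborel \<Otimes>\<^sub>M lborel)" by measurable
  have "(\<integral>\<^sup>+ p. ennreal (norm (case_prod f p)) \<partial>(lborel \<Otimes>\<^sub>M lborel)) = (\<integral>+x. \<integral>+y. ennreal \<bar>f x y\<bar>)"
    by (subst lborel.nn_integral_fst[symmetric]) (auto simp: split_beta)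
  with assms(2) show "(\<integral>\<^sup>+ p. ennreal (norm (case_prod f p)) \<partial>(lborel \<Otimes>\<^sub>M lborel)) < \<infinity>" by simp
qed

text \<open>
Bounded integrable functions are square integrable, and the class is closed under shifts and means.
\<close>

definition intbdd :: "('a::euclidean_space => real) => bool" where
  "intbdd w \<longleftrightarrow> integrable lborel w \<and> (\<exists>C. \<forall>x. \<bar>w x\<bar> \<le> C)"

lemma intbdd_measurable: "intbdd w ==> w \<in> borel_measurable borel"
  unfolding intbdd_def using borel_measurable_integrable[of lborel w] by simp

lemma intbdd_bound: "intbdd w ==> \<exists>C\<ge>0. \<forall>x. \<bar>w x\<bar> \<le> C"
  unfolding intbdd_def by (metis abs_ge_zero order_trans)

lemma intbdd_shift: "intbdd w ==> intbdd (\<lambda>x. w (a + x))"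
  unfolding intbdd_def by (auto intro: integrable_lborel_translate)

lemma intbdd_mult: "intbdd v ==> intbdd w ==> integrable lborel (\<lambda>x. v x * w x)"
proof -
  assume v: "intbdd v" and w: "intbdd w"
  note [measurable] = intbdd_measurable[OF v] intbdd_measurable[OF w]
  obtain C where C: "C \<ge> 0" "\<And>x. \<bar>v x\<bar> \<le> C" using intbdd_bound[OF v] by blast
  have "integrable lborel (\<lambda>x. C * w x)" using w by (simp add: intbdd_def)
  thus ?thesis
    by (rule Bochner_Integration.integrable_bound) (auto simp: abs_mult C intro!: mult_right_mono)
qed

lemma integral_scale:
  fixes f :: "'a::euclidean_space => real"
  assumes [measurable]: "f \<in> borel_measurable borel" and c: "c \<noteq> 0"
  shows "(\<integral>\<^sub>L y. f y) = \<bar>c\<bar> ^ DIM('a) * (\<integral>\<^sub>L y. f (x + c *\<^sub>R y))"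
  by (subst lborel_affine[OF c, of x]) (simp add: integral_density integral_distr)

lemma smooth_unit:
  fixes w :: "'a::euclidean_space => real"
  assumes [measurable]: "w \<in> borel_measurable borel" and s: "s > 0"
  shows "smooth s w x = (\<integral>\<^sub>L h. bump 1 h * w (s *\<^sub>R h + x))"
proof -
  have "smooth s w x = \<bar>s\<bar> ^ DIM('a) * (\<integral>\<^sub>L h. bump s (x - (x + s *\<^sub>R h)) * w (x + s *\<^sub>R h))"
    unfolding smooth_def using s by (subst integral_scale[of _ s x]) auto
  also have "... = \<bar>s\<bar> ^ DIM('a) * (\<integral>\<^sub>L h. (1 / s ^ DIM('a)) * (bump 1 h * w (s *\<^sub>R h + x)))"
    using s by (simp add: bump_scale add.commute mult_ac)
  also have "... = (\<integral>\<^sub>L h. bump 1 h * w (s *\<^sub>R h + x))"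
    using s by (subst integral_mult_right_zero) simp
  finally show ?thesis .
qed

text \<open>
Fubini moves the mean outside, so that every scalar product with a mollified function becomes an
average of the autocorrelation.
\<close>

lemma integral_mult_smooth:
  fixes v w :: "'a::euclidean_space => real"
  assumes v: "intbdd v" and w: "intbdd w" and s: "s > 0"
  shows "(\<integral>\<^sub>L x. v x * smooth s w x) = (\<integral>\<^sub>L h. bump 1 h * (\<integral>\<^sub>L x. v x * w (s *\<^sub>R h + x)))"
proof -
  note [measurable] = intbdd_measurable[OF v] intbdd_measurable[OF w]
  obtain C where C: "C \<ge> 0" "\<And>x. \<bar>w x\<bar> \<le> C" using intbdd_bound[OF w] by blast
  have "integrable (lborel \<Otimes>\<^sub>M lborel) (\<lambda>(h, x). v x * (bump 1 h * w (s *\<^sub>R h + x)))"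
  proof (rule integrable_lborel_pairI)
    have "(\<integral>+h. \<integral>+x. ennreal \<bar>v x * (bump 1 h * w (s *\<^sub>R h + x))\<bar>) \<le>
       (\<integral>\<^sup>+h. \<integral>\<^sup>+x. ennreal (bump 1 h) * (ennreal C * ennreal \<bar>v x\<bar>) \<partial>lborel \<partial>(lborel::'a measure))"
    proof (intro nn_integral_mono)
      fix h x
      have "\<bar>v x * (bump 1 h * w (s *\<^sub>R h + x))\<bar> = bump 1 h * (\<bar>w (s *\<^sub>R h + x)\<bar> * \<bar>v x\<bar>)" by (simp add: abs_mult mult_ac)
      also have "... \<le> bump 1 h * (C * \<bar>v x\<bar>)" using C by (intro mult_left_mono mult_right_mono) auto
      finally show "ennreal \<bar>v x * (bump 1 h * w (s *\<^sub>R h + x))\<bar> \<le> ennreal (bump 1 h) * (ennreal C * ennreal \<bar>v x\<bar>)"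
        using C by (simp add: ennreal_mult[symmetric] ennreal_leI)
    qed
    also have "... = ennreal C * (\<integral>+x. ennreal \<bar>v x\<bar>)"
      by (simp add: nn_integral_cmult nn_integral_multc nn_integral_bump)
    also have "... < \<infinity>" using v unfolding intbdd_def integrable_iff_bounded by (simp add: ennreal_mult_less_top)
    finally show "(\<integral>+h. \<integral>+x. ennreal \<bar>v x * (bump 1 h * w (s *\<^sub>R h + x))\<bar>) < \<infinity>" .
  qed measurable
  from lborel_pair.Fubini_integral[OF this]
  have "(\<integral>\<^sub>L x. \<integral>\<^sub>L h. v x * (bump 1 h * w (s *\<^sub>R h + x))) = (\<integral>\<^sub>L h. \<integral>\<^sub>L x. v x * (bump 1 h * w (s *\<^sub>R h + x)))" .
  moreover have "(\<integral>\<^sub>L h. v x * (bump 1 h * w (s *\<^sub>R h + x))) = v x * smooth s w x" for x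
    by (subst smooth_unit[OF _ s]) auto
  moreover have "(\<integral>\<^sub>L x. v x * (bump 1 h * w (s *\<^sub>R h + x))) = bump 1 h * (\<integral>\<^sub>L x. v x * w (s *\<^sub>R h + x))" for h
    by (subst integral_mult_right_zero[symmetric]) (simp add: mult_ac)
  ultimately show ?thesis by (simp only:)
qed

lemma abs_smooth_le:
  fixes w :: "'a::euclidean_space => real"
  assumes [measurable]: "w \<in> borel_measurable borel" and s: "s > 0"
  shows "ennreal \<bar>smooth s w x\<bar> \<le> conv (\<lambda>z. ennreal (bump s z)) (\<lambda>z. ennreal \<bar>w z\<bar>) x"
proof (cases "integrable lborel (\<lambda>y. bump s (x - y) * w y)")
  case True
  from integral_norm_bound_ennreal[OF True] show ?thesis
    using s unfolding smooth_def conv_def by (simp add: abs_mult ennreal_mult)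
qed (simp add: smooth_def not_integrable_integral_eq)

lemma intbdd_smooth:
  fixes w :: "'a::euclidean_space => real"
  assumes w: "intbdd w" and s: "s > 0"
  shows "intbdd (smooth s w)"
proof -
  note [measurable] = intbdd_measurable[OF w]
  obtain C where C: "C \<ge> 0" "\<And>x. \<bar>w x\<bar> \<le> C" using intbdd_bound[OF w] by blast
  have "(\<integral>+x. ennreal \<bar>smooth s w x\<bar>) \<le> (\<integral>+x. conv (\<lambda>z. ennreal (bump s z)) (\<lambda>z. ennreal \<bar>w z\<bar>) x)"
    by (intro nn_integral_mono abs_smooth_le s) measurable
  also have "... = (\<integral>+x. ennreal \<bar>w x\<bar>)" by (subst nn_integral_conv) (auto simp: nn_integral_bump s)
  also have "... < \<infinity>" using w unfolding intbdd_def integrable_iff_bounded by simp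
  finally have i: "integrable lborel (smooth s w)" by (intro integrableI_bounded) auto
  have "\<bar>smooth s w x\<bar> \<le> C" for x
  proof -
    have "ennreal \<bar>smooth s w x\<bar> \<le> conv (\<lambda>z. ennreal (bump s z)) (\<lambda>z. ennreal \<bar>w z\<bar>) x"
      by (intro abs_smooth_le s) measurable
    also have "... = ennreal (smooth s (\<lambda>z. \<bar>w z\<bar>) x)" by (rule ennreal_smooth[symmetric, OF s]) (use C in auto)
    finally have "\<bar>smooth s w x\<bar> \<le> smooth s (\<lambda>z. \<bar>w z\<bar>) x"
      by (subst (asm) ennreal_le_iff) (auto intro!: smooth_nonneg[OF s, of _ C] C)
    also have "... \<le> C" by (rule smooth_le[OF s]) (use C in auto)
    finally show ?thesis .
  qed
  with i show ?thesis unfolding intbdd_def by blast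
qed

definition autocorr :: "('a::euclidean_space => real) => 'a => real" where
  "autocorr w h = (\<integral>\<^sub>L x. w x * w (h + x))"

lemma measurable_autocorr [measurable]:
  assumes [measurable]: "w \<in> borel_measurable borel"
  shows "autocorr w \<in> borel_measurable borel"
  unfolding autocorr_def by measurable

lemma autocorr_shift:
  fixes w :: "'a::euclidean_space => real"
  assumes w: "intbdd w"
  shows "(\<integral>\<^sub>L x. w (a + x) * w (b + x)) = autocorr w (b - a)"
proof -
  note [measurable] = intbdd_measurable[OF w]
  have "(\<integral>\<^sub>L x. w (a + x) * w (b + x)) = (\<integral>\<^sub>L x. (\<lambda>x. w x * w (b - a + x)) (a + x))"
    by (simp add: algebra_simps)
  also have "... = autocorr w (b - a)" unfolding autocorr_def by (rule integral_lborel_translate) measurable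
  finally show ?thesis .
qed

lemma autocorr_minus: "intbdd w ==> autocorr w (- h) = autocorr w h"
  using autocorr_shift[of w h 0] by (simp add: autocorr_def mult.commute)

lemma autocorr_bound:
  fixes w :: "'a::euclidean_space => real"
  assumes w: "intbdd w"
  shows "\<exists>C. \<forall>h. \<bar>autocorr w h\<bar> \<le> C"
proof -
  obtain C where C: "C \<ge> 0" "\<And>x. \<bar>w x\<bar> \<le> C" using intbdd_bound[OF w] by blast
  have iw: "integrable lborel (\<lambda>x. \<bar>w x\<bar> * C)" using w by (simp add: intbdd_def)
  have "\<bar>autocorr w h\<bar> \<le> (\<integral>\<^sub>L x. \<bar>w x\<bar> * C)" for h
  proof -
    have "\<bar>autocorr w h\<bar> \<le> (\<integral>\<^sub>L x. \<bar>w x * w (h + x)\<bar>)" unfolding autocorr_def by (rule integral_abs_bound)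
    also have "... \<le> (\<integral>\<^sub>L x. \<bar>w x\<bar> * C)"
    proof (rule integral_mono)
      show "integrable lborel (\<lambda>x. \<bar>w x * w (h + x)\<bar>)"
        by (rule integrable_abs[OF intbdd_mult[OF w intbdd_shift[OF w]]])
    qed (use iw in \<open>auto simp: abs_mult intro!: mult_left_mono C\<close>)
    finally show ?thesis .
  qed
  thus ?thesis by blast
qed

abbreviation second_difference :: "('a::euclidean_space => real) => 'a => 'a => 'a => real" where
  "second_difference w h k x \<equiv> w (h + k + x) - w (h + x) - w (k + x) + w x"

text \<open>
The mean square size of second differences with random steps \<open>s h\<close> and \<open>s k\<close>, where \<open>h\<close> and \<open>k\<close> are
independent with the bump as density.
\<close>

abbreviation second_difference_energy :: "('a::euclidean_space => real) => real => ennreal" where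
  "second_difference_energy w s \<equiv> (\<integral>+h. \<integral>+k. ennreal (bump 1 h * bump 1 k) *
     (\<integral>+x. ennreal ((second_difference w (s *\<^sub>R h) (s *\<^sub>R k) x)^2)))"

lemma second_difference_L2:
  fixes w :: "'a::euclidean_space => real"
  assumes w: "intbdd w"
  shows "integrable lborel (\<lambda>x. (second_difference w h k x)^2)"
    and "(\<integral>\<^sub>L x. (second_difference w h k x)^2) =
       4 * autocorr w 0 - 4 * autocorr w h - 4 * autocorr w k + 2 * autocorr w (h + k) + 2 * autocorr w (h - k)"
proof -
  have i: "integrable lborel (\<lambda>x. w (a + x) * w (b + x))" for a b by (intro intbdd_mult intbdd_shift w)
  let ?p = "\<lambda>a b x. w (a + x) * w (b + x)"
  let ?e = "\<lambda>x. ?p (h + k) (h + k) x + ?p h h x + ?p k k x + ?p 0 0 x - 2 * ?p (h + k) h x - 2 * ?p (h + k) k x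
      + 2 * ?p (h + k) 0 x + 2 * ?p h k x - 2 * ?p h 0 x - 2 * ?p k 0 x"
  have e: "(\<lambda>x. (second_difference w h k x)^2) = ?e"
    by (auto simp: fun_eq_iff power2_eq_square algebra_simps)
  show "integrable lborel (\<lambda>x. (second_difference w h k x)^2)"
    unfolding e by (intro Bochner_Integration.integrable_add Bochner_Integration.integrable_diff integrable_mult_right i)
  have "(\<integral>\<^sub>L x. ?e x) = (\<integral>\<^sub>L x. ?p (h + k) (h + k) x) + (\<integral>\<^sub>L x. ?p h h x) + (\<integral>\<^sub>L x. ?p k k x) + (\<integral>\<^sub>L x. ?p 0 0 x)
     - 2 * (\<integral>\<^sub>L x. ?p (h + k) h x) - 2 * (\<integral>\<^sub>L x. ?p (h + k) k x) + 2 * (\<integral>\<^sub>L x. ?p (h + k) 0 x) + 2 * (\<integral>\<^sub>L x. ?p h k x)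
     - 2 * (\<integral>\<^sub>L x. ?p h 0 x) - 2 * (\<integral>\<^sub>L x. ?p k 0 x)"
    by (simp only: Bochner_Integration.integral_add Bochner_Integration.integral_diff integral_mult_right_zero
        Bochner_Integration.integrable_add Bochner_Integration.integrable_diff integrable_mult_right i)
  also have "... = 4 * autocorr w 0 - 4 * autocorr w h - 4 * autocorr w k + 2 * autocorr w (h + k) + 2 * autocorr w (h - k)"
    unfolding autocorr_shift[OF w]
    using autocorr_minus[OF w, of h] autocorr_minus[OF w, of k] autocorr_minus[OF w, of "h + k"] autocorr_minus[OF w, of "h - k"]
    by simp
  finally show "(\<integral>\<^sub>L x. (second_difference w h k x)^2) =
       4 * autocorr w 0 - 4 * autocorr w h - 4 * autocorr w k + 2 * autocorr w (h + k) + 2 * autocorr w (h - k)"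
    unfolding e .
qed

lemma integrable_bump_times:
  fixes c :: "'a::euclidean_space => real"
  assumes [measurable]: "c \<in> borel_measurable borel" and "\<And>h. \<bar>c h\<bar> \<le> C"
  shows "integrable lborel (\<lambda>h. bump 1 h * c h)"
proof -
  have "integrable lborel (\<lambda>h::'a. bump 1 h * C)" by (simp add: integrable_bump)
  thus ?thesis
  proof (rule Bochner_Integration.integrable_bound)
    show "AE h in lborel. norm (bump 1 h * c h) \<le> norm (bump 1 h * C)"
      using assms(2) by (intro AE_I2) (auto simp: abs_mult intro!: mult_left_mono order_trans[OF assms(2) abs_ge_self])
  qed measurable
qed

lemma abs_integral_bump_times:
  fixes c :: "'a::euclidean_space => real"
  assumes [measurable]: "c \<in> borel_measurable borel" and "\<And>h. \<bar>c h\<bar> \<le> C"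
  shows "\<bar>\<integral>h. bump 1 h * c h \<partial>lborel\<bar> \<le> C"
proof -
  have "\<bar>\<integral>h. bump 1 h * c h \<partial>lborel\<bar> \<le> (\<integral>\<^sub>L h. \<bar>bump 1 h * c h\<bar>)" by (rule integral_abs_bound)
  also have "... \<le> (\<integral>\<^sub>L (h::'a). bump 1 h * C)"
  proof (rule integral_mono)
    show "integrable lborel (\<lambda>h. \<bar>bump 1 h * c h\<bar>)" by (rule integrable_abs[OF integrable_bump_times[OF assms]])
  qed (use assms(2) in \<open>auto simp: abs_mult integrable_bump intro!: mult_left_mono\<close>)
  finally show ?thesis by (simp add: integral_bump)
qed

text \<open>
Both this and \<open>second_difference_L2\<close> expand a square into values of the autocorrelation.
\<close>

lemma smooth_defect_L2:
  fixes w :: "'a::euclidean_space => real"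
  assumes w: "intbdd w" and s: "s > 0"
  defines "m1 \<equiv> (\<integral>\<^sub>L h. bump 1 h * autocorr w (s *\<^sub>R h))"
    and "m2 \<equiv> (\<integral>\<^sub>L h. bump 1 h * (\<integral>\<^sub>L k. bump 1 k * autocorr w (s *\<^sub>R h - s *\<^sub>R k)))"
  shows "integrable lborel (\<lambda>x. (w x - smooth s w x)^2)"
    and "(\<integral>\<^sub>L x. (w x - smooth s w x)^2) = autocorr w 0 - 2 * m1 + m2"
proof -
  note ws = intbdd_smooth[OF w s]
  have e: "(\<lambda>x. (w x - smooth s w x)^2) = (\<lambda>x. w x * w x - 2 * (w x * smooth s w x) + smooth s w x * smooth s w x)"
    by (auto simp: fun_eq_iff power2_eq_square algebra_simps)
  note i = intbdd_mult[OF w w] intbdd_mult[OF w ws] intbdd_mult[OF ws ws]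
  show "integrable lborel (\<lambda>x. (w x - smooth s w x)^2)" unfolding e using i by simp
  have "(\<integral>\<^sub>L x. (w x - smooth s w x)^2) = (\<integral>\<^sub>L x. w x * w x) - 2 * (\<integral>\<^sub>L x. w x * smooth s w x) + (\<integral>\<^sub>L x. smooth s w x * smooth s w x)"
    unfolding e using i by simp
  also have "(\<integral>\<^sub>L x. w x * w x) = autocorr w 0" by (simp add: autocorr_def)
  also have "(\<integral>\<^sub>L x. w x * smooth s w x) = m1"
    unfolding m1_def autocorr_def by (rule integral_mult_smooth[OF w w s])
  also have "(\<integral>\<^sub>L x. smooth s w x * smooth s w x) = m2"
  proof -
    have "(\<integral>\<^sub>L x. smooth s w x * w (s *\<^sub>R h + x)) = (\<integral>\<^sub>L k. bump 1 k * autocorr w (s *\<^sub>R h - s *\<^sub>R k))" for h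
    proof -
      have "(\<integral>\<^sub>L x. smooth s w x * w (s *\<^sub>R h + x)) = (\<integral>\<^sub>L x. w (s *\<^sub>R h + x) * smooth s w x)"
        by (simp add: mult.commute)
      also have "... = (\<integral>\<^sub>L k. bump 1 k * (\<integral>\<^sub>L x. w (s *\<^sub>R h + x) * w (s *\<^sub>R k + x)))"
        by (rule integral_mult_smooth[OF intbdd_shift[OF w] w s])
      also have "... = (\<integral>\<^sub>L k. bump 1 k * autocorr w (s *\<^sub>R h - s *\<^sub>R k))"
        unfolding autocorr_shift[OF w] using autocorr_minus[OF w, of "s *\<^sub>R h - s *\<^sub>R k" for h k] by simp
      finally show ?thesis .
    qed
    thus ?thesis unfolding m2_def integral_mult_smooth[OF ws w s] by simp
  qed
  finally show "(\<integral>\<^sub>L x. (w x - smooth s w x)^2) = autocorr w 0 - 2 * m1 + m2" .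
qed

text \<open>
In Fourier terms the mean over \<open>h\<close> of \<open>norm (1 - exp (i h \<xi>))^2\<close> is \<open>2 * (1 - b \<xi>)\<close>, with \<open>b\<close> the
transform of the symmetric bump; for two independent steps the mean is \<open>4 * (1 - b \<xi>)^2\<close>, the multiplier
of \<open>4 * (w - smooth s w)^2\<close>. The proof compares the two expansions into autocorrelations.
\<close>

lemma second_difference_identity:
  fixes w :: "'a::euclidean_space => real"
  assumes w: "intbdd w" and s: "s > 0"
  shows "second_difference_energy w s
         = 4 * (\<integral>+x. ennreal ((w x - smooth s w x)^2))"
proof -
  note [measurable] = intbdd_measurable[OF w]
  let ?c = "autocorr w"
  obtain C where C: "\<And>h. \<bar>?c h\<bar> \<le> C" using autocorr_bound[OF w] by blast
  define I where "I h k = 4 * ?c 0 - 4 * ?c (s *\<^sub>R h) - 4 * ?c (s *\<^sub>R k) + 2 * ?c (s *\<^sub>R h + s *\<^sub>R k) + 2 * ?c (s *\<^sub>R h - s *\<^sub>R k)" for h k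
  have [measurable]: "(\<lambda>p. I (fst p) (snd p)) \<in> borel_measurable (borel \<Otimes>\<^sub>M borel)"
    unfolding I_def by measurable
  have Ie: "(\<integral>+x. ennreal ((second_difference w (s *\<^sub>R h) (s *\<^sub>R k) x)^2)) = ennreal (I h k)" for h k
    unfolding I_def second_difference_L2(2)[OF w, symmetric]
    by (rule nn_integral_eq_integral[OF second_difference_L2(1)[OF w]]) simp
  have I0: "I h k \<ge> 0" for h k
    unfolding I_def second_difference_L2(2)[OF w, symmetric] by simp
  have Ib: "\<bar>I h k\<bar> \<le> 16 * C" for h k
    using C[of 0] C[of "s *\<^sub>R h"] C[of "s *\<^sub>R k"] C[of "s *\<^sub>R h + s *\<^sub>R k"] C[of "s *\<^sub>R h - s *\<^sub>R k"] unfolding I_def abs_le_iff by linarith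
  define J where "J h = (\<integral>\<^sub>L k. bump 1 k * I h k)" for h
  have [measurable]: "I h \<in> borel_measurable borel" for h unfolding I_def by measurable
  have [measurable]: "J \<in> borel_measurable borel" unfolding J_def by measurable
  have J0: "J h \<ge> 0" for h unfolding J_def using I0 by (intro Bochner_Integration.integral_nonneg) simp
  have Jb: "\<bar>J h\<bar> \<le> 16 * C" for h unfolding J_def by (rule abs_integral_bump_times[OF _ Ib]) measurable
  have inner: "(\<integral>+k. ennreal (bump 1 h * bump 1 k) * ennreal (I h k)) = ennreal (bump 1 h * J h)" for h
  proof -
    have "(\<integral>+k. ennreal (bump 1 h * bump 1 k) * ennreal (I h k)) = ennreal (bump 1 h) * (\<integral>+k. ennreal (bump 1 k * I h k))"
      by (subst nn_integral_cmult[symmetric], measurable) (simp add: ennreal_mult mult.assoc I0)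
    also have "(\<integral>+k. ennreal (bump 1 k * I h k)) = ennreal (J h)"
      unfolding J_def by (rule nn_integral_eq_integral[OF integrable_bump_times[OF _ Ib]]) (measurable, simp add: I0)
    finally show ?thesis by (simp add: ennreal_mult J0)
  qed
  have outer: "(\<integral>+h. ennreal (bump 1 h * J h)) = ennreal (\<integral>\<^sub>L h. bump 1 h * J h)"
    by (rule nn_integral_eq_integral[OF integrable_bump_times[OF _ Jb]]) (measurable, simp add: J0)
  define m1 where "m1 = (\<integral>\<^sub>L h. bump 1 h * ?c (s *\<^sub>R h))"
  define P where "P h = (\<integral>\<^sub>L k. bump 1 k * ?c (s *\<^sub>R h - s *\<^sub>R k))" for h
  have [measurable]: "P \<in> borel_measurable borel" unfolding P_def by measurable
  have Pb: "\<bar>P h\<bar> \<le> C" for h unfolding P_def by (rule abs_integral_bump_times[OF _ C]) measurable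
  have P2: "(\<integral>\<^sub>L k. bump 1 k * ?c (s *\<^sub>R h + s *\<^sub>R k)) = P h" for h
  proof -
    have "(\<integral>\<^sub>L k. bump 1 k * ?c (s *\<^sub>R h + s *\<^sub>R k)) = (\<integral>\<^sub>L k. bump 1 (0 - k) * ?c (s *\<^sub>R h + s *\<^sub>R (0 - k)))"
      by (rule integral_reflect[symmetric]) measurable
    thus ?thesis by (simp add: P_def)
  qed
  have ib: "integrable lborel (\<lambda>k::'a. bump 1 k)" by (simp add: integrable_bump)
  have i1: "integrable lborel (\<lambda>k. bump 1 k * ?c (s *\<^sub>R k))" by (rule integrable_bump_times[OF _ C]) measurable
  have i2: "integrable lborel (\<lambda>k. bump 1 k * ?c (s *\<^sub>R h + s *\<^sub>R k))" for h by (rule integrable_bump_times[OF _ C]) measurable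
  have i3: "integrable lborel (\<lambda>k. bump 1 k * ?c (s *\<^sub>R h - s *\<^sub>R k))" for h by (rule integrable_bump_times[OF _ C]) measurable
  have i4: "integrable lborel (\<lambda>h. bump 1 h * P h)" by (rule integrable_bump_times[OF _ Pb]) measurable
  have J: "J h = 4 * ?c 0 - 4 * ?c (s *\<^sub>R h) - 4 * m1 + 4 * P h" for h
  proof -
    have "J h = (\<integral>\<^sub>L k. (4 * ?c 0 - 4 * ?c (s *\<^sub>R h)) * bump 1 k - 4 * (bump 1 k * ?c (s *\<^sub>R k)) + 2 * (bump 1 k * ?c (s *\<^sub>R h + s *\<^sub>R k)) + 2 * (bump 1 k * ?c (s *\<^sub>R h - s *\<^sub>R k)))"
      unfolding J_def I_def by (intro Bochner_Integration.integral_cong refl) (simp add: algebra_simps)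
    also have "... = (4 * ?c 0 - 4 * ?c (s *\<^sub>R h)) * (\<integral>\<^sub>L (k::'a). bump 1 k) - 4 * m1 + 2 * P h + 2 * P h"
      unfolding m1_def
      by (simp only: Bochner_Integration.integral_add Bochner_Integration.integral_diff integral_mult_right_zero
        Bochner_Integration.integrable_add Bochner_Integration.integrable_diff integrable_mult_right ib i1 i2 i3 P2 P_def[symmetric])
    finally show ?thesis by (simp add: integral_bump)
  qed
  have "(\<integral>\<^sub>L h. bump 1 h * J h) = (\<integral>\<^sub>L h. (4 * ?c 0 - 4 * m1) * bump 1 h - 4 * (bump 1 h * ?c (s *\<^sub>R h)) + 4 * (bump 1 h * P h))"
    unfolding J by (intro Bochner_Integration.integral_cong refl) (simp add: algebra_simps)
  also have "... = (4 * ?c 0 - 4 * m1) * (\<integral>\<^sub>L (h::'a). bump 1 h) - 4 * m1 + 4 * (\<integral>\<^sub>L h. bump 1 h * P h)"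
    unfolding m1_def
    by (simp only: Bochner_Integration.integral_add Bochner_Integration.integral_diff integral_mult_right_zero
        Bochner_Integration.integrable_add Bochner_Integration.integrable_diff integrable_mult_right ib i1 i4)
  also have "... = 4 * (\<integral>\<^sub>L x. (w x - smooth s w x)^2)"
    unfolding smooth_defect_L2(2)[OF w s] m1_def P_def by (simp add: integral_bump)
  finally have "ennreal (\<integral>\<^sub>L h. bump 1 h * J h) = ennreal (4 * (\<integral>\<^sub>L x. (w x - smooth s w x)^2))" by simp
  also have "... = 4 * (\<integral>+x. ennreal ((w x - smooth s w x)^2))"
    by (subst nn_integral_eq_integral[OF smooth_defect_L2(1)[OF w s]]) (auto simp: ennreal_mult)
  finally show ?thesis unfolding Ie inner outer .
qed

text \<open>
Here \<open>w\<close> is the potential of \<open>f = smooth \<rho>' g - smooth \<rho> g\<close>, so \<open>w - smooth s w\<close> is the convolution of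
\<open>f\<close> with the kernel \<open>newton - newton_reg s\<close> of integral \<open>O(s^2)\<close>; Young's inequality bounds its square
norm.
\<close>

lemma second_difference_bound:
  fixes g :: "'a::euclidean_space => real"
  assumes d: "DIM('a) \<ge> 3" and g: "bdd_density L g" and \<rho>: "\<rho> > 0" "\<rho>' > 0" and s: "s > 0"
  defines "w \<equiv> \<lambda>x. smooth \<rho>' (pot g) x - smooth \<rho> (pot g) x"
  shows "intbdd w"
    and "second_difference_energy w s
         \<le> 4 * (ennreal (diff_const TYPE('a) * s^2))^2 * (\<integral>+x. ennreal ((smooth \<rho>' g x - smooth \<rho> g x)^2))"
proof -
  note [measurable] = bdd_densityD(1)[OF g]
  have g0: "0 \<le> g y" "g y \<le> L" for y using bdd_densityD[OF g] by auto
  let ?D = "\<lambda>\<rho> z::'a. newton z - newton_reg \<rho> z"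
  have wm[measurable]: "w \<in> borel_measurable borel" unfolding w_def by measurable
  have wd: "w x = (\<integral>\<^sub>L y. ?D \<rho> (x - y) * g y) - (\<integral>\<^sub>L y. ?D \<rho>' (x - y) * g y)" for x
    unfolding w_def pot_minus_smooth_eq[OF d \<rho>(1) g, symmetric] pot_minus_smooth_eq[OF d \<rho>(2) g, symmetric] by simp
  have iw: "integrable lborel w"
  proof (rule integrableI_bounded)
    have b: "ennreal \<bar>\<integral>y. ?D r (x - y) * g y \<partial>lborel\<bar> \<le> conv (\<lambda>z. ennreal \<bar>?D r z\<bar>) (\<lambda>z. ennreal (g z)) x" if "r > 0" for r x
      using integral_norm_bound_ennreal[OF integrable_pot_minus_smooth[OF d that g, of x]] g0
      unfolding conv_def by (simp add: abs_mult ennreal_mult)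
    have "(\<integral>+x. ennreal (norm (w x))) \<le> (\<integral>+x. conv (\<lambda>z. ennreal \<bar>?D \<rho> z\<bar>) (\<lambda>z. ennreal (g z)) x + conv (\<lambda>z. ennreal \<bar>?D \<rho>' z\<bar>) (\<lambda>z. ennreal (g z)) x)"
    proof (intro nn_integral_mono)
      fix x
      have "ennreal (norm (w x)) \<le> ennreal (\<bar>\<integral>y. ?D \<rho> (x - y) * g y \<partial>lborel\<bar> + \<bar>\<integral>y. ?D \<rho>' (x - y) * g y \<partial>lborel\<bar>)"
        unfolding wd by (intro ennreal_leI) simp
      also have "... \<le> conv (\<lambda>z. ennreal \<bar>?D \<rho> z\<bar>) (\<lambda>z. ennreal (g z)) x + conv (\<lambda>z. ennreal \<bar>?D \<rho>' z\<bar>) (\<lambda>z. ennreal (g z)) x"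
        by (simp add: add_mono b \<rho>)
      finally show "ennreal (norm (w x)) \<le> conv (\<lambda>z. ennreal \<bar>?D \<rho> z\<bar>) (\<lambda>z. ennreal (g z)) x + conv (\<lambda>z. ennreal \<bar>?D \<rho>' z\<bar>) (\<lambda>z. ennreal (g z)) x" .
    qed
    also have "... = (\<integral>+x. ennreal \<bar>?D \<rho> x\<bar>) * (\<integral>+x. ennreal (g x)) + (\<integral>+x. ennreal \<bar>?D \<rho>' x\<bar>) * (\<integral>+x. ennreal (g x))"
      by (simp add: nn_integral_add nn_integral_conv)
    also have "... < \<infinity>"
    proof -
      have "(\<integral>+x. ennreal \<bar>?D r x\<bar>) < \<infinity>" if "r > 0" for r
        using nn_integral_newton_diff[OF d that] by (rule order.strict_trans1) simp
      moreover have "(\<integral>+x. ennreal (g x)) < \<infinity>"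
        using nn_integral_eq_integral[OF bdd_densityD(4)[OF g]] g0 by simp
      ultimately show ?thesis using \<rho> by (simp add: ennreal_mult_less_top)
    qed
    finally show "(\<integral>+x. ennreal (norm (w x))) < \<infinity>" .
  qed simp
  let ?B = "2 * newton_const TYPE('a) * L + (\<integral>\<^sub>L y. g y)"
  have sb: "0 \<le> smooth r (pot g) x" "smooth r (pot g) x \<le> ?B" if "r > 0" for r x
    using smooth_facts(3,4)[OF that, of "pot g" ?B] pot_facts[OF d g] by auto
  have "\<bar>w x\<bar> \<le> ?B" for x unfolding w_def using sb[OF \<rho>(1), of x] sb[OF \<rho>(2), of x] by auto
  with iw show W: "intbdd w" unfolding intbdd_def by blast
  define f where "f = (\<lambda>x. smooth \<rho>' g x - smooth \<rho> g x)"
  have [measurable]: "f \<in> borel_measurable borel" unfolding f_def by measurable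
  note gs = bdd_density_smooth(1)[OF \<rho>(1) g] bdd_density_smooth(1)[OF \<rho>(2) g]
  have weq: "w = (\<lambda>x. pot (smooth \<rho>' g) x - pot (smooth \<rho> g) x)"
    unfolding w_def using smooth_pot_eq_pot_smooth[OF d \<rho>(1) g] smooth_pot_eq_pot_smooth[OF d \<rho>(2) g] by auto
  have if': "integrable lborel (\<lambda>y. ?D s (x - y) * f y)" and defect: "w x - smooth s w x = (\<integral>\<^sub>L y. ?D s (x - y) * f y)" for x
  proof -
    note i = integrable_pot_minus_smooth[OF d s gs(1), of x] integrable_pot_minus_smooth[OF d s gs(2), of x]
    show "integrable lborel (\<lambda>y. ?D s (x - y) * f y)" unfolding f_def using Bochner_Integration.integrable_diff[OF i(2,1)] by (simp add: right_diff_distrib)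
    have ip: "integrable lborel (\<lambda>y. bump s (x - y) * pot (smooth r g) y)" if "r > 0" for r
      by (rule integrable_smooth[OF s]) (use pot_facts[OF d bdd_density_smooth(1)[OF that g]] in auto)
    have "smooth s w x = smooth s (pot (smooth \<rho>' g)) x - smooth s (pot (smooth \<rho> g)) x"
      unfolding weq smooth_def[of s] right_diff_distrib by (rule Bochner_Integration.integral_diff[OF ip ip]) (fact \<rho>)+
    hence "w x - smooth s w x = (pot (smooth \<rho>' g) x - smooth s (pot (smooth \<rho>' g)) x) - (pot (smooth \<rho> g) x - smooth s (pot (smooth \<rho> g)) x)"
      unfolding weq by simp
    also have "... = (\<integral>\<^sub>L y. ?D s (x - y) * smooth \<rho>' g y) - (\<integral>\<^sub>L y. ?D s (x - y) * smooth \<rho> g y)"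
      unfolding pot_minus_smooth_eq[OF d s gs(1)] pot_minus_smooth_eq[OF d s gs(2)] ..
    also have "... = (\<integral>\<^sub>L y. ?D s (x - y) * f y)"
      unfolding f_def right_diff_distrib by (rule Bochner_Integration.integral_diff[OF i(2,1), symmetric])
    finally show "w x - smooth s w x = (\<integral>\<^sub>L y. ?D s (x - y) * f y)" .
  qed
  let ?K = "\<lambda>z::'a. ennreal \<bar>?D s z\<bar>"
  let ?M = "\<integral>+z. ?K z"
  have pt: "ennreal ((w x - smooth s w x)^2) \<le> ?M * conv ?K (\<lambda>y. ennreal ((f y)^2)) x" for x
  proof -
    \<comment> \<open>Cauchy-Schwarz with the weight \<open>?K\<close> split into two square roots.\<close>
    have "ennreal \<bar>w x - smooth s w x\<bar> \<le> (\<integral>+y. ?K (x - y) * ennreal \<bar>f y\<bar>)"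
      unfolding defect using integral_norm_bound_ennreal[OF if', of x] by (simp add: abs_mult ennreal_mult)
    also have "... = (\<integral>+y. ennreal (sqrt \<bar>?D s (x - y)\<bar>) * ennreal (sqrt \<bar>?D s (x - y)\<bar> * \<bar>f y\<bar>))"
    proof (intro nn_integral_cong)
      fix y
      have "\<bar>?D s (x - y)\<bar> * \<bar>f y\<bar> = sqrt \<bar>?D s (x - y)\<bar> * (sqrt \<bar>?D s (x - y)\<bar> * \<bar>f y\<bar>)"
        by (simp add: mult.assoc[symmetric] del: mult.assoc)
      thus "?K (x - y) * ennreal \<bar>f y\<bar> = ennreal (sqrt \<bar>?D s (x - y)\<bar>) * ennreal (sqrt \<bar>?D s (x - y)\<bar> * \<bar>f y\<bar>)"
        by (simp add: ennreal_mult[symmetric])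
    qed
    finally have "(ennreal \<bar>w x - smooth s w x\<bar>)^2 \<le> (\<integral>+y. ennreal (sqrt \<bar>?D s (x - y)\<bar>) * ennreal (sqrt \<bar>?D s (x - y)\<bar> * \<bar>f y\<bar>))^2"
      by (intro power_mono) auto
    also have "... \<le> (\<integral>+y. (ennreal (sqrt \<bar>?D s (x - y)\<bar>))^2) * (\<integral>+y. (ennreal (sqrt \<bar>?D s (x - y)\<bar> * \<bar>f y\<bar>))^2)"
      by (rule Cauchy_Schwarz_nn_integral) measurable
    also have "(\<integral>+y. (ennreal (sqrt \<bar>?D s (x - y)\<bar>))^2) = (\<integral>+y. ?K (x - y))"
      by (simp add: ennreal_power)
    also have "... = ?M" by (rule nn_integral_reflect) measurable
    also have "(\<integral>+y. (ennreal (sqrt \<bar>?D s (x - y)\<bar> * \<bar>f y\<bar>))^2) = conv ?K (\<lambda>y. ennreal ((f y)^2)) x"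
      unfolding conv_def by (simp add: ennreal_power power_mult_distrib ennreal_mult)
    finally show ?thesis by (simp add: ennreal_power)
  qed
  have "(\<integral>+x. ennreal ((w x - smooth s w x)^2)) \<le> (\<integral>+x. ?M * conv ?K (\<lambda>y. ennreal ((f y)^2)) x)"
    by (intro nn_integral_mono pt)
  also have "... = ?M^2 * (\<integral>+x. ennreal ((f x)^2))"
    by (simp add: nn_integral_cmult nn_integral_conv power2_eq_square mult.assoc)
  also have "... \<le> (ennreal (diff_const TYPE('a) * s^2))^2 * (\<integral>+x. ennreal ((f x)^2))"
    by (intro mult_right_mono power_mono nn_integral_newton_diff d s) auto
  finally have "4 * (\<integral>+x. ennreal ((w x - smooth s w x)^2)) \<le> 4 * ((ennreal (diff_const TYPE('a) * s^2))^2 * (\<integral>+x. ennreal ((f x)^2)))"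
    by (intro mult_left_mono) auto
  thus "second_difference_energy w s
         \<le> 4 * (ennreal (diff_const TYPE('a) * s^2))^2 * (\<integral>+x. ennreal ((smooth \<rho>' g x - smooth \<rho> g x)^2))"
    unfolding second_difference_identity[OF W s] f_def by (simp add: mult.assoc)
qed

section \<open>Taylor expansions with integral remainder\<close>

text \<open>
A function with first derivative \<open>p\<close> and Hessian \<open>H\<close>, expressed by Taylor's formula with integral
remainder. This form is stable under averaging and is the only one that the estimates use.
\<close>

definition C2_fun :: "('a::euclidean_space => real) => ('a => 'a => real) => ('a => 'a => 'a => real) => bool" where
  "C2_fun w p H \<longleftrightarrow>
     (\<forall>x y. w (x + y) - w x - p x y = (\<integral>\<^sub>L s. indicator {0..1} s * ((1 - s) * H (x + s *\<^sub>R y) y y))) \<and>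
     (\<forall>x. linear (p x)) \<and> (\<forall>x k. linear (\<lambda>h. H x h k)) \<and> (\<forall>x h k. H x h k = H x k h) \<and>
     (\<forall>h k. continuous_on UNIV (\<lambda>x. H x h k))"

lemma C2_funD:
  assumes "C2_fun w p H"
  shows "w (x + y) - w x - p x y = (\<integral>\<^sub>L s. indicator {0..1} s * ((1 - s) * H (x + s *\<^sub>R y) y y))"
    "linear (p x)" "linear (\<lambda>h. H x h k)" "H x h k = H x k h" "continuous_on UNIV (\<lambda>x. H x h k)" "linear (H x h)"
proof -
  note * = assms[unfolded C2_fun_def]
  show "w (x + y) - w x - p x y = (\<integral>\<^sub>L s. indicator {0..1} s * ((1 - s) * H (x + s *\<^sub>R y) y y))"
    "linear (p x)" "linear (\<lambda>h. H x h k)" "continuous_on UNIV (\<lambda>x. H x h k)" using * by blast+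
  show s: "H x h k = H x k h" for h k using * by blast
  have "H x h = (\<lambda>k. H x k h)" using s by blast
  thus "linear (H x h)" using * by metis
qed

lemma integrable_01_continuous:
  fixes f :: "real => real"
  assumes "continuous_on UNIV f"
  shows "integrable lborel (\<lambda>s. indicator {0..1} s * f s)"
  using borel_integrable_compact[of "{0..1}" f] continuous_on_subset[OF assms] by simp

lemma C2_integrable:
  assumes "C2_fun w p H"
  shows "integrable lborel (\<lambda>s. indicator {0..1} s * ((1 - s) * H (x + s *\<^sub>R y) h k))"
  by (intro integrable_01_continuous continuous_intros continuous_on_compose2[OF C2_funD(5)[OF assms]]) auto

lemma C2_fun_diff:
  assumes 1: "C2_fun w p H" and 2: "C2_fun w' p' H'"
  shows "C2_fun (\<lambda>x. w x - w' x) (\<lambda>x y. p x y - p' x y) (\<lambda>x h k. H x h k - H' x h k)"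
  unfolding C2_fun_def
proof (intro conjI allI)
  fix x y
  show "w (x + y) - w' (x + y) - (w x - w' x) - (p x y - p' x y) =
     (\<integral>\<^sub>L s. indicator {0..1} s * ((1 - s) * (H (x + s *\<^sub>R y) y y - H' (x + s *\<^sub>R y) y y)))"
    unfolding right_diff_distrib
    by (subst Bochner_Integration.integral_diff[OF C2_integrable[OF 1] C2_integrable[OF 2]])
       (use C2_funD(1)[OF 1, of x y] C2_funD(1)[OF 2, of x y] in argo)
  show "linear (\<lambda>y. p x y - p' x y)" by (intro linear_compose_sub C2_funD(2)[OF 1] C2_funD(2)[OF 2])
  show "linear (\<lambda>h. H x h y - H' x h y)" by (intro linear_compose_sub C2_funD(3)[OF 1] C2_funD(3)[OF 2])
next
  fix x h k
  show "H x h k - H' x h k = H x k h - H' x k h" using C2_funD(4)[OF 1] C2_funD(4)[OF 2] by metis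
next
  fix h k
  show "continuous_on UNIV (\<lambda>x. H x h k - H' x h k)" by (intro continuous_on_diff C2_funD(5)[OF 1] C2_funD(5)[OF 2])
qed

lemma bilinear_expand:
  fixes B :: "'a::euclidean_space => 'a => real"
  assumes "\<And>k. linear (\<lambda>h. B h k)" "\<And>h. linear (B h)"
  shows "B h k = (\<Sum>i\<in>Basis. \<Sum>j\<in>Basis. (h \<bullet> i) * (k \<bullet> j) * B i j)"
proof -
  have "B h k = (\<Sum>i\<in>Basis. (h \<bullet> i) * B i k)"
    using linear_sum[OF assms(1)[of k], of "\<lambda>i. (h \<bullet> i) *\<^sub>R i" Basis] linear_scale[OF assms(1)[of k]]
    by (simp add: euclidean_representation)
  also have "... = (\<Sum>i\<in>Basis. (h \<bullet> i) * (\<Sum>j\<in>Basis. (k \<bullet> j) * B i j))"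
  proof (intro sum.cong refl arg_cong2[where f = "(*)"])
    fix i
    show "B i k = (\<Sum>j\<in>Basis. (k \<bullet> j) * B i j)"
      using linear_sum[OF assms(2)[of i], of "\<lambda>j. (k \<bullet> j) *\<^sub>R j" Basis] linear_scale[OF assms(2)[of i]]
      by (simp add: euclidean_representation)
  qed
  finally show ?thesis by (simp add: sum_distrib_left mult.assoc)
qed

lemma C2_hess_continuous:
  fixes H :: "'a::euclidean_space => 'a => 'a => real"
  assumes C: "C2_fun w p H" and e: "e > 0"
  obtains \<delta> where "\<delta> > 0" "\<And>y h. norm y < \<delta> ==> \<bar>H (x + y) h h - H x h h\<bar> \<le> e * (norm h)^2"
proof -
  let ?S = "\<lambda>y. \<Sum>i\<in>Basis. \<Sum>j\<in>Basis. \<bar>H (x + y) i j - H x i j\<bar>"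
  have "continuous_on UNIV ?S"
    by (intro continuous_intros continuous_on_compose2[OF C2_funD(5)[OF C]]) auto
  hence "isCont ?S 0" by (simp add: continuous_on_eq_continuous_at)
  hence "(?S \<longlongrightarrow> ?S 0) (at 0)" by (simp add: isCont_def)
  hence "(?S \<longlongrightarrow> 0) (at 0)" by simp
  hence "eventually (\<lambda>y. ?S y < e) (at 0)" using e by (rule order_tendstoD)
  then obtain \<delta> where \<delta>: "\<delta> > 0" "\<And>y. y \<noteq> 0 ==> norm y < \<delta> ==> ?S y < e"
    unfolding eventually_at by (auto simp: dist_norm)
  show ?thesis
  proof (rule that[OF \<delta>(1)])
    fix y h :: 'a assume y: "norm y < \<delta>"
    have S: "?S y \<le> e"
    proof (cases "y = 0")
      case False thus ?thesis using \<delta>(2) y by (intro less_imp_le) auto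
    qed (use e in simp)
    have "\<bar>H (x + y) h h - H x h h\<bar> = \<bar>\<Sum>i\<in>Basis. \<Sum>j\<in>Basis. (h \<bullet> i) * (h \<bullet> j) * (H (x + y) i j - H x i j)\<bar>"
      unfolding bilinear_expand[of "H (x + y)", OF C2_funD(3)[OF C] C2_funD(6)[OF C], of h h]
        bilinear_expand[of "H x", OF C2_funD(3)[OF C] C2_funD(6)[OF C], of h h]
      by (simp add: sum_subtractf right_diff_distrib)
    also have "... \<le> (\<Sum>i\<in>Basis. \<Sum>j\<in>Basis. (norm h)^2 * \<bar>H (x + y) i j - H x i j\<bar>)"
    proof (intro order_trans[OF sum_abs] sum_mono order_trans[OF sum_abs])
      fix i j :: 'a assume ij: "i \<in> Basis" "j \<in> Basis"
      have "\<bar>h \<bullet> i\<bar> * \<bar>h \<bullet> j\<bar> \<le> norm h * norm h" using ij by (intro mult_mono Basis_le_norm) auto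
      thus "\<bar>(h \<bullet> i) * (h \<bullet> j) * (H (x + y) i j - H x i j)\<bar> \<le> (norm h)^2 * \<bar>H (x + y) i j - H x i j\<bar>"
        by (simp add: abs_mult power2_eq_square mult_right_mono)
    qed
    also have "... = (norm h)^2 * ?S y" by (simp add: sum_distrib_left)
    also have "... \<le> (norm h)^2 * e" using S by (intro mult_left_mono) auto
    finally show "\<bar>H (x + y) h h - H x h h\<bar> \<le> e * (norm h)^2" by (simp add: mult.commute)
  qed
qed

lemma integral_01_linear: "(\<integral>\<^sub>L s. indicator {0..1} s * (1 - s)) = (1/2::real)"
proof -
  have "(\<integral>\<^sub>L s. (1 - s) * indicator {0..1::real} s) = (1 - 1^2/2) - (0 - 0^2/2::real)"
    by (rule integral_FTC_Icc_real) (auto intro!: derivative_eq_intros continuous_intros)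
  thus ?thesis by (simp add: mult.commute)
qed

lemma C2_peano:
  fixes H :: "'a::euclidean_space => 'a => 'a => real"
  assumes C: "C2_fun w p H" and e: "e > 0"
  obtains \<delta> where "\<delta> > 0" "\<And>y. norm y < \<delta> ==> \<bar>w (x + y) - w x - p x y - H x y y / 2\<bar> \<le> e * (norm y)^2"
proof -
  obtain \<delta> where \<delta>: "\<delta> > 0" "\<And>y h. norm y < \<delta> ==> \<bar>H (x + y) h h - H x h h\<bar> \<le> e * (norm h)^2"
    using C2_hess_continuous[OF C e] by blast
  show ?thesis
  proof (rule that[OF \<delta>(1)])
    fix y :: 'a assume y: "norm y < \<delta>"
    have i1: "integrable lborel (\<lambda>s. indicator {0..1} s * (1 - s::real))"
      by (intro integrable_01_continuous continuous_intros)
    have i2: "integrable lborel (\<lambda>s. indicator {0..1} s * (1 - s) * H x y y)" using i1 by simp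
    have i3: "integrable lborel (\<lambda>s. indicator {0..1} s * ((1 - s) * (H (x + s *\<^sub>R y) y y - H x y y)))"
      by (intro integrable_01_continuous continuous_intros continuous_on_compose2[OF C2_funD(5)[OF C]]) auto
    have "(\<integral>\<^sub>L s. indicator {0..1} s * (1 - s) * H x y y) = H x y y / 2"
      using integral_01_linear by simp
    hence "w (x + y) - w x - p x y - H x y y / 2 = (\<integral>\<^sub>L s. indicator {0..1} s * ((1 - s) * H (x + s *\<^sub>R y) y y) - indicator {0..1} s * (1 - s) * H x y y)"
      unfolding C2_funD(1)[OF C, of x y] using C2_integrable[OF C, of x y y y] i2 by simp
    also have "... = (\<integral>\<^sub>L s. indicator {0..1} s * ((1 - s) * (H (x + s *\<^sub>R y) y y - H x y y)))"
      by (intro Bochner_Integration.integral_cong) (auto simp: algebra_simps)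
    finally have "\<bar>w (x + y) - w x - p x y - H x y y / 2\<bar> = \<bar>\<dots>\<bar>" by (rule arg_cong)
    also have "... \<le> (\<integral>\<^sub>L s. \<bar>indicator {0..1} s * ((1 - s) * (H (x + s *\<^sub>R y) y y - H x y y))\<bar>)"
      by (rule integral_abs_bound)
    also have "... \<le> (\<integral>\<^sub>L s. e * (norm y)^2 * (indicator {0..1} s * (1 - s)))"
    proof (rule integral_mono[OF integrable_abs[OF i3]])
      show "integrable lborel (\<lambda>s. e * (norm y)^2 * (indicator {0..1} s * (1 - s)))" using i1 by simp
      fix s :: real
      show "\<bar>indicator {0..1} s * ((1 - s) * (H (x + s *\<^sub>R y) y y - H x y y))\<bar> \<le> e * (norm y)^2 * (indicator {0..1} s * (1 - s))"
      proof (cases "s \<in> {0..1}")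
        case True
        have "norm (s *\<^sub>R y) \<le> norm y" using True by (simp add: mult_left_le_one_le)
        hence "\<bar>H (x + s *\<^sub>R y) y y - H x y y\<bar> \<le> e * (norm y)^2" using y by (intro \<delta>(2)) simp
        hence "(1 - s) * \<bar>H (x + s *\<^sub>R y) y y - H x y y\<bar> \<le> (1 - s) * (e * (norm y)^2)"
          using True by (intro mult_left_mono) auto
        thus ?thesis using True by (simp add: abs_mult mult_ac)
      qed simp
    qed
    also have "... = e * (norm y)^2 / 2" using integral_01_linear by simp
    also have "... \<le> e * (norm y)^2" using e by simp
    finally show "\<bar>w (x + y) - w x - p x y - H x y y / 2\<bar> \<le> e * (norm y)^2" .
  qed
qed

text \<open>
Polarisation of the second order expansion at the points \<open>x + h / n\<close>, \<open>x + k / n\<close> and \<open>x + (h + k) / n\<close>.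
\<close>

lemma C2_second_difference:
  fixes H :: "'a::euclidean_space => 'a => 'a => real"
  assumes C: "C2_fun w p H"
  shows "(\<lambda>n. (second_difference w ((1 / Suc n) *\<^sub>R h) ((1 / Suc n) *\<^sub>R k) x) / (1 / Suc n)^2)
     \<longlonglongrightarrow> H x h k"
proof (rule LIMSEQ_I)
  fix e :: real assume e: "e > 0"
  define M where "M = (norm (h + k))^2 + (norm h)^2 + (norm k)^2 + 1"
  have M: "M > 0" by (simp add: M_def add_nonneg_pos)
  define e' where "e' = e / (2 * M)"
  have e': "e' > 0" using e M by (simp add: e'_def)
  obtain \<delta> where \<delta>: "\<delta> > 0" "\<And>y. norm y < \<delta> ==> \<bar>w (x + y) - w x - p x y - H x y y / 2\<bar> \<le> e' * (norm y)^2"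
    using C2_peano[OF C e'] by blast
  define R where "R y = w (x + y) - w x - p x y - H x y y / 2" for y
  define m where "m = norm h + norm k + 1"
  have m: "m > 0" by (simp add: m_def add_nonneg_pos)
  obtain N :: nat where N: "1 / Suc N < \<delta> / m" using \<delta>(1) m by (metis divide_pos_pos nat_approx_posE)
  show "\<exists>no. \<forall>n\<ge>no. norm ((second_difference w ((1 / Suc n) *\<^sub>R h) ((1 / Suc n) *\<^sub>R k) x) / (1 / Suc n)^2 - H x h k) < e"
  proof (intro exI[of _ N] allI impI)
    fix n :: nat assume n: "n \<ge> N"
    define s where "s = 1 / real (Suc n)"
    have s: "s > 0" by (simp add: s_def)
    have "s \<le> 1 / Suc N" unfolding s_def using n by (intro divide_left_mono) auto
    hence "s < \<delta> / m" using N by linarith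
    hence sm: "s * m < \<delta>" using m by (simp add: pos_less_divide_eq)
    have R: "\<bar>R (s *\<^sub>R y)\<bar> \<le> e' * s^2 * (norm y)^2" if "norm y \<le> m" for y
    proof -
      have "s * norm y \<le> s * m" using that s by (intro mult_left_mono) auto
      moreover have "norm (s *\<^sub>R y) = s * norm y" using s by simp
      ultimately have "norm (s *\<^sub>R y) < \<delta>" using sm by linarith
      from \<delta>(2)[OF this] show ?thesis using s by (simp add: R_def power_mult_distrib mult_ac)
    qed
    have nm: "norm (h + k) \<le> m" "norm h \<le> m" "norm k \<le> m" using norm_triangle_ineq[of h k] by (auto simp: m_def)
    note lp = linear_add[OF C2_funD(2)[OF C]] linear_scale[OF C2_funD(2)[OF C]]
    note lH = linear_add[OF C2_funD(3)[OF C]] linear_scale[OF C2_funD(3)[OF C]]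
       linear_add[OF C2_funD(6)[OF C]] linear_scale[OF C2_funD(6)[OF C]]
    have "second_difference w (s *\<^sub>R h) (s *\<^sub>R k) x = s^2 * H x h k + R (s *\<^sub>R (h + k)) - R (s *\<^sub>R h) - R (s *\<^sub>R k)"
      unfolding R_def using C2_funD(4)[OF C, of x k h]
      by (simp add: lp lH scaleR_add_right algebra_simps power2_eq_square)
    hence "(second_difference w (s *\<^sub>R h) (s *\<^sub>R k) x) / s^2 - H x h k
       = (R (s *\<^sub>R (h + k)) - R (s *\<^sub>R h) - R (s *\<^sub>R k)) / s^2" using s by (simp add: field_simps)
    hence "norm ((second_difference w (s *\<^sub>R h) (s *\<^sub>R k) x) / s^2 - H x h k) \<le>
       (\<bar>R (s *\<^sub>R (h + k))\<bar> + \<bar>R (s *\<^sub>R h)\<bar> + \<bar>R (s *\<^sub>R k)\<bar>) / s^2" using s by (simp add: divide_right_mono)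
    also have "... \<le> (e' * s^2 * (norm (h + k))^2 + e' * s^2 * (norm h)^2 + e' * s^2 * (norm k)^2) / s^2"
      by (intro divide_right_mono add_mono R nm) auto
    also have "... = e' * ((norm (h + k))^2 + (norm h)^2 + (norm k)^2)" using s by (simp add: field_simps)
    also have "... \<le> e' * M" using e' by (intro mult_left_mono) (auto simp: M_def)
    also have "... = e / 2" using M by (simp add: e'_def)
    also have "... < e" using e by simp
    finally show "norm ((second_difference w ((1 / Suc n) *\<^sub>R h) ((1 / Suc n) *\<^sub>R k) x) / (1 / Suc n)^2 - H x h k) < e"
      unfolding s_def .
  qed
qed

section \<open>Mollified functions\<close>

text \<open>
First and second derivatives of the bump, in the directions \<open>y\<close> and \<open>h\<close>, \<open>k\<close>.
\<close>

definition bumpD :: "real => 'a::euclidean_space => 'a => real" where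
  "bumpD \<rho> z y = - (8 / \<rho>^2) * (z \<bullet> y) * bump_pow 3 \<rho> z / (bump_mass TYPE('a) * \<rho> ^ DIM('a))"

definition bumpH :: "real => 'a::euclidean_space => 'a => 'a => real" where
  "bumpH \<rho> z h k = (- (8 / \<rho>^2) * (h \<bullet> k) * bump_pow 3 \<rho> z + (48 / \<rho>^2 / \<rho>^2) * (z \<bullet> h) * (z \<bullet> k) * bump_pow 2 \<rho> z) / (bump_mass TYPE('a) * \<rho> ^ DIM('a))"

lemma bump_deriv: "((\<lambda>t. bump \<rho> (z + t *\<^sub>R y)) has_real_derivative bumpD \<rho> (z + t *\<^sub>R y) y) (at t)"
proof -
  have "((\<lambda>t. bump_pow 4 \<rho> (z + t *\<^sub>R y)) has_real_derivative - (8 / \<rho>^2) * ((z + t *\<^sub>R y) \<bullet> y) * bump_pow 3 \<rho> (z + t *\<^sub>R y)) (at t)"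
    using bump_pow_deriv[of 4 \<rho> z y t] by simp
  from DERIV_cdivide[OF this] show ?thesis unfolding bump_def bumpD_def .
qed

lemma bumpD_deriv: "((\<lambda>t. bumpD \<rho> (z + t *\<^sub>R y) y) has_real_derivative bumpH \<rho> (z + t *\<^sub>R y) y y) (at t)"
proof -
  have 1: "((\<lambda>t. bump_pow 3 \<rho> (z + t *\<^sub>R y)) has_real_derivative - (6 / \<rho>^2) * ((z + t *\<^sub>R y) \<bullet> y) * bump_pow 2 \<rho> (z + t *\<^sub>R y)) (at t)"
    using bump_pow_deriv[of 3 \<rho> z y t] by simp
  have 2: "((\<lambda>t. - (8 / \<rho>^2) * ((z + t *\<^sub>R y) \<bullet> y)) has_real_derivative - (8 / \<rho>^2) * (y \<bullet> y)) (at t)"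
  proof (rule DERIV_cmult)
    show "((\<lambda>t. (z + t *\<^sub>R y) \<bullet> y) has_real_derivative y \<bullet> y) (at t)"
      unfolding inner_add_left inner_scaleR_left by (auto intro!: derivative_eq_intros)
  qed
  have "((\<lambda>t. - (8 / \<rho>^2) * ((z + t *\<^sub>R y) \<bullet> y) * bump_pow 3 \<rho> (z + t *\<^sub>R y)) has_real_derivative
     (- (8 / \<rho>^2) * (y \<bullet> y)) * bump_pow 3 \<rho> (z + t *\<^sub>R y) +
     (- (6 / \<rho>^2) * ((z + t *\<^sub>R y) \<bullet> y) * bump_pow 2 \<rho> (z + t *\<^sub>R y)) * (- (8 / \<rho>^2) * ((z + t *\<^sub>R y) \<bullet> y))) (at t)"
    by (rule DERIV_mult[OF 2 1])
  moreover have "(- (8 / r) * a) * B3 + (- (6 / r) * c * B2) * (- (8 / r) * c) = - (8 / r) * a * B3 + (48 / r / r) * c * c * B2"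
    for r a c B2 B3 :: real by simp
  ultimately have "((\<lambda>t. - (8 / \<rho>^2) * ((z + t *\<^sub>R y) \<bullet> y) * bump_pow 3 \<rho> (z + t *\<^sub>R y)) has_real_derivative
     - (8 / \<rho>^2) * (y \<bullet> y) * bump_pow 3 \<rho> (z + t *\<^sub>R y) +
     (48 / \<rho>^2 / \<rho>^2) * ((z + t *\<^sub>R y) \<bullet> y) * ((z + t *\<^sub>R y) \<bullet> y) * bump_pow 2 \<rho> (z + t *\<^sub>R y)) (at t)"
    by (simp only:)
  from DERIV_cdivide[OF this, of "bump_mass TYPE('a) * \<rho> ^ DIM('a)"] show ?thesis
    unfolding bumpD_def bumpH_def .
qed

lemma continuous_on_bumpH [continuous_intros]:
  "continuous_on A f ==> continuous_on A (\<lambda>x. bumpH \<rho> (f x) h k)"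
  unfolding bumpH_def divide_inverse by (intro continuous_intros)

lemma continuous_on_bumpD [continuous_intros]:
  "continuous_on A f ==> continuous_on A (\<lambda>x. bumpD \<rho> (f x) y)"
  unfolding bumpD_def divide_inverse by (intro continuous_intros)

lemma bump_taylor:
  "bump \<rho> (z + y) - bump \<rho> z - bumpD \<rho> z y = (\<integral>\<^sub>L s. indicator {0..1} s * ((1 - s) * bumpH \<rho> (z + s *\<^sub>R y) y y))"
proof -
  let ?D = "\<lambda>(i::nat) s. if i = 0 then bump \<rho> (z + s *\<^sub>R y) else if i = 1 then bumpD \<rho> (z + s *\<^sub>R y) y else bumpH \<rho> (z + s *\<^sub>R y) y y"
  have "((\<lambda>x. ((1 - x) ^ (2 - 1) / fact (2 - 1)) *\<^sub>R ?D 2 x) has_integral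
     bump \<rho> (z + 1 *\<^sub>R y) - (\<Sum>i<2. ((1 - 0) ^ i / fact i) *\<^sub>R ?D i 0)) {0..1::real}"
  proof (rule Taylor_has_integral[where Df = ?D and f = "\<lambda>s. bump \<rho> (z + s *\<^sub>R y)" and p = 2 and a = 0 and b = "1::real"])
    fix m :: nat and t :: real assume m: "m < 2"
    hence "m = 0 \<or> m = 1" by auto
    thus "(?D m has_vector_derivative ?D (Suc m) t) (at t within {0..1})"
      using bump_deriv[of \<rho> z y t] bumpD_deriv[of \<rho> z y t]
      by (auto simp: has_real_derivative_iff_has_vector_derivative[symmetric] intro: has_field_derivative_at_within)
  qed auto
  hence 1: "((\<lambda>s. (1 - s) * bumpH \<rho> (z + s *\<^sub>R y) y y) has_integral bump \<rho> (z + y) - bump \<rho> z - bumpD \<rho> z y) {0..1}"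
    by (simp add: numeral_2_eq_2 algebra_simps)
  have "set_integrable lborel {0..1} (\<lambda>s. (1 - s) * bumpH \<rho> (z + s *\<^sub>R y) y y)"
    unfolding set_integrable_def using integrable_01_continuous[of "\<lambda>s. (1 - s) * bumpH \<rho> (z + s *\<^sub>R y) y y"]
    by (simp add: continuous_intros)
  from set_borel_integral_eq_integral(2)[OF this] integral_unique[OF 1]
  show ?thesis by (simp add: set_lebesgue_integral_def)
qed

definition bumpH_const :: "real => 'a::euclidean_space itself => real" where
  "bumpH_const \<rho> _ = (56 / \<rho>^2) / (bump_mass TYPE('a) * \<rho> ^ DIM('a))"

lemma bumpH_const_pos: "\<rho> > 0 ==> bumpH_const \<rho> TYPE('a::euclidean_space) > 0"
  by (simp add: bumpH_const_def bump_mass_pos)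

lemma bumpH_bound:
  fixes z :: "'a::euclidean_space"
  assumes \<rho>: "\<rho> > 0"
  shows "\<bar>bumpH \<rho> z h k\<bar> \<le> bumpH_const \<rho> TYPE('a) * (norm h * norm k) * indicator (cball 0 \<rho>) z"
proof (cases "norm z \<le> \<rho>")
  case True
  let ?m = "bump_mass TYPE('a) * \<rho> ^ DIM('a)"
  have m: "?m > 0" using \<rho> bump_mass_pos[where 'a='a] by simp
  have "\<bar>- (8 / \<rho>^2) * (h \<bullet> k) * bump_pow 3 \<rho> z + (48 / \<rho>^2 / \<rho>^2) * (z \<bullet> h) * (z \<bullet> k) * bump_pow 2 \<rho> z\<bar> \<le>
     (8 / \<rho>^2) * (norm h * norm k) * 1 + (48 / \<rho>^2 / \<rho>^2) * (\<rho> * norm h) * (\<rho> * norm k) * 1"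
  proof (rule order_trans[OF abs_triangle_ineq], rule add_mono)
    show "\<bar>- (8 / \<rho>^2) * (h \<bullet> k) * bump_pow 3 \<rho> z\<bar> \<le> (8 / \<rho>^2) * (norm h * norm k) * 1"
      unfolding abs_mult by (intro mult_mono Cauchy_Schwarz_ineq2) auto
    have "\<bar>z \<bullet> v\<bar> \<le> \<rho> * norm v" for v
      using Cauchy_Schwarz_ineq2[of z v] mult_right_mono[OF True norm_ge_zero, of v] by linarith
    thus "\<bar>(48 / \<rho>^2 / \<rho>^2) * (z \<bullet> h) * (z \<bullet> k) * bump_pow 2 \<rho> z\<bar> \<le> (48 / \<rho>^2 / \<rho>^2) * (\<rho> * norm h) * (\<rho> * norm k) * 1"
      unfolding abs_mult using \<rho> by (intro mult_mono) auto
  qed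
  also have "... = (56 / \<rho>^2) * (norm h * norm k)" using \<rho> by (simp add: field_simps power2_eq_square)
  finally have "\<bar>- (8 / \<rho>^2) * (h \<bullet> k) * bump_pow 3 \<rho> z + (48 / \<rho>^2 / \<rho>^2) * (z \<bullet> h) * (z \<bullet> k) * bump_pow 2 \<rho> z\<bar> / ?m
      \<le> (56 / \<rho>^2) * (norm h * norm k) / ?m" using m by (intro divide_right_mono) auto
  hence "\<bar>bumpH \<rho> z h k\<bar> \<le> (56 / \<rho>^2) * (norm h * norm k) / ?m"
    unfolding bumpH_def abs_divide using m by (simp only: abs_of_pos)
  thus ?thesis using True by (simp add: bumpH_const_def)
next
  case False
  thus ?thesis using \<rho> by (simp add: bumpH_def bump_pow_eq_0)
qed

lemma bumpD_bound:
  fixes z :: "'a::euclidean_space"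
  assumes \<rho>: "\<rho> > 0"
  shows "\<bar>bumpD \<rho> z y\<bar> \<le> (8 / \<rho>) / (bump_mass TYPE('a) * \<rho> ^ DIM('a)) * norm y * indicator (cball 0 \<rho>) z"
proof (cases "norm z \<le> \<rho>")
  case True
  let ?m = "bump_mass TYPE('a) * \<rho> ^ DIM('a)"
  have m: "?m > 0" using \<rho> bump_mass_pos[where 'a='a] by simp
  have "\<bar>- (8 / \<rho>^2) * (z \<bullet> y) * bump_pow 3 \<rho> z\<bar> \<le> (8 / \<rho>^2) * (\<rho> * norm y) * 1"
    unfolding abs_mult using Cauchy_Schwarz_ineq2[of z y] mult_right_mono[OF True norm_ge_zero, of y] by (intro mult_mono) auto
  also have "... = (8 / \<rho>) * norm y" using \<rho> by (simp add: power2_eq_square)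
  finally have "\<bar>- (8 / \<rho>^2) * (z \<bullet> y) * bump_pow 3 \<rho> z\<bar> / ?m \<le> (8 / \<rho>) * norm y / ?m"
    using m by (intro divide_right_mono) auto
  hence "\<bar>bumpD \<rho> z y\<bar> \<le> (8 / \<rho>) * norm y / ?m"
    unfolding bumpD_def abs_divide using m by (simp only: abs_of_pos)
  thus ?thesis using True by simp
next
  case False
  thus ?thesis using \<rho> by (simp add: bumpD_def bump_pow_eq_0)
qed

definition smoothD :: "real => ('a::euclidean_space => real) => 'a => 'a => real" where
  "smoothD \<rho> u x y = (\<integral>\<^sub>L z. bumpD \<rho> (x - z) y * u z)"

definition smoothH :: "real => ('a::euclidean_space => real) => 'a => 'a => 'a => real" where
  "smoothH \<rho> u x h k = (\<integral>\<^sub>L z. bumpH \<rho> (x - z) h k * u z)"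

lemma integrable_indicator_cball: "integrable lborel (\<lambda>z. C * indicator (cball (x::'a::euclidean_space) r) z :: real)"
  using emeasure_bounded_finite[OF bounded_cball, of x r]
  by (intro integrable_mult_right integrable_real_indicator) auto

lemma integrable_local_kernel:
  fixes u :: "'a::euclidean_space => real"
  assumes [measurable]: "u \<in> borel_measurable borel" "f \<in> borel_measurable borel"
    and u: "\<And>x. \<bar>u x\<bar> \<le> M" and f: "\<And>z. \<bar>f z\<bar> \<le> K * indicator (cball 0 \<rho>) z"
  shows "integrable lborel (\<lambda>z. f (x - z) * u z)"
proof (rule Bochner_Integration.integrable_bound[OF integrable_indicator_cball[of "\<bar>K\<bar> * M" x \<rho>]])
  have M: "M \<ge> 0" using u order_trans[OF abs_ge_zero] by blast
  show "AE z in lborel. norm (f (x - z) * u z) \<le> norm (\<bar>K\<bar> * M * indicator (cball x \<rho>) z)"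
  proof (intro AE_I2)
    fix z
    have "\<bar>f (x - z)\<bar> \<le> \<bar>K\<bar> * indicator (cball x \<rho>) z"
      using f[of "x - z"] unfolding indicator_def mem_cball_0 unfolding mem_cball dist_norm by (auto split: if_splits)
    hence "\<bar>f (x - z)\<bar> * \<bar>u z\<bar> \<le> (\<bar>K\<bar> * indicator (cball x \<rho>) z) * M" by (intro mult_mono u) auto
    thus "norm (f (x - z) * u z) \<le> norm (\<bar>K\<bar> * M * indicator (cball x \<rho>) z)" using M by (simp add: abs_mult mult_ac)
  qed
qed measurable

lemma measurable_bumpH [measurable]: "(\<lambda>z. bumpH \<rho> z h k) \<in> borel_measurable borel"
  by (intro borel_measurable_continuous_onI continuous_intros)

lemma measurable_bumpD [measurable]: "(\<lambda>z. bumpD \<rho> z y) \<in> borel_measurable borel"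
  by (intro borel_measurable_continuous_onI continuous_intros)

text \<open>
All derivatives fall on the bump; Taylor's formula for the bump is integrated against \<open>u\<close>.
\<close>

lemma C2_smooth:
  fixes u :: "'a::euclidean_space => real"
  assumes \<rho>: "\<rho> > 0" and [measurable]: "u \<in> borel_measurable borel" and u: "\<And>x. \<bar>u x\<bar> \<le> M"
  shows "C2_fun (smooth \<rho> u) (smoothD \<rho> u) (smoothH \<rho> u)"
proof -
  have M: "M \<ge> 0" using u order_trans[OF abs_ge_zero] by blast
  have iB: "integrable lborel (\<lambda>z. bump \<rho> (x - z) * u z)" for x
  proof (rule integrable_local_kernel[OF _ _ u])
    fix z :: 'a
    show "\<bar>bump \<rho> z\<bar> \<le> (1 / (bump_mass TYPE('a) * \<rho> ^ DIM('a))) * indicator (cball 0 \<rho>) z"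
      using bump_le[OF \<rho>, of z] bump_eq_0[OF \<rho>, of z] \<rho> by (cases "norm z \<le> \<rho>") auto
  qed auto
  have iD: "integrable lborel (\<lambda>z. bumpD \<rho> (x - z) y * u z)" for x y
    by (rule integrable_local_kernel[OF _ _ u bumpD_bound[OF \<rho>]]) auto
  have iH: "integrable lborel (\<lambda>z. bumpH \<rho> (x - z) h k * u z)" for x h k
    by (rule integrable_local_kernel[OF _ _ u bumpH_bound[OF \<rho>]]) auto
  show ?thesis unfolding C2_fun_def
  proof (intro conjI allI)
    fix x y :: 'a
    let ?F = "\<lambda>s z. indicator {0..1} s * ((1 - s) * bumpH \<rho> (x - z + s *\<^sub>R y) y y) * u z"
    let ?C = "bumpH_const \<rho> TYPE('a) * (norm y * norm y) * M"
    have C0: "?C \<ge> 0" using M bumpH_const_pos[OF \<rho>, where 'a='a] by simp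
    have "integrable (lborel \<Otimes>\<^sub>M lborel) (\<lambda>(s, z). ?F s z)"
    proof (rule integrable_lborel_pairI)
      have "(\<lambda>p. bumpH \<rho> (x - snd p + fst p *\<^sub>R y) y y) \<in> borel_measurable (borel \<Otimes>\<^sub>M borel)" unfolding bumpH_def bump_pow_def by measurable
      thus "(\<lambda>(s, z). ?F s z) \<in> borel_measurable (borel \<Otimes>\<^sub>M borel)" unfolding split_beta by measurable
      have "(\<integral>+s. \<integral>+z. ennreal \<bar>?F s z\<bar>) \<le> (\<integral>\<^sup>+s. \<integral>\<^sup>+z. ennreal ?C * indicator {0..1} s * indicator (cball x (\<rho> + norm y)) z \<partial>lborel \<partial>(lborel :: real measure))"
      proof (intro nn_integral_mono)
        fix s :: real and z :: 'a
        show "ennreal \<bar>?F s z\<bar> \<le> ennreal ?C * indicator {0..1} s * indicator (cball x (\<rho> + norm y)) z"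
        proof (cases "s \<in> {0..1}")
          case True
          have ind: "(indicator (cball 0 \<rho>) (x - z + s *\<^sub>R y) :: real) \<le> indicator (cball x (\<rho> + norm y)) z"
          proof -
            have "norm (x - z) \<le> norm (x - z + s *\<^sub>R y) + norm (s *\<^sub>R y)" using norm_triangle_sub by (metis add_diff_cancel norm_triangle_ineq4)
            moreover have "norm (s *\<^sub>R y) \<le> norm y" using True by (simp add: mult_left_le_one_le)
            ultimately show ?thesis unfolding indicator_def mem_cball_0 unfolding mem_cball dist_norm by auto
          qed
          have "\<bar>?F s z\<bar> = (1 - s) * (\<bar>bumpH \<rho> (x - z + s *\<^sub>R y) y y\<bar> * \<bar>u z\<bar>)" using True by (simp add: abs_mult)
          also have "... \<le> 1 * ((bumpH_const \<rho> TYPE('a) * (norm y * norm y) * indicator (cball x (\<rho> + norm y)) z) * M)"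
          proof (intro mult_mono u)
            show "\<bar>bumpH \<rho> (x - z + s *\<^sub>R y) y y\<bar> \<le> bumpH_const \<rho> TYPE('a) * (norm y * norm y) * indicator (cball x (\<rho> + norm y)) z"
              using bumpH_const_pos[OF \<rho>, where 'a='a]
              by (intro order_trans[OF bumpH_bound[OF \<rho>]] mult_left_mono ind) auto
          qed (use True bumpH_const_pos[OF \<rho>, where 'a='a] in auto)
          also have "... = ?C * indicator (cball x (\<rho> + norm y)) z" by simp
          finally have "ennreal \<bar>?F s z\<bar> \<le> ennreal (?C * indicator (cball x (\<rho> + norm y)) z)" by (rule ennreal_leI)
          thus ?thesis using True C0 by (simp add: ennreal_mult ennreal_indicator split: split_indicator)
        qed simp
      qed
      also have "... = ennreal ?C * emeasure lborel (cball x (\<rho> + norm y))"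
        by (simp add: nn_integral_cmult_indicator nn_integral_multc nn_integral_cmult)
      also have "... < \<infinity>" using \<rho> by (simp add: emeasure_cball ennreal_mult_less_top)
      finally show "(\<integral>+s. \<integral>+z. ennreal \<bar>?F s z\<bar>) < \<infinity>" .
    qed
    from lborel_pair.Fubini_integral[OF this]
    have fub: "(\<integral>\<^sub>L z. \<integral>\<^sub>L s. ?F s z) = (\<integral>\<^sub>L s. \<integral>\<^sub>L z. ?F s z)" .
    have "smooth \<rho> u (x + y) - smooth \<rho> u x - smoothD \<rho> u x y = (\<integral>\<^sub>L z. bump \<rho> (x + y - z) * u z - bump \<rho> (x - z) * u z - bumpD \<rho> (x - z) y * u z)"
      unfolding smooth_def smoothD_def using iB iD by simp
    also have "... = (\<integral>\<^sub>L z. \<integral>\<^sub>L s. ?F s z)"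
    proof (intro Bochner_Integration.integral_cong refl)
      fix z
      have "(\<integral>\<^sub>L s. ?F s z) = (bump \<rho> (x - z + y) - bump \<rho> (x - z) - bumpD \<rho> (x - z) y) * u z"
        unfolding bump_taylor[of \<rho> "x - z" y] by simp
      thus "bump \<rho> (x + y - z) * u z - bump \<rho> (x - z) * u z - bumpD \<rho> (x - z) y * u z = (\<integral>\<^sub>L s. ?F s z)"
        by (simp add: algebra_simps)
    qed
    also have "... = (\<integral>\<^sub>L s. indicator {0..1} s * ((1 - s) * smoothH \<rho> u (x + s *\<^sub>R y) y y))"
      unfolding fub
    proof (intro Bochner_Integration.integral_cong refl)
      fix s :: real
      have "(\<integral>\<^sub>L z. ?F s z) = (\<integral>\<^sub>L z. (indicator {0..1} s * (1 - s)) * (bumpH \<rho> (x + s *\<^sub>R y - z) y y * u z))"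
        by (intro Bochner_Integration.integral_cong refl) (simp add: algebra_simps)
      also have "... = indicator {0..1} s * (1 - s) * smoothH \<rho> u (x + s *\<^sub>R y) y y" unfolding smoothH_def by (rule integral_mult_right_zero)
      finally show "(\<integral>\<^sub>L z. ?F s z) = indicator {0..1} s * ((1 - s) * smoothH \<rho> u (x + s *\<^sub>R y) y y)" by simp
    qed
    finally show "smooth \<rho> u (x + y) - smooth \<rho> u x - smoothD \<rho> u x y = (\<integral>\<^sub>L s. indicator {0..1} s * ((1 - s) * smoothH \<rho> u (x + s *\<^sub>R y) y y))" .
  next
    fix x :: 'a
    show "linear (smoothD \<rho> u x)"
    proof (rule linearI)
      fix a b :: 'a and c :: real
      have "bumpD \<rho> (x - z) (a + b) * u z = bumpD \<rho> (x - z) a * u z + bumpD \<rho> (x - z) b * u z" for z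
        by (simp add: bumpD_def inner_add_right add_divide_distrib diff_divide_distrib algebra_simps)
      thus "smoothD \<rho> u x (a + b) = smoothD \<rho> u x a + smoothD \<rho> u x b" unfolding smoothD_def using iD by simp
      have e: "bumpD \<rho> (x - z) (c *\<^sub>R a) * u z = c * (bumpD \<rho> (x - z) a * u z)" for z by (simp add: bumpD_def)
      show "smoothD \<rho> u x (c *\<^sub>R a) = c *\<^sub>R smoothD \<rho> u x a" unfolding smoothD_def e by simp
    qed
  next
    fix x k :: 'a
    show "linear (\<lambda>h. smoothH \<rho> u x h k)"
    proof (rule linearI)
      fix a b :: 'a and c :: real
      have "bumpH \<rho> (x - z) (a + b) k * u z = bumpH \<rho> (x - z) a k * u z + bumpH \<rho> (x - z) b k * u z" for z
        unfolding bumpH_def inner_add_left inner_add_right[of "x - z"] add_divide_distrib[symmetric] by (simp add: algebra_simps add_divide_distrib diff_divide_distrib)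
      thus "smoothH \<rho> u x (a + b) k = smoothH \<rho> u x a k + smoothH \<rho> u x b k" unfolding smoothH_def using iH by simp
      have e: "bumpH \<rho> (x - z) (c *\<^sub>R a) k * u z = c * (bumpH \<rho> (x - z) a k * u z)" for z
        by (simp add: bumpH_def algebra_simps add_divide_distrib diff_divide_distrib)
      show "smoothH \<rho> u x (c *\<^sub>R a) k = c *\<^sub>R smoothH \<rho> u x a k" unfolding smoothH_def e by simp
    qed
  next
    fix x h k :: 'a
    show "smoothH \<rho> u x h k = smoothH \<rho> u x k h"
      unfolding smoothH_def bumpH_def by (simp add: inner_commute[of h k] mult_ac)
  next
    fix h k :: 'a
    have "isCont (\<lambda>x. smoothH \<rho> u x h k) x" for x
      unfolding continuous_at_sequentially
    proof (intro allI impI)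
      fix X assume X: "X \<longlonglongrightarrow> x"
      have cont: "continuous_on UNIV (\<lambda>z. bumpH \<rho> z h k)" by (intro continuous_intros)
      let ?K = "bumpH_const \<rho> TYPE('a) * (norm h * norm k)"
      have K0: "?K \<ge> 0" using bumpH_const_pos[OF \<rho>, where 'a='a] by simp
      obtain N where N: "\<And>n. n \<ge> N ==> norm (X n - x) < 1"
        using LIMSEQ_D[OF X zero_less_one] by blast
      have "(\<lambda>n. \<integral>\<^sub>L z. bumpH \<rho> (X (n + N) - z) h k * u z) \<longlonglongrightarrow> (\<integral>\<^sub>L z. bumpH \<rho> (x - z) h k * u z)"
      proof (rule integral_dominated_convergence[where w = "\<lambda>z. ?K * M * indicator (cball x (\<rho> + 1)) z"])
        show "AE z in lborel. (\<lambda>n. bumpH \<rho> (X (n + N) - z) h k * u z) \<longlonglongrightarrow> bumpH \<rho> (x - z) h k * u z"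
        proof (intro AE_I2 tendsto_mult tendsto_const)
          fix z
          show "(\<lambda>n. bumpH \<rho> (X (n + N) - z) h k) \<longlonglongrightarrow> bumpH \<rho> (x - z) h k"
            by (rule continuous_on_tendsto_compose[OF cont tendsto_diff[OF LIMSEQ_ignore_initial_segment[OF X] tendsto_const]]) auto
        qed
        show "AE z in lborel. norm (bumpH \<rho> (X (n + N) - z) h k * u z) \<le> ?K * M * indicator (cball x (\<rho> + 1)) z" for n
        proof (intro AE_I2)
          fix z
          have "norm (x - z) \<le> norm (X (n + N) - z) + norm (X (n + N) - x)"
            using norm_triangle_ineq4[of "X (n + N) - z" "X (n + N) - x"] by (simp add: algebra_simps)
          hence ind: "(indicator (cball 0 \<rho>) (X (n + N) - z) :: real) \<le> indicator (cball x (\<rho> + 1)) z"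
            using N[of "n + N"] unfolding indicator_def mem_cball_0 unfolding mem_cball dist_norm by auto
          have "\<bar>bumpH \<rho> (X (n + N) - z) h k\<bar> * \<bar>u z\<bar> \<le> (?K * indicator (cball x (\<rho> + 1)) z) * M"
            using K0 M by (intro mult_mono u order_trans[OF bumpH_bound[OF \<rho>]] mult_left_mono ind) auto
          thus "norm (bumpH \<rho> (X (n + N) - z) h k * u z) \<le> ?K * M * indicator (cball x (\<rho> + 1)) z" by (simp add: abs_mult mult_ac)
        qed
      qed (use integrable_indicator_cball in auto)
      hence "(\<lambda>n. smoothH \<rho> u (X (n + N)) h k) \<longlonglongrightarrow> smoothH \<rho> u x h k" unfolding smoothH_def .
      thus "((\<lambda>x. smoothH \<rho> u x h k) \<circ> X) \<longlonglongrightarrow> smoothH \<rho> u x h k" unfolding o_def by (rule LIMSEQ_offset)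
    qed
    thus "continuous_on UNIV (\<lambda>x. smoothH \<rho> u x h k)" by (simp add: continuous_on_eq_continuous_at)
  qed
qed

section \<open>Linear forms controlled by their means\<close>

lemma unit_ball_vol_nz [simp]: "unit_ball_vol (real n) \<noteq> 0"
  using unit_ball_vol_pos[of "real n"] by linarith

text \<open>
A linear form is large on a ball around a point in the direction of its representing vector; on that
ball it dominates its values everywhere.
\<close>

lemma linear_test_ball:
  fixes f :: "'a::euclidean_space => real"
  assumes f: "linear f"
  obtains p where "\<And>h. h \<in> ball p (1/4) ==> norm h \<le> 3/4" "\<And>h e. h \<in> ball p (1/4) ==> \<bar>f e\<bar> \<le> 4 * \<bar>f h\<bar> * norm e"
proof -
  define b where "b = (\<Sum>i\<in>Basis. f i *\<^sub>R i)"
  have fb: "f h = b \<bullet> h" for h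
  proof -
    have "f h = f (\<Sum>i\<in>Basis. (h \<bullet> i) *\<^sub>R i)" by (simp add: euclidean_representation)
    also have "... = (\<Sum>i\<in>Basis. (h \<bullet> i) * f i)" by (simp add: linear_sum[OF f] linear_scale[OF f])
    finally show ?thesis by (simp add: b_def inner_sum_left inner_commute[of h] mult.commute)
  qed
  define p where "p = (1 / (2 * norm b)) *\<^sub>R b"
  have np: "norm p \<le> 1/2" by (simp add: p_def)
  show ?thesis
  proof (rule that[of p])
    fix h assume h: "h \<in> ball p (1/4)"
    have hp: "norm (h - p) \<le> 1/4" using h by (simp add: dist_norm norm_minus_commute)
    show "norm h \<le> 3/4" using norm_triangle_sub[of h p] hp np by linarith
    fix e
    have "\<bar>b \<bullet> (h - p)\<bar> \<le> norm b * (1/4)"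
      using Cauchy_Schwarz_ineq2[of b "h - p"] mult_left_mono[OF hp norm_ge_zero[of b]] by linarith
    moreover have "b \<bullet> p = norm b / 2" by (cases "b = 0") (auto simp: p_def dot_square_norm power2_eq_square)
    ultimately have "f h \<ge> norm b / 4" unfolding fb inner_diff_right by linarith
    hence "norm b \<le> 4 * \<bar>f h\<bar>" by linarith
    moreover have "\<bar>f e\<bar> \<le> norm b * norm e" unfolding fb by (rule Cauchy_Schwarz_ineq2)
    ultimately show "\<bar>f e\<bar> \<le> 4 * \<bar>f h\<bar> * norm e" by (meson mult_right_mono norm_ge_zero order_trans)
  qed
qed

lemma linear_borel [measurable_dest]: "linear f ==> f \<in> borel_measurable borel" for f :: "'a::euclidean_space => real"
  by (intro borel_measurable_continuous_onI linear_continuous_on) (simp add: linear_conv_bounded_linear)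

abbreviation ball_L1 :: "real => ('a::euclidean_space => real) => ennreal" where
  "ball_L1 r f \<equiv> (\<integral>+y. ennreal \<bar>f y\<bar> * indicator (ball 0 r) y)"

definition lin_const :: "'a::euclidean_space itself => real" where
  "lin_const _ = 4 / (unit_ball_vol DIM('a) * (1/4) ^ DIM('a))"

lemma lin_const_pos: "lin_const TYPE('a::euclidean_space) > 0" by (simp add: lin_const_def)

lemma linear_le_L1:
  fixes f :: "'a::euclidean_space => real"
  assumes f: "linear f"
  shows "ennreal \<bar>f e\<bar> \<le> ennreal (lin_const TYPE('a) * norm e) * ball_L1 1 f"
proof -
  note [measurable] = linear_borel[OF f]
  obtain p where p: "\<And>h. h \<in> ball p (1/4) ==> norm h \<le> 3/4" "\<And>h e. h \<in> ball p (1/4) ==> \<bar>f e\<bar> \<le> 4 * \<bar>f h\<bar> * norm e"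
    using linear_test_ball[OF f] by blast
  let ?v = "unit_ball_vol (real DIM('a)) * (1/4) ^ DIM('a)"
  have v: "?v > 0" by simp
  have "ennreal \<bar>f e\<bar> * ennreal ?v = ennreal \<bar>f e\<bar> * emeasure lborel (ball p (1/4))" by (subst emeasure_ball) auto
  also have "... = (\<integral>+h. ennreal \<bar>f e\<bar> * indicator (ball p (1/4)) h)" by (simp add: nn_integral_cmult_indicator)
  also have "... \<le> (\<integral>+h. ennreal (4 * norm e) * (ennreal \<bar>f h\<bar> * indicator (ball 0 1) h))"
  proof (intro nn_integral_mono)
    fix h
    show "ennreal \<bar>f e\<bar> * indicator (ball p (1/4)) h \<le> ennreal (4 * norm e) * (ennreal \<bar>f h\<bar> * indicator (ball 0 1) h)"
    proof (cases "h \<in> ball p (1/4)")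
      case True
      have "norm h < 1" using p(1)[OF True] by simp
      moreover have "ennreal \<bar>f e\<bar> \<le> ennreal (4 * norm e * \<bar>f h\<bar>)" using p(2)[OF True, of e] by (intro ennreal_leI) (simp add: mult_ac)
      ultimately show ?thesis using True by (simp add: ennreal_mult)
    qed simp
  qed
  also have "... = ennreal (4 * norm e) * ball_L1 1 f"
    by (rule nn_integral_cmult) measurable
  finally have "ennreal (1 / ?v) * (ennreal \<bar>f e\<bar> * ennreal ?v) \<le> ennreal (1 / ?v) * (ennreal (4 * norm e) * ball_L1 1 f)"
    by (rule mult_left_mono) simp
  moreover have "ennreal (1 / ?v) * (ennreal \<bar>f e\<bar> * ennreal ?v) = ennreal \<bar>f e\<bar>"
    using v by (simp only: ennreal_mult[symmetric] abs_ge_zero less_imp_le mult_nonneg_nonneg zero_le_divide_1_iff) simp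
  moreover have "ennreal (1 / ?v) * (ennreal (4 * norm e) * X) = ennreal (lin_const TYPE('a) * norm e) * X" for X
  proof -
    have "ennreal (lin_const TYPE('a) * norm e) = ennreal (1 / ?v) * ennreal (4 * norm e)"
      using v by (subst ennreal_mult[symmetric]) (auto simp: lin_const_def)
    thus ?thesis by (simp only: mult.assoc)
  qed
  ultimately show ?thesis by simp
qed

definition quad_const :: "'a::euclidean_space itself => real" where
  "quad_const _ = 16 * bump_mass TYPE('a) / ((7/16) ^ 4 * (unit_ball_vol DIM('a) * (1/4) ^ DIM('a)))"

lemma quad_const_pos: "quad_const TYPE('a::euclidean_space) > 0"
  by (simp add: quad_const_def bump_mass_pos)

lemma linear_le_L2:
  fixes f :: "'a::euclidean_space => real"
  assumes f: "linear f"
  shows "ennreal ((f e)^2) \<le> ennreal (quad_const TYPE('a) * (norm e)^2) * (\<integral>+h. ennreal (bump 1 h * (f h)^2))"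
proof -
  note [measurable] = linear_borel[OF f]
  obtain p where p: "\<And>h. h \<in> ball p (1/4) ==> norm h \<le> 3/4" "\<And>h e. h \<in> ball p (1/4) ==> \<bar>f e\<bar> \<le> 4 * \<bar>f h\<bar> * norm e"
    using linear_test_ball[OF f] by blast
  let ?bl = "(7/16) ^ 4 / bump_mass TYPE('a)"
  let ?v = "?bl * (unit_ball_vol (real DIM('a)) * (1/4) ^ DIM('a))"
  have bl: "?bl > 0" by (simp add: bump_mass_pos)
  have v: "?v > 0" using bl by (intro mult_pos_pos) auto
  have b: "bump 1 h \<ge> ?bl" if "norm h \<le> 3/4" for h :: 'a
  proof -
    have "(norm h)^2 \<le> (3/4)^2" using that by (intro power_mono) auto
    hence "7/16 \<le> 1 - h \<bullet> h" by (simp add: power2_norm_eq_inner power_divide)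
    hence "(7/16) ^ 4 \<le> bump_pow 4 1 h" unfolding bump_pow_def by (intro power_mono) auto
    thus ?thesis unfolding bump_def using bump_mass_pos[where 'a='a] by (simp add: divide_right_mono)
  qed
  have "ennreal ((f e)^2) * ennreal ?v = ennreal ((f e)^2 * ?bl) * emeasure lborel (ball p (1/4))"
  proof -
    have "ennreal x * ennreal (B * V) = ennreal (x * B) * ennreal V" if "x \<ge> 0" "B \<ge> 0" "V \<ge> 0" for x B V :: real
      using that by (simp add: ennreal_mult mult.assoc)
    note gen = this
    have e: "emeasure lborel (ball p (1/4)) = ennreal (unit_ball_vol (real DIM('a)) * (1/4) ^ DIM('a))"
      by (rule emeasure_ball) simp
    show ?thesis unfolding e by (rule gen) (use bl in auto)
  qed
  also have "... = (\<integral>+h. ennreal ((f e)^2 * ?bl) * indicator (ball p (1/4)) h)" by (simp add: nn_integral_cmult_indicator)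
  also have "... \<le> (\<integral>+h. ennreal (16 * (norm e)^2) * ennreal (bump 1 h * (f h)^2))"
  proof (intro nn_integral_mono)
    fix h
    show "ennreal ((f e)^2 * ?bl) * indicator (ball p (1/4)) h \<le> ennreal (16 * (norm e)^2) * ennreal (bump 1 h * (f h)^2)"
    proof (cases "h \<in> ball p (1/4)")
      case True
      have "\<bar>f e\<bar>^2 \<le> (4 * \<bar>f h\<bar> * norm e)^2" using p(2)[OF True, of e] by (intro power_mono) auto
      hence "(f e)^2 \<le> 16 * (norm e)^2 * (f h)^2" by (simp add: power_mult_distrib mult_ac)
      hence "(f e)^2 * ?bl \<le> (16 * (norm e)^2 * (f h)^2) * bump 1 h"
        using b[OF p(1)[OF True]] bl by (intro mult_mono) auto
      hence "(f e)^2 * ?bl \<le> (16 * (norm e)^2) * (bump 1 h * (f h)^2)" by (simp only: mult_ac)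
      thus ?thesis using True by (simp add: ennreal_mult[symmetric] ennreal_leI)
    qed simp
  qed
  also have "... = ennreal (16 * (norm e)^2) * (\<integral>+h. ennreal (bump 1 h * (f h)^2))"
    by (rule nn_integral_cmult) measurable
  finally have fin: "ennreal (1 / ?v) * (ennreal ((f e)^2) * ennreal ?v) \<le> ennreal (1 / ?v) * (ennreal (16 * (norm e)^2) * (\<integral>+h. ennreal (bump 1 h * (f h)^2)))"
    by (rule mult_left_mono) simp
  have E1: "ennreal (1 / V) * (ennreal ((f e)^2) * ennreal V) = ennreal ((f e)^2)" if "V > 0" for V
    using that by (simp add: ennreal_mult[symmetric])
  have E2: "ennreal (1 / ?v) * (ennreal (16 * (norm e)^2) * X) = ennreal (quad_const TYPE('a) * (norm e)^2) * X" for X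
  proof -
    have 1: "quad_const TYPE('a) * (norm e)^2 = 1 / ?v * (16 * (norm e)^2)"
      by (simp add: quad_const_def mult.commute)
    have "ennreal (1 / V * (16 * (norm e)^2)) = ennreal (1 / V) * ennreal (16 * (norm e)^2)" if "V > 0" for V
      using that by (simp add: ennreal_mult[symmetric])
    from this[OF v] have "ennreal (quad_const TYPE('a) * (norm e)^2) = ennreal (1 / ?v) * ennreal (16 * (norm e)^2)"
      unfolding 1 .
    thus ?thesis by (simp only: mult.assoc)
  qed
  show ?thesis using fin unfolding E1[OF v] E2 .
qed

section \<open>Mean square bounds for Hessians\<close>

text \<open>
Second difference quotients converge to the Hessian, so Fatou's lemma bounds the mean over \<open>h\<close>, \<open>k\<close> of
\<open>(H x h k)^2\<close>. As \<open>H x\<close> is bilinear, this mean controls all its values; \<open>W\<close> is a multiple of it.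
\<close>

lemma hessian_L2:
  fixes w :: "'a::euclidean_space => real"
  assumes C: "C2_fun w p H" and [measurable]: "w \<in> borel_measurable borel"
    and bound: "\<And>s. s > 0 ==> second_difference_energy w s
         \<le> ennreal (K * s ^ 4)" and K: "K \<ge> 0"
  obtains W where "W \<in> borel_measurable borel" "(\<integral>+x. W x) \<le> ennreal ((quad_const TYPE('a))^2 * K)"
    "\<And>x h k. ennreal ((H x h k)^2) \<le> ennreal ((norm h * norm k)^2) * W x"
proof -
  let ?q = "quad_const TYPE('a)"
  define Hij where "Hij i j x = H x i j" for i j x
  have [measurable]: "Hij i j \<in> borel_measurable borel" for i j
    unfolding Hij_def by (intro borel_measurable_continuous_onI C2_funD(5)[OF C])
  have He: "H x h k = (\<Sum>i\<in>Basis. \<Sum>j\<in>Basis. (h \<bullet> i) * (k \<bullet> j) * Hij i j x)" for x h k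
    unfolding Hij_def by (rule bilinear_expand[OF C2_funD(3)[OF C] C2_funD(6)[OF C]])
  define G where "G h k x = ennreal (bump 1 h * bump 1 k) * ennreal ((H x h k)^2)" for h k x
  define \<Delta> where "\<Delta> n h k x = (second_difference w ((1 / Suc n) *\<^sub>R h) ((1 / Suc n) *\<^sub>R k) x)" for n :: nat and h k x
  define F where "F n h k x = ennreal (bump 1 h * bump 1 k) * ennreal ((\<Delta> n h k x / (1 / Suc n)^2)^2)" for n :: nat and h k x
  have m1: "(\<lambda>x. F n h k x) \<in> borel_measurable lborel" for n h k unfolding F_def \<Delta>_def by measurable
  have m2: "(\<lambda>k. \<integral>+x. F n h k x) \<in> borel_measurable lborel" for n h unfolding F_def \<Delta>_def by measurable
  have m3: "(\<lambda>h. \<integral>+k. \<integral>+x. F n h k x) \<in> borel_measurable lborel" for n unfolding F_def \<Delta>_def by measurable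
  have lim: "liminf (\<lambda>n. F n h k x) = G h k x" for h k x
  proof -
    have "(\<lambda>n. F n h k x) \<longlonglongrightarrow> G h k x"
      unfolding F_def G_def \<Delta>_def
      by (intro ennreal_tendsto_cmult tendsto_ennrealI tendsto_power C2_second_difference[OF C]) simp
    thus ?thesis by (rule lim_imp_Liminf[rotated]) simp
  qed
  have FK: "(\<integral>+h. \<integral>+k. \<integral>+x. F n h k x) \<le> ennreal K" for n
  proof -
    define s where "s = 1 / real (Suc n)"
    have s: "s > 0" by (simp add: s_def)
    have "F n h k x = ennreal (1 / s ^ 4) * (ennreal (bump 1 h * bump 1 k) * ennreal ((\<Delta> n h k x)^2))" for h k x
    proof -
      have "(\<Delta> n h k x / s^2)^2 = 1 / s ^ 4 * (\<Delta> n h k x)^2" by (simp add: power_divide power_mult[symmetric])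
      thus ?thesis unfolding F_def s_def[symmetric] by (simp add: ennreal_mult[symmetric] mult_ac)
    qed
    hence "(\<integral>+h. \<integral>+k. \<integral>+x. F n h k x) =
      (\<integral>+h. \<integral>+k. \<integral>+x. ennreal (1 / s ^ 4) * (ennreal (bump 1 h * bump 1 k) * ennreal ((\<Delta> n h k x)^2)))" by simp
    also have "... = ennreal (1 / s ^ 4) * (\<integral>+h. \<integral>+k. ennreal (bump 1 h * bump 1 k) * (\<integral>+x. ennreal ((\<Delta> n h k x)^2)))"
      unfolding \<Delta>_def by (simp add: nn_integral_cmult)
    also have "... \<le> ennreal (1 / s ^ 4) * ennreal (K * s ^ 4)"
      unfolding \<Delta>_def s_def[symmetric] by (intro mult_left_mono bound s) simp
    also have "... = ennreal K" using s K by (simp add: ennreal_mult[symmetric])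
    finally show ?thesis .
  qed
  have "(\<integral>+h. \<integral>+k. \<integral>+x. G h k x) \<le> (\<integral>+h. \<integral>+k. liminf (\<lambda>n. \<integral>+x. F n h k x))"
    unfolding lim[symmetric] by (intro nn_integral_mono nn_integral_liminf m1)
  also have "... \<le> (\<integral>+h. liminf (\<lambda>n. \<integral>+k. \<integral>+x. F n h k x))"
    by (intro nn_integral_mono nn_integral_liminf m2)
  also have "... \<le> liminf (\<lambda>n. \<integral>+h. \<integral>+k. \<integral>+x. F n h k x)"
    by (intro nn_integral_liminf m3)
  also have "... \<le> ennreal K"
    using Liminf_mono[of "\<lambda>n. \<integral>+h. \<integral>+k. \<integral>+x. F n h k x" "\<lambda>_. ennreal K" sequentially] FK
    by (simp add: Liminf_const)
  finally have GK: "(\<integral>+h. \<integral>+k. \<integral>+x. G h k x) \<le> ennreal K" .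
  have "(\<integral>+x. \<integral>+h. \<integral>+k. G h k x) = (\<integral>+h. \<integral>+x. \<integral>+k. G h k x)"
    unfolding G_def He by (rule lborel_pair.Fubini') measurable
  also have "... = (\<integral>+h. \<integral>+k. \<integral>+x. G h k x)"
    unfolding G_def He by (intro nn_integral_cong lborel_pair.Fubini') measurable
  finally have GK': "(\<integral>+x. \<integral>+h. \<integral>+k. G h k x) \<le> ennreal K" using GK by simp
  define W0 where "W0 x = (\<integral>+h. \<integral>+k. G h k x)" for x
  have [measurable]: "W0 \<in> borel_measurable borel" unfolding W0_def[abs_def] G_def He by measurable
  have HW: "ennreal ((H x e e')^2) \<le> ennreal (?q * (norm e)^2) * (ennreal (?q * (norm e')^2) * W0 x)" for x e e'
  proof -
    have [measurable]: "(\<lambda>h. ennreal (bump 1 h * (H x h e')^2)) \<in> borel_measurable borel" unfolding He by measurable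
    have [measurable]: "(\<lambda>k. ennreal (bump 1 k * (H x h k)^2)) \<in> borel_measurable borel" for h unfolding He by measurable
    have [measurable]: "(\<lambda>p. (H x (fst p) (snd p))^2) \<in> borel_measurable (borel \<Otimes>\<^sub>M borel)" unfolding He by measurable
    have "ennreal ((H x e e')^2) \<le> ennreal (?q * (norm e)^2) * (\<integral>+h. ennreal (bump 1 h * (H x h e')^2))"
      by (rule linear_le_L2[OF C2_funD(3)[OF C]])
    also have "... \<le> ennreal (?q * (norm e)^2) * (\<integral>+h. ennreal (?q * (norm e')^2) * (\<integral>+k. G h k x))"
    proof (intro mult_left_mono nn_integral_mono)
      fix h
      have "ennreal (bump 1 h * (H x h e')^2) = ennreal (bump 1 h) * ennreal ((H x h e')^2)" by (simp add: ennreal_mult)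
      also have "... \<le> ennreal (bump 1 h) * (ennreal (?q * (norm e')^2) * (\<integral>+k. ennreal (bump 1 k * (H x h k)^2)))"
        by (intro mult_left_mono linear_le_L2[OF C2_funD(6)[OF C]]) simp
      also have "... = ennreal (?q * (norm e')^2) * (\<integral>+k. ennreal (bump 1 h) * ennreal (bump 1 k * (H x h k)^2))"
      proof -
        have mk: "(\<lambda>k. ennreal (bump 1 k * (H x h k)^2)) \<in> borel_measurable lborel" unfolding He by measurable
        show ?thesis unfolding nn_integral_cmult[OF mk] by (simp only: mult_ac)
      qed
      also have "(\<integral>+k. ennreal (bump 1 h) * ennreal (bump 1 k * (H x h k)^2)) = (\<integral>+k. G h k x)"
        unfolding G_def by (intro nn_integral_cong) (simp add: ennreal_mult mult.assoc)
      finally show "ennreal (bump 1 h * (H x h e')^2) \<le> ennreal (?q * (norm e')^2) * (\<integral>+k. G h k x)" .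
    qed simp
    also have "(\<integral>+h. ennreal (?q * (norm e')^2) * (\<integral>+k. G h k x)) = ennreal (?q * (norm e')^2) * W0 x"
      unfolding W0_def G_def He by (rule nn_integral_cmult) measurable
    finally show ?thesis .
  qed
  show ?thesis
  proof (rule that[of "\<lambda>x. ennreal (?q^2) * W0 x"])
    show "(\<lambda>x. ennreal (?q^2) * W0 x) \<in> borel_measurable borel" by measurable
    have "(\<integral>+x. ennreal (?q^2) * W0 x) = ennreal (?q^2) * (\<integral>+x. W0 x)" by (rule nn_integral_cmult) measurable
    also have "... \<le> ennreal (?q^2) * ennreal K" using GK' unfolding W0_def by (intro mult_left_mono) auto
    finally show "(\<integral>+x. ennreal (?q^2) * W0 x) \<le> ennreal (?q^2 * K)" using K by (simp add: ennreal_mult)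
    fix x h k :: 'a
    have "ennreal (?q * (norm h)^2) * (ennreal (?q * (norm k)^2) * W0 x) = ennreal ((norm h * norm k)^2) * (ennreal (?q^2) * W0 x)"
      using quad_const_pos[where 'a='a]
      by (simp add: mult.assoc[symmetric] ennreal_mult[symmetric] power2_eq_square) (simp add: mult_ac)
    with HW[of x h k] show "ennreal ((H x h k)^2) \<le> ennreal ((norm h * norm k)^2) * (ennreal (?q^2) * W0 x)" by simp
  qed
qed

lemma hess_pointwise:
  assumes W: "ennreal (a^2) \<le> ennreal (m^2) * W" and m: "m \<ge> 0" and t: "t > 0"
  shows "ennreal \<bar>a\<bar> \<le> ennreal m * (ennreal (1 / t) * W + ennreal t)"
proof (cases "m = 0")
  case True
  with W show ?thesis by simp
next
  case False
  show ?thesis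
  proof (cases W)
    case top
    thus ?thesis using False m t by (simp add: ennreal_mult_top)
  next
    case (real q)
    have "a^2 \<le> m^2 * q" using W real m by (simp add: ennreal_mult[symmetric])
    hence "\<bar>a\<bar> \<le> sqrt (m^2 * q)" by (simp add: real_le_rsqrt)
    also have "... = m * sqrt q" using m by (simp add: real_sqrt_mult)
    also have "sqrt q \<le> 1 / t * q + t"
    proof -
      have "0 \<le> (sqrt q - t)^2" by simp
      also have "(sqrt q - t)^2 = q - 2 * t * sqrt q + t^2" using real by (simp add: power2_diff)
      finally have "t * sqrt q * 2 \<le> q + t^2" by simp
      moreover have "0 \<le> t * sqrt q" using t real by simp
      ultimately have "t * sqrt q \<le> q + t^2" by linarith
      thus ?thesis using t by (simp add: field_simps power2_eq_square)
    qed
    finally have "\<bar>a\<bar> \<le> m * (1 / t * q + t)" using m by (simp add: mult_left_mono)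
    hence "ennreal \<bar>a\<bar> \<le> ennreal (m * (1 / t * q + t))" by (rule ennreal_leI)
    also have "... = ennreal m * (ennreal (1 / t) * W + ennreal t)"
      using real m t by (simp add: ennreal_mult[symmetric] ennreal_plus[symmetric] del: ennreal_plus)
    finally show ?thesis .
  qed
qed

text \<open>
\<open>H\<close> is continuous, so its value at \<open>a\<close> is the limit of means over small balls.
\<close>

lemma hess_at_point:
  fixes H :: "'a::euclidean_space => 'a => 'a => real"
  assumes C: "C2_fun w p H" and [measurable]: "W \<in> borel_measurable borel"
    and HW: "\<And>x h k. ennreal ((H x h k)^2) \<le> ennreal ((norm h * norm k)^2) * W x"
    and t: "t > 0" and M: "\<And>r. r > 0 ==> (\<integral>+x. W x * indicator (ball a r) x) \<le> ennreal (t^2 * r ^ DIM('a))"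
  shows "\<bar>H a h k\<bar> \<le> (1 + 1 / unit_ball_vol DIM('a)) * t * (norm h * norm k)"
proof (rule field_le_epsilon)
  fix e :: real assume e: "e > 0"
  let ?m = "norm h * norm k" and ?o = "unit_ball_vol (real DIM('a))"
  have o: "?o > 0" by simp
  have "isCont (\<lambda>x. H x h k) a" using C2_funD(5)[OF C, of h k] by (simp add: continuous_on_eq_continuous_at)
  then obtain r where r: "r > 0" "\<And>x. dist x a < r ==> dist (H x h k) (H a h k) < e"
    using e unfolding continuous_at_eps_delta by blast
  have "ennreal (\<bar>H a h k\<bar> - e) * emeasure lborel (ball a r) = (\<integral>+x. ennreal (\<bar>H a h k\<bar> - e) * indicator (ball a r) x)"
    by (simp add: nn_integral_cmult_indicator)
  also have "... \<le> (\<integral>+x. ennreal ?m * (ennreal (1 / t) * (W x * indicator (ball a r) x) + ennreal t * indicator (ball a r) x))"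
  proof (intro nn_integral_mono)
    fix x
    show "ennreal (\<bar>H a h k\<bar> - e) * indicator (ball a r) x \<le> ennreal ?m * (ennreal (1 / t) * (W x * indicator (ball a r) x) + ennreal t * indicator (ball a r) x)"
    proof (cases "x \<in> ball a r")
      case True
      have "\<bar>H a h k\<bar> - e \<le> \<bar>H x h k\<bar>" using r(2)[of x] True by (simp add: dist_real_def dist_commute abs_if split: if_splits)
      hence "ennreal (\<bar>H a h k\<bar> - e) \<le> ennreal \<bar>H x h k\<bar>" by (rule ennreal_leI)
      also have "... \<le> ennreal ?m * (ennreal (1 / t) * W x + ennreal t)" by (intro hess_pointwise HW t) simp
      finally show ?thesis using True by simp
    qed simp
  qed
  also have "... = ennreal ?m * (ennreal (1 / t) * (\<integral>+x. W x * indicator (ball a r) x) + ennreal t * emeasure lborel (ball a r))"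
  proof -
    have m1: "(\<lambda>x. W x * indicator (ball a r) x) \<in> borel_measurable lborel" by measurable
    have m2: "(\<lambda>x. ennreal (1 / t) * (W x * indicator (ball a r) x)) \<in> borel_measurable lborel" by measurable
    have m3: "(\<lambda>x. ennreal t * indicator (ball a r) x) \<in> borel_measurable lborel" by measurable
    show ?thesis
      by (subst nn_integral_cmult[OF borel_measurable_add[OF m2 m3]], subst nn_integral_add[OF m2 m3], subst nn_integral_cmult[OF m1], subst nn_integral_cmult_indicator) auto
  qed
  also have "... \<le> ennreal ?m * (ennreal (1 / t) * ennreal (t^2 * r ^ DIM('a)) + ennreal t * emeasure lborel (ball a r))"
    by (intro mult_left_mono add_right_mono M r) auto
  also have "... = ennreal (?m * (t * r ^ DIM('a) + t * (?o * r ^ DIM('a))))"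
  proof -
    have "1 / t * (t^2 * r ^ DIM('a)) = t * r ^ DIM('a)" using t by (simp add: power2_eq_square)
    hence "ennreal (1 / t) * ennreal (t^2 * r ^ DIM('a)) = ennreal (t * r ^ DIM('a))" using t r by (simp add: ennreal_mult[symmetric])
    thus ?thesis using t r o by (simp add: emeasure_ball ennreal_mult[symmetric] ennreal_plus[symmetric] del: ennreal_plus)
  qed
  finally have le: "ennreal (\<bar>H a h k\<bar> - e) * ennreal (?o * r ^ DIM('a)) \<le> ennreal (?m * (t * r ^ DIM('a) + t * (?o * r ^ DIM('a))))"
    using r by (simp add: emeasure_ball)
  show "\<bar>H a h k\<bar> \<le> (1 + 1 / ?o) * t * ?m + e"
  proof (cases "\<bar>H a h k\<bar> \<le> e")
    case True
    thus ?thesis using t o by (intro add_increasing mult_nonneg_nonneg) auto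
  next
    case False
    hence "(\<bar>H a h k\<bar> - e) * (?o * r ^ DIM('a)) \<le> ?m * (t * r ^ DIM('a) + t * (?o * r ^ DIM('a)))"
      using le r o t by (simp add: ennreal_mult[symmetric])
    also have "... = ((1 + 1 / ?o) * t * ?m) * (?o * r ^ DIM('a))" using o by (simp add: field_simps)
    finally have "\<bar>H a h k\<bar> - e \<le> (1 + 1 / ?o) * t * ?m" using r o by (simp add: mult_le_cancel_right)
    thus ?thesis by simp
  qed
qed

text \<open>
The integral remainder at \<open>a + y\<close> is a mean of Hessians along the segment. After Fubini and the
substitution \<open>y \<mapsto> s y\<close> only integrals of the Hessian over balls about \<open>a\<close> remain.
\<close>

lemma taylor_average:
  fixes H :: "'a::euclidean_space => 'a => 'a => real"
  assumes C: "C2_fun w p H" and [measurable]: "W \<in> borel_measurable borel"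
    and HW: "\<And>x h k. ennreal ((H x h k)^2) \<le> ennreal ((norm h * norm k)^2) * W x"
    and t: "t > 0" and M: "\<And>r. r > 0 ==> (\<integral>+x. W x * indicator (ball a r) x) \<le> ennreal (t^2 * r ^ DIM('a))"
    and r: "r > 0"
  shows "ball_L1 r (\<lambda>y. w (a + y) - w a - p a y)
     \<le> ennreal ((1 + unit_ball_vol DIM('a)) * t * r ^ (DIM('a) + 2))"
proof -
  let ?o = "unit_ball_vol (real DIM('a))" let ?d = "DIM('a)"
  have o: "?o > 0" by simp
  let ?G = "\<lambda>y s. indicator {0<..1} s * (ennreal (r^2) * ((ennreal (1 / t) * W (a + s *\<^sub>R y) + ennreal t) * indicator (ball 0 r) y))"
  have "ball_L1 r (\<lambda>y. w (a + y) - w a - p a y) \<le> (\<integral>+y. \<integral>+(s::real). ?G y s)"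
  proof (intro nn_integral_mono)
    fix y :: 'a
    show "ennreal \<bar>w (a + y) - w a - p a y\<bar> * indicator (ball 0 r) y \<le> (\<integral>+(s::real). ?G y s)"
    proof (cases "norm y < r")
      case True
      have "ennreal \<bar>w (a + y) - w a - p a y\<bar> \<le> (\<integral>+s. ennreal \<bar>indicator {0..1} s * ((1 - s) * H (a + s *\<^sub>R y) y y)\<bar>)"
        unfolding C2_funD(1)[OF C] using integral_norm_bound_ennreal[OF C2_integrable[OF C]] by simp
      also have "... \<le> (\<integral>+(s::real). ?G y s)"
      proof (rule nn_integral_mono_AE)
        have "AE s::real in lborel. s \<noteq> 0" by (rule AE_lborel_singleton)
        thus "AE s in lborel. ennreal \<bar>indicator {0..1} s * ((1 - s) * H (a + s *\<^sub>R y) y y)\<bar> \<le> ?G y s"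
        proof eventually_elim
          case (elim s)
          show ?case
          proof (cases "s \<in> {0..1}")
            case True2: True
            hence s: "0 < s" "s \<le> 1" using elim by auto
            have "\<bar>(1 - s) * H (a + s *\<^sub>R y) y y\<bar> \<le> \<bar>H (a + s *\<^sub>R y) y y\<bar>"
              using s by (simp add: abs_mult mult_left_le_one_le)
            hence "ennreal \<bar>(1 - s) * H (a + s *\<^sub>R y) y y\<bar> \<le> ennreal \<bar>H (a + s *\<^sub>R y) y y\<bar>" by (rule ennreal_leI)
            also have "... \<le> ennreal (norm y * norm y) * (ennreal (1 / t) * W (a + s *\<^sub>R y) + ennreal t)"
              by (intro hess_pointwise HW t) simp
            also have "... \<le> ennreal (r^2) * (ennreal (1 / t) * W (a + s *\<^sub>R y) + ennreal t)"
              unfolding power2_eq_square using True r by (intro mult_right_mono ennreal_leI mult_mono) auto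
            finally show ?thesis using s True by simp
          qed simp
        qed
      qed
      finally show ?thesis using True by simp
    qed simp
  qed
  also have "... = (\<integral>+s. \<integral>+y. ?G y s)"
    by (rule lborel_pair.Fubini') measurable
  also have "... \<le> (\<integral>+s. ennreal ((1 + ?o) * t * r ^ (?d + 2)) * indicator {0<..1::real} s)"
  proof (intro nn_integral_mono)
    fix s :: real
    show "(\<integral>+y. ?G y s) \<le> ennreal ((1 + ?o) * t * r ^ (?d + 2)) * indicator {0<..1} s"
    proof (cases "s \<in> {0<..1}")
      case True
      hence s: "s > 0" "s \<le> 1" by auto
      define X where "X = (\<integral>+y. W (a + s *\<^sub>R y) * indicator (ball 0 r) y)"
      have "ennreal (s ^ ?d) * X = (\<integral>+x. W x * indicator (ball a (s * r)) x)"
      proof -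
        have "(\<integral>+x. W x * indicator (ball a (s * r)) x) = ennreal (\<bar>s\<bar> ^ ?d) * (\<integral>+y. W (a + s *\<^sub>R y) * indicator (ball a (s * r)) (a + s *\<^sub>R y))"
          using s by (intro nn_integral_scale) auto
        moreover have "(indicator (ball a (s * r)) (a + s *\<^sub>R y) :: ennreal) = indicator (ball 0 r) y" for y
          using s by (auto simp: indicator_def dist_norm)
        ultimately show ?thesis using s by (simp add: X_def)
      qed
      also have "... \<le> ennreal (t^2 * (s * r) ^ ?d)" using s r by (intro M) simp
      finally have "ennreal (1 / s ^ ?d) * (ennreal (s ^ ?d) * X) \<le> ennreal (1 / s ^ ?d) * ennreal (t^2 * (s * r) ^ ?d)"
        by (rule mult_left_mono) simp
      moreover have "ennreal (1 / s ^ ?d) * ennreal (s ^ ?d) = 1" using s by (simp add: ennreal_mult[symmetric])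
      moreover have "ennreal (1 / s ^ ?d) * ennreal (t^2 * (s * r) ^ ?d) = ennreal (t^2 * r ^ ?d)"
        using s r by (simp add: ennreal_mult[symmetric] power_mult_distrib)
      ultimately have X: "X \<le> ennreal (t^2 * r ^ ?d)" by (simp add: mult.assoc[symmetric])
      have m1: "(\<lambda>y. W (a + s *\<^sub>R y) * indicator (ball 0 r) y) \<in> borel_measurable lborel" by measurable
      have m2: "(\<lambda>y. ennreal (1 / t) * (W (a + s *\<^sub>R y) * indicator (ball 0 r) y)) \<in> borel_measurable lborel" by measurable
      have m3: "(\<lambda>y::'a. ennreal t * indicator (ball 0 r) y) \<in> borel_measurable lborel" by measurable
      have "(\<integral>+y. ?G y s) = (\<integral>+y. ennreal (r^2) * (ennreal (1 / t) * (W (a + s *\<^sub>R y) * indicator (ball 0 r) y) + ennreal t * indicator (ball 0 r) y))"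
        using True by (intro nn_integral_cong) (simp add: distrib_right mult.assoc)
      also have "... = ennreal (r^2) * (ennreal (1 / t) * X + ennreal t * emeasure lborel (ball (0::'a) r))"
        unfolding X_def
        by (subst nn_integral_cmult[OF borel_measurable_add[OF m2 m3]], subst nn_integral_add[OF m2 m3], subst nn_integral_cmult[OF m1], subst nn_integral_cmult_indicator) auto
      also have "... \<le> ennreal (r^2) * (ennreal (1 / t) * ennreal (t^2 * r ^ ?d) + ennreal t * emeasure lborel (ball (0::'a) r))"
        by (intro mult_left_mono add_right_mono X) auto
      also have "... = ennreal (r^2 * (t * r ^ ?d + t * (?o * r ^ ?d)))"
      proof -
        have "1 / t * (t^2 * r ^ ?d) = t * r ^ ?d" using t by (simp add: power2_eq_square)
        hence "ennreal (1 / t) * ennreal (t^2 * r ^ ?d) = ennreal (t * r ^ ?d)" using t r by (simp add: ennreal_mult[symmetric])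
        thus ?thesis using t r o by (simp add: emeasure_ball ennreal_mult[symmetric] ennreal_plus[symmetric] del: ennreal_plus)
      qed
      also have "r^2 * (t * r ^ ?d + t * (?o * r ^ ?d)) = (1 + ?o) * t * r ^ (?d + 2)" by (simp add: power_add power2_eq_square algebra_simps)
      finally show ?thesis using True by simp
    qed simp
  qed
  also have "... = ennreal ((1 + ?o) * t * r ^ (?d + 2))" by (simp add: nn_integral_cmult_indicator)
  finally show ?thesis .
qed

section \<open>Second order expansion of potentials of bounded densities\<close>

lemma geometric_limit:
  fixes x :: "nat => real"
  assumes x: "\<And>j. j \<ge> k0 ==> \<bar>x (Suc j) - x j\<bar> \<le> c * (1/2) ^ j"
  obtains l where "\<And>k. k \<ge> k0 ==> \<bar>x k - l\<bar> \<le> 2 * c * (1/2) ^ k"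
proof -
  have c: "c \<ge> 0"
  proof (rule ccontr)
    assume "\<not> c \<ge> 0"
    hence "c * (1/2) ^ k0 < 0" by (intro mult_neg_pos) auto
    thus False using order_trans[OF abs_ge_zero x[OF order_refl]] by simp
  qed
  have *: "\<bar>x (k + n) - x k\<bar> \<le> 2 * c * (1/2) ^ k - 2 * c * (1/2) ^ (k + n)" if "k \<ge> k0" for k n
  proof (induction n)
    case (Suc n)
    have "\<bar>x (k + Suc n) - x k\<bar> \<le> \<bar>x (Suc (k + n)) - x (k + n)\<bar> + \<bar>x (k + n) - x k\<bar>" by simp
    also have "... \<le> c * (1/2) ^ (k + n) + (2 * c * (1/2) ^ k - 2 * c * (1/2) ^ (k + n))"
      using x[of "k + n"] that Suc by (intro add_mono) auto
    finally show ?case by simp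
  qed simp
  have **: "\<bar>x n - x k\<bar> \<le> 2 * c * (1/2) ^ k" if "k \<ge> k0" "n \<ge> k" for k n
  proof -
    have "0 \<le> 2 * c * (1/2) ^ (k + (n - k))" using c by simp
    thus ?thesis using *[OF that(1), of "n - k"] that(2) by simp
  qed
  have "Cauchy x"
  proof (rule CauchyI')
    fix e :: real assume e: "e > 0"
    have "(\<lambda>k. 2 * c * (1/2) ^ k) \<longlonglongrightarrow> 2 * c * 0" by (intro tendsto_intros LIMSEQ_power_zero) auto
    hence "eventually (\<lambda>k. 2 * c * (1/2) ^ k < e) sequentially" using e by (intro order_tendstoD) auto
    then obtain K where K: "\<And>k. k \<ge> K ==> 2 * c * (1/2) ^ k < e" by (auto simp: eventually_sequentially)
    show "\<exists>M. \<forall>m\<ge>M. \<forall>n>m. dist (x m) (x n) < e"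
    proof (intro exI allI impI)
      fix m n assume "m \<ge> max K k0" "n > m"
      with **[of m n] K[of m] show "dist (x m) (x n) < e" by (simp add: dist_real_def abs_minus_commute)
    qed
  qed
  then obtain l where l: "x \<longlonglongrightarrow> l" using Cauchy_convergent_iff convergent_def by blast
  show ?thesis
  proof (rule that[of l])
    fix k assume k: "k \<ge> k0"
    have "(\<lambda>n. \<bar>x n - x k\<bar>) \<longlonglongrightarrow> \<bar>l - x k\<bar>" by (intro tendsto_intros l)
    hence "\<bar>l - x k\<bar> \<le> 2 * c * (1/2) ^ k"
      by (rule LIMSEQ_le_const2) (use ** k in auto)
    thus "\<bar>x k - l\<bar> \<le> 2 * c * (1/2) ^ k" by (simp add: abs_minus_commute)
  qed
qed

definition poly2 :: "('a::euclidean_space => real) => ('a => 'a => real) => 'a => real" where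
  "poly2 A B y = (\<Sum>i\<in>Basis. A i * (y \<bullet> i)) + (\<Sum>j\<in>Basis. \<Sum>k\<in>Basis. B j k * (y \<bullet> j) * (y \<bullet> k))"

lemma continuous_on_poly2 [continuous_intros]:
  "continuous_on S f ==> continuous_on S (\<lambda>x. poly2 A B (f x))"
  unfolding poly2_def by (intro continuous_intros)

lemma measurable_poly2 [measurable]: "poly2 A B \<in> borel_measurable borel"
  by (intro borel_measurable_continuous_onI continuous_intros)

text \<open>
The Taylor polynomials of \<open>u k\<close> at \<open>a\<close> converge geometrically. For the gradients this uses that \<open>u k\<close> is
uniformly close to \<open>v\<close>, so that a linear form is small in the mean over the unit ball. To expand \<open>v\<close>,
fix a large \<open>k\<close>, expand the smooth function \<open>u k\<close>, and sum the remainders of the differences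
\<open>u (j + 1) - u j\<close> for \<open>j \<ge> k\<close>, each of which is small in the mean over balls.
\<close>

lemma taylor_telescope:
  fixes v :: "'a::euclidean_space => real" and u :: "nat => 'a => real"
  assumes C2: "\<And>k. C2_fun (u k) (p k) (H k)"
    and [measurable]: "v \<in> borel_measurable borel" "\<And>k. u k \<in> borel_measurable borel"
    and close: "\<And>k x. \<bar>u k x - v x\<bar> \<le> M * (1/4) ^ k"
    and avg: "\<And>k r. k \<ge> k0 ==> r > 0 ==>
      ball_L1 r (\<lambda>y. (u (Suc k) (a + y) - u k (a + y)) - (u (Suc k) a - u k a) - (p (Suc k) a y - p k a y))
        \<le> ennreal (c * (1/2) ^ k * r ^ (DIM('a) + 2))"
    and hess: "\<And>k h h'. k \<ge> k0 ==> \<bar>H (Suc k) a h h' - H k a h h'\<bar> \<le> c * (1/2) ^ k * (norm h * norm h')"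
    and c: "c > 0"
  obtains A B where "\<And>\<epsilon>. \<epsilon> > 0 ==> \<exists>r0>0. \<forall>r. 0 < r \<and> r < r0 -->
     ball_L1 r (\<lambda>y. v (a + y) - v a - poly2 A B y) \<le> ennreal (\<epsilon> * r ^ (DIM('a) + 2))"
proof -
  let ?d = "DIM('a)" and ?o = "unit_ball_vol (real DIM('a))"
  have o: "?o > 0" by simp
  have M: "M \<ge> 0" using order_trans[OF abs_ge_zero close[of 0 0]] by simp
  note lp = C2_funD(2)[OF C2]
  note [measurable] = linear_borel[OF lp]
  define f where "f k y = u k (a + y) - u k a - p k a y" for k y
  have [measurable]: "f k \<in> borel_measurable borel" for k unfolding f_def by measurable
  have D: "(u (Suc k) (a + y) - u k (a + y)) - (u (Suc k) a - u k a) - (p (Suc k) a y - p k a y) = f (Suc k) y - f k y" for k y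
    by (simp add: f_def)
  define c1 where "c1 = lin_const TYPE('a) * (c + 4 * M * ?o)"
  have c1: "c1 \<ge> 0" unfolding c1_def using lin_const_pos[where 'a='a] c M o by (intro mult_nonneg_nonneg add_nonneg_nonneg) auto
  have dp: "\<bar>p (Suc k) a e - p k a e\<bar> \<le> c1 * (1/2) ^ k * norm e" if k: "k \<ge> k0" for k e
  proof -
    have "ennreal \<bar>p (Suc k) a e - p k a e\<bar> \<le> ennreal (lin_const TYPE('a) * norm e) * ball_L1 1 (\<lambda>y. p (Suc k) a y - p k a y)"
      by (rule linear_le_L1) (intro linear_compose_sub lp)
    also have "ball_L1 1 (\<lambda>y. p (Suc k) a y - p k a y) \<le>
       (\<integral>+y. ennreal \<bar>f (Suc k) y - f k y\<bar> * indicator (ball 0 1) y + ennreal (4 * M * (1/4) ^ k) * indicator (ball 0 1) y)"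
    proof (intro nn_integral_mono)
      fix y
      have m4: "M * (1/4) ^ Suc k \<le> M * (1/4) ^ k" using M by (intro mult_left_mono power_decreasing) auto
      have "\<bar>p (Suc k) a y - p k a y\<bar> \<le> \<bar>f (Suc k) y - f k y\<bar> + 4 * M * (1/4) ^ k"
        using close[of "Suc k" "a + y"] close[of k "a + y"] close[of "Suc k" a] close[of k a] m4
        unfolding f_def by linarith
      hence "ennreal \<bar>p (Suc k) a y - p k a y\<bar> \<le> ennreal (\<bar>f (Suc k) y - f k y\<bar> + 4 * M * (1/4) ^ k)" by (rule ennreal_leI)
      thus "ennreal \<bar>p (Suc k) a y - p k a y\<bar> * indicator (ball 0 1) y \<le> ennreal \<bar>f (Suc k) y - f k y\<bar> * indicator (ball 0 1) y + ennreal (4 * M * (1/4) ^ k) * indicator (ball 0 1) y"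
        using M by (auto split: split_indicator)
    qed
    also have "... = ball_L1 1 (\<lambda>y. f (Suc k) y - f k y) + ennreal (4 * M * (1/4) ^ k) * emeasure lborel (ball (0::'a) 1)"
    proof -
      have m1: "(\<lambda>y. ennreal \<bar>f (Suc k) y - f k y\<bar> * indicator (ball 0 1) y) \<in> borel_measurable lborel" by measurable
      have m2: "(\<lambda>y::'a. ennreal (4 * M * (1/4) ^ k) * indicator (ball 0 1) y) \<in> borel_measurable lborel" by measurable
      show ?thesis by (subst nn_integral_add[OF m1 m2], subst nn_integral_cmult_indicator) auto
    qed
    also have "... \<le> ennreal (c * (1/2) ^ k * 1 ^ (?d + 2)) + ennreal (4 * M * (1/4) ^ k) * emeasure lborel (ball (0::'a) 1)"
      using avg[OF k, of 1] unfolding D by (intro add_right_mono) simp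
    also have "... = ennreal (c * (1/2) ^ k + 4 * M * (1/4) ^ k * ?o)"
      using c M o by (simp add: emeasure_ball ennreal_mult[symmetric] ennreal_plus[symmetric] del: ennreal_plus)
    also have "... \<le> ennreal ((c + 4 * M * ?o) * (1/2) ^ k)"
    proof (intro ennreal_leI)
      have "4 * M * ?o * (1/4) ^ k \<le> 4 * M * ?o * (1/2) ^ k" using M o by (intro mult_left_mono power_mono) auto
      thus "c * (1/2) ^ k + 4 * M * (1/4) ^ k * ?o \<le> (c + 4 * M * ?o) * (1/2) ^ k" by (simp add: algebra_simps)
    qed
    finally have "ennreal \<bar>p (Suc k) a e - p k a e\<bar> \<le> ennreal (lin_const TYPE('a) * norm e) * ennreal ((c + 4 * M * ?o) * (1/2) ^ k)"
      by (simp add: mult_left_mono)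
    also have "... = ennreal (c1 * (1/2) ^ k * norm e)"
      using lin_const_pos[where 'a='a] c M o unfolding c1_def by (subst ennreal_mult[symmetric]) (auto simp: mult_ac)
    finally show ?thesis using c1 by simp
  qed
  have "\<exists>l. \<forall>k\<ge>k0. \<bar>p k a i - l\<bar> \<le> 2 * c1 * (1/2) ^ k" if "i \<in> Basis" for i
  proof -
    have "\<bar>p (Suc k) a i - p k a i\<bar> \<le> c1 * (1/2) ^ k" if "k \<ge> k0" for k using dp[OF that, of i] \<open>i \<in> Basis\<close> by simp
    from geometric_limit[of k0 "\<lambda>k. p k a i" c1, OF this] show ?thesis by blast
  qed
  then obtain A where A: "\<And>i k. i \<in> Basis ==> k \<ge> k0 ==> \<bar>p k a i - A i\<bar> \<le> 2 * c1 * (1/2) ^ k" by metis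
  have "\<exists>l. \<forall>k\<ge>k0. \<bar>H k a i j - l\<bar> \<le> 2 * c * (1/2) ^ k" if "i \<in> Basis" "j \<in> Basis" for i j
  proof -
    have "\<bar>H (Suc k) a i j - H k a i j\<bar> \<le> c * (1/2) ^ k" if "k \<ge> k0" for k
      using hess[OF that, of i j] \<open>i \<in> Basis\<close> \<open>j \<in> Basis\<close> by simp
    from geometric_limit[of k0 "\<lambda>k. H k a i j" c, OF this] show ?thesis by blast
  qed
  then obtain B' where B': "\<And>i j k. i \<in> Basis ==> j \<in> Basis ==> k \<ge> k0 ==> \<bar>H k a i j - B' i j\<bar> \<le> 2 * c * (1/2) ^ k" by metis
  define B where "B i j = B' i j / 2" for i j
  define c2 where "c2 = real ?d * (2 * c1)"
  define c3 where "c3 = real ?d * (real ?d * c)"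
  have c23: "c2 \<ge> 0" "c3 \<ge> 0" using c1 c by (auto simp: c2_def c3_def)
  have Ap: "\<bar>p k a y - (\<Sum>i\<in>Basis. A i * (y \<bullet> i))\<bar> \<le> c2 * norm y * (1/2) ^ k" if "k \<ge> k0" for k y
  proof -
    have "p k a y = (\<Sum>i\<in>Basis. p k a i * (y \<bullet> i))"
      using linear_sum[OF lp[of k a], of "\<lambda>i. (y \<bullet> i) *\<^sub>R i" Basis] linear_scale[OF lp[of k a]]
      by (simp add: euclidean_representation mult.commute)
    hence "\<bar>p k a y - (\<Sum>i\<in>Basis. A i * (y \<bullet> i))\<bar> = \<bar>\<Sum>i\<in>Basis. (p k a i - A i) * (y \<bullet> i)\<bar>"
      by (simp add: sum_subtractf left_diff_distrib)
    also have "... \<le> (\<Sum>i\<in>(Basis::'a set). 2 * c1 * (1/2) ^ k * norm y)"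
      unfolding abs_mult[symmetric]
    proof (intro order_trans[OF sum_abs] sum_mono)
      fix i :: 'a assume i: "i \<in> Basis"
      show "\<bar>(p k a i - A i) * (y \<bullet> i)\<bar> \<le> 2 * c1 * (1/2) ^ k * norm y"
        unfolding abs_mult using c1 by (intro mult_mono A i that Basis_le_norm) auto
    qed
    finally show ?thesis by (simp add: c2_def mult_ac)
  qed
  have BH: "\<bar>H k a y y / 2 - (\<Sum>i\<in>Basis. \<Sum>j\<in>Basis. B i j * (y \<bullet> i) * (y \<bullet> j))\<bar> \<le> c3 * (norm y)^2 * (1/2) ^ k" if "k \<ge> k0" for k y
  proof -
    have "H k a y y = (\<Sum>i\<in>Basis. \<Sum>j\<in>Basis. (y \<bullet> i) * (y \<bullet> j) * H k a i j)"
      by (rule bilinear_expand[OF C2_funD(3)[OF C2] C2_funD(6)[OF C2]])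
    hence "H k a y y / 2 - (\<Sum>i\<in>Basis. \<Sum>j\<in>Basis. B i j * (y \<bullet> i) * (y \<bullet> j)) = (\<Sum>i\<in>Basis. \<Sum>j\<in>Basis. (H k a i j - B' i j) / 2 * ((y \<bullet> i) * (y \<bullet> j)))"
      by (simp add: sum_subtractf sum_divide_distrib B_def algebra_simps diff_divide_distrib)
    hence "\<bar>H k a y y / 2 - (\<Sum>i\<in>Basis. \<Sum>j\<in>Basis. B i j * (y \<bullet> i) * (y \<bullet> j))\<bar> \<le> (\<Sum>i\<in>(Basis::'a set). \<Sum>j\<in>(Basis::'a set). c * (1/2) ^ k * (norm y * norm y))"
    proof (simp only:, intro order_trans[OF sum_abs] sum_mono order_trans[OF sum_abs])
      fix i j :: 'a assume ij: "i \<in> Basis" "j \<in> Basis"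
      have "\<bar>(H k a i j - B' i j) / 2\<bar> \<le> c * (1/2) ^ k" using B'[OF ij that] by simp
      thus "\<bar>(H k a i j - B' i j) / 2 * ((y \<bullet> i) * (y \<bullet> j))\<bar> \<le> c * (1/2) ^ k * (norm y * norm y)"
        unfolding abs_mult using c ij by (intro mult_mono Basis_le_norm) auto
    qed
    thus ?thesis by (simp add: c3_def power2_eq_square mult_ac)
  qed
  show ?thesis
  proof (rule that[of A B])
    fix \<epsilon> :: real assume \<epsilon>: "\<epsilon> > 0"
    have "(\<lambda>k. (2 * c + c3 * ?o) * (1/2) ^ k) \<longlonglongrightarrow> (2 * c + c3 * ?o) * 0" by (intro tendsto_intros LIMSEQ_power_zero) auto
    hence "eventually (\<lambda>k. (2 * c + c3 * ?o) * (1/2) ^ k < \<epsilon> / 2) sequentially" using \<epsilon> by (intro order_tendstoD) auto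
    then obtain K where "\<And>k. k \<ge> K ==> (2 * c + c3 * ?o) * (1/2) ^ k < \<epsilon> / 2" by (auto simp: eventually_sequentially)
    note K = this
    define k where "k = max K k0"
    have k: "k \<ge> k0" "(2 * c + c3 * ?o) * (1/2) ^ k < \<epsilon> / 2" by (simp add: k_def, rule K, simp add: k_def)
    define e where "e = \<epsilon> / (2 * ?o)"
    have e: "e > 0" using \<epsilon> o by (simp add: e_def)
    obtain \<delta> where \<delta>: "\<delta> > 0" "\<And>y. norm y < \<delta> ==> \<bar>u k (a + y) - u k a - p k a y - H k a y y / 2\<bar> \<le> e * (norm y)^2"
      using C2_peano[OF C2 e] by blast
    show "\<exists>r0>0. \<forall>r. 0 < r \<and> r < r0 -->
     ball_L1 r (\<lambda>y. v (a + y) - v a - poly2 A B y) \<le> ennreal (\<epsilon> * r ^ (?d + 2))"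
    proof (intro exI[of _ \<delta>] conjI \<delta>(1) allI impI)
      fix r assume "0 < r \<and> r < \<delta>"
      hence r: "0 < r" "r < \<delta>" by auto
      define X where "X = ball_L1 r (\<lambda>y. v (a + y) - v a - poly2 A B y)"
      \<comment> \<open>\<open>m\<close> tends to infinity at the end; only the part of \<open>q m\<close> of order \<open>r^2\<close> survives.\<close>
      define q where "q m = 2 * M * (1/4) ^ m + c2 * r * (1/2) ^ m + (e + c3 * (1/2) ^ k) * r^2" for m :: nat
      have q0: "q m \<ge> 0" for m unfolding q_def using M c23 e r by (intro add_nonneg_nonneg mult_nonneg_nonneg) auto
      have main: "X \<le> ennreal (q m * (?o * r ^ ?d) + 2 * c * (1/2) ^ k * r ^ (?d + 2))" if m: "m \<ge> k" for m
      proof -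
        have "X \<le> (\<integral>+y. ennreal (q m) * indicator (ball 0 r) y + (\<Sum>j=k..<m. ennreal \<bar>f (Suc j) y - f j y\<bar> * indicator (ball 0 r) y))"
          unfolding X_def
        proof (intro nn_integral_mono)
          fix y
          show "ennreal \<bar>v (a + y) - v a - poly2 A B y\<bar> * indicator (ball 0 r) y \<le> ennreal (q m) * indicator (ball 0 r) y + (\<Sum>j=k..<m. ennreal \<bar>f (Suc j) y - f j y\<bar> * indicator (ball 0 r) y)"
          proof (cases "norm y < r")
            case True
            have tel: "f m y - f k y = (\<Sum>j=k..<m. f (Suc j) y - f j y)" using sum_Suc_diff'[OF m, of "\<lambda>j. f j y"] by simp
            have a1: "\<bar>f m y - f k y\<bar> \<le> (\<Sum>j=k..<m. \<bar>f (Suc j) y - f j y\<bar>)" unfolding tel by (rule sum_abs)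
            have a2: "\<bar>f k y - H k a y y / 2\<bar> \<le> e * (norm y)^2" unfolding f_def using True r by (intro \<delta>) simp
            have ny: "(norm y)^2 \<le> r^2" using True by (intro power_mono) auto
            have a3: "c2 * norm y * (1/2) ^ m \<le> c2 * r * (1/2) ^ m" using True c23 by (intro mult_right_mono mult_left_mono) auto
            have a4: "c3 * (norm y)^2 * (1/2) ^ k \<le> c3 * r^2 * (1/2) ^ k" using ny c23 by (intro mult_right_mono mult_left_mono) auto
            have a5: "e * (norm y)^2 \<le> e * r^2" using ny e by (intro mult_left_mono) auto
            have tri: "\<bar>v1 - v0 - (SA + SB)\<bar> \<le> 2 * b0 + b2 + b1 + b3 + S"
              if "\<bar>u1 - v1\<bar> \<le> b0" "\<bar>u0 - v0\<bar> \<le> b0" "\<bar>q - SA\<bar> \<le> b2" "\<bar>h - SB\<bar> \<le> b3"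
                "\<bar>(u1 - u0 - q) - fk\<bar> \<le> S" "\<bar>fk - h\<bar> \<le> b1" for v1 v0 SA SB b0 b1 b2 b3 S u1 u0 q h fk :: real
              using that unfolding abs_le_iff by linarith
            have mk: "m \<ge> k0" using m k(1) by simp
            have "\<bar>v (a + y) - v a - poly2 A B y\<bar> \<le> 2 * (M * (1/4) ^ m) + c2 * norm y * (1/2) ^ m + e * (norm y)^2 + c3 * (norm y)^2 * (1/2) ^ k + (\<Sum>j=k..<m. \<bar>f (Suc j) y - f j y\<bar>)"
              unfolding poly2_def by (rule tri[OF close close Ap[OF mk] BH[OF k(1)] a1[unfolded f_def[of m]] a2])
            also have "... \<le> 2 * M * (1/4) ^ m + c2 * r * (1/2) ^ m + e * r^2 + c3 * r^2 * (1/2) ^ k + (\<Sum>j=k..<m. \<bar>f (Suc j) y - f j y\<bar>)"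
              using a3 a4 a5 by linarith
            also have "... = q m + (\<Sum>j=k..<m. \<bar>f (Suc j) y - f j y\<bar>)" by (simp add: q_def algebra_simps)
            finally have "ennreal \<bar>v (a + y) - v a - poly2 A B y\<bar> \<le> ennreal (q m + (\<Sum>j=k..<m. \<bar>f (Suc j) y - f j y\<bar>))" by (rule ennreal_leI)
            also have "... = ennreal (q m) + (\<Sum>j=k..<m. ennreal \<bar>f (Suc j) y - f j y\<bar>)"
              using q0[of m] by (simp add: ennreal_plus sum_nonneg)
            finally show ?thesis using True by simp
          qed simp
        qed
        also have "... = ennreal (q m) * emeasure lborel (ball (0::'a) r) + (\<Sum>j=k..<m. \<integral>+y. ennreal \<bar>f (Suc j) y - f j y\<bar> * indicator (ball 0 r) y)"
        proof -
          have m1: "(\<lambda>y. ennreal \<bar>f (Suc j) y - f j y\<bar> * indicator (ball 0 r) y) \<in> borel_measurable lborel" for j by measurable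
          have m2: "(\<lambda>y. \<Sum>j=k..<m. ennreal \<bar>f (Suc j) y - f j y\<bar> * indicator (ball 0 r) y) \<in> borel_measurable lborel" by measurable
          have m3: "(\<lambda>y::'a. ennreal (q m) * indicator (ball 0 r) y) \<in> borel_measurable lborel" by measurable
          show ?thesis by (subst nn_integral_add[OF m3 m2], subst nn_integral_sum[OF m1], subst nn_integral_cmult_indicator) auto
        qed
        also have "... \<le> ennreal (q m) * emeasure lborel (ball (0::'a) r) + (\<Sum>j=k..<m. ennreal (c * (1/2) ^ j * r ^ (?d + 2)))"
          using k(1) by (intro add_left_mono sum_mono avg[unfolded D] r) auto
        also have "... = ennreal (q m * (?o * r ^ ?d) + (\<Sum>j=k..<m. c * (1/2) ^ j * r ^ (?d + 2)))"
        proof -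
          have "(\<Sum>j=k..<m. c * (1/2) ^ j * r ^ (?d + 2)) \<ge> 0" using c r by (intro sum_nonneg) simp
          moreover have "(\<Sum>j=k..<m. ennreal (c * (1/2) ^ j * r ^ (?d + 2))) = ennreal (\<Sum>j=k..<m. c * (1/2) ^ j * r ^ (?d + 2))"
            using c r by (intro sum_ennreal) simp
          ultimately show ?thesis using q0[of m] r o by (simp add: emeasure_ball ennreal_mult[symmetric] ennreal_plus[symmetric] del: ennreal_plus)
        qed
        also have "... \<le> ennreal (q m * (?o * r ^ ?d) + 2 * c * (1/2) ^ k * r ^ (?d + 2))"
        proof (intro ennreal_leI add_left_mono)
          have "(\<Sum>j=k..<m. (1/2::real) ^ j) \<le> 2 * (1/2) ^ k"
          proof -
            have "(\<Sum>j=k..<m. (1/2::real) ^ j) = 2 * (1/2) ^ k - 2 * (1/2) ^ m"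
              using m by (induction m rule: dec_induct) auto
            thus ?thesis by simp
          qed
          hence "c * r ^ (?d + 2) * (\<Sum>j=k..<m. (1/2::real) ^ j) \<le> c * r ^ (?d + 2) * (2 * (1/2) ^ k)"
            using c r by (intro mult_left_mono) auto
          thus "(\<Sum>j=k..<m. c * (1/2) ^ j * r ^ (?d + 2)) \<le> 2 * c * (1/2) ^ k * r ^ (?d + 2)"
            by (simp add: sum_distrib_left mult_ac)
        qed
        finally show ?thesis .
      qed
      define Q where "Q = (e + c3 * (1/2) ^ k) * r^2"
      have "(\<lambda>m. ennreal (q m * (?o * r ^ ?d) + 2 * c * (1/2) ^ k * r ^ (?d + 2))) \<longlonglongrightarrow> ennreal ((2 * M * 0 + c2 * r * 0 + Q) * (?o * r ^ ?d) + 2 * c * (1/2) ^ k * r ^ (?d + 2))"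
        unfolding q_def Q_def[symmetric] by (intro tendsto_ennrealI tendsto_intros LIMSEQ_power_zero) auto
      hence "X \<le> ennreal ((2 * M * 0 + c2 * r * 0 + Q) * (?o * r ^ ?d) + 2 * c * (1/2) ^ k * r ^ (?d + 2))"
        by (rule LIMSEQ_le_const) (use main in auto)
      also have "... \<le> ennreal (\<epsilon> * r ^ (?d + 2))"
      proof (intro ennreal_leI)
        have "(2 * M * 0 + c2 * r * 0 + Q) * (?o * r ^ ?d) + 2 * c * (1/2) ^ k * r ^ (?d + 2) = (e * ?o + (2 * c + c3 * ?o) * (1/2) ^ k) * r ^ (?d + 2)"
          unfolding Q_def by (simp add: power_add power2_eq_square algebra_simps)
        also have "e * ?o = \<epsilon> / 2" using o by (simp add: e_def)
        also have "(\<epsilon> / 2 + (2 * c + c3 * ?o) * (1/2) ^ k) * r ^ (?d + 2) \<le> \<epsilon> * r ^ (?d + 2)"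
          using k(2) r by (intro mult_right_mono) auto
        finally show "(2 * M * 0 + c2 * r * 0 + Q) * (?o * r ^ ?d) + 2 * c * (1/2) ^ k * r ^ (?d + 2) \<le> \<epsilon> * r ^ (?d + 2)" .
      qed
      finally show "ball_L1 r (\<lambda>y. v (a + y) - v a - poly2 A B y) \<le> ennreal (\<epsilon> * r ^ (?d + 2))" unfolding X_def .
    qed
  qed
qed

text \<open>
Let \<open>E\<close> be the remainder and average over the ball of radius \<open>s = \<eta> * norm y\<close> about \<open>y\<close>. The potential
changes by \<open>O(s^2)\<close>, the polynomial by the mean of its quadratic part, also \<open>O(s^2)\<close>; the average of
\<open>E\<close> is small by assumption. With \<open>\<eta>\<close> small and then \<open>y\<close> small all errors are below
\<open>\<epsilon> * (norm y)^2\<close>.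
\<close>

lemma average_to_pointwise:
  fixes g :: "'a::euclidean_space => real"
  assumes d: "DIM('a) \<ge> 3" and g: "bdd_density L g"
    and avg: "\<And>\<epsilon>. \<epsilon> > 0 ==> \<exists>r0>0. \<forall>r. 0 < r \<and> r < r0 -->
     ball_L1 r (\<lambda>y. pot g (a + y) - pot g a - poly2 A B y) \<le> ennreal (\<epsilon> * r ^ (DIM('a) + 2))"
    and \<epsilon>: "\<epsilon> > 0"
  shows "\<exists>r0>0. \<forall>y. norm y < r0 --> \<bar>pot g (a + y) - pot g a - poly2 A B y\<bar> \<le> \<epsilon> * (norm y)^2"
proof -
  note [measurable] = bdd_densityD(1)[OF g]
  let ?d = "DIM('a)" and ?bm = "bump_mass TYPE('a)"
  have bm: "?bm > 0" by (rule bump_mass_pos)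
  have L: "L \<ge> 0" using bdd_densityD(5)[OF g] .
  define Q where "Q y = (\<Sum>j\<in>Basis. \<Sum>k\<in>Basis. B j k * (y \<bullet> j) * (y \<bullet> k))" for y
  define CB where "CB = (\<Sum>j\<in>Basis. \<Sum>k\<in>Basis. \<bar>B j k\<bar>)"
  have CB0: "CB \<ge> 0" unfolding CB_def by (intro sum_nonneg) auto
  have QB: "\<bar>Q h\<bar> \<le> CB * (norm h)^2" for h
    unfolding Q_def CB_def sum_distrib_right
  proof (intro order_trans[OF sum_abs] sum_mono order_trans[OF sum_abs])
    fix i j :: 'a assume ij: "i \<in> Basis" "j \<in> Basis"
    have "\<bar>h \<bullet> i\<bar> * \<bar>h \<bullet> j\<bar> \<le> norm h * norm h" using ij by (intro mult_mono Basis_le_norm) auto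
    thus "\<bar>B i j * (h \<bullet> i) * (h \<bullet> j)\<bar> \<le> \<bar>B i j\<bar> * (norm h)^2"
      by (simp add: abs_mult power2_eq_square mult.assoc mult_left_mono)
  qed
  have Qsym: "poly2 A B (y - h) + poly2 A B (y + h) = 2 * poly2 A B y + 2 * Q h" for y h
    unfolding poly2_def Q_def
    by (simp add: inner_diff_left inner_add_left algebra_simps sum.distrib sum_subtractf sum_distrib_left)
  have contQ: "continuous_on UNIV Q" unfolding Q_def by (intro continuous_intros)
  define E where "E y = pot g (a + y) - pot g a - poly2 A B y" for y
  have [measurable]: "E \<in> borel_measurable borel" unfolding E_def by measurable
  define C where "C = L * diff_const TYPE('a) + CB"
  have C: "C \<ge> 0" using L CB0 diff_const_pos[where 'a='a] by (simp add: C_def)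
  \<comment> \<open>The errors of order \<open>s^2\<close> sum up to \<open>C * \<eta>^2 * (norm y)^2\<close>, which is to be half of the target.\<close>
  define \<eta> where "\<eta> = min 1 (sqrt (\<epsilon> / (2 * (C + 1))))"
  have \<eta>: "\<eta> > 0" "\<eta> \<le> 1" using \<epsilon> C by (auto simp: \<eta>_def)
  have "\<eta>^2 \<le> (sqrt (\<epsilon> / (2 * (C + 1))))^2" using \<eta>(1) unfolding \<eta>_def by (intro power_mono) auto
  also have "... = \<epsilon> / (2 * (C + 1))" using \<epsilon> C by simp
  finally have "(C + 1) * \<eta>^2 \<le> \<epsilon> / 2" using C by (simp add: field_simps)
  moreover have "C * \<eta>^2 \<le> (C + 1) * \<eta>^2" by (intro mult_right_mono) auto
  ultimately have C\<eta>: "C * \<eta>^2 \<le> \<epsilon> / 2" by linarith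
  define e' where "e' = \<epsilon> / 2 * (?bm * \<eta> ^ ?d) / 3 ^ (?d + 2)"
  have e': "e' > 0" using \<epsilon> bm \<eta> by (simp add: e'_def)
  obtain r0 where r0: "r0 > 0" "\<And>r. 0 < r ==> r < r0 ==> ball_L1 r E \<le> ennreal (e' * r ^ (?d + 2))"
    using avg[OF e'] unfolding E_def by blast
  have "\<bar>E y\<bar> \<le> \<epsilon> * (norm y)^2" if y: "norm y < r0 / 3" for y
  proof (cases "y = 0")
    case True
    thus ?thesis by (simp add: E_def poly2_def)
  next
    case False
    hence ny: "norm y > 0" by simp
    define s where "s = \<eta> * norm y"
    have s: "s > 0" "s \<le> norm y" using \<eta> ny by (auto simp: s_def mult_left_le_one_le)
    let ?x = "a + y"
    have bz: "bump s h = 0" if "norm h > s" for h :: 'a using that s by (intro bump_eq_0) auto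
    have iP: "integrable lborel (\<lambda>h. bump s h * poly2 A B (y - h))" "integrable lborel (\<lambda>h. bump s h * poly2 A B (y + h))"
      by (rule integrable_continuous_compact_support[of _ s]; (intro continuous_intros)?; simp add: bz)+
    have iQ: "integrable lborel (\<lambda>h. bump s h * Q h)"
      by (rule integrable_continuous_compact_support[of _ s]) (auto intro!: continuous_intros contQ simp: bz)
    have "(\<integral>\<^sub>L h. bump s h * poly2 A B (y + h)) = (\<integral>\<^sub>L h. bump s (0 - h) * poly2 A B (y + (0 - h)))"
      by (rule integral_reflect[symmetric]) measurable
    hence reflP: "(\<integral>\<^sub>L h. bump s h * poly2 A B (y + h)) = (\<integral>\<^sub>L h. bump s h * poly2 A B (y - h))" by simp
    have ib: "integrable lborel (bump s :: 'a => real)" by (rule integrable_bump[OF s(1)])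
    have "(\<integral>\<^sub>L h. bump s h * poly2 A B (y - h)) + (\<integral>\<^sub>L h. bump s h * poly2 A B (y + h))
       = (\<integral>\<^sub>L h. 2 * poly2 A B y * bump s h + 2 * (bump s h * Q h))"
    proof (subst Bochner_Integration.integral_add[symmetric, OF iP], rule Bochner_Integration.integral_cong[OF refl])
      fix h
      have "bump s h * (poly2 A B (y - h) + poly2 A B (y + h)) = bump s h * (2 * poly2 A B y + 2 * Q h)" unfolding Qsym ..
      thus "bump s h * poly2 A B (y - h) + bump s h * poly2 A B (y + h) = 2 * poly2 A B y * bump s h + 2 * (bump s h * Q h)"
        by (simp add: algebra_simps)
    qed
    also have "... = 2 * poly2 A B y + 2 * (\<integral>\<^sub>L h. bump s h * Q h)"
      using ib iQ integral_bump[OF s(1), where 'a='a] by simp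
    finally have P: "(\<integral>\<^sub>L h. bump s h * poly2 A B (y - h)) = poly2 A B y + (\<integral>\<^sub>L h. bump s h * Q h)"
      unfolding reflP by simp
    have Qint: "\<bar>\<integral>h. bump s h * Q h \<partial>lborel\<bar> \<le> CB * s^2"
    proof -
      have "\<bar>\<integral>h. bump s h * Q h \<partial>lborel\<bar> \<le> (\<integral>\<^sub>L h. \<bar>bump s h * Q h\<bar>)" by (rule integral_abs_bound)
      also have "... \<le> (\<integral>\<^sub>L (h::'a). CB * s^2 * bump s h)"
      proof (rule integral_mono[OF integrable_abs[OF iQ]])
        fix h :: 'a
        show "\<bar>bump s h * Q h\<bar> \<le> CB * s^2 * bump s h"
        proof (cases "norm h > s")
          case False
          hence "(norm h)^2 \<le> s^2" by (intro power_mono) auto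
          hence "\<bar>Q h\<bar> \<le> CB * s^2" using QB[of h] mult_left_mono[OF _ CB0, of "(norm h)^2" "s^2"] by linarith
          hence "\<bar>Q h\<bar> * bump s h \<le> CB * s^2 * bump s h" using s by (intro mult_right_mono) auto
          thus ?thesis using s by (simp add: abs_mult mult.commute[of "bump s h"])
        qed (simp add: bz)
      qed (use ib in simp)
      also have "... = CB * s^2" using integral_bump[OF s(1), where 'a='a] by simp
      finally show ?thesis .
    qed
    have iu: "integrable lborel (\<lambda>z. bump s (?x - z) * pot g z)"
      by (rule integrable_smooth[OF s(1) _ pot_nonneg[OF d g] pot_bound[OF d g]]) measurable
    have iu': "integrable lborel (\<lambda>h. bump s h * pot g (?x - h))"
    proof -
      have "(\<integral>+h. ennreal (norm (bump s h * pot g (?x - h)))) = (\<integral>+z. ennreal (norm (bump s (?x - z) * pot g (?x - (?x - z)))))"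
        by (rule nn_integral_reflect[symmetric]) measurable
      also have "... < \<infinity>" using iu unfolding integrable_iff_bounded by simp
      finally show ?thesis by (intro integrableI_bounded) auto
    qed
    have su: "smooth s (pot g) ?x = (\<integral>\<^sub>L h. bump s h * pot g (?x - h))"
    proof -
      have "(\<integral>\<^sub>L h. bump s h * pot g (?x - h)) = (\<integral>\<^sub>L z. bump s (?x - z) * pot g (?x - (?x - z)))"
        by (rule integral_reflect[symmetric]) measurable
      thus ?thesis by (simp add: smooth_def)
    qed
    have iE: "integrable lborel (\<lambda>h. bump s h * E (y - h))"
      using Bochner_Integration.integrable_diff[OF Bochner_Integration.integrable_diff[OF iu' integrable_mult_right[OF ib, of "pot g a"]] iP(1)]
      by (simp add: E_def algebra_simps)
    have "(\<integral>\<^sub>L h. bump s h * E (y - h)) = (\<integral>\<^sub>L h. bump s h * pot g (?x - h) - pot g a * bump s h - bump s h * poly2 A B (y - h))"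
      by (intro Bochner_Integration.integral_cong refl) (simp add: E_def algebra_simps)
    also have "... = smooth s (pot g) ?x - pot g a - (poly2 A B y + (\<integral>\<^sub>L h. bump s h * Q h))"
      unfolding su P[symmetric] using iu' ib iP(1) integral_bump[OF s(1), where 'a='a] by simp
    finally have Eid: "E y = (pot g ?x - smooth s (pot g) ?x) + (\<integral>\<^sub>L h. bump s h * E (y - h)) + (\<integral>\<^sub>L h. bump s h * Q h)"
      by (simp add: E_def)
    have Eint: "\<bar>\<integral>h. bump s h * E (y - h) \<partial>lborel\<bar> \<le> \<epsilon> / 2 * (norm y)^2"
    proof -
      have "ennreal \<bar>\<integral>h. bump s h * E (y - h) \<partial>lborel\<bar> \<le> (\<integral>+h. ennreal \<bar>bump s h * E (y - h)\<bar>)"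
        using integral_norm_bound_ennreal[OF iE] by simp
      also have "... \<le> (\<integral>+h. ennreal (1 / (?bm * s ^ ?d)) * (ennreal \<bar>E (y - h)\<bar> * indicator (ball 0 (3 * norm y)) (y - h)))"
      proof (intro nn_integral_mono)
        fix h
        show "ennreal \<bar>bump s h * E (y - h)\<bar> \<le> ennreal (1 / (?bm * s ^ ?d)) * (ennreal \<bar>E (y - h)\<bar> * indicator (ball 0 (3 * norm y)) (y - h))"
        proof (cases "norm h > s")
          case False
          have "norm (y - h) < 3 * norm y" using norm_triangle_ineq4[of y h] False s ny by linarith
          hence "y - h \<in> ball 0 (3 * norm y)" unfolding mem_ball_0 .
          moreover have "\<bar>bump s h * E (y - h)\<bar> \<le> 1 / (?bm * s ^ ?d) * \<bar>E (y - h)\<bar>"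
            unfolding abs_mult using s bump_le[OF s(1), of h] by (intro mult_right_mono) auto
          ultimately show ?thesis using bm s by (simp add: ennreal_mult[symmetric] ennreal_leI del: mem_ball)
        qed (simp add: bz)
      qed
      also have "... = ennreal (1 / (?bm * s ^ ?d)) * (\<integral>+h. ennreal \<bar>E (y - h)\<bar> * indicator (ball 0 (3 * norm y)) (y - h))"
        by (rule nn_integral_cmult) measurable
      also have "(\<integral>+h. ennreal \<bar>E (y - h)\<bar> * indicator (ball 0 (3 * norm y)) (y - h)) = (\<integral>+h. ennreal \<bar>E h\<bar> * indicator (ball 0 (3 * norm y)) h)"
        by (rule nn_integral_reflect) measurable
      also have "ennreal (1 / (?bm * s ^ ?d)) * ... \<le> ennreal (1 / (?bm * s ^ ?d)) * ennreal (e' * (3 * norm y) ^ (?d + 2))"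
        using y ny by (intro mult_left_mono r0) auto
      also have "... = ennreal (1 / (?bm * s ^ ?d) * (e' * (3 * norm y) ^ (?d + 2)))"
        using bm s e' by (simp add: ennreal_mult[symmetric])
      finally have "\<bar>\<integral>h. bump s h * E (y - h) \<partial>lborel\<bar> \<le> 1 / (?bm * s ^ ?d) * (e' * (3 * norm y) ^ (?d + 2))"
        using bm s e' by simp
      also have "... = \<epsilon> / 2 * (norm y)^2"
        using bm \<eta> ny unfolding e'_def s_def power_mult_distrib power_add by (simp add: field_simps)
      finally show ?thesis .
    qed
    have "\<bar>E y\<bar> \<le> L * diff_const TYPE('a) * s^2 + \<epsilon> / 2 * (norm y)^2 + CB * s^2"
      using Eid Eint Qint pot_minus_smooth_le[OF d s(1) g, of ?x] by linarith
    also have "... = (C * \<eta>^2) * (norm y)^2 + \<epsilon> / 2 * (norm y)^2" by (simp add: C_def s_def power_mult_distrib algebra_simps)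
    also have "... \<le> \<epsilon> / 2 * (norm y)^2 + \<epsilon> / 2 * (norm y)^2" using C\<eta> by (intro add_right_mono mult_right_mono) auto
    finally show ?thesis by simp
  qed
  thus ?thesis using r0(1) unfolding E_def by (intro exI[of _ "r0 / 3"]) auto
qed

text \<open>
The measures \<open>\<beta> k\<close> with density \<open>W k\<close> dominate the Hessians of \<open>u (k + 1) - u k\<close> and have mass of order
\<open>16 ^ (- k)\<close>. Their maximal sets at level \<open>4 ^ (- k)\<close> miss a set of volume of order \<open>4 ^ (- k)\<close>, so
almost every point eventually belongs to all of them.
\<close>

theorem pot_second_order:
  fixes g :: "'a::euclidean_space => real"
  assumes d: "DIM('a) \<ge> 3" and g: "bdd_density L g"
  shows "AE a in lborel. \<exists>A B. \<forall>\<epsilon>>0. \<exists>r0>0. \<forall>y. norm y < r0 --> \<bar>pot g (a + y) - pot g a - poly2 A B y\<bar> \<le> \<epsilon> * (norm y)^2"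
proof -
  note [measurable] = bdd_densityD(1)[OF g]
  let ?d = "DIM('a)" and ?o = "unit_ball_vol (real DIM('a))" and ?dc = "diff_const TYPE('a)" and ?vc = "vitali_const TYPE('a)" and ?qc = "quad_const TYPE('a)"
  have o: "?o > 0" by simp
  have L: "L \<ge> 0" using bdd_densityD(5)[OF g] .
  obtain \<rho> where \<rho>: "\<And>k. \<rho> k > 0" "\<And>k. \<rho> k \<le> (1/2) ^ k"
     "\<And>k. (\<integral>+x. ennreal ((smooth (\<rho> k) g x - g x)^2)) \<le> ennreal ((1/16) ^ k)"
    using smooth_L2_sequence[OF g] by blast
  define u where "u k = smooth (\<rho> k) (pot g)" for k
  define p where "p k = smoothD (\<rho> k) (pot g)" for k
  define H where "H k = smoothH (\<rho> k) (pot g)" for k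
  let ?U = "2 * newton_const TYPE('a) * L + (\<integral>\<^sub>L y. g y)"
  have [measurable]: "u k \<in> borel_measurable borel" for k unfolding u_def by measurable
  have pb: "\<bar>pot g x\<bar> \<le> ?U" for x using pot_nonneg[OF d g, of x] pot_bound[OF d g, of x] by simp
  have C2: "C2_fun (u k) (p k) (H k)" for k
    unfolding u_def p_def H_def by (rule C2_smooth[OF \<rho>(1) _ pb]) measurable
  note C2d = C2_fun_diff[OF C2 C2]
  define K where "K k = 16 * ?dc^2 * (1/16) ^ k" for k :: nat
  have K0: "K k \<ge> 0" for k by (simp add: K_def)
  \<comment> \<open>Both mollifications are within \<open>4 ^ (- k)\<close> of \<open>g\<close> in square norm.\<close>
  have f2: "(\<integral>+x. ennreal ((smooth (\<rho> (Suc k)) g x - smooth (\<rho> k) g x)^2)) \<le> ennreal (4 * (1/16) ^ k)" for k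
  proof -
    have "(\<integral>+x. ennreal ((smooth (\<rho> (Suc k)) g x - smooth (\<rho> k) g x)^2)) \<le>
      (\<integral>+x. 2 * ennreal ((smooth (\<rho> (Suc k)) g x - g x)^2) + 2 * ennreal ((smooth (\<rho> k) g x - g x)^2))"
    proof (intro nn_integral_mono)
      fix x
      have sq: "(b - c)^2 \<le> 2 * (b - a)^2 + 2 * (c - a)^2" for a b c :: real
        using zero_le_power2[of "(b - a) + (c - a)"] by (simp add: power2_eq_square algebra_simps)
      have "ennreal ((smooth (\<rho> (Suc k)) g x - smooth (\<rho> k) g x)^2) \<le> ennreal (2 * (smooth (\<rho> (Suc k)) g x - g x)^2 + 2 * (smooth (\<rho> k) g x - g x)^2)"
        by (intro ennreal_leI sq)
      thus "ennreal ((smooth (\<rho> (Suc k)) g x - smooth (\<rho> k) g x)^2) \<le> 2 * ennreal ((smooth (\<rho> (Suc k)) g x - g x)^2) + 2 * ennreal ((smooth (\<rho> k) g x - g x)^2)"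
        by (simp add: ennreal_mult)
    qed
    also have "... = 2 * (\<integral>+x. ennreal ((smooth (\<rho> (Suc k)) g x - g x)^2)) + 2 * (\<integral>+x. ennreal ((smooth (\<rho> k) g x - g x)^2))"
      by (simp add: nn_integral_add nn_integral_cmult)
    also have "... \<le> 2 * ennreal ((1/16) ^ Suc k) + 2 * ennreal ((1/16) ^ k)" by (intro add_mono mult_left_mono \<rho>) auto
    also have "... = ennreal (2 * (1/16) ^ Suc k + 2 * (1/16) ^ k)"
      by (subst ennreal_plus) (auto simp: ennreal_mult simp del: power_Suc)
    also have "... \<le> ennreal (4 * (1/16) ^ k)" by (intro ennreal_leI) simp
    finally show ?thesis .
  qed
  have "\<exists>W. W \<in> borel_measurable borel \<and> (\<integral>+x. W x) \<le> ennreal (?qc^2 * K k) \<and>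
    (\<forall>x h h'. ennreal ((H (Suc k) x h h' - H k x h h')^2) \<le> ennreal ((norm h * norm h')^2) * W x)" for k
  proof -
    have "second_difference_energy (\<lambda>x. u (Suc k) x - u k x) s
         \<le> ennreal (K k * s ^ 4)" if s: "s > 0" for s
    proof -
      note second_difference_bound(2)[OF d g \<rho>(1)[of k] \<rho>(1)[of "Suc k"] s, folded u_def]
      also have "4 * (ennreal (?dc * s^2))^2 * (\<integral>+x. ennreal ((smooth (\<rho> (Suc k)) g x - smooth (\<rho> k) g x)^2)) \<le>
         4 * (ennreal (?dc * s^2))^2 * ennreal (4 * (1/16) ^ k)" by (intro mult_left_mono f2) simp
      also have "... = ennreal (4 * (?dc * s^2)^2 * (4 * (1/16) ^ k))"
      proof -
        have "4 * (ennreal A)^2 * ennreal B = ennreal (4 * A^2 * B)" if "A \<ge> 0" "B \<ge> 0" for A B :: real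
          using that by (simp add: ennreal_mult ennreal_power)
        thus ?thesis using diff_const_pos[where 'a='a] by simp
      qed
      also have "4 * (?dc * s^2)^2 * (4 * (1/16) ^ k) = K k * s ^ 4"
        by (simp add: K_def power_mult_distrib power_mult[symmetric])
      finally show ?thesis .
    qed
    note bnd = this
    have m: "(\<lambda>x. u (Suc k) x - u k x) \<in> borel_measurable borel" by measurable
    show ?thesis by (rule hessian_L2[OF C2d[of "Suc k" k] m bnd K0]) blast+
  qed
  then obtain W where W: "\<And>k. W k \<in> borel_measurable borel" "\<And>k. (\<integral>+x. W k x) \<le> ennreal (?qc^2 * K k)"
    "\<And>k x h h'. ennreal ((H (Suc k) x h h' - H k x h h')^2) \<le> ennreal ((norm h * norm h')^2) * W k x"
    by metis
  note [measurable] = W(1)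
  define \<beta> where "\<beta> k = density lborel (W k)" for k
  have s\<beta>: "sets (\<beta> k) = sets borel" for k by (simp add: \<beta>_def)
  have e\<beta>: "emeasure (\<beta> k) S = (\<integral>+x. W k x * indicator S x)" if "S \<in> sets borel" for k S
    unfolding \<beta>_def using that by (subst emeasure_density) auto
  have \<beta>U: "emeasure (\<beta> k) UNIV \<le> ennreal (?qc^2 * K k)" for k using W(2)[of k] by (simp add: e\<beta>)
  have \<beta>fin: "emeasure (\<beta> k) UNIV < \<infinity>" for k using \<beta>U[of k] by (rule order.strict_trans1) simp
  define T where "T k = - maximal_set (\<beta> k) ((1/4) ^ k)" for k
  have T: "T k \<in> sets lborel" for k unfolding T_def using closed_maximal_set[OF s\<beta>] by auto
  define c0 where "c0 = ?vc * ?qc^2 * 16 * ?dc^2"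
  have c0: "c0 \<ge> 0" using vitali_const_pos[where 'a='a] by (simp add: c0_def)
  have eT: "emeasure lborel (T k) \<le> ennreal (c0 * (1/4) ^ k)" for k
  proof -
    have "emeasure lborel (T k) \<le> ennreal (?vc / (1/4) ^ k) * emeasure (\<beta> k) UNIV"
      unfolding T_def by (rule emeasure_compl_maximal_set[OF s\<beta> \<beta>fin]) simp
    also have "... \<le> ennreal (?vc / (1/4) ^ k) * ennreal (?qc^2 * K k)" by (intro mult_left_mono \<beta>U) simp
    also have "... = ennreal (?vc / (1/4) ^ k * (?qc^2 * K k))"
      using vitali_const_pos[where 'a='a] K0[of k] by (subst ennreal_mult) auto
    also have "?vc / (1/4) ^ k * (?qc^2 * K k) = c0 * (1/4) ^ k"
    proof -
      have "(1/16::real) ^ k = (1/4) ^ k * (1/4) ^ k" by (simp add: power_mult_distrib[symmetric])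
      thus ?thesis by (simp add: K_def c0_def)
    qed
    finally show ?thesis .
  qed
  have "AE x in lborel. eventually (\<lambda>k. x \<in> space lborel - T k) sequentially"
  proof (rule borel_cantelli_AE1[OF T])
    show "emeasure lborel (T k) < \<infinity>" for k using eT[of k] by (rule order.strict_trans1) simp
    show "summable (\<lambda>k. measure lborel (T k))"
    proof (rule summable_comparison_test'[of "\<lambda>k. c0 * (1/4) ^ k" 0])
      show "summable (\<lambda>k. c0 * (1/4) ^ k)" by (intro summable_mult summable_geometric) simp
      show "norm (measure lborel (T k)) \<le> c0 * (1/4) ^ k" for k
        using enn2real_mono[OF eT[of k]] c0 by (simp add: measure_def)
    qed
  qed
  thus ?thesis
  proof eventually_elim
    case (elim a)
    then obtain k0 where k0: "\<And>k. k \<ge> k0 ==> a \<in> maximal_set (\<beta> k) ((1/4) ^ k)"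
      by (auto simp: eventually_sequentially T_def)
    define c where "c = (1 + ?o) + (1 + 1 / ?o)"
    have c: "c > 0" using o by (simp add: c_def add_pos_pos)
    have M: "(\<integral>+x. W k x * indicator (ball a r) x) \<le> ennreal (((1/2) ^ k)^2 * r ^ ?d)" if "k \<ge> k0" "r > 0" for k r
    proof -
      have "((1/2::real) ^ k)^2 = (1/4) ^ k" by (simp add: power2_eq_square power_mult_distrib[symmetric])
      thus ?thesis using maximal_setD[OF k0[OF that(1)] that(2)] by (simp add: e\<beta>)
    qed
    obtain A B where AB: "\<And>\<epsilon>. \<epsilon> > 0 ==> \<exists>r0>0. \<forall>r. 0 < r \<and> r < r0 -->
     ball_L1 r (\<lambda>y. pot g (a + y) - pot g a - poly2 A B y) \<le> ennreal (\<epsilon> * r ^ (?d + 2))"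
    proof (rule taylor_telescope[OF C2, where v = "pot g" and M = "L * ?dc" and a = a and c = c and ?k0.0 = k0])
      fix k x
      have "\<bar>u k x - pot g x\<bar> \<le> L * ?dc * (\<rho> k)^2"
        using pot_minus_smooth_le[OF d \<rho>(1) g, of x k] unfolding u_def by (simp add: abs_minus_commute)
      also have "... \<le> L * ?dc * ((1/2) ^ k)^2"
        using L diff_const_pos[where 'a='a] less_imp_le[OF \<rho>(1)] by (intro mult_left_mono power_mono \<rho>) auto
      also have "((1/2::real) ^ k)^2 = (1/4) ^ k" by (simp add: power2_eq_square power_mult_distrib[symmetric])
      finally show "\<bar>u k x - pot g x\<bar> \<le> L * ?dc * (1/4) ^ k" .
    next
      fix k and r :: real assume k: "k \<ge> k0" and r: "r > 0"
      have "ball_L1 r (\<lambda>y. (u (Suc k) (a + y) - u k (a + y)) - (u (Suc k) a - u k a) - (p (Suc k) a y - p k a y))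
        \<le> ennreal ((1 + ?o) * (1/2) ^ k * r ^ (?d + 2))"
        by (rule taylor_average[OF C2d W(1) W(3) _ M[OF k] r]) auto
      also have "... \<le> ennreal (c * (1/2) ^ k * r ^ (?d + 2))"
        using o r by (intro ennreal_leI mult_right_mono) (auto simp: c_def)
      finally show "ball_L1 r (\<lambda>y. (u (Suc k) (a + y) - u k (a + y)) - (u (Suc k) a - u k a) - (p (Suc k) a y - p k a y))
        \<le> ennreal (c * (1/2) ^ k * r ^ (?d + 2))" .
    next
      fix k and h h' :: 'a assume k: "k \<ge> k0"
      have "\<bar>H (Suc k) a h h' - H k a h h'\<bar> \<le> (1 + 1 / ?o) * (1/2) ^ k * (norm h * norm h')"
        by (rule hess_at_point[OF C2d W(1) W(3) _ M[OF k]]) auto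
      also have "... \<le> c * (1/2) ^ k * (norm h * norm h')"
        using o by (intro mult_right_mono) (auto simp: c_def)
      finally show "\<bar>H (Suc k) a h h' - H k a h h'\<bar> \<le> c * (1/2) ^ k * (norm h * norm h')" .
    qed (use c in auto)
    show ?case using average_to_pointwise[OF d g AB] by blast
  qed
qed

section \<open>Potentials of measures\<close>

definition nkern :: "'a::euclidean_space => 'a => ennreal" where
  "nkern x y = e2ennreal (newton_kernel x y)"

lemma nkern_eq: "nkern x y = (if x = y then \<infinity> else ennreal (newton (x - y)))"
  by (simp add: nkern_def newton_kernel_def newton_def dist_norm e2ennreal_infty)

lemma nkern_commute: "nkern x y = nkern y x"
  using newton_minus[of "x - y"] by (auto simp: nkern_eq)

lemma newton_le_nkern: "ennreal (newton (x - y)) \<le> nkern x y" by (simp add: nkern_eq)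

lemma measurable_nkern [measurable (raw)]:
  assumes [measurable]: "f \<in> borel_measurable M" "g \<in> borel_measurable M"
  shows "(\<lambda>z. nkern (f z) (g z)) \<in> borel_measurable M"
  unfolding nkern_eq by measurable

definition potM :: "'a::euclidean_space measure => 'a => real" where
  "potM M x = (\<integral>y. newton (x - y) \<partial>M)"

abbreviation npot :: "'a::euclidean_space measure => 'a => ennreal" where
  "npot \<tau> x \<equiv> (\<integral>\<^sup>+y. nkern x y \<partial>\<tau>)"

definition pot_finite :: "'a::euclidean_space measure => 'a => bool" where
  "pot_finite M x \<longleftrightarrow> npot M x < \<infinity>"

lemma pot_finiteD:
  fixes M :: "'a::euclidean_space measure"
  assumes M[measurable_cong, simp]: "sets M = sets borel" and x: "pot_finite M x"
  shows "AE y in M. y \<noteq> x" "integrable M (\<lambda>y. newton (x - y))"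
proof -
  have "AE y in M. nkern x y \<noteq> \<infinity>"
    using x unfolding pot_finite_def by (intro nn_integral_noteq_infinite) (auto simp: less_top[symmetric])
  thus "AE y in M. y \<noteq> x" by eventually_elim (auto simp: nkern_eq)
  have "(\<integral>\<^sup>+y. ennreal (newton (x - y)) \<partial>M) \<le> npot M x" by (intro nn_integral_mono newton_le_nkern)
  hence "(\<integral>\<^sup>+y. ennreal (newton (x - y)) \<partial>M) < \<infinity>" using x unfolding pot_finite_def by (rule order.strict_trans1)
  thus "integrable M (\<lambda>y. newton (x - y))" by (intro integrableI_nonneg) auto
qed

text \<open>
Tonelli's theorem on each ball of an exhausting sequence.
\<close>

lemma AE_kernel_integral_finite:
  fixes k :: "'a::euclidean_space => 'a => ennreal"
  assumes M[measurable_cong, simp]: "sets M = sets borel" and fin: "emeasure M UNIV < \<infinity>"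
    and [measurable]: "case_prod k \<in> borel_measurable (borel \<Otimes>\<^sub>M borel)"
    and h: "\<And>n y. (\<integral>+x. k x y * indicator (cball 0 (Suc n)) x) \<le> h n y" "\<And>n. (\<integral>\<^sup>+y. h n y \<partial>M) < \<infinity>"
  shows "AE x in lborel. (\<integral>\<^sup>+y. k x y \<partial>M) < \<infinity>"
proof -
  have sp: "space M = UNIV" using sets_eq_imp_space_eq[OF M] by simp
  interpret finite_measure M using fin by (intro finite_measureI) (auto simp: sp)
  interpret P: pair_sigma_finite M "lborel :: 'a measure" ..
  have "AE x in lborel. \<forall>n::nat. (\<integral>\<^sup>+y. k x y * indicator (cball 0 (Suc n)) x \<partial>M) \<noteq> \<infinity>"
  proof (subst AE_all_countable, intro allI)
    fix n :: nat
    have "(\<integral>+x. \<integral>\<^sup>+y. k x y * indicator (cball 0 (Suc n)) x \<partial>M) = (\<integral>\<^sup>+y. (\<integral>+x. k x y * indicator (cball 0 (Suc n)) x) \<partial>M)"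
      by (rule P.Fubini') measurable
    also have "... \<le> (\<integral>\<^sup>+y. h n y \<partial>M)" by (intro nn_integral_mono h)
    also have "... < \<infinity>" by (rule h)
    finally have "(\<integral>+x. \<integral>\<^sup>+y. k x y * indicator (cball 0 (Suc n)) x \<partial>M) \<noteq> \<infinity>" by simp
    thus "AE x in lborel. (\<integral>\<^sup>+y. k x y * indicator (cball 0 (Suc n)) x \<partial>M) \<noteq> \<infinity>"
      by (intro nn_integral_noteq_infinite) auto
  qed
  thus ?thesis
  proof eventually_elim
    case (elim x)
    obtain n :: nat where "norm x < real n" using reals_Archimedean2 by blast
    hence n: "norm x \<le> real (Suc n)" by simp
    have "(\<integral>\<^sup>+y. k x y * indicator (cball 0 (Suc n)) x \<partial>M) \<noteq> \<infinity>" using elim by blast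
    thus ?case using n by (simp add: less_top)
  qed
qed

lemma AE_pot_finite:
  fixes M :: "'a::euclidean_space measure"
  assumes d: "DIM('a) \<ge> 3" and M: "sets M = sets borel" and fin: "emeasure M UNIV < \<infinity>"
  shows "AE x in lborel. pot_finite M x"
  unfolding pot_finite_def
proof (rule AE_kernel_integral_finite[OF M fin])
  show "case_prod nkern \<in> borel_measurable (borel \<Otimes>\<^sub>M (borel :: 'a measure))" unfolding split_beta by measurable
  show "(\<integral>+x. nkern x y * indicator (cball 0 (Suc n)) x) \<le> ennreal (2 * newton_const TYPE('a) * (real (Suc n))^2)" for n and y :: 'a
  proof -
    have "(\<integral>+x. nkern x y * indicator (cball 0 (Suc n)) x) = (\<integral>+x. ennreal (newton (y - x)) * indicator (cball 0 (Suc n)) x)"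
    proof (rule nn_integral_cong_AE)
      have "AE x in lborel. x \<noteq> y" by (rule AE_lborel_singleton)
      thus "AE x in lborel. nkern x y * indicator (cball 0 (Suc n)) x = ennreal (newton (y - x)) * indicator (cball 0 (Suc n)) x"
      proof eventually_elim
        case (elim x)
        thus ?case using newton_minus[of "x - y"] by (simp add: nkern_eq)
      qed
    qed
    also have "... \<le> ennreal (2 * newton_const TYPE('a) * (real (Suc n))^2)" by (intro nn_integral_newton_shift d) simp
    finally show ?thesis .
  qed
  show "(\<integral>\<^sup>+y. ennreal (2 * newton_const TYPE('a) * (real (Suc n))^2) \<partial>M) < \<infinity>" for n
    using fin sets_eq_imp_space_eq[OF M] by (simp add: ennreal_mult_less_top)
qed

text \<open>
The part of \<open>M\<close> on its maximal set is absolutely continuous, and its Radon-Nikodym density inherits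
the bound.
\<close>

lemma bounded_part_density:
  fixes M :: "'a::euclidean_space measure"
  assumes M[measurable_cong, simp]: "sets M = sets borel" and fin: "emeasure M UNIV < \<infinity>" and l: "l > 0"
  obtains g L where "bdd_density L g" "density M (indicator (maximal_set M l)) = density lborel (\<lambda>x. ennreal (g x))"
proof -
  have sp: "space M = UNIV" using sets_eq_imp_space_eq[OF M] by simp
  let ?F = "maximal_set M l"
  have F[measurable]: "?F \<in> sets borel" using closed_maximal_set[OF M] by auto
  define N where "N = density M (indicator ?F)"
  have sN[simp]: "sets N = sets lborel" by (simp add: N_def)
  have eN: "emeasure N E = emeasure M (E \<inter> ?F)" if "E \<in> sets borel" for E
    unfolding N_def using that by (simp add: emeasure_density indicator_inter_arith[symmetric] Int_commute)
  define K where "K = 10 ^ DIM('a) * l / unit_ball_vol DIM('a)"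
  have K: "K > 0" using l by (simp add: K_def)
  have NK: "emeasure N E \<le> ennreal K * emeasure lborel E" if E: "E \<in> sets borel" for E
  proof (cases "emeasure lborel E < \<infinity>")
    case True
    have "emeasure lborel (E \<inter> ?F) \<le> emeasure lborel E" using E by (intro emeasure_mono) auto
    hence lt: "emeasure lborel (E \<inter> ?F) < \<infinity>" using True by (rule order.strict_trans1)
    have "emeasure N E \<le> ennreal K * emeasure lborel (E \<inter> ?F)"
      unfolding eN[OF E] K_def using E l lt by (intro emeasure_subset_maximal_set) auto
    also have "... \<le> ennreal K * emeasure lborel E" using E by (intro mult_left_mono emeasure_mono) auto
    finally show ?thesis .
  next
    case False
    hence "emeasure lborel E = top" by (simp add: less_top[symmetric])
    thus ?thesis using K by (simp add: ennreal_mult_top)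
  qed
  have "absolutely_continuous lborel N"
    unfolding absolutely_continuous_def
  proof
    fix E :: "'a set" assume "E \<in> null_sets lborel"
    hence E: "E \<in> sets borel" "emeasure lborel E = 0" by auto
    with NK[OF E(1)] show "E \<in> null_sets N" by (intro null_setsI) auto
  qed
  then obtain f where f[measurable]: "f \<in> borel_measurable lborel" and fN: "density lborel f = N"
    using sigma_finite_measure.Radon_Nikodym[OF sigma_finite_lborel _ sN] by blast
  have fm[measurable]: "f \<in> borel_measurable borel" using f by simp
  have "AE x in lborel. \<forall>n::nat. x \<in> ball 0 n --> f x \<le> ennreal K"
  proof (subst AE_all_countable, intro allI)
    fix n :: nat
    define E where "E = {x. f x > ennreal K} \<inter> ball (0::'a) n"
    have E[measurable]: "E \<in> sets borel" unfolding E_def by measurable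
    have finE: "emeasure lborel E < \<infinity>"
    proof -
      have "emeasure lborel E \<le> emeasure lborel (ball (0::'a) n)" unfolding E_def by (intro emeasure_mono) auto
      thus ?thesis by (rule order.strict_trans1) (simp add: emeasure_ball)
    qed
    have "(\<integral>+x. (f x - ennreal K) * indicator E x) + ennreal K * emeasure lborel E = (\<integral>+x. (f x - ennreal K) * indicator E x + ennreal K * indicator E x)"
      by (subst nn_integral_add) (auto simp: nn_integral_cmult_indicator)
    also have "... = (\<integral>+x. f x * indicator E x)"
      by (intro nn_integral_cong) (auto simp: E_def diff_add_cancel_ennreal less_imp_le split: split_indicator)
    also have "... = emeasure N E" unfolding fN[symmetric] by (subst emeasure_density) auto
    also have "... \<le> 0 + ennreal K * emeasure lborel E" using NK[OF E] by simp
    finally have "(\<integral>+x. (f x - ennreal K) * indicator E x) + ennreal K * emeasure lborel E \<le> 0 + ennreal K * emeasure lborel E" .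
    moreover have "ennreal K * emeasure lborel E \<noteq> top" using finE by (simp add: ennreal_mult_eq_top_iff less_top)
    ultimately have "(\<integral>+x. (f x - ennreal K) * indicator E x) = 0"
    proof -
      fix X Y :: ennreal assume "X + Y \<le> 0 + Y" and Y: "Y \<noteq> top"
      hence "Y + X \<le> Y + 0" by (simp add: add.commute)
      hence "X \<le> 0" unfolding ennreal_add_left_cancel_le using Y by simp
      thus "X = 0" by simp
    qed
    hence "AE x in lborel. (f x - ennreal K) * indicator E x = 0" by (subst (asm) nn_integral_0_iff_AE) auto
    thus "AE x in lborel. x \<in> ball 0 n --> f x \<le> ennreal K"
    proof eventually_elim
      case (elim x)
      show ?case
      proof (rule impI, rule ccontr)
        assume x: "x \<in> ball 0 (real n)" "\<not> f x \<le> ennreal K"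
        hence "x \<in> E" by (simp add: E_def)
        hence "f x - ennreal K = 0" using elim by simp
        thus False using x(2) by (metis diff_gt_0_iff_gt_ennreal less_irrefl not_le)
      qed
    qed
  qed
  hence fK: "AE x in lborel. f x \<le> ennreal K"
  proof eventually_elim
    case (elim x)
    obtain n :: nat where "norm x < real n" using reals_Archimedean2 by blast
    thus ?case using elim by auto
  qed
  define g where "g x = enn2real (min (f x) (ennreal K))" for x
  have gm[measurable]: "g \<in> borel_measurable borel" unfolding g_def by measurable
  have ge: "ennreal (g x) = min (f x) (ennreal K)" for x
    unfolding g_def by (rule ennreal_enn2real) (simp add: min_less_iff_disj)
  have gK: "0 \<le> g x" "g x \<le> K" for x
  proof -
    show "0 \<le> g x" by (simp add: g_def)
    have "ennreal (g x) \<le> ennreal K" unfolding ge by simp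
    thus "g x \<le> K" using K by simp
  qed
  have dg: "density lborel (\<lambda>x. ennreal (g x)) = N"
    unfolding fN[symmetric]
  proof (rule density_cong)
    show "AE x in lborel. ennreal (g x) = f x" using fK by eventually_elim (simp add: ge min_absorb1)
  qed auto
  have "(\<integral>+x. ennreal (g x)) = emeasure N UNIV"
    unfolding dg[symmetric] by (subst emeasure_density) auto
  also have "... \<le> emeasure M UNIV" by (subst eN) (auto intro!: emeasure_mono)
  also note fin
  finally have "integrable lborel g" using gK by (intro integrableI_nonneg) auto
  hence "bdd_density K g" unfolding bdd_density_def using gK by auto
  thus ?thesis using that dg unfolding N_def by metis
qed

lemma measurable_infdist [measurable]: "(\<lambda>y. infdist y F) \<in> borel_measurable borel"
  by (intro borel_measurable_continuous_onI continuous_intros)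

section \<open>Splitting a measure at a maximal set\<close>

text \<open>
The points whose smeared mass reaches \<open>x\<close>: only these contribute to the change of the potential at \<open>x\<close>.
\<close>

abbreviation shadow :: "'a::euclidean_space set => 'a => 'a set" where
  "shadow F x \<equiv> {y. y \<notin> F \<and> dist x y \<le> infdist y F / 2}"

text \<open>
The density of the smeared mass is bounded: if the mass at \<open>y\<close> reaches \<open>x\<close>, then the distances of \<open>x\<close>
and \<open>y\<close> from \<open>F\<close> are comparable, so the value at \<open>x\<close> is at most a constant times
\<open>M (ball x \<delta>) / \<delta> ^ d\<close> with \<open>\<delta> = dist x F\<close>, and this ball lies in a ball of radius \<open>3 * \<delta>\<close> about a
point of \<open>F\<close>.
\<close>

lemma potential_decomposition:
  fixes M :: "'a::euclidean_space measure"
  assumes d: "DIM('a) \<ge> 3" and M[measurable_cong, simp]: "sets M = sets borel" and fin: "emeasure M UNIV < \<infinity>" and l: "l > 0"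
  defines "F \<equiv> maximal_set M l"
  assumes ne: "F \<noteq> {}"
  obtains g L where "bdd_density L g" "\<And>x. pot_finite M x ==>
     ennreal \<bar>potM M x - pot g x\<bar> \<le> ennreal (1 + reg_const TYPE('a)) *
        (\<integral>\<^sup>+y. ennreal (newton (x - y)) * indicator (shadow F x) y \<partial>M)"
proof -
  have sp: "space M = UNIV" using sets_eq_imp_space_eq[OF M] by simp
  interpret finite_measure M using fin by (intro finite_measureI) (auto simp: sp)
  interpret P: pair_sigma_finite M "lborel :: 'a measure" ..
  have cF: "closed F" unfolding F_def by (rule closed_maximal_set[OF M])
  have Fm[measurable]: "F \<in> sets borel" using cF by auto
  let ?\<delta> = "\<lambda>y. infdist y F" let ?d = "DIM('a)" and ?bm = "bump_mass TYPE('a)"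
  have bm: "?bm > 0" by (rule bump_mass_pos)
  have \<delta>pos: "?\<delta> y > 0" if "y \<notin> F" for y using that in_closed_iff_infdist_zero[OF cF ne] infdist_nonneg[of y F] by (metis less_eq_real_def)
  obtain g1 L1 where g1: "bdd_density L1 g1" and dg1: "density M (indicator F) = density lborel (\<lambda>x. ennreal (g1 x))"
    using bounded_part_density[OF M fin l] unfolding F_def by blast
  note [measurable] = bdd_densityD(1)[OF g1]
  define k where "k x y = ennreal (bump (?\<delta> y / 2) (x - y)) * indicator (- F) y" for x y
  define G where "G x = (\<integral>\<^sup>+y. k x y \<partial>M)" for x
  have Gm[measurable]: "G \<in> borel_measurable borel" unfolding G_def k_def bump_def bump_pow_def by measurable
  define L2 where "L2 = 9 ^ ?d * l / ?bm"
  have L2: "L2 \<ge> 0" using l bm by (simp add: L2_def)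
  have GL: "G x \<le> ennreal L2" for x
  proof -
    let ?c = "3 ^ ?d / (?bm * ?\<delta> x ^ ?d)"
    have near: "x \<notin> F \<and> dist x y < ?\<delta> x \<and> ?\<delta> x / 3 \<le> ?\<delta> y / 2" if y: "y \<notin> F" "dist x y < ?\<delta> y / 2" for y
    proof -
      have 1: "?\<delta> x \<le> ?\<delta> y + dist x y" by (rule infdist_triangle)
      have 2: "?\<delta> y \<le> ?\<delta> x + dist x y" using infdist_triangle[of y F x] by (simp add: dist_commute)
      have "x \<notin> F"
      proof
        assume "x \<in> F"
        hence "?\<delta> y \<le> dist y x" by (rule infdist_le)
        thus False using y(2) \<delta>pos[OF y(1)] by (simp add: dist_commute)
      qed
      moreover have "dist x y < ?\<delta> x" using 2 y(2) by linarith
      moreover have "?\<delta> x / 3 \<le> ?\<delta> y / 2" using 1 y(2) by linarith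
      ultimately show ?thesis by blast
    qed
    show ?thesis
    proof (cases "x \<in> F")
      case True
      have "k x y = 0" for y
      proof (cases "y \<in> F")
        case False
        hence "\<not> dist x y < ?\<delta> y / 2" using near[of y] True by blast
        thus ?thesis using False \<delta>pos[OF False] by (simp add: k_def bump_eq_0 dist_norm)
      qed (simp add: k_def)
      thus ?thesis by (simp add: G_def)
    next
      case False
      have dx: "?\<delta> x > 0" using \<delta>pos[OF False] .
      obtain p where p: "p \<in> F" "?\<delta> x = dist x p" using infdist_attains_inf[OF cF ne] by blast
      have "G x \<le> (\<integral>\<^sup>+y. ennreal ?c * indicator (ball x (?\<delta> x)) y \<partial>M)"
        unfolding G_def
      proof (intro nn_integral_mono)
        fix y
        show "k x y \<le> ennreal ?c * indicator (ball x (?\<delta> x)) y"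
        proof (cases "y \<notin> F \<and> dist x y < ?\<delta> y / 2")
          case True
          note n = near[of y]
          have dy: "?\<delta> y / 2 > 0" using \<delta>pos True by auto
          have "bump (?\<delta> y / 2) (x - y) \<le> 1 / (?bm * (?\<delta> y / 2) ^ ?d)" by (rule bump_le[OF dy])
          also have "... \<le> 1 / (?bm * (?\<delta> x / 3) ^ ?d)"
            using n True bm dx dy by (intro divide_left_mono mult_left_mono power_mono mult_pos_pos zero_less_power) auto
          also have "... = ?c" using dx by (simp add: power_divide)
          finally have "ennreal (bump (?\<delta> y / 2) (x - y)) \<le> ennreal ?c" by (rule ennreal_leI)
          thus ?thesis using n True by (simp add: k_def)
        next
          case False
          hence "k x y = 0" using \<delta>pos[of y] by (cases "y \<in> F") (auto simp: k_def bump_eq_0 dist_norm)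
          thus ?thesis by simp
        qed
      qed
      also have "... = ennreal ?c * emeasure M (ball x (?\<delta> x))" by (simp add: nn_integral_cmult_indicator)
      also have "... \<le> ennreal ?c * emeasure M (ball p (3 * ?\<delta> x))"
      proof (intro mult_left_mono emeasure_mono)
        show "ball x (?\<delta> x) \<subseteq> ball p (3 * ?\<delta> x)"
        proof
          fix y assume "y \<in> ball x (?\<delta> x)"
          thus "y \<in> ball p (3 * ?\<delta> x)" using p(2) dx dist_triangle[of p y x] dist_commute[of p x] unfolding mem_ball by linarith
        qed
      qed auto
      also have "... \<le> ennreal ?c * ennreal (l * (3 * ?\<delta> x) ^ ?d)"
        using p(1) dx unfolding F_def by (intro mult_left_mono maximal_setD) auto
      also have "... = ennreal (?c * (l * (3 * ?\<delta> x) ^ ?d))" using bm dx l by (simp add: ennreal_mult[symmetric])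
      also have "?c * (l * (3 * ?\<delta> x) ^ ?d) = L2"
      proof -
        have "(9::real) ^ ?d = 3 ^ ?d * 3 ^ ?d" by (simp add: power_mult_distrib[symmetric])
        thus ?thesis using dx bm by (simp add: L2_def power_mult_distrib)
      qed
      finally show ?thesis .
    qed
  qed
  define g2 where "g2 x = enn2real (G x)" for x
  have g2m[measurable]: "g2 \<in> borel_measurable borel" unfolding g2_def by measurable
  have g2e: "ennreal (g2 x) = G x" for x
    unfolding g2_def by (rule ennreal_enn2real) (use order.strict_trans1[OF GL[of x]] in simp)
  have g2L: "0 \<le> g2 x" "g2 x \<le> L2" for x
  proof -
    show "0 \<le> g2 x" by (simp add: g2_def)
    have "ennreal (g2 x) \<le> ennreal L2" unfolding g2e by (rule GL)
    thus "g2 x \<le> L2" using L2 by simp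
  qed
  have "(\<integral>+x. ennreal (g2 x)) = (\<integral>\<^sup>+y. \<integral>\<^sup>+x. k x y \<partial>lborel \<partial>M)"
    unfolding g2e G_def k_def bump_def bump_pow_def by (rule P.Fubini') measurable
  also have "... \<le> (\<integral>\<^sup>+y. 1 \<partial>M)"
  proof (intro nn_integral_mono)
    fix y
    show "(\<integral>+x. k x y) \<le> 1"
    proof (cases "y \<in> F")
      case False
      have "(\<integral>+x. k x y) = (\<integral>+x. ennreal (bump (?\<delta> y / 2) (- y + x)))"
        using False by (simp add: k_def)
      also have "... = (\<integral>\<^sup>+x. ennreal (bump (?\<delta> y / 2) x) \<partial>(lborel :: 'a measure))" by (rule nn_integral_translate) measurable
      also have "... = 1" using \<delta>pos[OF False] by (intro nn_integral_bump) simp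
      finally show ?thesis by simp
    qed (simp add: k_def)
  qed
  also have "... < \<infinity>" using fin by (simp add: sp)
  finally have ig2: "integrable lborel g2" using g2L by (intro integrableI_nonneg) auto
  have g2: "bdd_density L2 g2" unfolding bdd_density_def using ig2 g2L by auto
  define g where "g x = g1 x + g2 x" for x
  have g: "bdd_density (L1 + L2) g"
    unfolding bdd_density_def g_def using bdd_densityD[OF g1] bdd_densityD[OF g2]
    by (auto intro!: add_mono add_nonneg_nonneg Bochner_Integration.integrable_add)
  have pg: "pot g x = pot g1 x + pot g2 x" for x
    unfolding pot_def g_def using integrable_pot[OF d g1, of x] integrable_pot[OF d g2, of x] by (simp add: distrib_left)
  have p1: "ennreal (pot g1 x) = (\<integral>\<^sup>+y. ennreal (newton (x - y)) * indicator F y \<partial>M)" for x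
  proof -
    have "(\<integral>\<^sup>+y. ennreal (newton (x - y)) * indicator F y \<partial>M) = (\<integral>\<^sup>+y. ennreal (newton (x - y)) \<partial>density M (indicator F))"
      by (subst nn_integral_density) (auto simp: mult.commute)
    also have "... = (\<integral>+y. ennreal (g1 y) * ennreal (newton (x - y)))" unfolding dg1 by (subst nn_integral_density) auto
    also have "... = ennreal (pot g1 x)" unfolding ennreal_pot[OF d g1] conv_def by (simp add: mult.commute)
    finally show ?thesis ..
  qed
  have p2: "ennreal (pot g2 x) = (\<integral>\<^sup>+y. ennreal (newton_reg (?\<delta> y / 2) (x - y)) * indicator (- F) y \<partial>M)" for x
  proof -
    have "ennreal (pot g2 x) = (\<integral>+z. (\<integral>\<^sup>+y. ennreal (newton (x - z)) * k z y \<partial>M))"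
    proof -
      have "(\<lambda>y. k z y) \<in> borel_measurable M" for z unfolding k_def bump_def bump_pow_def by measurable
      thus ?thesis unfolding ennreal_pot[OF d g2] conv_def g2e G_def by (simp add: nn_integral_cmult)
    qed
    also have "... = (\<integral>\<^sup>+y. (\<integral>+z. ennreal (newton (x - z)) * k z y) \<partial>M)"
      unfolding k_def bump_def bump_pow_def by (rule P.Fubini') measurable
    also have "... = (\<integral>\<^sup>+y. ennreal (newton_reg (?\<delta> y / 2) (x - y)) * indicator (- F) y \<partial>M)"
    proof (intro nn_integral_cong)
      fix y
      show "(\<integral>+z. ennreal (newton (x - z)) * k z y) = ennreal (newton_reg (?\<delta> y / 2) (x - y)) * indicator (- F) y"
      proof (cases "y \<in> F")
        case False
        have dy: "?\<delta> y / 2 > 0" using \<delta>pos[OF False] by simp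
        have "(\<integral>+z. ennreal (newton (x - z)) * k z y) = (\<integral>+z. ennreal (newton (x - z)) * ennreal (bump (?\<delta> y / 2) (z - y)))"
          using False by (simp add: k_def)
        also have "... = (\<integral>+w. ennreal (newton (x - (y + w))) * ennreal (bump (?\<delta> y / 2) (y + w - y)))"
          by (rule nn_integral_translate[symmetric]) measurable
        also have "... = ennreal (newton_reg (?\<delta> y / 2) (x - y))"
          unfolding ennreal_newton_reg[OF d dy] conv_def by (simp add: algebra_simps)
        finally show ?thesis using False by simp
      qed (simp add: k_def)
    qed
    finally show ?thesis .
  qed
  show ?thesis
  proof (rule that[OF g])
    fix x assume x: "pot_finite M x"
    let ?N = "\<lambda>y. newton (x - y)" and ?R = "\<lambda>y. newton_reg (?\<delta> y / 2) (x - y)"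
    have Rm: "(\<lambda>y. ?R y) \<in> borel_measurable borel"
      using measurable_compose[OF _ measurable_newton_reg2, of "\<lambda>y. (infdist y F / 2, x - y)"] by simp
    have Rm'[measurable]: "?R \<in> borel_measurable M" using Rm by simp
    have Rn: "?R y * indicator (- F) y \<ge> 0" for y
      using newton_reg_nonneg[OF d, of "?\<delta> y / 2"] \<delta>pos[of y] by (cases "y \<in> F") auto
    have iN: "integrable M ?N" using pot_finiteD(2)[OF M x] .
    have iF: "integrable M (\<lambda>y. ?N y * indicator F y)" "integrable M (\<lambda>y. ?N y * indicator (- F) y)"
      using iN by (auto intro: integrable_real_mult_indicator)
    have RR: "(\<integral>\<^sup>+y. ennreal (?R y * indicator (- F) y) \<partial>M) = ennreal (pot g2 x)"
      unfolding p2 by (intro nn_integral_cong) (auto split: split_indicator)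
    have iR: "integrable M (\<lambda>y. ?R y * indicator (- F) y)"
      by (rule integrableI_nonneg) (use RR Rn in auto)
    have eR: "(\<integral>y. ?R y * indicator (- F) y \<partial>M) = pot g2 x"
      using nn_integral_eq_integral[OF iR] Rn RR pot_nonneg[OF d g2, of x]
      by (metis (no_types, lifting) AE_I2 Bochner_Integration.integral_nonneg ennreal_inj)
    have eF: "(\<integral>y. ?N y * indicator F y \<partial>M) = pot g1 x"
    proof -
      have "ennreal (\<integral>y. ?N y * indicator F y \<partial>M) = (\<integral>\<^sup>+y. ennreal (?N y * indicator F y) \<partial>M)"
        by (rule nn_integral_eq_integral[OF iF(1), symmetric]) simp
      also have "... = ennreal (pot g1 x)" unfolding p1 by (intro nn_integral_cong) (auto split: split_indicator)
      finally show ?thesis using pot_nonneg[OF d g1, of x] by (subst (asm) ennreal_inj) auto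
    qed
    have "potM M x = (\<integral>y. ?N y * indicator F y + ?N y * indicator (- F) y \<partial>M)"
      unfolding potM_def by (intro Bochner_Integration.integral_cong) (auto split: split_indicator)
    also have "... = pot g1 x + (\<integral>y. ?N y * indicator (- F) y \<partial>M)" using iF eF by simp
    finally have "potM M x - pot g x = (\<integral>y. ?N y * indicator (- F) y \<partial>M) - (\<integral>y. ?R y * indicator (- F) y \<partial>M)"
      unfolding pg eR by simp
    also have "... = (\<integral>y. ?N y * indicator (- F) y - ?R y * indicator (- F) y \<partial>M)" using iF iR by simp
    finally have "ennreal \<bar>potM M x - pot g x\<bar> \<le> (\<integral>\<^sup>+y. ennreal \<bar>?N y * indicator (- F) y - ?R y * indicator (- F) y\<bar> \<partial>M)"
      using integral_norm_bound_ennreal[OF Bochner_Integration.integrable_diff[OF iF(2) iR]] by simp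
    also have "... \<le> (\<integral>\<^sup>+y. ennreal (1 + reg_const TYPE('a)) * (ennreal (?N y) * indicator (shadow F x) y) \<partial>M)"
    proof (rule nn_integral_mono_AE)
      show "AE y in M. ennreal \<bar>?N y * indicator (- F) y - ?R y * indicator (- F) y\<bar> \<le>
         ennreal (1 + reg_const TYPE('a)) * (ennreal (?N y) * indicator (shadow F x) y)"
        using pot_finiteD(1)[OF M x]
      proof eventually_elim
        case (elim y)
        show ?case
        proof (cases "y \<in> F")
          case False
          have rc: "1 + reg_const TYPE('a) \<ge> 0" using reg_const_pos[where 'a='a] by simp
          have "\<bar>?N y - ?R y\<bar> \<le> (1 + reg_const TYPE('a)) * ?N y * indicator (cball 0 (?\<delta> y / 2)) (x - y)"
            using elim \<delta>pos[OF False] by (intro newton_diff_le[OF d]) auto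
          hence "ennreal \<bar>?N y - ?R y\<bar> \<le> ennreal ((1 + reg_const TYPE('a)) * (?N y * indicator (cball 0 (?\<delta> y / 2)) (x - y)))"
            by (intro ennreal_leI) (simp add: mult.assoc)
          also have "... = ennreal (1 + reg_const TYPE('a)) * ennreal (?N y * indicator (cball 0 (?\<delta> y / 2)) (x - y))"
            by (rule ennreal_mult) (use rc in auto)
          also have "ennreal (?N y * indicator (cball 0 (?\<delta> y / 2)) (x - y)) = ennreal (?N y) * indicator (shadow F x) y"
            unfolding indicator_def mem_cball_0 using False by (simp add: dist_norm)
          finally show ?thesis using False by simp
        qed simp
      qed
    qed
    also have "... = ennreal (1 + reg_const TYPE('a)) * (\<integral>\<^sup>+y. ennreal (?N y) * indicator (shadow F x) y \<partial>M)"
      by (rule nn_integral_cmult) measurable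
    finally show "ennreal \<bar>potM M x - pot g x\<bar> \<le> ennreal (1 + reg_const TYPE('a)) *
        (\<integral>\<^sup>+y. ennreal (?N y) * indicator (shadow F x) y \<partial>M)" .
  qed
qed

abbreviation remainder :: "'a::euclidean_space measure => 'a => ('a => real) => ('a => 'a => real) => 'a => real" where
  "remainder M a A B x \<equiv> potM M x - potM M a - poly2 A B (x - a)"

abbreviation taylor_le where
  "taylor_le M a A B \<epsilon> \<tau> x \<equiv> ennreal \<bar>remainder M a A B x\<bar> \<le> ennreal ((norm (x - a))^2) * (ennreal \<epsilon> + npot \<tau> x)"

text \<open>
A second order expansion whose error, relative to \<open>(norm (x - a))^2\<close>, is at most \<open>\<epsilon>\<close> plus the potential
of a measure of small mass. Unlike the capacity condition, this form adds up over the two parts of a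
signed measure.
\<close>

definition cap_taylor :: "'a::euclidean_space measure => 'a => ('a => real) => ('a => 'a => real) => bool" where
  "cap_taylor M a A B \<longleftrightarrow> (\<forall>\<epsilon>>0. \<exists>r0>0. \<forall>r. 0 < r \<and> r < r0 -->
     (\<exists>\<tau>. sets \<tau> = sets borel \<and> emeasure \<tau> UNIV \<le> ennreal (\<epsilon> * r ^ (DIM('a) - 2)) \<and>
       (\<forall>x\<in>ball a r. pot_finite M x -->
          taylor_le M a A B \<epsilon> \<tau> x)))"

text \<open>
Dyadic shells again: the shell of radius \<open>2 ^ (- k) * r\<close> contributes
\<open>\<epsilon> * (2 ^ (- k) * r) ^ (d - 2)\<close>, and \<open>d \<ge> 3\<close> makes the sum geometric.
\<close>

lemma inverse_square_mass:
  fixes \<sigma> :: "'a::euclidean_space measure"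
  assumes d: "DIM('a) \<ge> 3" and s[measurable_cong, simp]: "sets \<sigma> = sets borel" and a: "emeasure \<sigma> {a} = 0"
    and r: "r > 0" and \<epsilon>: "\<epsilon> \<ge> 0" and dens: "\<And>s. 0 < s ==> s \<le> 2 * r ==> emeasure \<sigma> (ball a s) \<le> ennreal (\<epsilon> * s ^ DIM('a))"
  shows "(\<integral>\<^sup>+y. ennreal (1 / (norm (y - a))^2) * indicator (ball a r) y \<partial>\<sigma>) \<le> ennreal (32 * 2 ^ DIM('a) * \<epsilon> * r ^ (DIM('a) - 2))"
proof -
  let ?d = "DIM('a)"
  obtain n where n: "?d = n + 2" "?d - 2 = n" "n \<ge> 1" using d by (intro that[of "?d - 2"]) auto
  define s where "s k = r * (1/2) ^ k" for k :: nat
  define c where "c k = 4 * 4 ^ k / r^2" for k :: nat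
  have s: "s k > 0" "s k \<le> r" for k using r by (auto simp: s_def power_le_one mult_left_le)
  have c: "c k \<ge> 0" for k by (simp add: c_def)
  have "(\<integral>\<^sup>+y. ennreal (1 / (norm (y - a))^2) * indicator (ball a r) y \<partial>\<sigma>) \<le> (\<integral>\<^sup>+y. (\<Sum>k. ennreal (c k) * indicator (cball a (s k)) y) \<partial>\<sigma>)"
  proof (rule nn_integral_mono_AE)
    have "AE y in \<sigma>. y \<noteq> a" using a by (intro AE_I'[of "{a}"]) (auto simp: null_sets_def)
    thus "AE y in \<sigma>. ennreal (1 / (norm (y - a))^2) * indicator (ball a r) y \<le> (\<Sum>k. ennreal (c k) * indicator (cball a (s k)) y)"
    proof eventually_elim
      case (elim y)
      show ?case
      proof (cases "y \<in> ball a r")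
        case True
        let ?t = "norm (y - a) / r"
        have ya: "norm (y - a) > 0" using elim by simp
        have "?t > 0" "?t \<le> 1" using r ya True by (auto simp: dist_norm norm_minus_commute)
        then obtain k where k: "(1/2) ^ Suc k < ?t" "?t \<le> (1/2) ^ k" using dyadic_exists by blast
        have in1: "y \<in> cball a (s k)" using k(2) r by (simp add: s_def dist_norm norm_minus_commute field_simps)
        have "r * (1/2) ^ Suc k < norm (y - a)" using k(1) r by (simp add: field_simps)
        hence "(r * (1/2) ^ Suc k)^2 \<le> (norm (y - a))^2" using r by (intro power_mono) auto
        moreover have "(r * (1/2) ^ Suc k)^2 > 0" using r by simp
        ultimately have "1 / (norm (y - a))^2 \<le> 1 / (r * (1/2) ^ Suc k)^2" by (intro divide_left_mono mult_pos_pos) auto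
        also have "... = c k"
        proof -
          have "((2::real) ^ k)^2 = 4 ^ k" by (simp add: power2_eq_square power_mult_distrib[symmetric])
          thus ?thesis by (simp add: c_def power_divide power_mult_distrib)
        qed
        finally have "ennreal (1 / (norm (y - a))^2) * indicator (ball a r) y \<le> ennreal (c k) * indicator (cball a (s k)) y"
          using True in1 by (simp add: ennreal_leI)
        also have "... \<le> (\<Sum>k. ennreal (c k) * indicator (cball a (s k)) y)" by (rule ennreal_le_suminf)
        finally show ?thesis .
      qed simp
    qed
  qed
  also have "... = (\<Sum>k. ennreal (c k) * emeasure \<sigma> (cball a (s k)))"
    by (subst nn_integral_suminf, measurable) (simp add: nn_integral_cmult_indicator)
  also have "... \<le> (\<Sum>k. ennreal (16 * 2 ^ n * \<epsilon> * r ^ n * (1/2) ^ k))"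
  proof (intro suminf_le)
    fix k :: nat
    define h where "h = (1/2::real) ^ k"
    have h: "h > 0" "h \<le> 1" by (auto simp: h_def power_le_one)
    have "4 ^ k * (h * h) = (4 * (1/2) * (1/2)) ^ k" unfolding h_def by (simp only: power_mult_distrib mult.assoc)
    hence 4: "4 ^ k * (h * h) = 1" by simp
    have "emeasure \<sigma> (cball a (s k)) \<le> emeasure \<sigma> (ball a (2 * s k))"
      using s[of k] by (intro emeasure_mono) auto
    also have "... \<le> ennreal (\<epsilon> * (2 * s k) ^ ?d)" using s[of k] by (intro dens) auto
    finally have "ennreal (c k) * emeasure \<sigma> (cball a (s k)) \<le> ennreal (c k) * ennreal (\<epsilon> * (2 * s k) ^ ?d)" by (rule mult_left_mono) simp
    also have "... = ennreal (c k * (\<epsilon> * (2 * s k) ^ ?d))" using c \<epsilon> s[of k] by (simp add: ennreal_mult)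
    also have "c k * (\<epsilon> * (2 * s k) ^ ?d) = 16 * 2 ^ n * \<epsilon> * r ^ n * h ^ n"
    proof -
      have "c k * (\<epsilon> * (2 * s k) ^ ?d) = 16 * \<epsilon> * (4 ^ k * (h * h)) * (2 * r * h) ^ n"
        unfolding n(1) c_def s_def h_def[symmetric] power_add power2_eq_square using r by (simp add: field_simps)
      thus ?thesis unfolding 4 by (simp add: power_mult_distrib mult_ac)
    qed
    also have "ennreal (16 * 2 ^ n * \<epsilon> * r ^ n * h ^ n) \<le> ennreal (16 * 2 ^ n * \<epsilon> * r ^ n * h)"
    proof (intro ennreal_leI mult_left_mono)
      show "h ^ n \<le> h" using power_decreasing[OF n(3), of h] h by simp
    qed (use \<epsilon> r in auto)
    finally show "ennreal (c k) * emeasure \<sigma> (cball a (s k)) \<le> ennreal (16 * 2 ^ n * \<epsilon> * r ^ n * (1/2) ^ k)" unfolding h_def .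
  qed auto
  also have "... = ennreal (\<Sum>k. 16 * 2 ^ n * \<epsilon> * r ^ n * (1/2) ^ k)"
    using \<epsilon> r by (intro suminf_ennreal2) (auto intro!: summable_mult summable_geometric)
  also have "(\<Sum>k. 16 * 2 ^ n * \<epsilon> * r ^ n * (1/2) ^ k) = 16 * 2 ^ n * \<epsilon> * r ^ n * 2"
    by (subst suminf_mult) (auto simp: summable_geometric suminf_geometric)
  also have "ennreal ... \<le> ennreal (32 * 2 ^ ?d * \<epsilon> * r ^ (?d - 2))"
  proof (rule ennreal_leI)
    have "(2::real) ^ n \<le> 2 ^ ?d" unfolding n(1) by (intro power_increasing) auto
    hence "32 * 2 ^ n * (\<epsilon> * r ^ n) \<le> 32 * 2 ^ ?d * (\<epsilon> * r ^ n)" using \<epsilon> r by (intro mult_right_mono) auto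
    thus "16 * 2 ^ n * \<epsilon> * r ^ n * 2 \<le> 32 * 2 ^ ?d * \<epsilon> * r ^ (?d - 2)" unfolding n(2) by (simp add: mult_ac)
  qed
  finally show ?thesis .
qed

text \<open>
At \<open>a \<in> F\<close> the decomposition leaves the potential unchanged, and nearby the change is bounded by the
potential of \<open>\<tau>\<close>, since \<open>y \<in> shadow F x\<close> forces \<open>norm (y - a) \<le> 2 * norm (x - a)\<close>.
\<close>

lemma cap_taylor_at_maximal_set:
  fixes M :: "'a::euclidean_space measure"
  assumes d: "DIM('a) \<ge> 3" and M[measurable_cong, simp]: "sets M = sets borel" and fin: "emeasure M UNIV < \<infinity>" and l: "l > 0"
  shows "AE a in lborel. a \<in> maximal_set M l --> (\<exists>A B. cap_taylor M a A B)"
proof (cases "maximal_set M l = {}")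
  case False
  let ?d = "DIM('a)"
  define F where "F = maximal_set M l"
  have ne: "F \<noteq> {}" using False by (simp add: F_def)
  have cF: "closed F" unfolding F_def by (rule closed_maximal_set[OF M])
  have Fm[measurable]: "F \<in> sets borel" using cF by auto
  have \<delta>pos: "infdist y F > 0" if "y \<notin> F" for y
    using that in_closed_iff_infdist_zero[OF cF ne] infdist_nonneg[of y F] by (metis less_eq_real_def)
  obtain g L where g: "bdd_density L g" and dec: "\<And>x. pot_finite M x ==>
     ennreal \<bar>potM M x - pot g x\<bar> \<le> ennreal (1 + reg_const TYPE('a)) *
        (\<integral>\<^sup>+y. ennreal (newton (x - y)) * indicator (shadow F x) y \<partial>M)"
    using potential_decomposition[OF d M fin l] False unfolding F_def by blast
  define C where "C = 1 + reg_const TYPE('a)"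
  have C: "C > 0" using reg_const_pos[where 'a='a] by (simp add: C_def)
  define \<sigma> where "\<sigma> = density M (indicator (- F))"
  have s\<sigma>[measurable_cong, simp]: "sets \<sigma> = sets borel" by (simp add: \<sigma>_def)
  have e\<sigma>: "emeasure \<sigma> E = (\<integral>\<^sup>+y. indicator (- F) y * indicator E y \<partial>M)" if "E \<in> sets borel" for E
    unfolding \<sigma>_def using that by (subst emeasure_density) auto
  have fin\<sigma>: "emeasure \<sigma> UNIV < \<infinity>"
  proof -
    have "emeasure \<sigma> UNIV = emeasure M (- F)" by (subst e\<sigma>) simp_all
    also have "... \<le> emeasure M UNIV" by (intro emeasure_mono) auto
    finally show ?thesis using fin by (rule order.strict_trans1)
  qed
  have \<sigma>F: "emeasure \<sigma> F = 0"
  proof -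
    have "(\<lambda>y. indicator (- F) y * indicator F y :: ennreal) = (\<lambda>_. 0)" by (auto simp: fun_eq_iff indicator_def)
    thus ?thesis by (simp add: e\<sigma>[OF Fm])
  qed
  show ?thesis
    using AE_zero_density[OF s\<sigma> fin\<sigma> Fm \<sigma>F] pot_second_order[OF d g] AE_pot_finite[OF d M fin]
  proof eventually_elim
    case (elim a)
    show ?case
    proof
      assume "a \<in> maximal_set M l"
      hence aF: "a \<in> F" by (simp add: F_def)
      have pa: "potM M a = pot g a"
      proof -
        have "\<not> (y \<notin> F \<and> dist a y \<le> infdist y F / 2)" for y
          using infdist_le[OF aF, of y] \<delta>pos[of y] by (auto simp: dist_commute)
        hence "shadow F a = {}" by blast
        hence "ennreal \<bar>potM M a - pot g a\<bar> \<le> 0"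
          using dec[OF elim(3)] by simp
        thus ?thesis by simp
      qed
      from elim(2) obtain A B where AB: "\<And>\<epsilon>. \<epsilon> > 0 ==> \<exists>r0>0. \<forall>y. norm y < r0 --> \<bar>pot g (a + y) - pot g a - poly2 A B y\<bar> \<le> \<epsilon> * (norm y)^2"
        by blast
      have "cap_taylor M a A B"
        unfolding cap_taylor_def
      proof (intro allI impI)
        fix \<epsilon> :: real assume \<epsilon>: "\<epsilon> > 0"
        define e where "e = \<epsilon> / (4 * C * 32 * 2 ^ ?d * 2 ^ ?d)"
        have e: "e > 0" using \<epsilon> C by (simp add: e_def)
        obtain r1 where r1: "r1 > 0" "\<And>y. norm y < r1 ==> \<bar>pot g (a + y) - pot g a - poly2 A B y\<bar> \<le> \<epsilon> * (norm y)^2"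
          using AB[OF \<epsilon>] by blast
        obtain r2 where r2: "r2 > 0" "\<And>r. 0 < r ==> r < r2 ==> emeasure \<sigma> (ball a r) \<le> ennreal (e * r ^ ?d)"
          using elim(1) aF e by blast
        show "\<exists>r0>0. \<forall>r. 0 < r \<and> r < r0 -->
          (\<exists>\<tau>. sets \<tau> = sets borel \<and> emeasure \<tau> UNIV \<le> ennreal (\<epsilon> * r ^ (?d - 2)) \<and>
            (\<forall>x\<in>ball a r. pot_finite M x -->
              taylor_le M a A B \<epsilon> \<tau> x))"
        proof (intro exI[of _ "min r1 (r2 / 4)"] conjI allI impI)
          show "min r1 (r2 / 4) > 0" using r1 r2 by simp
          fix r assume "0 < r \<and> r < min r1 (r2 / 4)"
          hence r: "0 < r" "r < r1" "4 * r < r2" by auto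
          \<comment> \<open>The factor \<open>4\<close> absorbs \<open>norm (y - a) \<le> 2 * norm (x - a)\<close>.\<close>
          define w where "w y = ennreal (4 * C * (1 / (norm (y - a))^2)) * indicator (ball a (2 * r)) y" for y
          have [measurable]: "w \<in> borel_measurable borel" unfolding w_def by measurable
          define \<tau> where "\<tau> = density \<sigma> w"
          have "sets \<tau> = sets borel" by (simp add: \<tau>_def)
          moreover have "emeasure \<tau> UNIV \<le> ennreal (\<epsilon> * r ^ (?d - 2))"
          proof -
            have "emeasure \<tau> UNIV = (\<integral>\<^sup>+y. ennreal (4 * C) * (ennreal (1 / (norm (y - a))^2) * indicator (ball a (2 * r)) y) \<partial>\<sigma>)"
              unfolding \<tau>_def w_def using C by (subst emeasure_density) (auto simp: ennreal_mult[symmetric] mult.assoc[symmetric])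
            also have "... = ennreal (4 * C) * (\<integral>\<^sup>+y. (ennreal (1 / (norm (y - a))^2) * indicator (ball a (2 * r)) y) \<partial>\<sigma>)"
              by (rule nn_integral_cmult) measurable
            also have "... \<le> ennreal (4 * C) * ennreal (32 * 2 ^ ?d * e * (2 * r) ^ (?d - 2))"
            proof (intro mult_left_mono inverse_square_mass d s\<sigma>)
              have "emeasure \<sigma> {a} \<le> emeasure \<sigma> F" using aF by (intro emeasure_mono) auto
              thus "emeasure \<sigma> {a} = 0" using \<sigma>F by simp
              fix s assume "0 < s" "s \<le> 2 * (2 * r)"
              thus "emeasure \<sigma> (ball a s) \<le> ennreal (e * s ^ ?d)" using r by (intro r2) auto
            qed (use r e in auto)
            also have "... = ennreal (4 * C * (32 * 2 ^ ?d * e * (2 * r) ^ (?d - 2)))"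
              using C e r by (simp add: ennreal_mult[symmetric])
            also have "... \<le> ennreal (\<epsilon> * r ^ (?d - 2))"
            proof (rule ennreal_leI)
              have "(2::real) ^ (?d - 2) \<le> 2 ^ ?d" by (intro power_increasing) auto
              hence "4 * C * 32 * 2 ^ ?d * e * (2 ^ (?d - 2)) * r ^ (?d - 2) \<le> 4 * C * 32 * 2 ^ ?d * e * (2 ^ ?d) * r ^ (?d - 2)"
                using C e r by (intro mult_right_mono mult_left_mono) auto
              also have "4 * C * 32 * 2 ^ ?d * e * (2 ^ ?d) = \<epsilon>" using C by (simp add: e_def)
              finally show "4 * C * (32 * 2 ^ ?d * e * (2 * r) ^ (?d - 2)) \<le> \<epsilon> * r ^ (?d - 2)"
                by (simp add: power_mult_distrib mult_ac)
            qed
            finally show ?thesis .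
          qed
          moreover have "taylor_le M a A B \<epsilon> \<tau> x"
            if x: "x \<in> ball a r" "pot_finite M x" for x
          proof -
            let ?n = "(norm (x - a))^2"
            have nxa: "norm (x - a) < r" using x(1) by (simp add: dist_norm norm_minus_commute)
            have b1: "\<bar>pot g x - pot g a - poly2 A B (x - a)\<bar> \<le> \<epsilon> * ?n"
              using r1(2)[of "x - a"] nxa r by simp
            have "ennreal \<bar>remainder M a A B x\<bar> \<le> ennreal (\<bar>pot g x - pot g a - poly2 A B (x - a)\<bar> + \<bar>potM M x - pot g x\<bar>)"
              unfolding pa by (intro ennreal_leI) simp
            also have "... = ennreal \<bar>pot g x - pot g a - poly2 A B (x - a)\<bar> + ennreal \<bar>potM M x - pot g x\<bar>" by simp
            also have "... \<le> ennreal (\<epsilon> * ?n) + ennreal ?n * npot \<tau> x"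
            proof (intro add_mono ennreal_leI b1)
              have "ennreal \<bar>potM M x - pot g x\<bar> \<le> ennreal C * (\<integral>\<^sup>+y. ennreal (newton (x - y)) * indicator (shadow F x) y \<partial>M)"
                unfolding C_def by (rule dec[OF x(2)])
              also have "... = (\<integral>\<^sup>+y. ennreal C * (ennreal (newton (x - y)) * indicator (shadow F x) y) \<partial>M)"
                by (rule nn_integral_cmult[symmetric]) measurable
              also have "... \<le> (\<integral>\<^sup>+y. ennreal ?n * (indicator (- F) y * (w y * nkern x y)) \<partial>M)"
              proof (intro nn_integral_mono)
                fix y
                show "ennreal C * (ennreal (newton (x - y)) * indicator (shadow F x) y) \<le> ennreal ?n * (indicator (- F) y * (w y * nkern x y))"
                proof (cases "y \<notin> F \<and> dist x y \<le> infdist y F / 2")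
                  case True
                  have ya: "y \<noteq> a" using True aF by auto
                  have "infdist y F \<le> dist y a" by (rule infdist_le[OF aF])
                  hence 1: "dist x y \<le> norm (y - a) / 2" using True by (simp add: dist_norm)
                  have 2: "norm (y - a) \<le> 2 * norm (x - a)"
                    using 1 dist_triangle[of y a x] by (simp add: dist_norm norm_minus_commute)
                  have yb: "y \<in> ball a (2 * r)" using 2 nxa by (simp add: dist_norm norm_minus_commute)
                  have "(norm (y - a))^2 \<le> (2 * norm (x - a))^2" using 2 by (intro power_mono) auto
                  hence "1 \<le> ?n * (4 * (1 / (norm (y - a))^2))" using ya by (simp add: power_mult_distrib field_simps)
                  hence "C * 1 \<le> C * (?n * (4 * (1 / (norm (y - a))^2)))" using C by (intro mult_left_mono) auto
                  hence "C \<le> ?n * (4 * C * (1 / (norm (y - a))^2))" by (simp add: mult_ac)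
                  hence "ennreal C \<le> ennreal (?n * (4 * C * (1 / (norm (y - a))^2)))" by (rule ennreal_leI)
                  also have "... = ennreal ?n * w y" using yb C by (simp add: w_def ennreal_mult[symmetric])
                  finally have "ennreal C * ennreal (newton (x - y)) \<le> (ennreal ?n * w y) * nkern x y"
                    by (intro mult_mono newton_le_nkern) auto
                  thus ?thesis using True by (simp add: mult.assoc)
                qed simp
              qed
              also have "... = ennreal ?n * (\<integral>\<^sup>+y. indicator (- F) y * (w y * nkern x y) \<partial>M)"
                by (rule nn_integral_cmult) measurable
              also have "(\<integral>\<^sup>+y. indicator (- F) y * (w y * nkern x y) \<partial>M) = npot \<tau> x"
                unfolding \<tau>_def by (subst nn_integral_density, measurable) (simp add: \<sigma>_def nn_integral_density)
              finally show "ennreal \<bar>potM M x - pot g x\<bar> \<le> ennreal ?n * npot \<tau> x" .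
            qed
            also have "... = ennreal ?n * (ennreal \<epsilon> + npot \<tau> x)"
              using \<epsilon> by (simp add: distrib_left ennreal_mult mult.commute[of "ennreal \<epsilon>"])
            finally show ?thesis .
          qed
          ultimately show "\<exists>\<tau>. sets \<tau> = sets borel \<and> emeasure \<tau> UNIV \<le> ennreal (\<epsilon> * r ^ (?d - 2)) \<and>
            (\<forall>x\<in>ball a r. pot_finite M x -->
              taylor_le M a A B \<epsilon> \<tau> x)"
            by blast
        qed
      qed
      thus "\<exists>A B. cap_taylor M a A B" by blast
    qed
  qed
qed simp

text \<open>
The maximal sets at levels \<open>1, 2, 3, ...\<close> exhaust the space up to a null set.
\<close>

theorem AE_cap_taylor:
  fixes M :: "'a::euclidean_space measure"
  assumes d: "DIM('a) \<ge> 3" and M: "sets M = sets borel" and fin: "emeasure M UNIV < \<infinity>"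
  shows "AE a in lborel. \<exists>A B. cap_taylor M a A B"
proof -
  let ?c = "vitali_const TYPE('a)"
  define T where "T = enn2real (emeasure M UNIV)"
  have T: "emeasure M UNIV = ennreal T" "T \<ge> 0" using fin by (auto simp: T_def less_top)
  have Fm: "maximal_set M l \<in> sets borel" for l using closed_maximal_set[OF M] by auto
  have "emeasure lborel (\<Inter>n. - maximal_set M (real (Suc n))) \<le> ennreal 0"
  proof (rule LIMSEQ_le_const)
    show "(\<lambda>n. ennreal (?c * T * (1 / real (Suc n)))) \<longlonglongrightarrow> ennreal 0"
    proof (rule tendsto_ennrealI)
      have "(\<lambda>n. ?c * T * (1 / real (Suc n))) \<longlonglongrightarrow> ?c * T * 0" by (intro tendsto_intros LIMSEQ_Suc lim_1_over_n)
      thus "(\<lambda>n. ?c * T * (1 / real (Suc n))) \<longlonglongrightarrow> 0" by simp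
    qed
    show "\<exists>N. \<forall>n\<ge>N. emeasure lborel (\<Inter>n. - maximal_set M (real (Suc n))) \<le> ennreal (?c * T * (1 / real (Suc n)))"
    proof (intro exI allI impI)
      fix n
      have "emeasure lborel (\<Inter>n. - maximal_set M (real (Suc n))) \<le> emeasure lborel (- maximal_set M (real (Suc n)))"
        using Fm by (intro emeasure_mono) auto
      also have "... \<le> ennreal (?c / real (Suc n)) * emeasure M UNIV" by (rule emeasure_compl_maximal_set[OF M fin]) simp
      also have "... = ennreal (?c * T * (1 / real (Suc n)))" unfolding T(1) using vitali_const_pos[where 'a='a] T(2) by (simp add: ennreal_mult[symmetric])
      finally show "emeasure lborel (\<Inter>n. - maximal_set M (real (Suc n))) \<le> ennreal (?c * T * (1 / real (Suc n)))" .
    qed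
  qed
  hence "(\<Inter>n. - maximal_set M (real (Suc n))) \<in> null_sets lborel" using Fm by (intro null_setsI) auto
  hence 1: "AE a in lborel. a \<notin> (\<Inter>n. - maximal_set M (real (Suc n)))" by (rule AE_not_in)
  have 2: "AE a in lborel. \<forall>n. a \<in> maximal_set M (real (Suc n)) --> (\<exists>A B. cap_taylor M a A B)"
    by (subst AE_all_countable, intro allI cap_taylor_at_maximal_set[OF d M fin]) simp
  from 1 2 show ?thesis by eventually_elim blast
qed

section \<open>Newtonian capacity\<close>

lemma compact_capacity_mono:
  fixes K :: "'a::euclidean_space => 'a => ereal"
  assumes "compact C" "compact D" "C \<subseteq> D"
  shows "compact_capacity K C \<le> compact_capacity K D"
  unfolding compact_capacity_def
proof (rule SUP_mono)
  fix \<nu> assume "\<nu> \<in> {\<nu>. finite_measure \<nu> \<and> sets \<nu> = sets borel \<and> emeasure \<nu> (- C) = 0 \<and> (\<forall>x. ereal_integral \<nu> (K x) \<le> 1)}"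
  hence n: "finite_measure \<nu>" "sets \<nu> = sets borel" "emeasure \<nu> (- C) = 0" "\<forall>x. ereal_integral \<nu> (K x) \<le> 1" by auto
  have CD: "C \<in> sets borel" "D \<in> sets borel" using assms by (auto intro: borel_compact)
  have "emeasure \<nu> (- D) \<le> emeasure \<nu> (- C)" using assms CD n(2) by (intro emeasure_mono) auto
  hence "emeasure \<nu> (- D) = 0" using n(3) by simp
  moreover have "emeasure \<nu> C \<le> emeasure \<nu> D" using assms CD n(2) by (intro emeasure_mono) auto
  ultimately show "\<exists>m\<in>{\<nu>. finite_measure \<nu> \<and> sets \<nu> = sets borel \<and> emeasure \<nu> (- D) = 0 \<and> (\<forall>x. ereal_integral \<nu> (K x) \<le> 1)}. emeasure \<nu> C \<le> emeasure m D"
    using n by blast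
qed

text \<open>
Inner regularity holds for compact sets too, so the case distinction in the definition disappears.
\<close>

lemma capacity_eq_SUP:
  fixes K :: "'a::euclidean_space => 'a => ereal"
  shows "capacity K E = (SUP C\<in>{C. compact C \<and> C \<subseteq> E}. compact_capacity K C)"
proof (cases "compact E")
  case True
  have "(SUP C\<in>{C. compact C \<and> C \<subseteq> E}. compact_capacity K C) = compact_capacity K E"
    by (intro antisym SUP_least SUP_upper compact_capacity_mono) (use True in auto)
  thus ?thesis using True by (simp add: capacity_def)
qed (simp add: capacity_def)

lemma capacity_mono: "E \<subseteq> E' ==> capacity K E \<le> capacity K E'"
  unfolding capacity_eq_SUP by (intro SUP_subset_mono) auto

lemma ereal_integral_newton_le_1:
  "ereal_integral \<nu> (newton_kernel x) \<le> 1 \<longleftrightarrow> npot \<nu> x \<le> 1"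
proof -
  have "e2ennreal (- newton_kernel x y) = 0" for y
    by (rule e2ennreal_neg) (simp add: newton_kernel_def)
  hence "ereal_integral \<nu> (newton_kernel x) = enn2ereal (npot \<nu> x)"
    unfolding ereal_integral_def nkern_def by (simp add: zero_ennreal.rep_eq)
  thus ?thesis by (simp add: less_eq_ennreal.rep_eq one_ennreal.rep_eq)
qed

text \<open>
A measure \<open>\<nu>\<close> on \<open>E\<close> that is admissible for the capacity has potential at most \<open>1\<close>. Integrating the
assumption against \<open>\<nu>\<close> and exchanging the order of integration, which the symmetry of the kernel
allows, bounds \<open>t * \<nu> E\<close> by the masses of \<open>\<tau>\<close> and \<open>\<tau>'\<close>.
\<close>

lemma newton_weak_type:
  fixes \<tau> \<tau>' :: "'a::euclidean_space measure"
  assumes s: "sets \<tau> = sets borel" "sets \<tau>' = sets borel" and fin: "emeasure \<tau> UNIV < \<infinity>" "emeasure \<tau>' UNIV < \<infinity>"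
    and E: "\<And>x. x \<in> E ==> t \<le> npot \<tau> x + npot \<tau>' x"
  shows "t * capacity newton_kernel E \<le> emeasure \<tau> UNIV + emeasure \<tau>' UNIV"
  unfolding capacity_eq_SUP
proof (subst SUP_mult_left_ennreal, rule SUP_least)
  fix C assume "C \<in> {C. compact C \<and> C \<subseteq> E}"
  hence C: "compact C" "C \<subseteq> E" by auto
  show "t * compact_capacity newton_kernel C \<le> emeasure \<tau> UNIV + emeasure \<tau>' UNIV"
    unfolding compact_capacity_def
  proof (subst SUP_mult_left_ennreal, rule SUP_least)
    fix \<nu> :: "'a measure"
    assume "\<nu> \<in> {\<nu>. finite_measure \<nu> \<and> sets \<nu> = sets borel \<and> emeasure \<nu> (- C) = 0 \<and> (\<forall>x. ereal_integral \<nu> (newton_kernel x) \<le> 1)}"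
    hence \<nu>: "finite_measure \<nu>" and sn: "sets \<nu> = sets borel" and n1: "\<And>x. npot \<nu> x \<le> 1"
      by (auto simp: ereal_integral_newton_le_1)
    note [measurable_cong, simp] = sn s
    interpret \<nu>: finite_measure \<nu> by fact
    have Cb[measurable]: "C \<in> sets borel" using C(1) by (rule borel_compact)
    have one: "(\<integral>\<^sup>+x. \<integral>\<^sup>+y. nkern x y \<partial>\<rho> \<partial>\<nu>) \<le> emeasure \<rho> UNIV"
      if sr[measurable_cong, simp]: "sets \<rho> = sets borel" and fr: "emeasure \<rho> UNIV < \<infinity>" for \<rho> :: "'a measure"
    proof -
      have sp: "space \<rho> = UNIV" using sets_eq_imp_space_eq[OF sr] by simp
      interpret \<rho>: finite_measure \<rho> using fr by (intro finite_measureI) (auto simp: sp)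
      interpret P: pair_sigma_finite \<rho> \<nu> ..
      have "(\<integral>\<^sup>+x. \<integral>\<^sup>+y. nkern x y \<partial>\<rho> \<partial>\<nu>) = (\<integral>\<^sup>+y. \<integral>\<^sup>+x. nkern x y \<partial>\<nu> \<partial>\<rho>)"
        by (rule P.Fubini') measurable
      also have "... \<le> (\<integral>\<^sup>+y. 1 \<partial>\<rho>)"
      proof (intro nn_integral_mono)
        fix y :: 'a
        show "(\<integral>\<^sup>+x. nkern x y \<partial>\<nu>) \<le> 1" using n1[of y] by (subst nkern_commute)
      qed
      also have "... = emeasure \<rho> UNIV" by (simp add: sp)
      finally show ?thesis .
    qed
    have "t * emeasure \<nu> C = (\<integral>\<^sup>+x. t * indicator C x \<partial>\<nu>)" by (simp add: nn_integral_cmult_indicator)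
    also have "... \<le> (\<integral>\<^sup>+x. npot \<tau> x + npot \<tau>' x \<partial>\<nu>)"
      using C(2) E by (intro nn_integral_mono) (auto split: split_indicator)
    also have "... = (\<integral>\<^sup>+x. \<integral>\<^sup>+y. nkern x y \<partial>\<tau> \<partial>\<nu>) + (\<integral>\<^sup>+x. \<integral>\<^sup>+y. nkern x y \<partial>\<tau>' \<partial>\<nu>)"
    proof -
      have f: "finite_measure \<rho>" if "sets \<rho> = sets borel" "emeasure \<rho> UNIV < \<infinity>" for \<rho> :: "'a measure"
        using that sets_eq_imp_space_eq[OF that(1)] by (intro finite_measureI) auto
      interpret t1: finite_measure \<tau> by (rule f[OF s(1) fin(1)])
      interpret t2: finite_measure \<tau>' by (rule f[OF s(2) fin(2)])
      show ?thesis by (rule nn_integral_add) measurable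
    qed
    also have "... \<le> emeasure \<tau> UNIV + emeasure \<tau>' UNIV" by (intro add_mono one s fin)
    finally show "t * emeasure \<nu> C \<le> emeasure \<tau> UNIV + emeasure \<tau>' UNIV" .
  qed
qed

definition ball_cap_const :: "'a::euclidean_space itself => real" where
  "ball_cap_const _ = unit_ball_vol DIM('a) / (2 * newton_const TYPE('a)) / 2 ^ (DIM('a) - 2)"

lemma ball_cap_const_pos: "ball_cap_const TYPE('a::euclidean_space) > 0"
  by (simp add: ball_cap_const_def newton_const_pos)

text \<open>
Test with a multiple of Lebesgue measure on a concentric closed ball.
\<close>

lemma capacity_ball_lower:
  fixes a :: "'a::euclidean_space"
  assumes d: "DIM('a) \<ge> 3" and r: "r > 0"
  shows "ennreal (ball_cap_const TYPE('a) * r ^ (DIM('a) - 2)) \<le> capacity newton_kernel (ball a r)"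
proof -
  let ?nc = "newton_const TYPE('a)" and ?o = "unit_ball_vol (real DIM('a))"
  have nc: "?nc > 0" by (rule newton_const_pos)
  define s where "s = r / 2"
  have s: "s > 0" using r by (simp add: s_def)
  define c where "c = 1 / (2 * ?nc * s^2)"
  have c: "c > 0" using nc s by (simp add: c_def)
  define \<nu> where "\<nu> = density lborel (\<lambda>y. ennreal c * indicator (cball a s) y)"
  have sn[simp]: "sets \<nu> = sets borel" by (simp add: \<nu>_def)
  have en: "emeasure \<nu> E = ennreal c * emeasure lborel (cball a s \<inter> E)" if "E \<in> sets borel" for E
  proof -
    have "emeasure \<nu> E = (\<integral>+y. ennreal c * indicator (cball a s \<inter> E) y)"
      unfolding \<nu>_def using that by (subst emeasure_density) (auto intro!: nn_integral_cong split: split_indicator)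
    thus ?thesis using that by (simp add: nn_integral_cmult_indicator)
  qed
  have "finite_measure \<nu>"
    using s by (intro finite_measureI) (simp add: \<nu>_def[symmetric] en emeasure_cball ennreal_mult_eq_top_iff, simp add: \<nu>_def emeasure_density nn_integral_cmult_indicator emeasure_cball ennreal_mult_eq_top_iff)
  moreover have "emeasure \<nu> (- cball a s) = 0" by (subst en) auto
  moreover have "ereal_integral \<nu> (newton_kernel x) \<le> 1" for x
    unfolding ereal_integral_newton_le_1
  proof -
    have "npot \<nu> x = (\<integral>+y. ennreal c * indicator (cball a s) y * nkern x y)"
      unfolding \<nu>_def by (subst nn_integral_density) auto
    also have "... = (\<integral>+y. ennreal c * (ennreal (newton (x - y)) * indicator (cball a s) y))"
    proof (rule nn_integral_cong_AE)
      have "AE y in lborel. y \<noteq> x" by (rule AE_lborel_singleton)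
      thus "AE y in lborel. ennreal c * indicator (cball a s) y * nkern x y = ennreal c * (ennreal (newton (x - y)) * indicator (cball a s) y)"
        by eventually_elim (auto simp: nkern_eq mult_ac)
    qed
    also have "... = ennreal c * (\<integral>+y. ennreal (newton (x - y)) * indicator (cball a s) y)"
      by (rule nn_integral_cmult) measurable
    also have "... \<le> ennreal c * ennreal (2 * ?nc * s^2)"
      by (intro mult_left_mono nn_integral_newton_shift d s) simp
    also have "... = 1" using c nc s by (simp add: ennreal_mult[symmetric] c_def)
    finally show "npot \<nu> x \<le> 1" .
  qed
  ultimately have "emeasure \<nu> (cball a s) \<le> compact_capacity newton_kernel (cball a s)"
    unfolding compact_capacity_def by (intro SUP_upper) auto
  also have "... \<le> capacity newton_kernel (ball a r)"
    unfolding capacity_eq_SUP using r by (intro SUP_upper) (auto simp: s_def)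
  also have "emeasure \<nu> (cball a s) = ennreal (c * (?o * s ^ DIM('a)))"
    using c s by (subst en) (auto simp: emeasure_cball ennreal_mult[symmetric])
  also have "c * (?o * s ^ DIM('a)) = ball_cap_const TYPE('a) * r ^ (DIM('a) - 2)"
  proof -
    have "DIM('a) = (DIM('a) - 2) + 2" using d by simp
    hence "s ^ DIM('a) = s ^ (DIM('a) - 2) * s^2" by (metis power_add)
    thus ?thesis using s nc unfolding ball_cap_const_def c_def by (simp add: s_def power_divide)
  qed
  finally show ?thesis .
qed

section \<open>Jordan decomposition\<close>

lemma signed_borel_measure_uminus: "signed_borel_measure \<mu> ==> signed_borel_measure (\<lambda>A. - \<mu> A)"
  unfolding signed_borel_measure_def by (auto intro: sums_minus)

lemma sets_jordan_pos: "sets (jordan_pos \<mu>) = sets borel"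
  using sets.sigma_sets_eq[of borel] by (simp add: jordan_pos_def)

text \<open>
If the values were unbounded, one could successively split off disjoint sets of measure at least \<open>1\<close> in
absolute value, keeping the values unbounded on the subsets of the rest; the series of their measures
would not converge.
\<close>

lemma signed_borel_measure_bounded:
  fixes \<mu> :: "'a::topological_space set => real"
  assumes \<mu>: "signed_borel_measure \<mu>"
  shows "\<exists>C. \<forall>B\<in>sets borel. \<bar>\<mu> B\<bar> \<le> C"
proof (rule ccontr)
  assume unb: "\<nexists>C. \<forall>B\<in>sets borel. \<bar>\<mu> B\<bar> \<le> C"
  define bad where "bad X \<longleftrightarrow> X \<in> sets borel \<and> (\<forall>C. \<exists>B\<in>sets borel. B \<subseteq> X \<and> \<bar>\<mu> B\<bar> > C)" for X
  have add: "\<mu> (A \<union> B) = \<mu> A + \<mu> B" if "A \<in> sets borel" "B \<in> sets borel" "A \<inter> B = {}" for A B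
    by (rule signed_borel_measure_Un[OF \<mu> that])
  have step: "\<exists>Y. bad Y \<and> Y \<subseteq> X \<and> \<bar>\<mu> (X - Y)\<bar> \<ge> 1" if X: "bad X" for X
  proof -
    have Xm: "X \<in> sets borel" using X by (simp add: bad_def)
    obtain A where A: "A \<in> sets borel" "A \<subseteq> X" "\<bar>\<mu> A\<bar> > 1 + \<bar>\<mu> X\<bar>" using X unfolding bad_def by blast
    have XA: "\<mu> X = \<mu> A + \<mu> (X - A)" using add[of A "X - A"] A Xm by (simp add: Un_absorb1)
    have big: "\<bar>\<mu> A\<bar> \<ge> 1" "\<bar>\<mu> (X - A)\<bar> \<ge> 1" using A(3) XA by linarith+
    have "bad A \<or> bad (X - A)"
    proof (rule ccontr)
      assume "\<not> (bad A \<or> bad (X - A))"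
      moreover have "\<exists>C. \<forall>B\<in>sets borel. B \<subseteq> Y --> \<bar>\<mu> B\<bar> \<le> C" if "Y \<in> sets borel" "\<not> bad Y" for Y
        using that unfolding bad_def by (meson not_le)
      moreover have "X - A \<in> sets borel" using A(1) Xm by simp
      ultimately obtain C1 C2 where C: "\<And>B. B \<in> sets borel ==> B \<subseteq> A ==> \<bar>\<mu> B\<bar> \<le> C1" "\<And>B. B \<in> sets borel ==> B \<subseteq> X - A ==> \<bar>\<mu> B\<bar> \<le> C2"
        using A(1) by (metis (no_types))
      obtain B where B: "B \<in> sets borel" "B \<subseteq> X" "\<bar>\<mu> B\<bar> > C1 + C2" using X unfolding bad_def by blast
      have "\<mu> B = \<mu> (B \<inter> A) + \<mu> (B - A)" using add[of "B \<inter> A" "B - A"] A B by (simp add: Int_Diff_Un Int_Diff_disjoint)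
      moreover have "\<bar>\<mu> (B \<inter> A)\<bar> \<le> C1" "\<bar>\<mu> (B - A)\<bar> \<le> C2" using A B by (auto intro!: C)
      ultimately show False using B(3) by linarith
    qed
    thus ?thesis
    proof
      assume "bad A"
      thus ?thesis using A(2) big(2) by blast
    next
      assume "bad (X - A)"
      moreover have "X - (X - A) = A" using A(2) by blast
      ultimately show ?thesis using big(1) by (intro exI[of _ "X - A"]) auto
    qed
  qed
  have "bad UNIV" unfolding bad_def using unb by (auto simp: not_le)
  hence "\<exists>X. \<forall>n::nat. bad (X n) \<and> (X (Suc n) \<subseteq> X n \<and> \<bar>\<mu> (X n - X (Suc n))\<bar> \<ge> 1)"
    using step by (intro dependent_nat_choice) auto
  then obtain X where X: "\<And>n::nat. bad (X n)" "\<And>n. X (Suc n) \<subseteq> X n \<and> \<bar>\<mu> (X n - X (Suc n))\<bar> \<ge> 1"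
    by blast
  define D where "D n = X n - X (Suc n)" for n
  have anti: "X n \<subseteq> X m" if "m \<le> n" for m n using lift_Suc_antimono_le[of X m n] that X(2) by blast
  have "range D \<subseteq> sets borel" using X(1) by (auto simp: D_def bad_def)
  moreover have "disjoint_family D"
    unfolding disjoint_family_on_def
  proof (intro ballI impI)
    fix m n :: nat assume "m \<noteq> n"
    thus "D m \<inter> D n = {}"
    proof (cases m n rule: linorder_cases)
      case less
      thus ?thesis using anti[of "Suc m" n] by (auto simp: D_def)
    next
      case greater
      thus ?thesis using anti[of "Suc n" m] by (auto simp: D_def)
    qed simp
  qed
  ultimately have "(\<lambda>n. \<mu> (D n)) sums \<mu> (\<Union>n. D n)" using \<mu> unfolding signed_borel_measure_def by blast
  hence "(\<lambda>n. \<mu> (D n)) \<longlonglongrightarrow> 0" by (intro summable_LIMSEQ_zero sums_summable)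
  hence "eventually (\<lambda>n. \<bar>\<mu> (D n)\<bar> < 1) sequentially" using order_tendstoD(2)[of "\<lambda>n. \<bar>\<mu> (D n)\<bar>" 0 sequentially 1] tendsto_rabs_zero by force
  then obtain n where "\<bar>\<mu> (D n)\<bar> < 1" by (auto simp: eventually_sequentially)
  thus False using X(2)[of n] by (simp add: D_def)
qed

lemma jordan_pos_finite:
  fixes \<mu> :: "'a::topological_space set => real"
  assumes "signed_borel_measure \<mu>"
  shows "emeasure (jordan_pos \<mu>) UNIV < \<infinity>"
proof -
  obtain C where C: "\<And>B. B \<in> sets borel ==> \<bar>\<mu> B\<bar> \<le> C" using signed_borel_measure_bounded[OF assms] by blast
  have "emeasure (jordan_pos \<mu>) UNIV = jordan_pos_fun \<mu> UNIV" by (rule emeasure_jordan_pos[OF assms]) simp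
  also have "... \<le> ennreal C"
    unfolding jordan_pos_fun_def
  proof (rule SUP_least)
    fix B :: "'a set" assume "B \<in> {B \<in> sets borel. B \<subseteq> UNIV}"
    thus "ennreal (\<mu> B) \<le> ennreal C" using C[of B] by (intro ennreal_leI) auto
  qed
  finally show ?thesis by (rule order.strict_trans1) simp
qed

lemma emeasure_total_variation:
  assumes \<mu>: "signed_borel_measure \<mu>" and A: "A \<in> sets borel"
  shows "emeasure (total_variation \<mu>) A = emeasure (jordan_pos \<mu>) A + emeasure (jordan_neg \<mu>) A"
proof (rule emeasure_measure_of[OF total_variation_def])
  show "positive (sets (total_variation \<mu>)) (\<lambda>A. emeasure (jordan_pos \<mu>) A + emeasure (jordan_neg \<mu>) A)"
    by (simp add: positive_def)
  have st: "sets (total_variation \<mu>) = sets borel"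
    using sets.sigma_sets_eq[of borel] by (simp add: total_variation_def)
  show "A \<in> sets (total_variation \<mu>)" using A st by simp
  show "countably_additive (sets (total_variation \<mu>)) (\<lambda>A. emeasure (jordan_pos \<mu>) A + emeasure (jordan_neg \<mu>) A)"
  proof (rule countably_additiveI)
    fix F :: "nat => 'a set" assume F: "range F \<subseteq> sets (total_variation \<mu>)" "disjoint_family F"
    have "(\<Sum>i. emeasure (jordan_pos \<mu>) (F i) + emeasure (jordan_neg \<mu>) (F i)) = (\<Sum>i. emeasure (jordan_pos \<mu>) (F i)) + (\<Sum>i. emeasure (jordan_neg \<mu>) (F i))"
      by (rule suminf_add[symmetric]) auto
    also have "... = emeasure (jordan_pos \<mu>) (\<Union> (range F)) + emeasure (jordan_neg \<mu>) (\<Union> (range F))"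
      using F unfolding st jordan_neg_def by (intro arg_cong2[where f = "(+)"] suminf_emeasure) (auto simp: sets_jordan_pos)
    finally show "(\<Sum>i. emeasure (jordan_pos \<mu>) (F i) + emeasure (jordan_neg \<mu>) (F i)) = emeasure (jordan_pos \<mu>) (\<Union> (range F)) + emeasure (jordan_neg \<mu>) (\<Union> (range F))" .
  qed
qed auto

lemma sets_total_variation: "sets (total_variation \<mu>) = sets borel"
  using sets.sigma_sets_eq[of borel] by (simp add: total_variation_def)

lemma nn_integral_total_variation:
  assumes \<mu>: "signed_borel_measure \<mu>" and f: "f \<in> borel_measurable borel"
  shows "(\<integral>\<^sup>+x. f x \<partial>total_variation \<mu>) = (\<integral>\<^sup>+x. f x \<partial>jordan_pos \<mu>) + (\<integral>\<^sup>+x. f x \<partial>jordan_neg \<mu>)"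
  using f
proof (induction rule: borel_measurable_induct)
  note [measurable_cong, simp] = sets_total_variation[of \<mu>] sets_jordan_pos[of \<mu>]
  have [measurable_cong, simp]: "sets (jordan_neg \<mu>) = sets borel" by (simp add: jordan_neg_def sets_jordan_pos)
  {
    case (cong f g)
    thus ?case by (simp add: space_borel)
  next
    case (set A)
    thus ?case by (simp add: emeasure_total_variation[OF \<mu>])
  next
    case (mult u c)
    thus ?case by (simp add: nn_integral_cmult distrib_left)
  next
    case (add u v)
    thus ?case by (simp add: nn_integral_add add_ac)
  next
    case (seq U)
    have inc: "incseq (\<lambda>i. \<integral>\<^sup>+x. U i x \<partial>N)" for N
      using seq by (auto simp: incseq_def le_fun_def intro!: nn_integral_mono)
    have s: "(\<integral>\<^sup>+x. (SUP i. U i x) \<partial>N) = (SUP i. \<integral>\<^sup>+x. U i x \<partial>N)" if "sets N = sets borel" for N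
      using seq that by (intro nn_integral_monotone_convergence_SUP) (auto simp: measurable_cong_sets[OF that refl])
    have IH: "(\<integral>\<^sup>+x. U i x \<partial>total_variation \<mu>) = (\<integral>\<^sup>+x. U i x \<partial>jordan_pos \<mu>) + (\<integral>\<^sup>+x. U i x \<partial>jordan_neg \<mu>)" for i
      using seq by blast
    have "(\<integral>\<^sup>+x. (SUP i. U i x) \<partial>total_variation \<mu>) = (\<integral>\<^sup>+x. (SUP i. U i x) \<partial>jordan_pos \<mu>) + (\<integral>\<^sup>+x. (SUP i. U i x) \<partial>jordan_neg \<mu>)"
      by (simp only: s sets_total_variation sets_jordan_pos jordan_neg_def[of \<mu>] IH[unfolded jordan_neg_def])
         (rule ennreal_SUP_add[OF inc inc])
    thus ?case by (simp only: SUP_apply)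
  }
qed

section \<open>Capacity differentiability of Newtonian potentials\<close>

lemma tendsto_0_ennrealI:
  fixes f :: "'b => ennreal"
  assumes "\<And>e. e > 0 ==> eventually (\<lambda>x. f x \<le> ennreal e) F"
  shows "(f \<longlongrightarrow> 0) F"
proof (rule order_tendstoI)
  fix a :: ennreal assume "a > 0"
  then obtain b where b: "0 < b" "b < a" using dense by blast
  have "b < top" using b(2) by (rule order.strict_trans2) simp
  then obtain e where e: "b = ennreal e" "e \<ge> 0" by (cases b) auto
  with b have "e > 0" by (auto simp: less_le)
  from assms[OF this] show "eventually (\<lambda>x. f x < a) F" by eventually_elim (use b e in auto)
qed simp

lemma small_radius:
  assumes "\<exists>r0>0. \<forall>r::real. 0 < r \<and> r < r0 --> P r" "\<And>r0. 0 < r0 ==> (\<And>r. 0 < r ==> r < r0 ==> P r) ==> thesis"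
  shows thesis
  using assms by blast

text \<open>
For \<open>t \<le> 4 * \<epsilon>\<close> the exceptional set is merely a subset of the ball, and monotonicity of the capacity
suffices. For larger \<open>t\<close> the potential of \<open>\<tau>\<close> or \<open>\<tau>'\<close> must be of size \<open>t\<close>, and the weak type
bound applies.
\<close>

lemma cap_taylor_signed:
  fixes M N :: "'a::euclidean_space measure"
  assumes d: "DIM('a) \<ge> 3"
    and M: "cap_taylor M a A B" and N: "cap_taylor N a A' B'"
    and S: "\<And>x. x \<in> S ==> pot_finite M x \<and> pot_finite N x" and a: "a \<in> S"
    and u: "\<And>x. u x = potM M x - potM N x"
  shows "capacity_differentiable2 newton_kernel S u a"
  unfolding capacity_differentiable2_def
proof (intro conjI a exI)
  let ?d = "DIM('a)" and ?b = "ball_cap_const TYPE('a)"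
  have b: "?b > 0" by (rule ball_cap_const_pos)
  let ?A = "\<lambda>i. A i - A' i" and ?B = "\<lambda>i j. B i j - B' i j"
  let ?E = "\<lambda>r t. {x \<in> ball a r \<inter> S. t < taylor2_error u a ?A ?B x / (norm (x - a))^2}"
  show "((\<lambda>r. (SUP t\<in>{0<..}. ennreal t * capacity newton_kernel (?E r t)) / capacity newton_kernel (ball a r)) \<longlongrightarrow> 0) (at_right 0)"
  proof (rule tendsto_0_ennrealI)
    fix e :: real assume e: "e > 0"
    define \<epsilon> where "\<epsilon> = e / (4 + 4 / ?b)"
    have \<epsilon>: "\<epsilon> > 0" using e b by (simp add: \<epsilon>_def add_pos_pos)
    obtain r1 where r1: "r1 > 0" "\<And>r. 0 < r ==> r < r1 ==>
     (\<exists>\<tau>. sets \<tau> = sets borel \<and> emeasure \<tau> UNIV \<le> ennreal (\<epsilon> * r ^ (DIM('a) - 2)) \<and>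
       (\<forall>x\<in>ball a r. pot_finite M x -->
          taylor_le M a A B \<epsilon> \<tau> x))"
      by (rule small_radius[OF M[unfolded cap_taylor_def, THEN spec, THEN mp, OF \<epsilon>]]) (rule that, assumption, blast)
    obtain r2 where r2: "r2 > 0" "\<And>r. 0 < r ==> r < r2 ==>
     (\<exists>\<tau>. sets \<tau> = sets borel \<and> emeasure \<tau> UNIV \<le> ennreal (\<epsilon> * r ^ (DIM('a) - 2)) \<and>
       (\<forall>x\<in>ball a r. pot_finite N x -->
          taylor_le N a A' B' \<epsilon> \<tau> x))"
      by (rule small_radius[OF N[unfolded cap_taylor_def, THEN spec, THEN mp, OF \<epsilon>]]) (rule that, assumption, blast)
    have "(SUP t\<in>{0<..}. ennreal t * capacity newton_kernel (?E r t)) / capacity newton_kernel (ball a r) \<le> ennreal e"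
      if r: "0 < r" "r < min r1 r2" for r
    proof -
      let ?c = "capacity newton_kernel (ball a r)"
      obtain \<tau> where \<tau>: "sets \<tau> = sets borel" "emeasure \<tau> UNIV \<le> ennreal (\<epsilon> * r ^ (?d - 2))"
        "\<And>x. x \<in> ball a r ==> pot_finite M x ==> taylor_le M a A B \<epsilon> \<tau> x"
        using r1(2)[of r] r by auto
      obtain \<tau>' where \<tau>': "sets \<tau>' = sets borel" "emeasure \<tau>' UNIV \<le> ennreal (\<epsilon> * r ^ (?d - 2))"
        "\<And>x. x \<in> ball a r ==> pot_finite N x ==> taylor_le N a A' B' \<epsilon> \<tau>' x"
        using r2(2)[of r] r by auto
      have c: "ennreal (?b * r ^ (?d - 2)) \<le> ?c" by (rule capacity_ball_lower[OF d r(1)])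
      have cpos: "?c > 0"
      proof -
        have "0 < ennreal (?b * r ^ (?d - 2))" using b r by simp
        thus ?thesis using c by (rule order.strict_trans2)
      qed
      have rc: "ennreal (r ^ (?d - 2)) \<le> ennreal (1 / ?b) * ?c"
      proof -
        have "ennreal (r ^ (?d - 2)) = ennreal (1 / ?b) * ennreal (?b * r ^ (?d - 2))" using b r by (simp add: ennreal_mult[symmetric])
        also have "... \<le> ennreal (1 / ?b) * ?c" using c by (rule mult_left_mono) simp
        finally show ?thesis .
      qed
      have sup: "ennreal t * capacity newton_kernel (?E r t) \<le> ennreal e * ?c" if t: "t > 0" for t
      proof (cases "t \<le> 4 * \<epsilon>")
        case True
        have "4 * \<epsilon> \<le> e" using \<epsilon> e b by (simp add: \<epsilon>_def field_simps)
        have "ennreal t * capacity newton_kernel (?E r t) \<le> ennreal e * ?c"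
          using True \<open>4 * \<epsilon> \<le> e\<close> by (intro mult_mono capacity_mono ennreal_leI) auto
        thus ?thesis .
      next
        case False
        have "ennreal (t / 2) * capacity newton_kernel (?E r t) \<le> emeasure \<tau> UNIV + emeasure \<tau>' UNIV"
        proof (rule newton_weak_type[OF \<tau>(1) \<tau>'(1)])
          show "emeasure \<tau> UNIV < \<infinity>" "emeasure \<tau>' UNIV < \<infinity>" using \<tau>(2) \<tau>'(2) by (auto intro: order.strict_trans1)
          fix x assume x: "x \<in> ?E r t"
          let ?n = "(norm (x - a))^2" and ?R = "npot \<tau> x + npot \<tau>' x"
          have xa: "x \<noteq> a" using x t by auto
          have n: "?n > 0" using xa by simp
          have "t * ?n \<le> taylor2_error u a ?A ?B x" using x n by (auto simp: pos_less_divide_eq intro: less_imp_le)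
          also have "... \<le> \<bar>remainder M a A B x\<bar> + \<bar>remainder N a A' B' x\<bar>"
          proof -
            have "(\<Sum>i\<in>Basis. ?A i * ((x - a) \<bullet> i)) + (\<Sum>j\<in>Basis. \<Sum>k\<in>Basis. ?B j k * ((x - a) \<bullet> j) * ((x - a) \<bullet> k)) = poly2 A B (x - a) - poly2 A' B' (x - a)"
              unfolding poly2_def by (simp add: left_diff_distrib sum_subtractf)
            hence "taylor2_error u a ?A ?B x = \<bar>(remainder M a A B x) - (remainder N a A' B' x)\<bar>"
              unfolding taylor2_error_def u by (simp add: algebra_simps)
            thus ?thesis by simp
          qed
          finally have "ennreal (t * ?n) \<le> ennreal (\<bar>remainder M a A B x\<bar> + \<bar>remainder N a A' B' x\<bar>)"
            by (rule ennreal_leI)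
          also have "... = ennreal \<bar>remainder M a A B x\<bar> + ennreal \<bar>remainder N a A' B' x\<bar>" by simp
          also have "... \<le> ennreal ?n * (ennreal \<epsilon> + npot \<tau> x) + ennreal ?n * (ennreal \<epsilon> + npot \<tau>' x)"
            using x S by (intro add_mono \<tau>(3) \<tau>'(3)) auto
          also have "... = ennreal ?n * (ennreal (2 * \<epsilon>) + ?R)"
          proof -
            have "ennreal (2 * \<epsilon>) = ennreal \<epsilon> + ennreal \<epsilon>" using \<epsilon> by (simp add: ennreal_plus[symmetric] del: ennreal_plus)
            thus ?thesis unfolding distrib_left[symmetric] by (simp only: add_ac)
          qed
          finally have "ennreal ?n * ennreal t \<le> ennreal ?n * (ennreal (2 * \<epsilon>) + ?R)"
            using t by (simp add: ennreal_mult mult.commute)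
          hence tR: "ennreal t \<le> ennreal (2 * \<epsilon>) + ?R" using n by (subst (asm) ennreal_mult_le_mult_iff) auto
          show "ennreal (t / 2) \<le> ?R"
          proof (cases ?R)
            case (real q)
            have "t \<le> 2 * \<epsilon> + q" using tR \<epsilon> real by (simp add: ennreal_plus[symmetric] del: ennreal_plus)
            hence "t / 2 \<le> q" using False by linarith
            thus ?thesis using real by (simp add: ennreal_leI)
          next
            case top
            show ?thesis unfolding top by simp
          qed
        qed
        also have "... \<le> ennreal (\<epsilon> * r ^ (?d - 2)) + ennreal (\<epsilon> * r ^ (?d - 2))" by (intro add_mono \<tau> \<tau>')
        also have "... = ennreal (2 * \<epsilon>) * ennreal (r ^ (?d - 2))"
        proof -
          have R: "0 \<le> r ^ (?d - 2)" "0 \<le> \<epsilon> * r ^ (?d - 2)" "0 \<le> 2 * \<epsilon>" using \<epsilon> r by auto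
          have "\<epsilon> * r ^ (?d - 2) + \<epsilon> * r ^ (?d - 2) = 2 * \<epsilon> * r ^ (?d - 2)" by linarith
          thus ?thesis unfolding ennreal_plus[OF R(2) R(2), symmetric] ennreal_mult[OF R(3) R(1), symmetric] by (rule arg_cong)
        qed
        also have "... \<le> ennreal (2 * \<epsilon>) * (ennreal (1 / ?b) * ?c)" by (intro mult_left_mono rc) simp
        finally have "ennreal 2 * (ennreal (t / 2) * capacity newton_kernel (?E r t)) \<le> ennreal 2 * (ennreal (2 * \<epsilon>) * (ennreal (1 / ?b) * ?c))"
          by (rule mult_left_mono) simp
        moreover have "ennreal 2 * (ennreal (t / 2) * X) = ennreal t * X" for X
        proof -
          have "ennreal 2 * ennreal (t / 2) = ennreal t" using t by (subst ennreal_mult[symmetric]) auto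
          thus ?thesis by (simp only: mult.assoc[symmetric])
        qed
        moreover have "ennreal 2 * (ennreal (2 * \<epsilon>) * (ennreal (1 / ?b) * ?c)) = ennreal (4 * \<epsilon> / ?b) * ?c"
        proof -
          have "ennreal 2 * (ennreal (2 * \<epsilon>) * ennreal (1 / ?b)) = ennreal (4 * \<epsilon> / ?b)"
            using \<epsilon> b by (simp only: ennreal_mult[symmetric] less_imp_le zero_le_divide_1_iff mult_nonneg_nonneg zero_le_numeral) simp
          thus ?thesis by (simp only: mult.assoc[symmetric])
        qed
        moreover have "ennreal (4 * \<epsilon> / ?b) * ?c \<le> ennreal e * ?c"
        proof (intro mult_right_mono ennreal_leI)
          have "4 * \<epsilon> / ?b = e / (1 + ?b)" unfolding \<epsilon>_def using b by (simp add: divide_simps) (simp add: algebra_simps)?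
          also have "... \<le> e / 1" using e b by (intro divide_left_mono) auto
          finally show "4 * \<epsilon> / ?b \<le> e" by simp
        qed simp
        ultimately show ?thesis by simp
      qed
      have "(SUP t\<in>{0<..}. ennreal t * capacity newton_kernel (?E r t)) \<le> ?c * ennreal e"
        using sup by (intro SUP_least) (auto simp: mult.commute)
      thus ?thesis by (rule divide_le_posI_ennreal[OF cpos])
    qed
    thus "eventually (\<lambda>r. (SUP t\<in>{0<..}. ennreal t * capacity newton_kernel (?E r t)) / capacity newton_kernel (ball a r) \<le> ennreal e) (at_right 0)"
      unfolding eventually_at_right_field using r1(1) r2(1) by (intro exI[of _ "min r1 r2"]) auto
  qed
qed

theorem newton_potential_capacity_differentiable2:
  fixes \<mu> :: "'a::euclidean_space set => real"
  assumes d: "DIM('a) \<ge> 3" and \<mu>: "signed_borel_measure \<mu>"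
  shows "AE a in lborel. capacity_differentiable2 newton_kernel (potential_dom newton_kernel \<mu>) (potential newton_kernel \<mu>) a"
proof -
  let ?M = "jordan_pos \<mu>" and ?N = "jordan_neg \<mu>"
  note \<mu>' = signed_borel_measure_uminus[OF \<mu>]
  have sM: "sets ?M = sets borel" by (rule sets_jordan_pos)
  have sN: "sets ?N = sets borel" unfolding jordan_neg_def by (rule sets_jordan_pos)
  have fM: "emeasure ?M UNIV < \<infinity>" by (rule jordan_pos_finite[OF \<mu>])
  have fN: "emeasure ?N UNIV < \<infinity>" unfolding jordan_neg_def by (rule jordan_pos_finite[OF \<mu>'])
  have dom: "x \<in> potential_dom newton_kernel \<mu> \<longleftrightarrow> pot_finite ?M x \<and> pot_finite ?N x" for x
  proof -
    have "\<bar>newton_kernel x y\<bar> = newton_kernel x y" for y by (rule abs_ereal_ge0) (simp add: newton_kernel_def)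
    hence "(\<integral>\<^sup>+y. e2ennreal \<bar>newton_kernel x y\<bar> \<partial>total_variation \<mu>) = (\<integral>\<^sup>+y. nkern x y \<partial>total_variation \<mu>)"
      by (simp add: nkern_def)
    also have "... = npot ?M x + npot ?N x"
      by (rule nn_integral_total_variation[OF \<mu>]) measurable
    finally show ?thesis by (simp add: potential_dom_def pot_finite_def)
  qed
  have u: "potential newton_kernel \<mu> x = potM ?M x - potM ?N x" for x
  proof -
    have "real_of_ereal (newton_kernel x y) = newton (x - y)" for y
    proof (cases "x = y")
      case True
      thus ?thesis using d by (simp add: newton_kernel_def newton_def power_0_left)
    qed (simp add: newton_kernel_def newton_def dist_norm)
    thus ?thesis by (simp add: potential_def signed_integral_def potM_def)
  qed
  show ?thesis
    using AE_cap_taylor[OF d sM fM] AE_cap_taylor[OF d sN fN] AE_pot_finite[OF d sM fM] AE_pot_finite[OF d sN fN]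
  proof eventually_elim
    case (elim a)
    then obtain A B A' B' where "cap_taylor ?M a A B" "cap_taylor ?N a A' B'" by blast
    thus ?case by (rule cap_taylor_signed[OF d _ _ _ _ u]) (use dom elim in auto)
  qed
qed

section \<open>Logarithmic capacity\<close>

abbreviation "\<omega>2 \<equiv> unit_ball_vol (real DIM(complex))"

text \<open>
Each halving of \<open>norm z\<close> adds one ball to the sum and \<open>ln 2 < 1\<close> to the logarithm.
\<close>

lemma log_plus_dyadic:
  fixes z :: complex
  assumes \<rho>: "\<rho> > 0"
  shows "ennreal (ln (\<rho> / norm z)) \<le> (\<Sum>j. indicator (cball 0 (\<rho> * (1/2) ^ j)) z)"
proof (cases "z \<noteq> 0 \<and> norm z \<le> \<rho>")
  case True
  let ?t = "norm z / \<rho>"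
  have t: "?t > 0" "?t \<le> 1" using True \<rho> by auto
  then obtain k where k: "(1/2) ^ Suc k < ?t" "?t \<le> (1/2) ^ k" using dyadic_exists by blast
  have "ln (\<rho> / norm z) \<le> ln (2 ^ Suc k)"
  proof -
    have "\<rho> / norm z \<le> 2 ^ Suc k" using k(1) True \<rho> by (simp add: field_simps)
    moreover have "\<rho> / norm z > 0" using True \<rho> by simp
    ultimately show ?thesis by (rule ln_mono)
  qed
  also have "... = real (Suc k) * ln 2" by (subst ln_realpow) auto
  also have "... \<le> real (Suc k) * 1" using ln_2_less_1 by (intro mult_left_mono) auto
  finally have "ennreal (ln (\<rho> / norm z)) \<le> ennreal (real (Suc k))" by (intro ennreal_leI) simp
  also have "... = (\<Sum>j\<in>{..k}. 1 :: ennreal)" by (simp add: ennreal_of_nat_eq_real_of_nat)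
  also have "... = (\<Sum>j\<in>{..k}. indicator (cball 0 (\<rho> * (1/2) ^ j)) z)"
  proof (intro sum.cong refl)
    fix j assume "j \<in> {..k}"
    hence "(1/2::real) ^ k \<le> (1/2) ^ j" by (intro power_decreasing) auto
    hence "\<rho> * (1/2) ^ k \<le> \<rho> * (1/2) ^ j" using \<rho> by (intro mult_left_mono) auto
    moreover have "norm z \<le> \<rho> * (1/2) ^ k" using k(2) \<rho> by (simp add: pos_divide_le_eq mult.commute)
    ultimately have "norm z \<le> \<rho> * (1/2) ^ j" by linarith
    thus "(1::ennreal) = indicator (cball 0 (\<rho> * (1/2) ^ j)) z" by simp
  qed
  also have "... \<le> (\<Sum>j. indicator (cball 0 (\<rho> * (1/2) ^ j)) z)" by (rule sum_le_suminf) auto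
  finally show ?thesis .
next
  case False
  hence "ln (\<rho> / norm z) \<le> 0" using \<rho> by (cases "z = 0") (auto simp: ln_div)
  thus ?thesis by (simp add: ennreal_neg)
qed

lemma nn_integral_log_plus:
  fixes x :: complex
  assumes \<rho>: "\<rho> > 0"
  shows "(\<integral>+y. ennreal (ln (\<rho> / norm (x - y)))) \<le> ennreal (2 * \<omega>2 * \<rho>^2)"
proof -
  have "(\<integral>+y. ennreal (ln (\<rho> / norm (x - y)))) = (\<integral>+z. ennreal (ln (\<rho> / norm (z::complex))))"
    by (rule nn_integral_reflect) measurable
  also have "... \<le> (\<integral>+(z::complex). (\<Sum>j. indicator (cball 0 (\<rho> * (1/2) ^ j)) z))"
    by (intro nn_integral_mono log_plus_dyadic \<rho>)
  also have "... = (\<Sum>j. emeasure lborel (cball (0::complex) (\<rho> * (1/2) ^ j)))"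
    by (subst nn_integral_suminf) auto
  also have "... = (\<Sum>j. ennreal (\<omega>2 * \<rho>^2 * (1/4) ^ j))"
  proof (intro suminf_cong)
    fix j
    have "((1/2::real) ^ j)^2 = (1/4) ^ j" by (simp add: power2_eq_square power_mult_distrib[symmetric])
    thus "emeasure lborel (cball (0::complex) (\<rho> * (1/2) ^ j)) = ennreal (\<omega>2 * \<rho>^2 * (1/4) ^ j)"
      using \<rho> by (subst emeasure_cball) (auto simp: power_mult_distrib)
  qed
  also have "... = ennreal (\<Sum>j. \<omega>2 * \<rho>^2 * (1/4) ^ j)"
    by (intro suminf_ennreal2) (auto intro!: summable_mult summable_geometric)
  also have "(\<Sum>j. \<omega>2 * \<rho>^2 * (1/4) ^ j) = \<omega>2 * \<rho>^2 * (4/3)"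
    by (subst suminf_mult) (auto simp: summable_geometric suminf_geometric)
  also have "ennreal ... \<le> ennreal (2 * \<omega>2 * \<rho>^2)"
  proof (rule ennreal_leI)
    have "\<omega>2 * \<rho>^2 \<ge> 0" by simp
    thus "\<omega>2 * \<rho>^2 * (4/3) \<le> 2 * \<omega>2 * \<rho>^2" by linarith
  qed
  finally show ?thesis .
qed

lemma e2ennreal_log_kernel: "y \<noteq> x ==> e2ennreal (log_kernel x y) = ennreal (ln (1 / norm (x - y)))"
  by (simp add: log_kernel_def dist_norm e2ennreal_ereal)

text \<open>
Evaluate the potential of an admissible measure at the centre of the disc.
\<close>

lemma capacity_log_ball_upper:
  fixes a :: complex
  assumes r: "0 < r" "r < 1"
  shows "capacity log_kernel (ball a r) \<le> ennreal (1 / ln (1 / r))"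
  unfolding capacity_eq_SUP compact_capacity_def
proof (intro SUP_least)
  fix C \<nu> assume C: "C \<in> {C. compact C \<and> C \<subseteq> ball a r}"
    and "\<nu> \<in> {\<nu>. finite_measure \<nu> \<and> sets \<nu> = sets borel \<and> emeasure \<nu> (- C) = 0 \<and> (\<forall>x. ereal_integral \<nu> (log_kernel x) \<le> 1)}"
  hence \<nu>: "finite_measure \<nu>" "sets \<nu> = sets borel" "emeasure \<nu> (- C) = 0" "ereal_integral \<nu> (log_kernel a) \<le> 1" by auto
  note [measurable_cong, simp] = \<nu>(2)
  have l: "ln (1 / r) > 0" using r by (simp add: ln_div)
  have Cb[measurable]: "C \<in> sets borel" using C by (auto intro: borel_compact)
  have AEC: "AE y in \<nu>. y \<in> C"
    using \<nu>(3) by (intro AE_I'[of "- C"]) (auto intro!: null_setsI)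
  have ge: "log_kernel a y \<ge> ereal (ln (1 / r))" if "y \<in> C" for y
  proof (cases "a = y")
    case False
    have "dist a y < r" using that C by auto
    hence "ln (1 / r) \<le> ln (1 / dist a y)" using False r by (intro ln_mono) (auto intro!: divide_left_mono)
    thus ?thesis using False by (simp add: log_kernel_def)
  qed (simp add: log_kernel_def)
  have "(\<integral>\<^sup>+y. e2ennreal (- log_kernel a y) \<partial>\<nu>) = (\<integral>\<^sup>+y. 0 \<partial>\<nu>)"
  proof (rule nn_integral_cong_AE)
    show "AE y in \<nu>. e2ennreal (- log_kernel a y) = 0"
      using AEC
    proof eventually_elim
      case (elim y)
      have "log_kernel a y \<ge> 0" using ge[OF elim] l by (metis ereal_less_eq(5) less_imp_le order_trans)
      thus ?case by (intro e2ennreal_neg) simp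
    qed
  qed
  hence "enn2ereal (\<integral>\<^sup>+y. e2ennreal (log_kernel a y) \<partial>\<nu>) \<le> 1"
    using \<nu>(4) unfolding ereal_integral_def by (simp add: zero_ennreal.rep_eq)
  hence 1: "(\<integral>\<^sup>+y. e2ennreal (log_kernel a y) \<partial>\<nu>) \<le> 1" by (simp add: less_eq_ennreal.rep_eq one_ennreal.rep_eq)
  have "ennreal (ln (1 / r)) * emeasure \<nu> C = (\<integral>\<^sup>+y. ennreal (ln (1 / r)) * indicator C y \<partial>\<nu>)" by (simp add: nn_integral_cmult_indicator)
  also have "... \<le> (\<integral>\<^sup>+y. e2ennreal (log_kernel a y) \<partial>\<nu>)"
  proof (intro nn_integral_mono)
    fix y
    show "ennreal (ln (1 / r)) * indicator C y \<le> e2ennreal (log_kernel a y)"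
      using e2ennreal_mono[OF ge[of y]] by (auto simp: e2ennreal_ereal split: split_indicator)
  qed
  also note 1
  finally have "ennreal (1 / ln (1 / r)) * (ennreal (ln (1 / r)) * emeasure \<nu> C) \<le> ennreal (1 / ln (1 / r)) * 1"
    by (rule mult_left_mono) simp
  moreover have "ennreal (1 / ln (1 / r)) * ennreal (ln (1 / r)) = 1" using l by (subst ennreal_mult[symmetric]) auto
  ultimately show "emeasure \<nu> C \<le> ennreal (1 / ln (1 / r))" by (simp add: mult.assoc[symmetric])
qed

text \<open>
The potential of normalised Lebesgue measure on \<open>ball w \<rho>\<close> is at most \<open>ln (1 / \<rho>) + 2\<close>. A compact part
of \<open>S\<close> carries at least half of that measure.
\<close>

lemma capacity_log_lower:
  fixes w :: complex
  assumes \<rho>: "0 < \<rho>" "\<rho> < 1" and S: "S \<in> sets borel" "AE x in lborel. x \<in> S"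
  shows "ennreal (1 / (2 * (ln (1 / \<rho>) + 2))) \<le> capacity log_kernel (ball w \<rho> \<inter> S)"
proof -
  have o: "\<omega>2 > 0" by simp
  have l: "ln (1 / \<rho>) > 0" using \<rho> by (simp add: ln_div)
  define E where "E = ball w \<rho> \<inter> S"
  have Eb: "E \<in> sets borel" using S unfolding E_def by auto
  have eE: "emeasure lborel E = ennreal (\<omega>2 * \<rho>^2)"
  proof -
    have "emeasure lborel E = emeasure lborel (ball w \<rho>)"
      by (rule emeasure_eq_AE) (use S Eb in \<open>auto simp: E_def\<close>)
    thus ?thesis using \<rho> by (simp add: emeasure_ball)
  qed
  have e0: "\<omega>2 * \<rho>^2 / 2 > 0" using o \<rho> by simp
  have "E \<in> sets lebesgue" using Eb by (simp add: sets_completionI_sets)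
  then obtain C where C: "closed C" "C \<subseteq> E" "E - C \<in> lmeasurable" "emeasure lebesgue (E - C) < ennreal (\<omega>2 * \<rho>^2 / 2)"
    using sets_lebesgue_inner_closed[OF _ e0] by blast
  have Cb[measurable]: "C \<in> sets borel" using C(1) by auto
  have cC: "compact C" using C(1,2) unfolding E_def by (meson bounded_ball bounded_subset compact_eq_bounded_closed inf.boundedE)
  have "E - C \<in> sets lborel" using Eb Cb by auto
  hence EC: "emeasure lborel (E - C) < ennreal (\<omega>2 * \<rho>^2 / 2)" using C(4) by (simp add: main_part_sets)
  have big: "ennreal (\<omega>2 * \<rho>^2 / 2) \<le> emeasure lborel C"
  proof (rule ccontr)
    assume "\<not> ?thesis"
    hence lt: "emeasure lborel C < ennreal (\<omega>2 * \<rho>^2 / 2)" by simp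
    have "emeasure lborel E \<le> emeasure lborel ((E - C) \<union> C)" using C(2) Eb by (intro emeasure_mono) auto
    also have "... \<le> emeasure lborel (E - C) + emeasure lborel C" using Eb by (intro emeasure_subadditive) auto
    also have "... < ennreal (\<omega>2 * \<rho>^2 / 2) + ennreal (\<omega>2 * \<rho>^2 / 2)" by (rule add_strict_mono[OF EC lt])
    also have "... = ennreal (\<omega>2 * \<rho>^2)" using e0 by (simp add: ennreal_plus[symmetric] del: ennreal_plus)
    finally show False using eE by simp
  qed
  define \<beta> where "\<beta> = 1 / (\<omega>2 * \<rho>^2 * (ln (1 / \<rho>) + 2))"
  have \<beta>: "\<beta> > 0"
  proof -
    have "0 < \<rho>^2" using \<rho>(1) by simp
    moreover have "0 < ln (1 / \<rho>) + 2" using l by linarith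
    ultimately show ?thesis unfolding \<beta>_def using o by (intro divide_pos_pos mult_pos_pos) auto
  qed
  define \<nu> where "\<nu> = density lborel (\<lambda>y. ennreal \<beta> * indicator C y)"
  have sn[simp]: "sets \<nu> = sets borel" by (simp add: \<nu>_def)
  have en: "emeasure \<nu> A = ennreal \<beta> * emeasure lborel (C \<inter> A)" if "A \<in> sets borel" for A
  proof -
    have "emeasure \<nu> A = (\<integral>+y. ennreal \<beta> * indicator (C \<inter> A) y)"
      unfolding \<nu>_def using that by (subst emeasure_density) (auto intro!: nn_integral_cong split: split_indicator)
    thus ?thesis using that by (simp add: nn_integral_cmult_indicator)
  qed
  have sp: "space \<nu> = UNIV" using sets_eq_imp_space_eq[OF sn] by simp
  have "emeasure lborel C \<le> emeasure lborel E" using C(2) Eb by (intro emeasure_mono) auto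
  hence Cf: "emeasure lborel C < \<infinity>" unfolding eE by (rule order.strict_trans1) simp
  have "finite_measure \<nu>" using Cf by (intro finite_measureI) (auto simp: sp en ennreal_mult_eq_top_iff)
  moreover have "emeasure \<nu> (- C) = 0" by (subst en) auto
  moreover have "ereal_integral \<nu> (log_kernel x) \<le> 1" for x
  proof -
    have "(\<integral>\<^sup>+y. e2ennreal (log_kernel x y) \<partial>\<nu>) = (\<integral>+y. ennreal \<beta> * indicator C y * e2ennreal (log_kernel x y))"
      unfolding \<nu>_def
    proof (rule nn_integral_density)
      show "(\<lambda>y. e2ennreal (log_kernel x y)) \<in> borel_measurable lborel" unfolding log_kernel_def by measurable
    qed measurable
    also have "... \<le> (\<integral>+y. ennreal \<beta> * (ennreal (ln (1 / \<rho>)) * indicator C y + ennreal (ln (\<rho> / norm (x - y)))))"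
    proof (rule nn_integral_mono_AE)
      have "AE y in lborel. y \<noteq> x" by (rule AE_lborel_singleton)
      thus "AE y in lborel. ennreal \<beta> * indicator C y * e2ennreal (log_kernel x y) \<le> ennreal \<beta> * (ennreal (ln (1 / \<rho>)) * indicator C y + ennreal (ln (\<rho> / norm (x - y))))"
      proof eventually_elim
        case (elim y)
        show ?case
        proof (cases "y \<in> C")
          case True
          have "ln (1 / norm (x - y)) = ln (1 / \<rho>) + ln (\<rho> / norm (x - y))" using elim \<rho> by (simp add: ln_div)
          also have "... \<le> ln (1 / \<rho>) + max 0 (ln (\<rho> / norm (x - y)))" by simp
          finally have "ennreal (ln (1 / norm (x - y))) \<le> ennreal (ln (1 / \<rho>) + max 0 (ln (\<rho> / norm (x - y))))" by (rule ennreal_leI)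
          also have "... = ennreal (ln (1 / \<rho>)) + ennreal (ln (\<rho> / norm (x - y)))"
            using l by (subst ennreal_plus) (auto simp: max_def ennreal_neg)
          finally show ?thesis using True elim by (simp add: e2ennreal_log_kernel mult_left_mono)
        qed simp
      qed
    qed
    also have "... = ennreal \<beta> * (ennreal (ln (1 / \<rho>)) * emeasure lborel C + (\<integral>+y. ennreal (ln (\<rho> / norm (x - y)))))"
    proof -
      have m1: "(\<lambda>y. ennreal (ln (1 / \<rho>)) * indicator C y) \<in> borel_measurable lborel" by measurable
      have m2: "(\<lambda>y. ennreal (ln (\<rho> / norm (x - y)))) \<in> borel_measurable lborel" by measurable
      show ?thesis by (subst nn_integral_cmult[OF borel_measurable_add[OF m1 m2]], subst nn_integral_add[OF m1 m2], subst nn_integral_cmult_indicator) auto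
    qed
    also have "... \<le> ennreal \<beta> * (ennreal (ln (1 / \<rho>)) * ennreal (\<omega>2 * \<rho>^2) + ennreal (2 * \<omega>2 * \<rho>^2))"
      using \<open>emeasure lborel C \<le> emeasure lborel E\<close> unfolding eE
      by (intro mult_left_mono add_mono nn_integral_log_plus \<rho>) auto
    also have "... = ennreal (\<beta> * (ln (1 / \<rho>) * (\<omega>2 * \<rho>^2) + 2 * \<omega>2 * \<rho>^2))"
      using \<beta> l o by (simp add: ennreal_mult[symmetric] ennreal_plus[symmetric] del: ennreal_plus)
    also have "\<beta> * (ln (1 / \<rho>) * (\<omega>2 * \<rho>^2) + 2 * \<omega>2 * \<rho>^2) = 1"
    proof -
      have "ln (1 / \<rho>) * (\<omega>2 * \<rho>^2) + 2 * \<omega>2 * \<rho>^2 = \<omega>2 * \<rho>^2 * (ln (1 / \<rho>) + 2)" by (simp add: algebra_simps)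
      moreover have "\<omega>2 * \<rho>^2 * (ln (1 / \<rho>) + 2) \<noteq> 0" using \<beta> unfolding \<beta>_def by (metis div_0 divide_eq_0_iff less_irrefl)
      ultimately show ?thesis unfolding \<beta>_def by simp
    qed
    finally have "(\<integral>\<^sup>+y. e2ennreal (log_kernel x y) \<partial>\<nu>) \<le> 1" by simp
    hence "enn2ereal (\<integral>\<^sup>+y. e2ennreal (log_kernel x y) \<partial>\<nu>) \<le> 1" by (simp add: less_eq_ennreal.rep_eq one_ennreal.rep_eq)
    hence "enn2ereal (\<integral>\<^sup>+y. e2ennreal (log_kernel x y) \<partial>\<nu>) - enn2ereal (\<integral>\<^sup>+y. e2ennreal (- log_kernel x y) \<partial>\<nu>) \<le> 1 - 0"
      by (intro ereal_minus_mono) auto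
    thus ?thesis unfolding ereal_integral_def by simp
  qed
  ultimately have "emeasure \<nu> C \<le> compact_capacity log_kernel C"
    unfolding compact_capacity_def by (intro SUP_upper) auto
  also have "... \<le> capacity log_kernel (ball w \<rho> \<inter> S)"
    unfolding capacity_eq_SUP using cC C(2) by (intro SUP_upper) (auto simp: E_def)
  finally have "emeasure \<nu> C \<le> capacity log_kernel (ball w \<rho> \<inter> S)" .
  moreover have "ennreal (1 / (2 * (ln (1 / \<rho>) + 2))) \<le> emeasure \<nu> C"
  proof -
    have *: "1 / (2 * L) = 1 / (q * L) * (q / 2)" if "q > 0" for q L :: real using that by (simp add: field_simps)
    have "\<omega>2 * \<rho>^2 > 0" using e0 by linarith
    hence "1 / (2 * (ln (1 / \<rho>) + 2)) = \<beta> * (\<omega>2 * \<rho>^2 / 2)" unfolding \<beta>_def by (rule *)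
    hence "ennreal (1 / (2 * (ln (1 / \<rho>) + 2))) = ennreal \<beta> * ennreal (\<omega>2 * \<rho>^2 / 2)"
      by (simp only: ennreal_mult[OF less_imp_le[OF \<beta>] less_imp_le[OF e0]])
    also have "... \<le> ennreal \<beta> * emeasure lborel C" by (intro mult_left_mono big) simp
    also have "... = emeasure \<nu> C" by (subst en) auto
    finally show ?thesis .
  qed
  ultimately show ?thesis by (rule order_trans[rotated])
qed

section \<open>Positive measures as signed measures\<close>

context
  fixes M :: "'a::topological_space measure"
  assumes sM: "sets M = sets borel" and fM: "finite_measure M"
begin

lemma signed_borel_measure_measure: "signed_borel_measure (measure M)"
  unfolding signed_borel_measure_def
  using finite_measure.finite_measure_UNION[OF fM] by (auto simp: sM)

lemma jordan_pos_measure: "jordan_pos (measure M) = M"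
proof (rule measure_eqI)
  show "sets (jordan_pos (measure M)) = sets M" by (simp add: sets_jordan_pos sM)
  fix A assume "A \<in> sets (jordan_pos (measure M))"
  hence A: "A \<in> sets borel" by (simp add: sets_jordan_pos)
  have "emeasure (jordan_pos (measure M)) A = jordan_pos_fun (measure M) A"
    by (rule emeasure_jordan_pos[OF signed_borel_measure_measure A])
  also have "... = emeasure M A"
    unfolding jordan_pos_fun_def
  proof (rule antisym)
    show "(SUP B\<in>{B \<in> sets borel. B \<subseteq> A}. ennreal (measure M B)) \<le> emeasure M A"
      using A sM by (intro SUP_least) (auto simp: finite_measure.emeasure_eq_measure[OF fM, symmetric] intro!: emeasure_mono)
    show "emeasure M A \<le> (SUP B\<in>{B \<in> sets borel. B \<subseteq> A}. ennreal (measure M B))"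
      using A by (intro SUP_upper2[of A]) (auto simp: finite_measure.emeasure_eq_measure[OF fM])
  qed
  finally show "emeasure (jordan_pos (measure M)) A = emeasure M A" .
qed

lemma emeasure_jordan_neg_measure: "A \<in> sets borel ==> emeasure (jordan_neg (measure M)) A = 0"
proof -
  assume A: "A \<in> sets borel"
  have "emeasure (jordan_neg (measure M)) A = jordan_pos_fun (\<lambda>A. - measure M A) A"
    unfolding jordan_neg_def
    by (rule emeasure_jordan_pos[OF signed_borel_measure_uminus[OF signed_borel_measure_measure] A])
  also have "... \<le> 0" unfolding jordan_pos_fun_def by (intro SUP_least) (simp add: ennreal_neg)
  finally show ?thesis by simp
qed

lemma total_variation_measure: "total_variation (measure M) = M"
proof (rule measure_eqI)
  show "sets (total_variation (measure M)) = sets M" by (simp add: sets_total_variation sM)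
  fix A assume "A \<in> sets (total_variation (measure M))"
  hence A: "A \<in> sets borel" by (simp add: sets_total_variation)
  show "emeasure (total_variation (measure M)) A = emeasure M A"
    by (simp add: emeasure_total_variation[OF signed_borel_measure_measure A] emeasure_jordan_neg_measure[OF A] jordan_pos_measure)
qed

lemma signed_integral_measure: "signed_integral (measure M) f = (\<integral>x. f x \<partial>M)"
proof -
  have "AE x in jordan_neg (measure M). f x = 0"
    using emeasure_jordan_neg_measure[of UNIV]
    by (intro AE_I'[of UNIV]) (auto intro!: null_setsI simp: jordan_neg_def sets_jordan_pos)
  hence "(\<integral>x. f x \<partial>jordan_neg (measure M)) = 0" by (rule integral_eq_zero_AE)
  thus ?thesis by (simp add: signed_integral_def jordan_pos_measure)
qed

end

section \<open>Logarithmic potentials\<close>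

definition abs_log_kernel :: "complex => complex => ennreal" where
  "abs_log_kernel x y = e2ennreal \<bar>log_kernel x y\<bar>"

lemma abs_log_kernel_eq:
  "abs_log_kernel x y = (if x = y then \<infinity> else ennreal \<bar>ln (1 / norm (x - y))\<bar>)"
  by (simp add: abs_log_kernel_def log_kernel_def dist_norm e2ennreal_infty)

lemma measurable_abs_log_kernel [measurable (raw)]:
  assumes [measurable]: "f \<in> borel_measurable M" "g \<in> borel_measurable M"
  shows "(\<lambda>z. abs_log_kernel (f z) (g z)) \<in> borel_measurable M"
  unfolding abs_log_kernel_eq by measurable

lemma log_distance_lower:
  fixes x y :: complex
  shows "0 \<le> ln (1 / norm (x - y)) + ln (1 + norm x) + ln (1 + norm y)"
proof (cases "x = y")
  case False
  have "norm (x - y) \<le> (1 + norm x) * (1 + norm y)"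
  proof -
    have "0 \<le> norm x * norm y" by simp
    moreover have "(1 + norm x) * (1 + norm y) = 1 + norm x + norm y + norm x * norm y" by (simp add: algebra_simps)
    ultimately show ?thesis using norm_triangle_ineq4[of x y] by linarith
  qed
  moreover have p: "0 < norm (x - y)" using False by simp
  ultimately have "ln (norm (x - y)) \<le> ln ((1 + norm x) * (1 + norm y))" by (rule ln_mono)
  also have "... = ln (1 + norm x) + ln (1 + norm y)"
    using norm_ge_zero[of x] norm_ge_zero[of y] by (intro ln_mult_pos) linarith+
  finally show ?thesis using False by (simp add: ln_div)
qed simp

text \<open>
The negative part of the logarithmic kernel grows only logarithmically, hence is integrable against a
measure that integrates \<open>ln (1 + norm w)\<close>.
\<close>

lemma abs_log_kernel_le:
  assumes "x \<noteq> y"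
  shows "abs_log_kernel x y \<le> ennreal (ln (1 / norm (x - y))) + (ennreal (ln (1 + norm x)) + ennreal (ln (1 + norm y)))"
proof -
  have n: "0 \<le> ln (1 + norm x)" "0 \<le> ln (1 + norm y)" by auto
  have "\<bar>ln (1 / norm (x - y))\<bar> \<le> max 0 (ln (1 / norm (x - y))) + (ln (1 + norm x) + ln (1 + norm y))"
    using log_distance_lower[of x y] n by linarith
  hence "abs_log_kernel x y \<le> ennreal (max 0 (ln (1 / norm (x - y))) + (ln (1 + norm x) + ln (1 + norm y)))"
    using assms by (simp add: abs_log_kernel_eq ennreal_leI del: ennreal_plus)
  also have "... = ennreal (max 0 (ln (1 / norm (x - y)))) + (ennreal (ln (1 + norm x)) + ennreal (ln (1 + norm y)))"
    using n by (subst ennreal_plus, simp, simp, subst ennreal_plus) auto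
  also have "ennreal (max 0 (ln (1 / norm (x - y)))) = ennreal (ln (1 / norm (x - y)))"
    by (simp add: max_def ennreal_neg)
  finally show ?thesis .
qed

context
  fixes M :: "complex measure"
  assumes sM: "sets M = sets borel" and fM: "emeasure M UNIV < \<infinity>"
    and lM: "(\<integral>\<^sup>+w. ennreal (ln (1 + norm w)) \<partial>M) < \<infinity>"
begin

lemma finM: "finite_measure M"
  using fM sets_eq_imp_space_eq[OF sM] by (intro finite_measureI) auto

lemma dom_log_potential: "potential_dom log_kernel (measure M) = {x. (\<integral>\<^sup>+y. abs_log_kernel x y \<partial>M) < \<infinity>}"
  unfolding potential_dom_def abs_log_kernel_def total_variation_measure[OF sM finM] ..

lemma borel_dom_log_potential: "potential_dom log_kernel (measure M) \<in> sets borel"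
proof -
  note [measurable_cong] = sM
  interpret finite_measure M by (rule finM)
  have "(\<lambda>x. \<integral>\<^sup>+y. abs_log_kernel x y \<partial>M) \<in> borel_measurable borel" by measurable
  thus ?thesis unfolding dom_log_potential by measurable
qed

lemma AE_dom_log_potential: "AE x in lborel. x \<in> potential_dom log_kernel (measure M)"
proof -
  note [measurable_cong, simp] = sM
  have sp: "space M = UNIV" using sets_eq_imp_space_eq[OF sM] by simp
  have "AE x in lborel. (\<integral>\<^sup>+y. abs_log_kernel x y \<partial>M) < \<infinity>"
  proof (rule AE_kernel_integral_finite[OF sM fM])
    show "case_prod abs_log_kernel \<in> borel_measurable (borel \<Otimes>\<^sub>M borel)" unfolding split_beta by measurable
    fix n :: nat
    let ?C = "cball (0::complex) (Suc n)" let ?V = "emeasure lborel (cball (0::complex) (Suc n))"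
    let ?c = "ennreal (2 * \<omega>2) + ennreal (real (Suc n)) * ?V"
    have V: "?V < \<infinity>" by (simp add: emeasure_cball)
    show "(\<integral>+x. abs_log_kernel x y * indicator ?C x) \<le> ?c + ?V * ennreal (ln (1 + norm y))" for y
    proof -
      have m1: "(\<lambda>x. ennreal (ln (1 / norm (y - x)))) \<in> borel_measurable lborel" by measurable
      have m2: "(\<lambda>x. ennreal (real (Suc n)) * indicator ?C x) \<in> borel_measurable lborel" by measurable
      have m3: "(\<lambda>x. ennreal (ln (1 + norm y)) * indicator ?C x) \<in> borel_measurable lborel" by measurable
      have "(\<integral>+x. abs_log_kernel x y * indicator ?C x)
          \<le> (\<integral>+x. ennreal (ln (1 / norm (y - x))) + (ennreal (real (Suc n)) * indicator ?C x + ennreal (ln (1 + norm y)) * indicator ?C x))"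
      proof (rule nn_integral_mono_AE)
        have "AE x in lborel. x \<noteq> y" by (rule AE_lborel_singleton)
        thus "AE x in lborel. abs_log_kernel x y * indicator ?C x \<le> ennreal (ln (1 / norm (y - x))) + (ennreal (real (Suc n)) * indicator ?C x + ennreal (ln (1 + norm y)) * indicator ?C x)"
        proof eventually_elim
          case (elim x)
          show ?case
          proof (cases "x \<in> ?C")
            case True
            have "ln (1 + norm x) \<le> norm x" by (rule ln_add_one_self_le_self) simp
            also have "... \<le> real (Suc n)" using True by simp
            finally have *: "ennreal (ln (1 + norm x)) \<le> ennreal (real (Suc n))" by (rule ennreal_leI)
            have "abs_log_kernel x y \<le> ennreal (ln (1 / norm (x - y))) + (ennreal (ln (1 + norm x)) + ennreal (ln (1 + norm y)))"
              by (rule abs_log_kernel_le[OF elim])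
            also have "... \<le> ennreal (ln (1 / norm (y - x))) + (ennreal (real (Suc n)) + ennreal (ln (1 + norm y)))"
              unfolding norm_minus_commute[of x y] by (intro add_left_mono add_right_mono *)
            finally show ?thesis using True by simp
          qed simp
        qed
      qed
      also have "... = (\<integral>+x. ennreal (ln (1 / norm (y - x)))) + (ennreal (real (Suc n)) * ?V + ennreal (ln (1 + norm y)) * ?V)"
        unfolding nn_integral_add[OF m1 borel_measurable_add[OF m2 m3]] nn_integral_add[OF m2 m3]
        by (subst nn_integral_cmult_indicator, simp, subst nn_integral_cmult_indicator) auto
      also have "... \<le> ennreal (2 * \<omega>2) + (ennreal (real (Suc n)) * ?V + ennreal (ln (1 + norm y)) * ?V)"
        using nn_integral_log_plus[of 1 y] by (intro add_right_mono) simp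
      also have "... = ?c + ?V * ennreal (ln (1 + norm y))" by (simp only: add.assoc mult.commute[of ?V])
      finally show ?thesis .
    qed
    have "(\<integral>\<^sup>+y. ?c + ?V * ennreal (ln (1 + norm y)) \<partial>M) = ?c * emeasure M UNIV + ?V * (\<integral>\<^sup>+y. ennreal (ln (1 + norm y)) \<partial>M)"
    proof -
      have m1: "(\<lambda>y. ?c) \<in> borel_measurable M" by measurable
      have m0: "(\<lambda>y. ennreal (ln (1 + norm y))) \<in> borel_measurable M" by measurable
      have m2: "(\<lambda>y. ?V * ennreal (ln (1 + norm y))) \<in> borel_measurable M" by measurable
      show ?thesis unfolding nn_integral_add[OF m1 m2] nn_integral_cmult[OF m0] nn_integral_const sp ..
    qed
    also have "... < \<infinity>"
    proof -
      have "?c < \<infinity>" using V by (simp add: ennreal_mult_less_top)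
      hence "?c * emeasure M UNIV < \<infinity>" using fM by (simp only: infinity_ennreal_def ennreal_mult_less_top) blast
      moreover have "?V * (\<integral>\<^sup>+y. ennreal (ln (1 + norm y)) \<partial>M) < \<infinity>" using V lM by (simp only: infinity_ennreal_def ennreal_mult_less_top) blast
      ultimately show ?thesis by (simp only: infinity_ennreal_def ennreal_add_less_top)
    qed
    finally show "(\<integral>\<^sup>+y. ?c + ?V * ennreal (ln (1 + norm y)) \<partial>M) < \<infinity>" .
  qed
  thus ?thesis by (simp add: dom_log_potential)
qed

text \<open>
At an atom the potential is infinite. This matters because \<open>ln (1 / 0) = 0\<close>, so the real-valued kernel
would give a wrong value there.
\<close>

lemma dom_log_potential_atom:
  assumes x: "x \<in> potential_dom log_kernel (measure M)"
  shows "emeasure M {x} = 0"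
proof (rule ccontr)
  note [measurable_cong, simp] = sM
  assume "emeasure M {x} \<noteq> 0"
  hence "\<infinity> = (\<integral>\<^sup>+y. \<infinity> * indicator {x} y \<partial>M)" by (subst nn_integral_cmult_indicator) (auto simp: ennreal_top_mult)
  also have "... \<le> (\<integral>\<^sup>+y. abs_log_kernel x y \<partial>M)"
    by (intro nn_integral_mono) (auto simp: abs_log_kernel_eq split: split_indicator)
  finally show False using x by (simp add: dom_log_potential top_unique)
qed

lemma log_potential_eq: "potential log_kernel (measure M) x = (\<integral>y. ln (1 / norm (x - y)) \<partial>M)"
proof -
  have "real_of_ereal (log_kernel x y) = ln (1 / norm (x - y))" for y
    by (cases "x = y") (simp_all add: log_kernel_def dist_norm)
  thus ?thesis by (simp add: potential_def signed_integral_measure[OF sM finM])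
qed

text \<open>
The shifted kernel \<open>ln (1 / norm (x - y)) + ln (1 + norm x) + ln (1 + norm y)\<close> is nonnegative, so its
integral is at least the contribution of the atom \<open>w\<close>.
\<close>

lemma log_potential_lower:
  assumes x: "x \<in> potential_dom log_kernel (measure M)" and w: "norm (x - w) < 1"
    and c: "0 < c" "ennreal c \<le> emeasure M {w}"
  shows "c * ln (1 / norm (x - w)) - ln (1 + norm x) * measure M UNIV - (\<integral>y. ln (1 + norm y) \<partial>M)
    \<le> potential log_kernel (measure M) x"
proof -
  note [measurable_cong, simp] = sM
  interpret finite_measure M by (rule finM)
  have sp: "space M = UNIV" using sets_eq_imp_space_eq[OF sM] by simp
  have xw: "x \<noteq> w" using dom_log_potential_atom[OF x] c by (auto simp: ennreal_eq_0_iff)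
  let ?f = "\<lambda>y. ln (1 / norm (x - y))"
  have "(\<integral>\<^sup>+y. ennreal (norm (?f y)) \<partial>M) \<le> (\<integral>\<^sup>+y. abs_log_kernel x y \<partial>M)"
    by (intro nn_integral_mono) (auto simp: abs_log_kernel_eq)
  also have "... < \<infinity>" using x by (simp add: dom_log_potential)
  finally have i1: "integrable M ?f" by (intro integrableI_bounded) auto
  have i2: "integrable M (\<lambda>y. ln (1 + norm x))" by simp
  have i3: "integrable M (\<lambda>y::complex. ln (1 + norm y))" using lM by (intro integrableI_nonneg) auto
  have l: "ln (1 / norm (x - w)) \<ge> 0" using w xw by (simp add: ln_div)
  have "c * ln (1 / norm (x - w)) \<le> measure M {w} * ln (1 / norm (x - w))"
    using c l by (intro mult_right_mono) (auto simp: emeasure_eq_measure)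
  also have "... = (\<integral>y. indicator {w} y * ln (1 / norm (x - w)) \<partial>M)" by simp
  also have "... \<le> (\<integral>y. ?f y + ln (1 + norm x) + ln (1 + norm y) \<partial>M)"
  proof (rule Bochner_Integration.integral_mono)
    show "integrable M (\<lambda>y. indicator {w} y * ln (1 / norm (x - w)))" by (intro integrable_mult_left integrable_real_indicator) (auto simp: emeasure_eq_measure)
    show "integrable M (\<lambda>y. ?f y + ln (1 + norm x) + ln (1 + norm y))" by (intro Bochner_Integration.integrable_add i1 i2 i3)
    fix y :: complex
    have "0 \<le> ln (1 + norm x)" "0 \<le> ln (1 + norm y)" by auto
    thus "indicator {w} y * ln (1 / norm (x - w)) \<le> ?f y + ln (1 + norm x) + ln (1 + norm y)"
      using log_distance_lower[of x y] by (cases "y = w") auto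
  qed
  also have "... = (\<integral>y. ?f y \<partial>M) + ln (1 + norm x) * measure M UNIV + (\<integral>y. ln (1 + norm y) \<partial>M)"
    unfolding Bochner_Integration.integral_add[OF Bochner_Integration.integrable_add[OF i1 i2] i3] Bochner_Integration.integral_add[OF i1 i2]
    by (simp add: sp)
  finally show ?thesis unfolding log_potential_eq by linarith
qed

end

section \<open>A measure with atoms on fine grids\<close>

definition mesh :: "nat => real" where
  "mesh n = 1 / 2 ^ (16 ^ n)"

definition atom_mass :: "nat => real" where
  "atom_mass n = (mesh n)^2 / 16 ^ n"

text \<open>
Grid points of mesh \<open>1 / 2 ^ 16 ^ n\<close> in the square of half-width \<open>n\<close>: the squares exhaust the plane,
and there are at most \<open>(2 * n + 1)^2 / (mesh n)^2\<close> points.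
\<close>

definition grid_index :: "nat => (int \<times> int) set" where
  "grid_index n = (let N = int n * 2 ^ (16 ^ n) in {-N..N} \<times> {-N..N})"

definition grid_point :: "nat \<times> int \<times> int => complex" where
  "grid_point = (\<lambda>(n, i, j). Complex (of_int i * mesh n) (of_int j * mesh n))"

definition grid_weight :: "nat \<times> int \<times> int => ennreal" where
  "grid_weight = (\<lambda>(n, q). ennreal (atom_mass n) * indicator (grid_index n) q)"

definition grid_measure :: "complex measure" where
  "grid_measure = distr (density (count_space UNIV) grid_weight) borel grid_point"

lemma mesh_pos: "0 < mesh n" by (simp add: mesh_def)

lemma mesh_le: "mesh n \<le> 1" by (simp add: mesh_def)

lemma atom_mass_pos: "0 < atom_mass n" using mesh_pos[of n] by (simp add: atom_mass_def)

lemma sets_grid_measure: "sets grid_measure = sets borel" by (simp add: grid_measure_def)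

lemma nn_integral_grid_measure:
  assumes [measurable]: "g \<in> borel_measurable borel"
  shows "(\<integral>\<^sup>+w. g w \<partial>grid_measure) = (\<integral>\<^sup>+p. grid_weight p * g (grid_point p) \<partial>count_space UNIV)"
  unfolding grid_measure_def by (subst nn_integral_distr) (auto simp: nn_integral_density)

lemma grid_index_iff: "(i, j) \<in> grid_index n \<longleftrightarrow> \<bar>of_int i * mesh n\<bar> \<le> real n \<and> \<bar>of_int j * mesh n\<bar> \<le> real n"
proof -
  have "\<bar>of_int i * mesh n\<bar> \<le> real n \<longleftrightarrow> - (int n * 2 ^ 16 ^ n) \<le> i \<and> i \<le> int n * 2 ^ 16 ^ n" for i
  proof -
    have "\<bar>of_int i * mesh n\<bar> \<le> real n \<longleftrightarrow> \<bar>of_int i :: real\<bar> \<le> real n * 2 ^ 16 ^ n"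
      by (simp add: mesh_def abs_mult pos_divide_le_eq)
    also have "real n * 2 ^ 16 ^ n = of_int (int n * 2 ^ 16 ^ n)" by simp
    also have "\<bar>of_int i :: real\<bar> \<le> of_int (int n * 2 ^ 16 ^ n) \<longleftrightarrow> \<bar>i\<bar> \<le> int n * 2 ^ 16 ^ n"
      by (simp only: of_int_abs[symmetric] of_int_le_iff)
    also have "... \<longleftrightarrow> - (int n * 2 ^ 16 ^ n) \<le> i \<and> i \<le> int n * 2 ^ 16 ^ n" by (rule abs_le_iff[THEN trans]) auto
    finally show ?thesis .
  qed
  thus ?thesis by (auto simp: grid_index_def Let_def)
qed

lemma finite_grid_index: "finite (grid_index n)" by (simp add: grid_index_def Let_def)

lemma card_grid_index: "real (card (grid_index n)) * (mesh n)^2 \<le> (2 * real n + 1)^2"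
proof -
  define N where "N = int n * 2 ^ 16 ^ n"
  have N: "0 \<le> N" by (simp add: N_def)
  have "card (grid_index n) = (nat (2 * N + 1))^2"
    by (simp add: grid_index_def Let_def N_def[symmetric] card_cartesian_product power2_eq_square)
  moreover have "real (nat (2 * N + 1)) = 2 * of_int N + 1" using N by simp
  ultimately have "real (card (grid_index n)) * (mesh n)^2 = ((2 * of_int N + 1) * mesh n)^2" by (simp add: power_mult_distrib)
  also have "(2 * of_int N + 1) * mesh n = 2 * real n + mesh n" by (simp add: N_def mesh_def field_simps)
  also have "(2 * real n + mesh n)^2 \<le> (2 * real n + 1)^2" using mesh_le[of n] mesh_pos[of n] by (intro power_mono) auto
  finally show ?thesis .
qed

text \<open>
Level \<open>n\<close> has mass at most \<open>(2 * n + 1)^2 / 16 ^ n\<close> and lies within distance \<open>2 * n\<close> of the origin.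
\<close>

lemma nn_integral_grid_measure_log: "(\<integral>\<^sup>+w. ennreal (1 + ln (1 + norm w)) \<partial>grid_measure) < \<infinity>"
proof -
  let ?g = "\<lambda>w::complex. ennreal (1 + ln (1 + norm w))"
  have level: "(\<integral>\<^sup>+q. grid_weight (n, q) * ?g (grid_point (n, q)) \<partial>count_space UNIV) \<le> ennreal (8 * (1/2) ^ n)" for n
  proof -
    have "(\<integral>\<^sup>+q. grid_weight (n, q) * ?g (grid_point (n, q)) \<partial>count_space UNIV)
        \<le> (\<integral>\<^sup>+q. ennreal (atom_mass n * (2 * real n + 1)) * indicator (grid_index n) q \<partial>count_space UNIV)"
    proof (intro nn_integral_mono)
      fix q :: "int \<times> int"
      obtain i j where q: "q = (i, j)" by (cases q)
      show "grid_weight (n, q) * ?g (grid_point (n, q)) \<le> ennreal (atom_mass n * (2 * real n + 1)) * indicator (grid_index n) q"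
      proof (cases "q \<in> grid_index n")
        case True
        let ?w = "grid_point (n, q)"
        have w: "?w = Complex (of_int i * mesh n) (of_int j * mesh n)" by (simp add: grid_point_def q)
        have "ln (1 + norm ?w) \<le> norm ?w" by (rule ln_add_one_self_le_self) simp
        also have "... \<le> \<bar>Re ?w\<bar> + \<bar>Im ?w\<bar>" by (rule cmod_le)
        also have "... \<le> 2 * real n"
        proof -
          have "Re ?w = of_int i * mesh n" "Im ?w = of_int j * mesh n" unfolding w by simp_all
          thus ?thesis using True unfolding q grid_index_iff by linarith
        qed
        finally have "?g ?w \<le> ennreal (2 * real n + 1)" by (intro ennreal_leI) simp
        hence "ennreal (atom_mass n) * ?g ?w \<le> ennreal (atom_mass n) * ennreal (2 * real n + 1)" by (rule mult_left_mono) simp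
        thus ?thesis using True atom_mass_pos[of n] by (simp add: grid_weight_def ennreal_mult del: ennreal_plus)
      qed (simp add: grid_weight_def)
    qed
    also have "... = ennreal (atom_mass n * (2 * real n + 1)) * ennreal (real (card (grid_index n)))"
      by (subst nn_integral_cmult_indicator) (simp_all add: emeasure_count_space_finite finite_grid_index ennreal_of_nat_eq_real_of_nat)
    also have "... = ennreal (atom_mass n * (2 * real n + 1) * real (card (grid_index n)))"
      by (rule ennreal_mult[symmetric]) (use atom_mass_pos[of n] in auto)
    also have "... \<le> ennreal (8 * (1/2) ^ n)"
    proof (rule ennreal_leI)
      have "atom_mass n * (2 * real n + 1) * real (card (grid_index n)) = (2 * real n + 1) / 16 ^ n * (real (card (grid_index n)) * (mesh n)^2)"
        by (simp add: atom_mass_def)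
      also have "... \<le> (2 * real n + 1) / 16 ^ n * (2 * real n + 1)^2"
        by (intro mult_left_mono card_grid_index) auto
      also have "... = (2 * real n + 1) ^ 3 / 16 ^ n" by (simp add: power2_eq_square power3_eq_cube)
      also have "... \<le> (2 * 2 ^ n) ^ 3 / 16 ^ n"
      proof (intro divide_right_mono power_mono)
        have "n + 1 \<le> 2 ^ n" by (induction n) auto
        hence "real (n + 1) \<le> real (2 ^ n)" by (rule of_nat_mono)
        thus "2 * real n + 1 \<le> 2 * 2 ^ n" by simp
      qed auto
      also have "... = 8 * (1/2) ^ n"
      proof -
        have "(2 ^ n) ^ 3 = (8::real) ^ n" by (simp add: power_mult[symmetric] mult.commute[of n] power_mult)
        moreover have "(8::real) ^ n / 16 ^ n = (1/2) ^ n" by (simp add: power_divide[symmetric])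
        ultimately show ?thesis by (simp add: power_mult_distrib)
      qed
      finally show "atom_mass n * (2 * real n + 1) * real (card (grid_index n)) \<le> 8 * (1/2) ^ n" .
    qed
    finally show ?thesis .
  qed
  have "(\<integral>\<^sup>+w. ?g w \<partial>grid_measure) = (\<integral>\<^sup>+p. grid_weight p * ?g (grid_point p) \<partial>count_space UNIV)"
    by (rule nn_integral_grid_measure) measurable
  also have "... = (\<integral>\<^sup>+n. \<integral>\<^sup>+q. grid_weight (n, q) * ?g (grid_point (n, q)) \<partial>count_space UNIV \<partial>count_space UNIV)"
    by (rule nn_integral_fst_count_space[symmetric])
  also have "... = (\<Sum>n. \<integral>\<^sup>+q. grid_weight (n, q) * ?g (grid_point (n, q)) \<partial>count_space UNIV)" by (rule nn_integral_count_space_nat)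
  also have "... \<le> (\<Sum>n. ennreal (8 * (1/2) ^ n))" by (intro suminf_le level) auto
  also have "... = ennreal (\<Sum>n. 8 * (1/2) ^ n)" by (intro suminf_ennreal2) (auto intro!: summable_mult summable_geometric)
  also have "... < \<infinity>" by simp
  finally show ?thesis .
qed

lemma finite_grid_measure: "emeasure grid_measure UNIV < \<infinity>"
proof -
  have sp: "space grid_measure = UNIV" by (simp add: grid_measure_def)
  have "emeasure grid_measure UNIV = (\<integral>\<^sup>+w. 1 \<partial>grid_measure)" by (simp add: sp)
  also have "... \<le> (\<integral>\<^sup>+w. ennreal (1 + ln (1 + norm w)) \<partial>grid_measure)"
    unfolding ennreal_1[symmetric] by (intro nn_integral_mono ennreal_leI) auto
  also note nn_integral_grid_measure_log
  finally show ?thesis .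
qed

lemma grid_measure_log: "(\<integral>\<^sup>+w. ennreal (ln (1 + norm w)) \<partial>grid_measure) < \<infinity>"
proof -
  have "(\<integral>\<^sup>+w. ennreal (ln (1 + norm w)) \<partial>grid_measure) \<le> (\<integral>\<^sup>+w. ennreal (1 + ln (1 + norm w)) \<partial>grid_measure)"
    by (intro nn_integral_mono ennreal_leI) auto
  also note nn_integral_grid_measure_log
  finally show ?thesis .
qed

lemma grid_measure_atom:
  assumes "q \<in> grid_index n"
  shows "ennreal (atom_mass n) \<le> emeasure grid_measure {grid_point (n, q)}"
proof -
  let ?w = "grid_point (n, q)"
  have "ennreal (atom_mass n) = (\<integral>\<^sup>+p. ennreal (atom_mass n) * indicator {(n, q)} p \<partial>count_space UNIV)"
    by (subst nn_integral_cmult_indicator) auto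
  also have "... \<le> (\<integral>\<^sup>+p. grid_weight p * indicator {?w} (grid_point p) \<partial>count_space UNIV)"
    using assms by (intro nn_integral_mono) (auto simp: grid_weight_def split: split_indicator)
  also have "... = (\<integral>\<^sup>+w. indicator {?w} w \<partial>grid_measure)" by (rule nn_integral_grid_measure[symmetric]) measurable
  also have "... = emeasure grid_measure {?w}" by (rule nn_integral_indicator) (simp add: sets_grid_measure)
  finally show ?thesis .
qed

lemma grid_point_near:
  fixes a :: complex
  assumes n: "real n \<ge> norm a + 1"
  obtains q where "q \<in> grid_index n" "norm (a - grid_point (n, q)) \<le> 2 * mesh n"
proof -
  define f where "f x = \<lfloor>x / mesh n\<rfloor>" for x
  have f: "\<bar>x - of_int (f x) * mesh n\<bar> \<le> mesh n" for x
  proof -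
    have "of_int (f x) \<le> x / mesh n" "x / mesh n < of_int (f x) + 1" unfolding f_def by linarith+
    hence "of_int (f x) * mesh n \<le> x" "x \<le> (of_int (f x) + 1) * mesh n" using mesh_pos[of n] by (simp_all add: field_simps)
    thus ?thesis by (simp add: distrib_right)
  qed
  have b: "\<bar>of_int (f x) * mesh n\<bar> \<le> real n" if "\<bar>x\<bar> \<le> norm a" for x
    using f[of x] that n mesh_le[of n] by linarith
  show ?thesis
  proof (rule that)
    show "(f (Re a), f (Im a)) \<in> grid_index n"
      unfolding grid_index_iff using b[OF abs_Re_le_cmod] b[OF abs_Im_le_cmod] by blast
    let ?z = "a - grid_point (n, f (Re a), f (Im a))"
    have "norm ?z \<le> \<bar>Re ?z\<bar> + \<bar>Im ?z\<bar>" by (rule cmod_le)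
    also have "... \<le> 2 * mesh n" using f[of "Re a"] f[of "Im a"] by (simp add: grid_point_def)
    finally show "norm ?z \<le> 2 * mesh n" .
  qed
qed

section \<open>Failure of second order differentiability\<close>

lemma taylor2_error_lower:
  fixes a :: "'a::euclidean_space"
  assumes "norm (x - a) \<le> R"
  shows "u x - \<bar>u a\<bar> - R * (\<Sum>i\<in>Basis. \<bar>A i\<bar>) - R^2 * (\<Sum>j\<in>Basis. \<Sum>k\<in>Basis. \<bar>B j k\<bar>) \<le> taylor2_error u a A B x"
proof -
  have R: "0 \<le> R" using assms norm_ge_zero order_trans by blast
  have b: "\<bar>(x - a) \<bullet> i\<bar> \<le> R" if "i \<in> Basis" for i using Basis_le_norm[OF that, of "x - a"] assms by linarith
  have "\<bar>\<Sum>i\<in>Basis. A i * ((x - a) \<bullet> i)\<bar> \<le> (\<Sum>i\<in>Basis. R * \<bar>A i\<bar>)"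
  proof (rule sum_abs[THEN order_trans], rule sum_mono)
    fix i :: 'a assume "i \<in> Basis"
    thus "\<bar>A i * ((x - a) \<bullet> i)\<bar> \<le> R * \<bar>A i\<bar>" unfolding abs_mult mult.commute[of R] by (intro mult_left_mono b) auto
  qed
  moreover have "\<bar>\<Sum>j\<in>Basis. \<Sum>k\<in>Basis. B j k * ((x - a) \<bullet> j) * ((x - a) \<bullet> k)\<bar> \<le> (\<Sum>j\<in>Basis. \<Sum>k\<in>Basis. R^2 * \<bar>B j k\<bar>)"
  proof (rule sum_abs[THEN order_trans], rule sum_mono, rule sum_abs[THEN order_trans], rule sum_mono)
    fix j k :: 'a assume jk: "j \<in> Basis" "k \<in> Basis"
    have "\<bar>(x - a) \<bullet> j\<bar> * \<bar>(x - a) \<bullet> k\<bar> \<le> R * R" using R by (intro mult_mono b jk) auto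
    hence "\<bar>B j k\<bar> * (\<bar>(x - a) \<bullet> j\<bar> * \<bar>(x - a) \<bullet> k\<bar>) \<le> \<bar>B j k\<bar> * (R * R)" by (rule mult_left_mono) simp
    thus "\<bar>B j k * ((x - a) \<bullet> j) * ((x - a) \<bullet> k)\<bar> \<le> R^2 * \<bar>B j k\<bar>" by (simp add: abs_mult power2_eq_square mult_ac)
  qed
  ultimately show ?thesis unfolding taylor2_error_def sum_distrib_left by linarith
qed

text \<open>
The polynomial, \<open>u a\<close> and the rest of the potential change \<open>u\<close> on the ball by at most a constant \<open>m\<close>.
So the error exceeds \<open>t\<close> on the disc of radius \<open>\<rho> = exp (- (t + m + c) / c)\<close> about the atom, whose
capacity is at least about \<open>c / (2 * t)\<close>. The choice of \<open>t\<close> makes \<open>m\<close> negligible and \<open>\<rho> \<le> h\<close>.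
\<close>

lemma SUP_capacity_lower:
  fixes M :: "complex measure"
  assumes M: "sets M = sets borel" "emeasure M UNIV < \<infinity>" "(\<integral>\<^sup>+w. ennreal (ln (1 + norm w)) \<partial>M) < \<infinity>"
    and c: "0 < c" "ennreal c \<le> emeasure M {w}" and h: "0 < h" "h < 1" and w: "norm (a - w) \<le> 2 * h"
  shows "ennreal (c / 4) \<le> (SUP t\<in>{0<..}. ennreal t * capacity log_kernel
      {x \<in> ball a (3 * h) \<inter> potential_dom log_kernel (measure M). taylor2_error (potential log_kernel (measure M)) a A B x > t})"
proof -
  let ?u = "potential log_kernel (measure M)" and ?S = "potential_dom log_kernel (measure M)"
  define m where "m = ln (1 + (norm a + 3)) * measure M UNIV + (\<integral>y. ln (1 + norm y) \<partial>M) + \<bar>?u a\<bar>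
    + 3 * (\<Sum>i\<in>Basis. \<bar>A i\<bar>) + 3^2 * (\<Sum>j\<in>Basis. \<Sum>k\<in>Basis. \<bar>B j k\<bar>)"
  have m: "0 \<le> m" unfolding m_def
    by (intro add_nonneg_nonneg mult_nonneg_nonneg sum_nonneg Bochner_Integration.integral_nonneg) auto
  have L: "0 < ln (1 / h)" using h by (simp add: ln_div)
  define t where "t = m + 3 * c + c * ln (1 / h)"
  have cL: "0 < c * ln (1 / h)" using c L by simp
  have t: "0 < t" "m + 3 * c \<le> t" "c * ln (1 / h) \<le> t" unfolding t_def using m c cL by linarith+
  define \<rho> where "\<rho> = exp (- ((t + m + c) / c))"
  have l\<rho>: "ln (1 / \<rho>) = (t + m + c) / c" unfolding \<rho>_def by (simp add: ln_div)
  have \<rho>0: "0 < \<rho>" by (simp add: \<rho>_def)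
  have \<rho>h: "\<rho> \<le> h"
  proof -
    have "ln (1 / h) \<le> (t + m + c) / c" using t m c by (simp add: pos_le_divide_eq mult.commute)
    hence "\<rho> \<le> exp (- ln (1 / h))" unfolding \<rho>_def by simp
    also have "... = h" using h by (simp add: ln_div)
    finally show ?thesis .
  qed
  have sub: "ball w \<rho> \<inter> ?S \<subseteq> {x \<in> ball a (3 * h) \<inter> ?S. taylor2_error ?u a A B x > t}"
  proof
    fix x assume x: "x \<in> ball w \<rho> \<inter> ?S"
    hence xw: "norm (x - w) < \<rho>" and xS: "x \<in> ?S" by (auto simp: dist_norm norm_minus_commute)
    have "norm (x - a) \<le> norm (x - w) + norm (w - a)" using norm_triangle_ineq[of "x - w" "w - a"] by simp
    hence xa: "norm (x - a) < 3 * h" using xw \<rho>h w norm_minus_commute[of w a] by linarith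
    hence xa3: "norm (x - a) \<le> 3" using h by linarith
    have ne: "x \<noteq> w" using dom_log_potential_atom[OF M xS] c by (auto simp: ennreal_eq_0_iff)
    have low: "c * ln (1 / norm (x - w)) - ln (1 + norm x) * measure M UNIV - (\<integral>y. ln (1 + norm y) \<partial>M) \<le> ?u x"
      using xw \<rho>h h by (intro log_potential_lower[OF M xS _ c]) linarith
    have "norm x \<le> norm a + 3" using xa3 norm_triangle_ineq2[of x a] by linarith
    hence "ln (1 + norm x) \<le> ln (1 + (norm a + 3))" by (intro ln_mono) (auto intro: add_pos_nonneg)
    hence "ln (1 + norm x) * measure M UNIV \<le> ln (1 + (norm a + 3)) * measure M UNIV" by (intro mult_right_mono) auto
    moreover have "t + m + c < c * ln (1 / norm (x - w))"
    proof -
      have "1 / \<rho> < 1 / norm (x - w)" using xw ne \<rho>0 by (intro divide_strict_left_mono) auto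
      hence "ln (1 / \<rho>) < ln (1 / norm (x - w))" using \<rho>0 by (intro ln_strict_mono) auto
      thus ?thesis unfolding l\<rho> using c by (simp add: pos_divide_less_eq mult.commute)
    qed
    ultimately have "t < taylor2_error ?u a A B x"
      using low taylor2_error_lower[OF xa3, of ?u A B] c unfolding m_def by linarith
    thus "x \<in> {x \<in> ball a (3 * h) \<inter> ?S. taylor2_error ?u a A B x > t}" using xa xS by (simp add: dist_norm norm_minus_commute)
  qed
  have "c / 4 \<le> t * (1 / (2 * (ln (1 / \<rho>) + 2)))"
  proof -
    have "ln (1 / \<rho>) + 2 = (t + m + 3 * c) / c" unfolding l\<rho> using c by (simp add: field_simps)
    hence "t * (1 / (2 * (ln (1 / \<rho>) + 2))) = c * (t / (2 * (t + m + 3 * c)))" by simp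
    moreover have "1 / 4 \<le> t / (2 * (t + m + 3 * c))"
      using t m c by (simp add: pos_le_divide_eq)
    hence "c * (1 / 4) \<le> c * (t / (2 * (t + m + 3 * c)))" using c by (intro mult_left_mono) auto
    ultimately show ?thesis by simp
  qed
  hence "ennreal (c / 4) \<le> ennreal (t * (1 / (2 * (ln (1 / \<rho>) + 2))))" by (rule ennreal_leI)
  also have "... = ennreal t * ennreal (1 / (2 * (ln (1 / \<rho>) + 2)))" using t by (intro ennreal_mult') simp
  also have "... \<le> ennreal t * capacity log_kernel (ball w \<rho> \<inter> ?S)"
    using \<rho>0 \<rho>h h by (intro mult_left_mono capacity_log_lower borel_dom_log_potential[OF M] AE_dom_log_potential[OF M]) auto
  also have "... \<le> ennreal t * capacity log_kernel {x \<in> ball a (3 * h) \<inter> ?S. taylor2_error ?u a A B x > t}"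
    by (intro mult_left_mono capacity_mono sub) simp
  also have "... \<le> (SUP t\<in>{0<..}. ennreal t * capacity log_kernel {x \<in> ball a (3 * h) \<inter> ?S. taylor2_error ?u a A B x > t})"
    using t by (intro SUP_upper) simp
  finally show ?thesis .
qed

text \<open>
\<open>ln (1 / (3 * mesh n))\<close> is of order \<open>16 ^ n\<close>, and \<open>2 / 3 \<le> ln 2\<close> makes this explicit.
\<close>

lemma grid_denominator:
  fixes a :: complex
  assumes n: "1 \<le> n"
  shows "ennreal ((3 * mesh n)^2) * capacity log_kernel (ball a (3 * mesh n)) \<le> ennreal (18 * atom_mass n)"
proof -
  have "(16::real) ^ 1 \<le> 16 ^ n" using n by (rule power_increasing) simp
  hence N: "(16::real) \<le> 16 ^ n" by simp
  have "ln (3::real) \<le> ln (2 * 2)" by (rule ln_mono) auto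
  hence 3: "ln (3::real) \<le> 2 * ln 2" by (subst (asm) ln_mult_pos) auto
  have "ln (1 / (3 * mesh n)) = ln (2 ^ 16 ^ n / 3)" by (simp add: mesh_def)
  also have "... = 16 ^ n * ln 2 - ln 3" by (simp add: ln_div ln_realpow)
  also have "... \<ge> (16 ^ n - 2) * (2 / 3)"
  proof -
    have "(16 ^ n - 2) * (2 / 3) \<le> (16 ^ n - 2) * ln (2::real)" using N ln2_ge_two_thirds by (intro mult_left_mono) auto
    thus ?thesis using 3 by (simp add: left_diff_distrib)
  qed
  finally have ln: "16 ^ n / 2 \<le> ln (1 / (3 * mesh n))" using N by simp
  have "0 < ln (1 / (3 * mesh n))" using ln N by linarith
  hence "1 < 1 / (3 * mesh n)" using mesh_pos[of n] by (subst (asm) ln_gt_zero_iff) auto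
  hence m1: "3 * mesh n < 1" using mesh_pos[of n] by (simp add: field_simps)
  have "ennreal ((3 * mesh n)^2) * capacity log_kernel (ball a (3 * mesh n)) \<le> ennreal ((3 * mesh n)^2) * ennreal (1 / ln (1 / (3 * mesh n)))"
    using mesh_pos[of n] m1 by (intro mult_left_mono capacity_log_ball_upper) auto
  also have "... = ennreal ((3 * mesh n)^2 * (1 / ln (1 / (3 * mesh n))))" by (rule ennreal_mult'[symmetric]) simp
  also have "... \<le> ennreal (18 * atom_mass n)"
  proof (rule ennreal_leI)
    have "1 / ln (1 / (3 * mesh n)) \<le> 1 / (16 ^ n / 2)" using ln N by (intro divide_left_mono) auto
    hence "(3 * mesh n)^2 * (1 / ln (1 / (3 * mesh n))) \<le> (3 * mesh n)^2 * (1 / (16 ^ n / 2))" by (rule mult_left_mono) simp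
    thus "(3 * mesh n)^2 * (1 / ln (1 / (3 * mesh n))) \<le> 18 * atom_mass n" by (simp add: atom_mass_def power_mult_distrib)
  qed
  finally show ?thesis .
qed

lemma grid_potential_not_differentiable2:
  "\<not> weak_capacity_differentiable2 log_kernel (potential_dom log_kernel (measure grid_measure)) (potential log_kernel (measure grid_measure)) a"
proof
  let ?u = "potential log_kernel (measure grid_measure)" and ?S = "potential_dom log_kernel (measure grid_measure)"
  assume "weak_capacity_differentiable2 log_kernel ?S ?u a"
  then obtain A B where lim: "((\<lambda>r. (SUP t\<in>{0<..}. ennreal t *
                    capacity log_kernel {x \<in> ball a r \<inter> ?S. taylor2_error ?u a A B x > t})
                  / (ennreal (r^2) * capacity log_kernel (ball a r))) \<longlongrightarrow> 0) (at_right (0::real))"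
    unfolding weak_capacity_differentiable2_def by blast
  have "eventually (\<lambda>r. (SUP t\<in>{0<..}. ennreal t *
                    capacity log_kernel {x \<in> ball a r \<inter> ?S. taylor2_error ?u a A B x > t})
                  / (ennreal (r^2) * capacity log_kernel (ball a r)) < ennreal (1 / 72)) (at_right 0)"
    by (rule order_tendstoD(2)[OF lim]) simp
  then obtain b where b: "b > 0" and small: "\<And>r. 0 < r ==> r < b ==> (SUP t\<in>{0<..}. ennreal t *
                    capacity log_kernel {x \<in> ball a r \<inter> ?S. taylor2_error ?u a A B x > t})
                  / (ennreal (r^2) * capacity log_kernel (ball a r)) < ennreal (1 / 72)"
    unfolding eventually_at_right_field by blast
  obtain n :: nat where "max (norm a + 1) (3 / b) < real n" using reals_Archimedean2 by blast
  hence n: "norm a + 1 \<le> real n" "3 / b < real n" by auto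
  have n1: "1 \<le> n" using n(1) norm_ge_zero[of a] by linarith
  have mn: "mesh n < 1 / real n"
  proof -
    have "n < 2 ^ n" by (rule less_exp)
    also have "n < (16::nat) ^ n" by (rule power_gt_expt) simp
    hence "(2::nat) ^ n \<le> 2 ^ 16 ^ n" by (intro power_increasing) auto
    finally have "real n < real (2 ^ 16 ^ n)" by (rule of_nat_less_iff[THEN iffD2])
    thus ?thesis using n1 by (simp add: mesh_def field_simps)
  qed
  have "3 / real n < b" using n(2) b n1 by (simp add: field_simps)
  hence r: "0 < 3 * mesh n" "3 * mesh n < b" using mesh_pos[of n] mn by (auto simp: field_simps)
  have m1: "mesh n < 1"
  proof -
    have "1 / real n \<le> 1" using n1 by simp
    thus ?thesis using mn by linarith
  qed
  obtain q where q: "q \<in> grid_index n" "norm (a - grid_point (n, q)) \<le> 2 * mesh n" using grid_point_near[OF n(1)] by blast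
  let ?num = "SUP t\<in>{0<..}. ennreal t * capacity log_kernel {x \<in> ball a (3 * mesh n) \<inter> ?S. taylor2_error ?u a A B x > t}"
  let ?den = "ennreal ((3 * mesh n)^2) * capacity log_kernel (ball a (3 * mesh n))"
  have num: "ennreal (atom_mass n / 4) \<le> ?num"
    by (rule SUP_capacity_lower[OF sets_grid_measure finite_grid_measure grid_measure_log atom_mass_pos grid_measure_atom[OF q(1)] mesh_pos m1 q(2)])
  have "ennreal (1 / 72) = ennreal (atom_mass n / 4) / ennreal (18 * atom_mass n)"
    using atom_mass_pos[of n] by (subst divide_ennreal) auto
  also have "... \<le> ennreal (atom_mass n / 4) / ?den"
  proof (cases ?den)
    case (real y)
    hence y: "y \<le> 18 * atom_mass n" using grid_denominator[OF n1, of a] atom_mass_pos[of n] by (simp only: ennreal_le_iff)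
    show ?thesis
    proof (cases "y = 0")
      case True
      show ?thesis unfolding real(2) True using atom_mass_pos[of n] by simp
    next
      case False
      hence "0 < y" using real by simp
      hence "(atom_mass n / 4) / (18 * atom_mass n) \<le> (atom_mass n / 4) / y" using y atom_mass_pos[of n] by (intro divide_left_mono) auto
      hence "ennreal ((atom_mass n / 4) / (18 * atom_mass n)) \<le> ennreal ((atom_mass n / 4) / y)" by (rule ennreal_leI)
      thus ?thesis unfolding real(2) using \<open>0 < y\<close> atom_mass_pos[of n] by (subst (1 2) divide_ennreal) auto
    qed
  next
    case top
    have False using grid_denominator[OF n1, of a] unfolding top by (simp add: top_unique)
    thus ?thesis ..
  qed
  also have "... \<le> ?num / ?den" by (rule divide_right_mono_ennreal[OF num])
  also have "... < ennreal (1 / 72)" by (rule small[OF r])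
  finally show False by simp
qed

theorem theorem5:
  shows "(DIM('a::euclidean_space) \<ge> 3 \<longrightarrow>
           (\<forall>\<mu> :: 'a set \<Rightarrow> real. signed_borel_measure \<mu> \<longrightarrow>
             (AE a in lborel. capacity_differentiable2 newton_kernel
                (potential_dom newton_kernel \<mu>) (potential newton_kernel \<mu>) a))) \<and>
         (\<exists>\<mu> :: complex set \<Rightarrow> real. signed_borel_measure \<mu> \<and>
           (\<integral>\<^sup>+w. ennreal (ln (1 + norm w)) \<partial>total_variation \<mu>) < \<infinity> \<and>
           (AE a in lborel. \<not> weak_capacity_differentiable2 log_kernel
              (potential_dom log_kernel \<mu>) (potential log_kernel \<mu>) a))"
proof (intro conjI)
  show "DIM('a) \<ge> 3 -->
           (\<forall>\<mu> :: 'a set => real. signed_borel_measure \<mu> -->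
             (AE a in lborel. capacity_differentiable2 newton_kernel
                (potential_dom newton_kernel \<mu>) (potential newton_kernel \<mu>) a))"
    by (intro impI allI newton_potential_capacity_differentiable2)
next
  let ?M = grid_measure
  note fin = finM[OF sets_grid_measure finite_grid_measure grid_measure_log]
  have "signed_borel_measure (measure ?M)" by (rule signed_borel_measure_measure[OF sets_grid_measure fin])
  moreover have "(\<integral>\<^sup>+w. ennreal (ln (1 + norm w)) \<partial>total_variation (measure ?M)) < \<infinity>"
    unfolding total_variation_measure[OF sets_grid_measure fin] by (rule grid_measure_log)
  ultimately show "\<exists>\<mu> :: complex set => real. signed_borel_measure \<mu> \<and>
           (\<integral>\<^sup>+w. ennreal (ln (1 + norm w)) \<partial>total_variation \<mu>) < \<infinity> \<and>
           (AE a in lborel. \<not> weak_capacity_differentiable2 log_kernel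
              (potential_dom log_kernel \<mu>) (potential log_kernel \<mu>) a)"
    using grid_potential_not_differentiable2 by (intro exI[of _ "measure ?M"]) simp
qed

end
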